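(* If two singular foliations $(N_0,\mathcal{F}_0)$ and $(N_1,\mathcal{F}_1)$ are Molino transverse equivalent, then their complexes of basic forms $\Omega_b^\bullet(N_0,\mathcal{F}_0)$ and $\Omega_b^\bullet(N_1,\mathcal{F}_1)$ are isomorphic, and hence their basic cohomologies $H_b^\bullet(N_0,\mathcal{F}_0)$ and $H_b^\bullet(N_1,\mathcal{F}_1)$ are isomorphic.
   Context: A manifold is a set with a maximal smooth atlas whose topology is Hausdorff and second-countable. Singular foliation: A subset $L\subseteq M$ is a diffeological submanifold if its subspace diffeology (a map $q:O\to L$ from an open subset $O$ of a Cartesian space is a plot iff $q$ is smooth as a map into $M$) is a manifold diffeology, i.e. there is a (necessarily unique) manifold structure on $L$ whose smooth maps $O\to L$ are exactly these plots; $L$ always carries this manifold structure. It is weakly-embedded if moreover the inclusion $L\hookrightarrow M$ is an immersion. A (Stefan) singular foliation of an $n$-dimensional manifold $M$ is a partition $\mathcal{F}$ of $M$ into connected, weakly-embedded submanifolds, called leaves, such that about each $x\in M$ there is a chart $\psi$ of $M$ with: (a) $\psi$ is a diffeomorphism $V\to U\times W$, where $V$ is an open neighbourhood of $x$, $U$ and $W$ are open neighbourhoods of the origin in $\mathbb{R}^k$ and $\mathbb{R}^{n-k}$, and $k$ is the dimension of the leaf through $x$; (b) $\psi(x)=(0,0)$; (c) for every leaf $L$ of $\mathcal{F}$, $\psi(L\cap V)=U\times\ell$ for some $\ell\subseteq W$. Pullback and Molino transverse equivalence: for a surjective submersion with connected fibers $p:M\to N$ and a singular foliation $\mathcal{F}$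 of $N$, $p^{-1}\mathcal{F}$ is the singular foliation of $M$ whose leaves are the sets $p^{-1}(L)$, $L$ a leaf of $\mathcal{F}$. $(N_0,\mathcal{F}_0)$ and $(N_1,\mathcal{F}_1)$ are Molino transverse equivalent if there exist a singular foliation $(M,\mathcal{F})$ and surjective submersions with connected fibers $p_i:M\to N_i$ such that $p_i^{-1}\mathcal{F}_i=\mathcal{F}$ for $i=0,1$. Basic forms: a vector field $X$ on $M$ is tangent to $\mathcal{F}$ if $X_x\in T_xL$ for every $x$, where $L$ is the leaf through $x$. A differential form $\alpha\in\Omega^\bullet(M)$ is $\mathcal{F}$-basic if $\iota_X\alpha=0$ and $\mathcal{L}_X\alpha=0$ for every vector field $X$ tangent to $\mathcal{F}$. The basic forms make up a subcomplex $\Omega_b^\bullet(M,\mathcal{F})$ of the de Rham complex, whose cohomology $H_b^\bullet(M,\mathcal{F})$ is the basic cohomology of $\mathcal{F}$. *)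

theory Defs
  imports "HOL-Analysis.Analysis"
begin

section \<open>Smooth functions on open subsets of Cartesian spaces\<close>

text \<open>
  Leaves of a singular foliation have varying dimensions, and plots have domains of every
  dimension, so \<open>\<real>\<^sup>n\<close> is the library's \<^const>\<open>Euclidean_space\<close> \<open>n\<close>: the sequences
  \<open>nat \<Rightarrow> real\<close> that vanish from index \<open>n\<close> on.
\<close>

abbreviation Rn :: "nat \<Rightarrow> (nat \<Rightarrow> real) set" where
  "Rn n \<equiv> topspace (Euclidean_space n)"

definition partial :: "nat \<Rightarrow> ((nat \<Rightarrow> real) \<Rightarrow> real) \<Rightarrow> (nat \<Rightarrow> real) \<Rightarrow> real" where
  "partial i f x = deriv (\<lambda>t. f (x(i := t))) (x i)"

text \<open>\<open>U\<close> is meant to be open in \<open>\<real>\<^sup>n\<close>; values of the function off \<open>U\<close> do not matter.\<close>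

fun C_k_on :: "nat \<Rightarrow> nat \<Rightarrow> (nat \<Rightarrow> real) set \<Rightarrow> ((nat \<Rightarrow> real) \<Rightarrow> real) \<Rightarrow> bool" where
  "C_k_on n 0 U f \<longleftrightarrow> continuous_on U f"
| "C_k_on n (Suc k) U f \<longleftrightarrow> continuous_on U f \<and>
     (\<forall>i<n. (\<forall>x\<in>U. (\<lambda>t. f (x(i := t))) field_differentiable at (x i)) \<and>
            C_k_on n k U (partial i f))"

definition smooth_fun_on :: "nat \<Rightarrow> (nat \<Rightarrow> real) set \<Rightarrow> ((nat \<Rightarrow> real) \<Rightarrow> real) \<Rightarrow> bool" where
  "smooth_fun_on n U f \<longleftrightarrow> (\<forall>k. C_k_on n k U f)"

text \<open>Smoothness of a map \<open>U \<rightarrow> \<real>\<^sup>m\<close>, \<open>U\<close> open in \<open>\<real>\<^sup>n\<close>.\<close>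

definition smooth_vec_on ::
    "nat \<Rightarrow> nat \<Rightarrow> (nat \<Rightarrow> real) set \<Rightarrow> ((nat \<Rightarrow> real) \<Rightarrow> nat \<Rightarrow> real) \<Rightarrow> bool" where
  "smooth_vec_on n m U F \<longleftrightarrow> F ` U \<subseteq> Rn m \<and> (\<forall>j<m. smooth_fun_on n U (\<lambda>x. F x j))"

definition dir_deriv ::
    "nat \<Rightarrow> ((nat \<Rightarrow> real) \<Rightarrow> real) \<Rightarrow> (nat \<Rightarrow> real) \<Rightarrow> (nat \<Rightarrow> real) \<Rightarrow> real" where
  "dir_deriv n f x v = (\<Sum>i<n. v i * partial i f x)"

definition jacobian_map ::
    "nat \<Rightarrow> nat \<Rightarrow> ((nat \<Rightarrow> real) \<Rightarrow> nat \<Rightarrow> real) \<Rightarrow> (nat \<Rightarrow> real) \<Rightarrow> (nat \<Rightarrow> real) \<Rightarrow> nat \<Rightarrow> real" where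
  "jacobian_map n m F x v = (\<lambda>j. if j < m then dir_deriv n (\<lambda>y. F y j) x v else 0)"


section \<open>Manifolds and smooth maps\<close>

text \<open>
  A chart is a pair \<open>(V, \<psi>)\<close>; \<open>\<psi>\<close> is kept \<^const>\<open>extensional\<close> so that it is determined
  by its values on \<open>V\<close>.
\<close>

type_synonym 'a chart = "'a set \<times> ('a \<Rightarrow> nat \<Rightarrow> real)"

record 'a manifold =
  mcarrier :: "'a set"
  mdim :: nat
  atlas :: "'a chart set"

definition is_chart :: "'a set \<Rightarrow> nat \<Rightarrow> 'a chart \<Rightarrow> bool" where
  "is_chart C n c \<longleftrightarrow> fst c \<subseteq> C \<and> snd c \<in> extensional (fst c) \<and> inj_on (snd c) (fst c) \<and>
     openin (Euclidean_space n) (snd c ` fst c)"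

definition chart_inv :: "'a chart \<Rightarrow> (nat \<Rightarrow> real) \<Rightarrow> 'a" where
  "chart_inv c = inv_into (fst c) (snd c)"

definition transition :: "'a chart \<Rightarrow> 'a chart \<Rightarrow> (nat \<Rightarrow> real) \<Rightarrow> nat \<Rightarrow> real" where
  "transition c d = snd d \<circ> chart_inv c"

definition smooth_transition :: "nat \<Rightarrow> 'a chart \<Rightarrow> 'a chart \<Rightarrow> bool" where
  "smooth_transition n c d \<longleftrightarrow>
     openin (Euclidean_space n) (snd c ` (fst c \<inter> fst d)) \<and>
     smooth_vec_on n n (snd c ` (fst c \<inter> fst d)) (transition c d)"

definition compatible :: "nat \<Rightarrow> 'a chart \<Rightarrow> 'a chart \<Rightarrow> bool" where
  "compatible n c d \<longleftrightarrow> smooth_transition n c d \<and> smooth_transition n d c"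

definition maximal_atlas :: "'a set \<Rightarrow> nat \<Rightarrow> 'a chart set \<Rightarrow> bool" where
  "maximal_atlas C n A \<longleftrightarrow>
     (\<forall>c\<in>A. is_chart C n c) \<and> (\<Union>c\<in>A. fst c) = C \<and>
     (\<forall>c\<in>A. \<forall>d\<in>A. compatible n c d) \<and>
     (\<forall>c. is_chart C n c \<and> (\<forall>d\<in>A. compatible n c d) \<longrightarrow> c \<in> A)"

definition mtopology :: "'a manifold \<Rightarrow> 'a topology" where
  "mtopology M = topology (\<lambda>U. U \<subseteq> mcarrier M \<and>
     (\<forall>c\<in>atlas M. openin (Euclidean_space (mdim M)) (snd c ` (U \<inter> fst c))))"

definition second_countable_space :: "'a topology \<Rightarrow> bool" where
  "second_countable_space T \<longleftrightarrow> (\<exists>B. countable B \<and> (\<forall>U\<in>B. openin T U) \<and>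
     (\<forall>U x. openin T U \<and> x \<in> U \<longrightarrow> (\<exists>V\<in>B. x \<in> V \<and> V \<subseteq> U)))"

definition smooth_manifold :: "'a manifold \<Rightarrow> bool" where
  "smooth_manifold M \<longleftrightarrow> maximal_atlas (mcarrier M) (mdim M) (atlas M) \<and>
     Hausdorff_space (mtopology M) \<and> second_countable_space (mtopology M)"

definition charts_at :: "'a manifold \<Rightarrow> 'a \<Rightarrow> 'a chart set" where
  "charts_at M x = {c \<in> atlas M. x \<in> fst c}"

definition smooth_map :: "'a manifold \<Rightarrow> 'b manifold \<Rightarrow> ('a \<Rightarrow> 'b) \<Rightarrow> bool" where
  "smooth_map M N f \<longleftrightarrow> f ` mcarrier M \<subseteq> mcarrier N \<and>
     (\<forall>x\<in>mcarrier M. \<exists>c\<in>charts_at M x. \<exists>d\<in>charts_at N (f x). f ` fst c \<subseteq> fst d \<and>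
        smooth_vec_on (mdim M) (mdim N) (snd c ` fst c) (snd d \<circ> f \<circ> chart_inv c))"

text \<open>Smoothness of a map from an open subset \<open>Q\<close> of \<open>\<real>\<^sup>m\<close> into a manifold.\<close>

definition smooth_into :: "nat \<Rightarrow> (nat \<Rightarrow> real) set \<Rightarrow> 'a manifold \<Rightarrow> ((nat \<Rightarrow> real) \<Rightarrow> 'a) \<Rightarrow> bool" where
  "smooth_into m Q M q \<longleftrightarrow> q ` Q \<subseteq> mcarrier M \<and>
     (\<forall>u\<in>Q. \<exists>P. openin (Euclidean_space m) P \<and> u \<in> P \<and> P \<subseteq> Q \<and>
        (\<exists>d\<in>charts_at M (q u). q ` P \<subseteq> fst d \<and> smooth_vec_on m (mdim M) P (snd d \<circ> q)))"


section \<open>Tangent vectors\<close>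

text \<open>
  A tangent vector at \<open>x\<close> is the family of its coordinate vectors with respect to all charts
  around \<open>x\<close>, transforming by the Jacobians of the coordinate changes (and set to \<open>0\<close>
  on the other charts).
\<close>

type_synonym 'a tvec = "'a chart \<Rightarrow> nat \<Rightarrow> real"

definition tangent_space :: "'a manifold \<Rightarrow> 'a \<Rightarrow> 'a tvec set" where
  "tangent_space M x = {v.
     (\<forall>c\<in>charts_at M x. v c \<in> Rn (mdim M)) \<and>
     (\<forall>c\<in>charts_at M x. \<forall>d\<in>charts_at M x.
        v d = jacobian_map (mdim M) (mdim M) (transition c d) (snd c x) (v c)) \<and>
     (\<forall>c. c \<notin> charts_at M x \<longrightarrow> v c = (\<lambda>i. 0))}"

text \<open>The tangent vector at \<open>x\<close> with coordinates \<open>w\<close> in the chart \<open>c\<close>.\<close>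

definition coord_vec :: "'a manifold \<Rightarrow> 'a chart \<Rightarrow> 'a \<Rightarrow> (nat \<Rightarrow> real) \<Rightarrow> 'a tvec" where
  "coord_vec M c x w = (\<lambda>d. if d \<in> charts_at M x
     then jacobian_map (mdim M) (mdim M) (transition c d) (snd c x) w else (\<lambda>i. 0))"

definition unit_vec :: "nat \<Rightarrow> nat \<Rightarrow> real" where
  "unit_vec i = (\<lambda>j. if j = i then 1 else 0)"

definition tv_lincomb :: "real \<Rightarrow> 'a tvec \<Rightarrow> real \<Rightarrow> 'a tvec \<Rightarrow> 'a tvec" where
  "tv_lincomb a u b w = (\<lambda>c i. a * u c i + b * w c i)"

text \<open>
  A chart around \<open>x\<close>, used to evaluate expressions that do not depend on the choice of chart.
\<close>

definition chart_at :: "'a manifold \<Rightarrow> 'a \<Rightarrow> 'a chart" where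
  "chart_at M x = (SOME c. c \<in> charts_at M x)"

definition tangent_map ::
    "'a manifold \<Rightarrow> 'b manifold \<Rightarrow> ('a \<Rightarrow> 'b) \<Rightarrow> 'a \<Rightarrow> 'a tvec \<Rightarrow> 'b tvec" where
  "tangent_map M N f x v = (let c = chart_at M x in
     (\<lambda>d. if d \<in> charts_at N (f x)
          then jacobian_map (mdim M) (mdim N) (snd d \<circ> f \<circ> chart_inv c) (snd c x) (v c)
          else (\<lambda>i. 0)))"

definition immersion :: "'a manifold \<Rightarrow> 'b manifold \<Rightarrow> ('a \<Rightarrow> 'b) \<Rightarrow> bool" where
  "immersion M N f \<longleftrightarrow> smooth_map M N f \<and>
     (\<forall>x\<in>mcarrier M. inj_on (tangent_map M N f x) (tangent_space M x))"

definition submersion :: "'a manifold \<Rightarrow> 'b manifold \<Rightarrow> ('a \<Rightarrow> 'b) \<Rightarrow> bool" where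
  "submersion M N f \<longleftrightarrow> smooth_map M N f \<and>
     (\<forall>x\<in>mcarrier M. tangent_map M N f x ` tangent_space M x = tangent_space N (f x))"

definition smooth_vector_field :: "'a manifold \<Rightarrow> ('a \<Rightarrow> 'a tvec) \<Rightarrow> bool" where
  "smooth_vector_field M X \<longleftrightarrow> (\<forall>x\<in>mcarrier M. X x \<in> tangent_space M x) \<and>
     (\<forall>c\<in>atlas M. smooth_vec_on (mdim M) (mdim M) (snd c ` fst c) (\<lambda>y. X (chart_inv c y) c))"


section \<open>Singular foliations\<close>

text \<open>
  \<open>S\<close> is a manifold structure on \<open>L\<close> whose smooth maps from open subsets of Cartesian spaces
  are exactly the plots of the subspace diffeology of \<open>L \<subseteq> M\<close>.
\<close>

definition diffeological_structure :: "'a manifold \<Rightarrow> 'a set \<Rightarrow> 'a manifold \<Rightarrow> bool" where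
  "diffeological_structure M L S \<longleftrightarrow> smooth_manifold S \<and> mcarrier S = L \<and>
     (\<forall>m Q q. openin (Euclidean_space m) Q \<and> q ` Q \<subseteq> L \<longrightarrow>
        (smooth_into m Q S q \<longleftrightarrow> smooth_into m Q M q))"

definition diffeological_submanifold :: "'a manifold \<Rightarrow> 'a set \<Rightarrow> bool" where
  "diffeological_submanifold M L \<longleftrightarrow>
     L \<subseteq> mcarrier M \<and> (\<exists>S. diffeological_structure M L S)"

text \<open>For nonempty \<open>L\<close> there is at most one such structure, so the choice is immaterial.\<close>

definition submanifold_structure :: "'a manifold \<Rightarrow> 'a set \<Rightarrow> 'a manifold" where
  "submanifold_structure M L = (SOME S. diffeological_structure M L S)"

definition weakly_embedded :: "'a manifold \<Rightarrow> 'a set \<Rightarrow> bool" where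
  "weakly_embedded M L \<longleftrightarrow> diffeological_submanifold M L \<and>
     immersion (submanifold_structure M L) M (\<lambda>x. x)"

text \<open>\<open>U \<times> W\<close> inside \<open>\<real>\<^sup>k \<times> \<real>\<^sup>n\<^sup>-\<^sup>k = \<real>\<^sup>n\<close>: first \<open>k\<close> coordinates in \<open>U\<close>, the others in \<open>W\<close>.\<close>

definition cartesian_prod ::
    "nat \<Rightarrow> (nat \<Rightarrow> real) set \<Rightarrow> (nat \<Rightarrow> real) set \<Rightarrow> (nat \<Rightarrow> real) set" where
  "cartesian_prod k U W = {z. (\<lambda>i. if i < k then z i else 0) \<in> U \<and> (\<lambda>i. z (k + i)) \<in> W}"

definition foliated_chart :: "'a manifold \<Rightarrow> 'a set set \<Rightarrow> nat \<Rightarrow> 'a \<Rightarrow> 'a chart \<Rightarrow> bool" where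
  "foliated_chart M F k x c \<longleftrightarrow> c \<in> charts_at M x \<and> snd c x = (\<lambda>i. 0) \<and>
     (\<exists>U W. openin (Euclidean_space k) U \<and> (\<lambda>i. 0) \<in> U \<and>
            openin (Euclidean_space (mdim M - k)) W \<and> (\<lambda>i. 0) \<in> W \<and>
            snd c ` fst c = cartesian_prod k U W \<and>
            (\<forall>L\<in>F. \<exists>l\<subseteq>W. snd c ` (L \<inter> fst c) = cartesian_prod k U l))"

definition singular_foliation :: "'a manifold \<Rightarrow> 'a set set \<Rightarrow> bool" where
  "singular_foliation M F \<longleftrightarrow> smooth_manifold M \<and> partition_on (mcarrier M) F \<and>
     (\<forall>L\<in>F. weakly_embedded M L \<and> connected_space (mtopology (submanifold_structure M L))) \<and>
     (\<forall>L\<in>F. \<forall>x\<in>L. \<exists>c. foliated_chart M F (mdim (submanifold_structure M L)) x c)"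

definition leaf_tangent_space :: "'a manifold \<Rightarrow> 'a set \<Rightarrow> 'a \<Rightarrow> 'a tvec set" where
  "leaf_tangent_space M L x = (let S = submanifold_structure M L in
     tangent_map S M (\<lambda>x. x) x ` tangent_space S x)"

definition tangent_to :: "'a manifold \<Rightarrow> 'a set set \<Rightarrow> ('a \<Rightarrow> 'a tvec) \<Rightarrow> bool" where
  "tangent_to M F X \<longleftrightarrow> (\<forall>L\<in>F. \<forall>x\<in>L. X x \<in> leaf_tangent_space M L x)"


section \<open>Molino transverse equivalence\<close>

definition surj_submersion_conn_fibers :: "'a manifold \<Rightarrow> 'b manifold \<Rightarrow> ('a \<Rightarrow> 'b) \<Rightarrow> bool" where
  "surj_submersion_conn_fibers M N p \<longleftrightarrow> submersion M N p \<and> p ` mcarrier M = mcarrier N \<and>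
     (\<forall>y\<in>mcarrier N. connectedin (mtopology M) {x \<in> mcarrier M. p x = y})"

definition pullback_foliation :: "'a manifold \<Rightarrow> ('a \<Rightarrow> 'b) \<Rightarrow> 'b set set \<Rightarrow> 'a set set" where
  "pullback_foliation M p F = (\<lambda>L. {x \<in> mcarrier M. p x \<in> L}) ` F"

text \<open>
  HOL cannot quantify existentially over the type that carries \<open>M\<close>, so it is a parameter.
  A theorem with hypothesis \<open>molino_transverse_equivalent TYPE('m) \<dots>\<close> for a type variable
  \<open>'m\<close> covers every \<open>M\<close>.
\<close>

definition molino_transverse_equivalent ::
    "'m itself \<Rightarrow> 'a manifold \<Rightarrow> 'a set set \<Rightarrow> 'b manifold \<Rightarrow> 'b set set \<Rightarrow> bool" where
  "molino_transverse_equivalent (_ :: 'm itself) N0 F0 N1 F1 \<longleftrightarrow>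
     (\<exists>(M :: 'm manifold) F p0 p1. singular_foliation M F \<and>
        surj_submersion_conn_fibers M N0 p0 \<and> surj_submersion_conn_fibers M N1 p1 \<and>
        pullback_foliation M p0 F0 = F \<and> pullback_foliation M p1 F1 = F)"


section \<open>Differential forms and basic forms\<close>

text \<open>
  A \<open>k\<close>-form takes a point and the list of its \<open>k\<close> arguments. It is extended by \<open>0\<close> to
  all other inputs, so that equality of forms is equality of functions.
\<close>

type_synonym 'a form = "'a \<Rightarrow> 'a tvec list \<Rightarrow> real"

definition diff_forms :: "'a manifold \<Rightarrow> nat \<Rightarrow> 'a form set" where
  "diff_forms M k = {\<alpha>.
     (\<forall>x vs. \<not> (x \<in> mcarrier M \<and> length vs = k \<and> set vs \<subseteq> tangent_space M x) \<longrightarrow> \<alpha> x vs = 0) \<and>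
     (\<forall>x\<in>mcarrier M. \<forall>vs. length vs = k \<and> set vs \<subseteq> tangent_space M x \<longrightarrow>
        (\<forall>i<k. \<forall>u\<in>tangent_space M x. \<forall>w\<in>tangent_space M x. \<forall>a b.
           \<alpha> x (vs[i := tv_lincomb a u b w]) = a * \<alpha> x (vs[i := u]) + b * \<alpha> x (vs[i := w])) \<and>
        (\<forall>i<k. \<forall>j<k. i \<noteq> j \<and> vs ! i = vs ! j \<longrightarrow> \<alpha> x vs = 0)) \<and>
     (\<forall>c\<in>atlas M. \<forall>js. length js = k \<and> set js \<subseteq> {..<mdim M} \<longrightarrow>
        smooth_fun_on (mdim M) (snd c ` fst c)
          (\<lambda>y. \<alpha> (chart_inv c y) (map (\<lambda>j. coord_vec M c (chart_inv c y) (unit_vec j)) js)))}"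

text \<open>
  The coordinate expression of \<open>\<alpha>\<close> in the chart \<open>c\<close>, evaluated on the vector fields with
  constant coordinates \<open>ws\<close>.
\<close>

definition local_form :: "'a manifold \<Rightarrow> 'a form \<Rightarrow> 'a chart \<Rightarrow> (nat \<Rightarrow> real) list \<Rightarrow> (nat \<Rightarrow> real) \<Rightarrow> real" where
  "local_form M \<alpha> c ws y = \<alpha> (chart_inv c y) (map (coord_vec M c (chart_inv c y)) ws)"

text \<open>
  \<open>d\<alpha>(v\<^sub>0,\<dots>,v\<^sub>k) = \<Sum>\<^sub>i (-1)\<^sup>i v\<^sub>i(\<alpha>(v\<^sub>0,\<dots>,v\<^sub>i\<^sub>-\<^sub>1,v\<^sub>i\<^sub>+\<^sub>1,\<dots>,v\<^sub>k))\<close>, the \<open>v\<^sub>i\<close> being extended to vector fields with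
  constant coordinates in a chart.
\<close>

definition ext_deriv :: "'a manifold \<Rightarrow> 'a form \<Rightarrow> 'a form" where
  "ext_deriv M \<alpha> x vs =
     (if x \<in> mcarrier M \<and> set vs \<subseteq> tangent_space M x then
        let c = chart_at M x; ws = map (\<lambda>v. v c) vs in
        (\<Sum>i<length vs. (-1) ^ i *
           dir_deriv (mdim M) (local_form M \<alpha> c (take i ws @ drop (Suc i) ws)) (snd c x) (ws ! i))
      else 0)"

definition interior_prod :: "('a \<Rightarrow> 'a tvec) \<Rightarrow> 'a form \<Rightarrow> 'a form" where
  "interior_prod X \<alpha> x vs = \<alpha> x (X x # vs)"

text \<open>
  \<open>(L\<^sub>X\<alpha>)(v\<^sub>1,\<dots>,v\<^sub>k) = X(\<alpha>(v\<^sub>1,\<dots>,v\<^sub>k)) - \<Sum>\<^sub>i \<alpha>(v\<^sub>1,\<dots>,[X,v\<^sub>i],\<dots>,v\<^sub>k)\<close>, where the \<open>v\<^sub>i\<close> are extended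
  with constant coordinates in a chart, so that \<open>-[X,v\<^sub>i]\<close> is the derivative of the coordinates
  of \<open>X\<close> in the direction \<open>v\<^sub>i\<close>.
\<close>

definition lie_deriv :: "'a manifold \<Rightarrow> ('a \<Rightarrow> 'a tvec) \<Rightarrow> 'a form \<Rightarrow> 'a form" where
  "lie_deriv M X \<alpha> x vs =
     (if x \<in> mcarrier M \<and> set vs \<subseteq> tangent_space M x then
        let c = chart_at M x; ws = map (\<lambda>v. v c) vs in
        dir_deriv (mdim M) (local_form M \<alpha> c ws) (snd c x) (X x c) +
        (\<Sum>i<length vs. local_form M \<alpha> c
           (ws[i := jacobian_map (mdim M) (mdim M) (\<lambda>y. X (chart_inv c y) c) (snd c x) (ws ! i)])
           (snd c x))
      else 0)"

definition basic_forms :: "'a manifold \<Rightarrow> 'a set set \<Rightarrow> nat \<Rightarrow> 'a form set" where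
  "basic_forms M F k = {\<alpha> \<in> diff_forms M k.
     \<forall>X. smooth_vector_field M X \<and> tangent_to M F X \<longrightarrow>
       (\<forall>x\<in>mcarrier M. \<forall>vs. interior_prod X \<alpha> x vs = 0 \<and> lie_deriv M X \<alpha> x vs = 0)}"


section \<open>Real cochain complexes and cohomology\<close>

record 'v real_space =
  vset :: "'v set"
  vadd :: "'v \<Rightarrow> 'v \<Rightarrow> 'v"
  vscale :: "real \<Rightarrow> 'v \<Rightarrow> 'v"

definition linear_iso :: "('v \<Rightarrow> 'w) \<Rightarrow> 'v real_space \<Rightarrow> 'w real_space \<Rightarrow> bool" where
  "linear_iso \<phi> V W \<longleftrightarrow> bij_betw \<phi> (vset V) (vset W) \<and>
     (\<forall>u\<in>vset V. \<forall>v\<in>vset V. \<phi> (vadd V u v) = vadd W (\<phi> u) (\<phi> v)) \<and>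
     (\<forall>a. \<forall>v\<in>vset V. \<phi> (vscale V a v) = vscale W a (\<phi> v))"

definition linearly_isomorphic :: "'v real_space \<Rightarrow> 'w real_space \<Rightarrow> bool" where
  "linearly_isomorphic V W \<longleftrightarrow> (\<exists>\<phi>. linear_iso \<phi> V W)"

definition vcoset :: "'v real_space \<Rightarrow> 'v set \<Rightarrow> 'v \<Rightarrow> 'v set" where
  "vcoset V B v = (\<lambda>b. vadd V v b) ` B"

definition quotient_space :: "'v real_space \<Rightarrow> 'v set \<Rightarrow> 'v set real_space" where
  "quotient_space V B =
     \<lparr>vset = vcoset V B ` vset V,
      vadd = (\<lambda>P Q. {vadd V p q |p q. p \<in> P \<and> q \<in> Q}),
      vscale = (\<lambda>a P. {vadd V (vscale V a p) b |p b. p \<in> P \<and> b \<in> B})\<rparr>"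

record 'v cochain_complex =
  cspace :: "nat \<Rightarrow> 'v real_space"
  czero :: 'v
  cdiff :: "nat \<Rightarrow> 'v \<Rightarrow> 'v"

definition cocycles :: "'v cochain_complex \<Rightarrow> nat \<Rightarrow> 'v set" where
  "cocycles C k = {v \<in> vset (cspace C k). cdiff C k v = czero C}"

fun coboundaries :: "'v cochain_complex \<Rightarrow> nat \<Rightarrow> 'v set" where
  "coboundaries C 0 = {czero C}"
| "coboundaries C (Suc k) = cdiff C k ` vset (cspace C k)"

definition cohomology :: "'v cochain_complex \<Rightarrow> nat \<Rightarrow> 'v set real_space" where
  "cohomology C k =
     quotient_space ((cspace C k)\<lparr>vset := cocycles C k\<rparr>) (coboundaries C k)"

definition isomorphic_complexes :: "'v cochain_complex \<Rightarrow> 'w cochain_complex \<Rightarrow> bool" where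
  "isomorphic_complexes C D \<longleftrightarrow> (\<exists>\<Phi>. \<forall>k. linear_iso (\<Phi> k) (cspace C k) (cspace D k) \<and>
     (\<forall>v\<in>vset (cspace C k). \<Phi> (Suc k) (cdiff C k v) = cdiff D k (\<Phi> k v)))"

definition basic_complex :: "'a manifold \<Rightarrow> 'a set set \<Rightarrow> 'a form cochain_complex" where
  "basic_complex M F =
     \<lparr>cspace = (\<lambda>k. \<lparr>vset = basic_forms M F k,
                     vadd = (\<lambda>\<alpha> \<beta> x vs. \<alpha> x vs + \<beta> x vs),
                     vscale = (\<lambda>a \<alpha> x vs. a * \<alpha> x vs)\<rparr>),
      czero = (\<lambda>x vs. 0),
      cdiff = (\<lambda>k. ext_deriv M)\<rparr>"

definition basic_cohomology :: "'a manifold \<Rightarrow> 'a set set \<Rightarrow> nat \<Rightarrow> 'a form set real_space" where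
  "basic_cohomology M F = cohomology (basic_complex M F)"

end

theory Submission
  imports Defs
begin

text \<open>
  For a surjective submersion \<open>p : M \<rightarrow> N\<close> with connected fibers, pullback along \<open>p\<close> is an
  isomorphism from the basic forms of \<open>\<F>\<close> onto those of \<open>p\<^sup>-\<^sup>1\<F>\<close>; the required map is
  \<open>(p\<^sub>1\<^sup>*)\<^sup>-\<^sup>1 p\<^sub>0\<^sup>*\<close>.

  A form \<open>\<alpha>\<close> is basic iff \<open>\<alpha>\<close> and \<open>d\<alpha>\<close> vanish as soon as one argument is tangent to a leaf:
  by means of bump functions in foliated charts, every vector tangent to a leaf extends to a vector
  field tangent to the foliation, and \<open>L\<^sub>X\<alpha> = \<iota>\<^sub>Xd\<alpha>\<close> if \<open>\<iota>\<^sub>X\<alpha> = 0\<close>. This pointwise condition is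
  compatible with pullback, because \<open>p\<^sup>*\<close> commutes with \<open>d\<close> and because the tangent spaces of a
  leaf consist of the velocities of the plots of the leaf, which \<open>p\<close> pushes forward and which
  lift through \<open>p\<close>.

  A basic form of \<open>p\<^sup>-\<^sup>1\<F>\<close> vanishes on vertical vectors together with its differential, so in
  coordinates in which \<open>p\<close> is a linear projection its coefficients do not depend on the fiber
  coordinates. As the fibers are connected, it descends to \<open>N\<close>.
\<close>

section \<open>Neighbourhoods in Cartesian spaces\<close>

text \<open>Charts, leaves and plots have varying dimensions, so R^n is a set here, and calculus is
  built from one-variable derivatives: coordinates are moved one at a time and the mean value
  theorem controls each move. The same device replaces a single coordinate by a function with
  nonzero partial derivative, and repeating it straightens a submersion. Extending a leaf vector
  hides a difficulty: the field must stay tangent to nearby leaves, possibly of larger dimension. A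
  foliated chart with k leaf coordinates makes all of R^k tangent to every leaf that meets it; that
  the leaf through the centre has no further tangent directions in this chart is a dimension count.
  The differential belongs to the pointwise condition because constancy along fibers concerns
  derivatives of coefficients: when \<beta> and d\<beta> both vanish on a vertical w, the identity
  d\<beta>(w, ...) = 0 reduces to the vanishing of the derivative of each coefficient along w.
  Adapted charts have cubes as images, so the part of a fiber inside one is convex; connectedness
  then compares distant points of a fiber.\<close>

abbreviation E :: "nat \<Rightarrow> (nat \<Rightarrow> real) topology" where
  "E \<equiv> Euclidean_space"

lemma mem_Rn: "x \<in> Rn n \<longleftrightarrow> (\<forall>i\<ge>n. x i = 0)"
  by (simp add: topspace_Euclidean_space)

lemma Rn_upd: "x \<in> Rn n \<Longrightarrow> i < n \<Longrightarrow> x(i := t) \<in> Rn n"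
  by (simp add: mem_Rn)

lemma Rn_mono: "x \<in> Rn k \<Longrightarrow> k \<le> n \<Longrightarrow> x \<in> Rn n"
  by (simp add: mem_Rn)

lemma unit_vec_Rn: "i < n \<Longrightarrow> unit_vec i \<in> Rn n"
  by (simp add: mem_Rn unit_vec_def)

lemma zero_Rn: "(\<lambda>i. 0) \<in> Rn n"
  by (simp add: mem_Rn)

lemma lincomb_Rn: "u \<in> Rn n \<Longrightarrow> v \<in> Rn n \<Longrightarrow> (\<lambda>i. a * u i + b * v i) \<in> Rn n"
  by (simp add: mem_Rn)

lemma jacobian_map_Rn: "jacobian_map n m F x v \<in> Rn m"
  by (simp add: mem_Rn jacobian_map_def)

lemma Euclidean_space_top_of_set: "E n = top_of_set {x. \<forall>i\<ge>n. x i = 0}"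
  by (simp add: Euclidean_space_def euclidean_product_topology)

text \<open>Unlike \<open>at x within\<close>, this filter does not exclude x itself: for x in
  \<open>Rn n\<close> an eventual property holds at x too, and
  \<open>(f \<longlongrightarrow> f x) (nb n x)\<close> is continuity at x relative to
  \<open>Rn n\<close>.\<close>

definition nb :: "nat \<Rightarrow> (nat \<Rightarrow> real) \<Rightarrow> (nat \<Rightarrow> real) filter" where
  "nb n x = inf (nhds x) (principal (Rn n))"

lemma eventually_nb:
  assumes "x \<in> Rn n"
  shows "eventually P (nb n x) \<longleftrightarrow> (\<exists>U. openin (E n) U \<and> x \<in> U \<and> (\<forall>y\<in>U. P y))"
proof -
  have *: "eventually P (nb n x) \<longleftrightarrow> (\<exists>S. open S \<and> x \<in> S \<and> (\<forall>y\<in>S. y \<in> Rn n \<longrightarrow> P y))"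
    by (simp add: nb_def eventually_inf_principal eventually_nhds)
  have **: "openin (E n) U \<longleftrightarrow> (\<exists>S. open S \<and> U = Rn n \<inter> S)" for U
    by (simp add: Euclidean_space_top_of_set openin_open)
  show ?thesis
  proof
    assume "eventually P (nb n x)"
    then obtain S where S: "open S" "x \<in> S" "\<And>y. y \<in> S \<Longrightarrow> y \<in> Rn n \<Longrightarrow> P y" using * by auto
    have "openin (E n) (Rn n \<inter> S)" using ** S(1) by metis
    then show "\<exists>U. openin (E n) U \<and> x \<in> U \<and> (\<forall>y\<in>U. P y)"
      using S assms by (meson IntD1 IntD2 IntI)
  next
    assume "\<exists>U. openin (E n) U \<and> x \<in> U \<and> (\<forall>y\<in>U. P y)"
    then obtain U where U: "openin (E n) U" "x \<in> U" "\<forall>y\<in>U. P y" by blast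
    then obtain S where "open S" "U = Rn n \<inter> S" using ** by metis
    then show "eventually P (nb n x)"
      using U * by (metis IntD2 IntI)
  qed
qed

lemma openin_iff_nb:
  "openin (E n) U \<longleftrightarrow> U \<subseteq> Rn n \<and> (\<forall>x\<in>U. eventually (\<lambda>y. y \<in> U) (nb n x))"
proof
  assume "openin (E n) U"
  then show "U \<subseteq> Rn n \<and> (\<forall>x\<in>U. eventually (\<lambda>y. y \<in> U) (nb n x))"
    using openin_subset[of "E n" U] eventually_nb by blast
next
  assume "U \<subseteq> Rn n \<and> (\<forall>x\<in>U. eventually (\<lambda>y. y \<in> U) (nb n x))"
  then have U: "U \<subseteq> Rn n" and ev: "\<And>x. x \<in> U \<Longrightarrow> eventually (\<lambda>y. y \<in> U) (nb n x)"
    by auto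
  show "openin (E n) U"
  proof (subst openin_subopen, intro ballI)
    fix x assume "x \<in> U"
    then show "\<exists>T. openin (E n) T \<and> x \<in> T \<and> T \<subseteq> U"
      using ev[of x] U eventually_nb[of x n "\<lambda>y. y \<in> U"] by blast
  qed
qed

lemma openin_eventually_nb: "openin (E n) U \<Longrightarrow> x \<in> U \<Longrightarrow> eventually (\<lambda>y. y \<in> U) (nb n x)"
  using openin_iff_nb by blast

lemma openin_Rn: "openin (E n) U \<Longrightarrow> U \<subseteq> Rn n"
  by (rule openin_subset)

lemma eventually_nb_self: "eventually P (nb n x) \<Longrightarrow> x \<in> Rn n \<Longrightarrow> P x"
  using eventually_nb by blast

lemma eventually_nb_Rn: "eventually (\<lambda>y. y \<in> Rn n) (nb n x)"
  by (simp add: nb_def eventually_inf_principal)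

lemma eventually_nb_nb:
  assumes "eventually P (nb n x)" "x \<in> Rn n"
  shows "eventually (\<lambda>y. eventually P (nb n y)) (nb n x)"
proof -
  obtain U where U: "openin (E n) U" "x \<in> U" "\<And>y. y \<in> U \<Longrightarrow> P y"
    using assms(1) unfolding eventually_nb[OF assms(2)] by auto
  have "eventually P (nb n y)" if "y \<in> U" for y
    using openin_eventually_nb[OF U(1) that] by (rule eventually_mono) (rule U(3))
  then show ?thesis
    using openin_eventually_nb[OF U(1,2)] by (auto elim: eventually_mono)
qed

lemma tendsto_coord_nb: "((\<lambda>y. y i) \<longlongrightarrow> x i) (nb n x)"
proof -
  have "continuous_on UNIV (\<lambda>y :: nat \<Rightarrow> real. y i)"
    by (rule continuous_on_product_coordinates)
  then have "((\<lambda>y. y i) \<longlongrightarrow> x i) (nhds x)"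
    by (metis UNIV_I continuous_on_eq_continuous_at isCont_def open_UNIV tendsto_at_iff_tendsto_nhds)
  then show ?thesis
    by (rule tendsto_mono[rotated]) (simp add: nb_def)
qed

text \<open>A basic open set of the product topology restricts finitely many coordinates. Those of
  index at least n agree for x and y, both being 0 there, so only the first n intervals
  matter.\<close>

lemma eventually_nb_box:
  assumes x: "x \<in> Rn n"
  shows "eventually P (nb n x) \<longleftrightarrow> (\<exists>e>0. \<forall>y\<in>Rn n. (\<forall>i<n. \<bar>y i - x i\<bar> < e) \<longrightarrow> P y)"
proof
  assume "eventually P (nb n x)"
  then obtain S where S: "open S" "x \<in> S" "\<And>y. y \<in> S \<Longrightarrow> y \<in> Rn n \<Longrightarrow> P y"
    by (auto simp: nb_def eventually_inf_principal eventually_nhds)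
  have "openin (powertop_real UNIV) S"
    by (metis S(1) euclidean_product_topology open_openin)
  then obtain X where X: "x \<in> (\<Pi>\<^sub>E i\<in>UNIV. X i)" "\<And>i. openin euclideanreal (X i)"
      "finite {i. X i \<noteq> topspace euclideanreal}" "(\<Pi>\<^sub>E i\<in>UNIV. X i) \<subseteq> S"
    using product_topology_open_contains_basis[of "\<lambda>_. euclideanreal" UNIV S x] S(2) by auto
  have "\<exists>e>0. \<forall>t. \<bar>t - x i\<bar> < e \<longrightarrow> t \<in> X i" for i
  proof -
    have "open (X i)" "x i \<in> X i" using X(1,2) by (auto simp: PiE_def)
    then show ?thesis
      by (auto simp: open_dist dist_real_def)
  qed
  then obtain e where e: "\<And>i. e i > 0" "\<And>i t. \<bar>t - x i\<bar> < e i \<Longrightarrow> t \<in> X i"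
    by metis
  \<comment> \<open>The extra element 1 keeps the minimum meaningful for n = 0.\<close>
  define d where "d = Min (insert 1 (e ` {..<n}))"
  have d: "d > 0" "\<And>i. i < n \<Longrightarrow> d \<le> e i"
    unfolding d_def using e(1) by (auto simp: Min_gr_iff)
  have "P y" if y: "y \<in> Rn n" "\<forall>i<n. \<bar>y i - x i\<bar> < d" for y
  proof (rule S(3)[OF _ y(1)])
    have "y i \<in> X i" for i
    proof (cases "i < n")
      case True then show ?thesis using y d e(2) by (meson less_le_trans)
    next
      case False then show ?thesis using y x e by (simp add: mem_Rn)
    qed
    then show "y \<in> S" using X(4) by (auto simp: PiE_def)
  qed
  then show "\<exists>e>0. \<forall>y\<in>Rn n. (\<forall>i<n. \<bar>y i - x i\<bar> < e) \<longrightarrow> P y" using d by blast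
next
  assume "\<exists>e>0. \<forall>y\<in>Rn n. (\<forall>i<n. \<bar>y i - x i\<bar> < e) \<longrightarrow> P y"
  then obtain e where e: "e > 0" "\<And>y. y \<in> Rn n \<Longrightarrow> (\<forall>i<n. \<bar>y i - x i\<bar> < e) \<Longrightarrow> P y" by auto
  have "eventually (\<lambda>y. \<forall>i\<in>{..<n}. \<bar>y i - x i\<bar> < e) (nb n x)"
  proof (intro eventually_ball_finite ballI)
    fix i show "\<forall>\<^sub>F y in nb n x. \<bar>y i - x i\<bar> < e"
      using tendstoD[OF tendsto_coord_nb e(1)] by (simp add: dist_real_def)
  qed simp
  then show "eventually P (nb n x)"
    using eventually_nb_Rn[of n x] by eventually_elim (use e in auto)
qed

lemma filterlim_nb:
  assumes x: "x \<in> Rn n" and Rn: "eventually (\<lambda>t. F t \<in> Rn n) G"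
    and lim: "\<And>j. j < n \<Longrightarrow> ((\<lambda>t. F t j) \<longlongrightarrow> x j) G"
  shows "filterlim F (nb n x) G"
  unfolding filterlim_iff
proof (intro allI impI)
  fix P assume "eventually P (nb n x)"
  then obtain e where e: "e > 0" "\<And>y. y \<in> Rn n \<Longrightarrow> (\<forall>i<n. \<bar>y i - x i\<bar> < e) \<Longrightarrow> P y"
    using eventually_nb_box[OF x] by auto
  have "eventually (\<lambda>t. \<forall>i\<in>{..<n}. \<bar>F t i - x i\<bar> < e) G"
  proof (intro eventually_ball_finite ballI)
    fix i assume "i \<in> {..<n}"
    then show "\<forall>\<^sub>F t in G. \<bar>F t i - x i\<bar> < e"
      using tendstoD[OF lim[of i] e(1)] by (simp add: dist_real_def)
  qed simp
  then show "eventually (\<lambda>t. P (F t)) G" using Rn by eventually_elim (use e in auto)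
qed

lemma continuous_on_nb:
  assumes U: "openin (E n) U"
  shows "continuous_on U f \<longleftrightarrow> (\<forall>x\<in>U. (f \<longlongrightarrow> f x) (nb n x))"
proof -
  have "(f \<longlongrightarrow> f x) (at x within U) \<longleftrightarrow> (f \<longlongrightarrow> f x) (nb n x)" if x: "x \<in> U" for x
  proof -
    have *: "eventually P (nb n x) \<longleftrightarrow> eventually (\<lambda>y. y \<in> U \<longrightarrow> P y) (nhds x)" for P
    proof
      assume "eventually P (nb n x)"
      then show "eventually (\<lambda>y. y \<in> U \<longrightarrow> P y) (nhds x)"
        unfolding nb_def eventually_inf_principal
        by eventually_elim (use openin_Rn[OF U] in auto)
    next
      assume "eventually (\<lambda>y. y \<in> U \<longrightarrow> P y) (nhds x)"
      moreover have "eventually (\<lambda>y. y \<in> Rn n \<longrightarrow> y \<in> U) (nhds x)"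
        using openin_eventually_nb[OF U x] by (simp add: nb_def eventually_inf_principal)
      ultimately show "eventually P (nb n x)"
        unfolding nb_def eventually_inf_principal by eventually_elim auto
    qed
    show ?thesis
      unfolding tendsto_def * eventually_at_filter
      by (intro all_cong1 imp_cong refl) (auto elim!: eventually_mono)
  qed
  then show ?thesis by (simp add: continuous_on_def)
qed

lemma continuous_onD_nb:
  "continuous_on U f \<Longrightarrow> openin (E n) U \<Longrightarrow> x \<in> U \<Longrightarrow> (f \<longlongrightarrow> f x) (nb n x)"
  by (simp only: continuous_on_nb)

lemma openin_upd:
  assumes "openin (E n) U" "x \<in> U" "i < n"
  shows "eventually (\<lambda>t. x(i := t) \<in> U) (nhds (x i))"
proof -
  have x: "x \<in> Rn n" using assms openin_Rn by blast
  have "filterlim (\<lambda>t. x(i := t)) (nb n x) (nhds (x i))"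
  proof (rule filterlim_nb[OF x])
    show "\<forall>\<^sub>F t in nhds (x i). x(i := t) \<in> Rn n" using x assms by (simp add: Rn_upd)
    show "((\<lambda>t. (x(i := t)) j) \<longlongrightarrow> x j) (nhds (x i))" for j
      by (cases "j = i") (auto simp: filterlim_ident)
  qed
  then show ?thesis
    using openin_eventually_nb[OF assms(1,2)] by (rule eventually_compose_filterlim[rotated])
qed

section \<open>Functions of class \<open>C\<^sup>k\<close>\<close>

lemma C_k_on_partial:
  assumes "C_k_on n (Suc k) U f" "x \<in> U" "i < n"
  shows "((\<lambda>t. f (x(i := t))) has_real_derivative partial i f x) (at (x i))"
  using assms by (simp add: partial_def field_differentiable_derivI)

lemma C_k_on_continuous: "C_k_on n k U f \<Longrightarrow> continuous_on U f"
  by (cases k) auto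

lemma C_k_on_Suc: "C_k_on n (Suc k) U f \<Longrightarrow> C_k_on n k U f"
  by (induction k arbitrary: f) auto

lemma C_k_on_le: "C_k_on n l U f \<Longrightarrow> k \<le> l \<Longrightarrow> C_k_on n k U f"
proof (induction l)
  case (Suc l)
  then show ?case using C_k_on_Suc by (cases "k = Suc l") auto
qed simp

lemma C_k_on_subset: "C_k_on n k U f \<Longrightarrow> V \<subseteq> U \<Longrightarrow> C_k_on n k V f"
  by (induction k arbitrary: f) (auto intro: continuous_on_subset)

lemma partial_cong:
  assumes "openin (E n) U" "x \<in> U" "i < n" "\<And>y. y \<in> U \<Longrightarrow> f y = g y"
  shows "partial i f x = partial i g x"
  unfolding partial_def
proof (rule deriv_cong_ev)
  show "\<forall>\<^sub>F t in nhds (x i). f (x(i := t)) = g (x(i := t))"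
    using openin_upd[OF assms(1-3)] by (rule eventually_mono) (rule assms(4))
qed simp

text \<open>\<open>partial i f\<close> equals \<open>D i\<close> only on U, so passing from one to
  the other requires that \<open>C_k_on\<close> at level k respects equality on U. That congruence
  is itself proved from this lemma by induction on k, and therefore enters as an assumption.\<close>

lemma C_k_on_SucI_cong:
  assumes U: "openin (E n) U" and cont: "continuous_on U f"
    and der: "\<And>i x. i < n \<Longrightarrow> x \<in> U \<Longrightarrow> ((\<lambda>t. f (x(i := t))) has_real_derivative D i x) (at (x i))"
    and D: "\<And>i. i < n \<Longrightarrow> C_k_on n k U (D i)"
    and cong: "\<And>f g. (\<And>x. x \<in> U \<Longrightarrow> f x = g x) \<Longrightarrow> C_k_on n k U f \<Longrightarrow> C_k_on n k U g"
  shows "C_k_on n (Suc k) U f"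
proof -
  have "partial i f x = D i x" if "i < n" "x \<in> U" for i x
    unfolding partial_def using der[OF that] by (rule DERIV_imp_deriv)
  then show ?thesis
    using cont der cong[OF _ D] by (auto simp: field_differentiable_def) metis
qed

lemma C_k_on_cong:
  assumes U: "openin (E n) U" and eq: "\<And>x. x \<in> U \<Longrightarrow> f x = g x" and f: "C_k_on n k U f"
  shows "C_k_on n k U g"
  using eq f
proof (induction k arbitrary: f g)
  case 0
  then show ?case using continuous_on_cong[of U U f g] by simp
next
  case (Suc k)
  show ?case
  proof (rule C_k_on_SucI_cong[OF U, where D = "\<lambda>i. partial i f"])
    show "continuous_on U g"
      using Suc.prems C_k_on_continuous[OF Suc.prems(2)] continuous_on_cong[of U U f g] by auto
    fix i x assume i: "i < n" and x: "x \<in> U"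
    show "((\<lambda>t. g (x(i := t))) has_real_derivative partial i f x) (at (x i))"
    proof -
      have "eventually (\<lambda>t. g (x(i := t)) = f (x(i := t))) (nhds (x i))"
        using openin_upd[OF U x i] by (rule eventually_mono) (rule Suc.prems(1)[symmetric])
      from DERIV_cong_ev[OF refl this refl] show ?thesis
        using C_k_on_partial[OF Suc.prems(2) x i] by blast
    qed
  qed (use Suc in auto)
qed

lemma C_k_on_SucI:
  assumes "openin (E n) U" "continuous_on U f"
    "\<And>i x. i < n \<Longrightarrow> x \<in> U \<Longrightarrow> ((\<lambda>t. f (x(i := t))) has_real_derivative D i x) (at (x i))"
    "\<And>i. i < n \<Longrightarrow> C_k_on n k U (D i)"
  shows "C_k_on n (Suc k) U f"
  by (rule C_k_on_SucI_cong[OF assms(1,2), where D = D]) (auto intro: assms C_k_on_cong[OF assms(1)])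

lemma C_k_on_open_cover:
  assumes U: "openin (E n) U"
    and loc: "\<And>x. x \<in> U \<Longrightarrow> \<exists>V. openin (E n) V \<and> x \<in> V \<and> C_k_on n k V f"
  shows "C_k_on n k U f"
  using loc
proof (induction k arbitrary: f)
  case 0
  show ?case unfolding C_k_on.simps continuous_on_nb[OF U]
  proof
    fix x assume "x \<in> U"
    then obtain V where V: "openin (E n) V" "x \<in> V" "continuous_on V f" using 0[of x] by auto
    show "(f \<longlongrightarrow> f x) (nb n x)" using V(2,3) unfolding continuous_on_nb[OF V(1)] by blast
  qed
next
  case (Suc k)
  have "C_k_on n k U (partial i f)" if i: "i < n" for i
  proof (rule Suc.IH)
    fix x assume "x \<in> U"
    from Suc.prems[OF this] show "\<exists>V. openin (E n) V \<and> x \<in> V \<and> C_k_on n k V (partial i f)"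
      using i by auto
  qed
  moreover have "(\<lambda>t. f (x(i := t))) field_differentiable at (x i)" if "i < n" "x \<in> U" for i x
    using Suc.prems[OF that(2)] that(1) by auto
  moreover have "continuous_on U f"
    unfolding continuous_on_nb[OF U]
  proof
    fix x assume "x \<in> U"
    then obtain V where V: "openin (E n) V" "x \<in> V" "continuous_on V f" using Suc.prems[of x] by auto
    show "(f \<longlongrightarrow> f x) (nb n x)" using V(2,3) unfolding continuous_on_nb[OF V(1)] by blast
  qed
  ultimately show ?case by simp
qed

lemma C_k_on_const: "openin (E n) U \<Longrightarrow> C_k_on n k U (\<lambda>x. a)"
proof (induction k arbitrary: a)
  case (Suc k)
  then show ?case
    by (intro C_k_on_SucI[where D = "\<lambda>_ _. 0"]) auto
qed simp

lemma C_k_on_coord: "openin (E n) U \<Longrightarrow> C_k_on n k U (\<lambda>x. x j)"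
proof (cases k)
  case (Suc k)
  assume "openin (E n) U"
  moreover have "((\<lambda>t. (x(i := t)) j) has_real_derivative (if i = j then 1 else 0)) (at (x i))" for x i
    by (cases "i = j") auto
  ultimately show ?thesis unfolding Suc
    by (intro C_k_on_SucI[where D = "\<lambda>i _. if i = j then 1 else 0"] C_k_on_const)
       (auto intro: continuous_on_subset[OF continuous_on_product_coordinates])
qed (auto intro: continuous_on_subset[OF continuous_on_product_coordinates])

lemma C_k_on_add:
  assumes U: "openin (E n) U" and "C_k_on n k U f" "C_k_on n k U g"
  shows "C_k_on n k U (\<lambda>x. f x + g x)"
  using assms(2,3)
proof (induction k arbitrary: f g)
  case (Suc k)
  show ?case
  proof (rule C_k_on_SucI[OF U, where D = "\<lambda>i x. partial i f x + partial i g x"])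
    show "((\<lambda>t. f (x(i := t)) + g (x(i := t))) has_real_derivative partial i f x + partial i g x) (at (x i))"
      if "i < n" "x \<in> U" for i x
      by (rule DERIV_add[OF C_k_on_partial[OF Suc.prems(1) that(2,1)] C_k_on_partial[OF Suc.prems(2) that(2,1)]])
  qed (use Suc in \<open>auto intro!: continuous_intros\<close>)
qed (auto intro: continuous_intros)

lemma C_k_on_mult:
  assumes U: "openin (E n) U" and "C_k_on n k U f" "C_k_on n k U g"
  shows "C_k_on n k U (\<lambda>x. f x * g x)"
  using assms(2,3)
proof (induction k arbitrary: f g)
  case (Suc k)
  show ?case
  proof (rule C_k_on_SucI[OF U, where D = "\<lambda>i x. partial i f x * g x + partial i g x * f x"])
    show "((\<lambda>t. f (x(i := t)) * g (x(i := t))) has_real_derivative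
        partial i f x * g x + partial i g x * f x) (at (x i))" if "i < n" "x \<in> U" for i x
      by (rule DERIV_cong[OF DERIV_mult[OF C_k_on_partial[OF Suc.prems(1) that(2,1)]
              C_k_on_partial[OF Suc.prems(2) that(2,1)]]]) (simp only: fun_upd_triv)
    show "C_k_on n k U (\<lambda>x. partial i f x * g x + partial i g x * f x)" if "i < n" for i
      using Suc that by (intro C_k_on_add[OF U] Suc.IH) (auto intro: C_k_on_Suc)
  qed (use Suc in \<open>auto intro!: continuous_intros\<close>)
qed (auto intro: continuous_intros)

lemma C_k_on_sum:
  assumes U: "openin (E n) U" and "\<And>j. j \<in> J \<Longrightarrow> C_k_on n k U (f j)"
  shows "C_k_on n k U (\<lambda>x. \<Sum>j\<in>J. f j x)"
  using assms(2)
  by (induction J rule: infinite_finite_induct) (auto intro: C_k_on_const C_k_on_add U)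

lemma C_k_on_inverse:
  assumes U: "openin (E n) U" and "C_k_on n k U f" and nz: "\<And>x. x \<in> U \<Longrightarrow> f x \<noteq> 0"
  shows "C_k_on n k U (\<lambda>x. inverse (f x))"
  using assms(2)
proof (induction k)
  case 0
  then show ?case using nz by (auto intro!: continuous_intros)
next
  case (Suc k)
  have inv: "C_k_on n k U (\<lambda>x. inverse (f x))" using Suc by (simp del: C_k_on.simps add: C_k_on_Suc)
  show ?case
  proof (rule C_k_on_SucI[OF U, where D = "\<lambda>i x. (-1) * (inverse (f x) * partial i f x * inverse (f x))"])
    show "((\<lambda>t. inverse (f (x(i := t)))) has_real_derivative
        (-1) * (inverse (f x) * partial i f x * inverse (f x))) (at (x i))" if "i < n" "x \<in> U" for i x
    proof (rule DERIV_cong[OF DERIV_inverse'[OF C_k_on_partial[OF Suc.prems that(2,1)]]])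
      show "f (x(i := x i)) \<noteq> 0" using nz[OF that(2)] by simp
    qed (simp only: fun_upd_triv mult_minus1)
    show "C_k_on n k U (\<lambda>x. (-1) * (inverse (f x) * partial i f x * inverse (f x)))" if "i < n" for i
      using Suc.prems that by (intro C_k_on_mult[OF U] C_k_on_const[OF U] inv) auto
  qed (use Suc nz in \<open>auto intro!: continuous_intros\<close>)
qed

text \<open>Stated with \<open>closed_segment\<close> so that a and b may come in either order, as
  they do when both endpoints move.\<close>

lemma partial_mean_value:
  assumes U: "openin (E n) U" and f: "C_k_on n (Suc 0) U f" and l: "l < n"
    and seg: "\<And>s. s \<in> closed_segment a b \<Longrightarrow> y(l := s) \<in> U"
  shows "\<exists>s\<in>closed_segment a b. f (y(l := b)) - f (y(l := a)) = (b - a) * partial l f (y(l := s))"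
proof -
  have der: "((\<lambda>s. f (y(l := s))) has_real_derivative partial l f (y(l := s))) (at s)"
    if "s \<in> closed_segment a b" for s
    using C_k_on_partial[OF f seg[OF that] l] by simp
  consider "a < b" | "a = b" | "b < a" by linarith
  then show ?thesis
  proof cases
    case 1
    obtain z where "z > a" "z < b"
        "f (y(l := b)) - f (y(l := a)) = (b - a) * partial l f (y(l := z))"
      using MVT2[OF 1, of "\<lambda>s. f (y(l := s))" "\<lambda>s. partial l f (y(l := s))"] der 1
      by (auto simp: closed_segment_eq_real_ivl)
    then show ?thesis using 1 by (auto simp: closed_segment_eq_real_ivl intro!: bexI[of _ z])
  next
    case 2 then show ?thesis by auto
  next
    case 3
    obtain z where "z > b" "z < a"
        "f (y(l := a)) - f (y(l := b)) = (a - b) * partial l f (y(l := z))"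
      using MVT2[OF 3, of "\<lambda>s. f (y(l := s))" "\<lambda>s. partial l f (y(l := s))"] der 3
      by (auto simp: closed_segment_eq_real_ivl)
    then show ?thesis using 3 by (auto simp: closed_segment_eq_real_ivl algebra_simps intro!: bexI[of _ z])
  qed
qed

text \<open>This takes the place of total differentiability: the base point \<open>y t\<close> may
  move together with the endpoints. The mean value point lies between \<open>a t\<close> and
  \<open>b t\<close>, is squeezed to \<open>x l\<close>, and continuity of the partial derivative
  gives the limit of D. The increment is stated as a product, which stays correct where
  \<open>a t = b t\<close>.\<close>

lemma partial_increment:
  fixes y :: "'b \<Rightarrow> nat \<Rightarrow> real" and a b :: "'b \<Rightarrow> real"
  assumes U: "openin (E n) U" and f: "C_k_on n (Suc 0) U f" and x: "x \<in> U" and l: "l < n"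
    and y: "filterlim y (nb n x) G" and a: "(a \<longlongrightarrow> x l) G" and b: "(b \<longlongrightarrow> x l) G"
  obtains D where "(D \<longlongrightarrow> partial l f x) G"
    "eventually (\<lambda>t. f ((y t)(l := b t)) - f ((y t)(l := a t)) = (b t - a t) * D t) G"
proof -
  have xR: "x \<in> Rn n" using U x openin_Rn by blast
  obtain e where e: "e > 0" "\<And>z. z \<in> Rn n \<Longrightarrow> (\<forall>i<n. \<bar>z i - x i\<bar> < e) \<Longrightarrow> z \<in> U"
    using openin_eventually_nb[OF U x] eventually_nb_box[OF xR] by auto
  have yR: "eventually (\<lambda>t. y t \<in> Rn n) G"
    using y eventually_nb_Rn by (auto simp: filterlim_iff)
  have yj: "((\<lambda>t. y t j) \<longlongrightarrow> x j) G" for j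
    using filterlim_compose[OF tendsto_coord_nb y] .
  have ye: "eventually (\<lambda>t. \<forall>i\<in>{..<n}. \<bar>y t i - x i\<bar> < e) G"
    by (intro eventually_ball_finite ballI) (use tendstoD[OF yj e(1)] in \<open>auto simp: dist_real_def\<close>)
  have ab: "eventually (\<lambda>t. \<bar>a t - x l\<bar> < e) G" "eventually (\<lambda>t. \<bar>b t - x l\<bar> < e) G"
    using tendstoD[OF a e(1)] tendstoD[OF b e(1)] by (auto simp: dist_real_def)
  \<comment> \<open>A mean value point for those t at which the segment lies in U; elsewhere the
    value is arbitrary.\<close>
  define s where "s t = (SOME s. s \<in> closed_segment (a t) (b t) \<and>
      f ((y t)(l := b t)) - f ((y t)(l := a t)) = (b t - a t) * partial l f ((y t)(l := s)))" for t
  have s: "eventually (\<lambda>t. s t \<in> closed_segment (a t) (b t) \<and>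
      f ((y t)(l := b t)) - f ((y t)(l := a t)) = (b t - a t) * partial l f ((y t)(l := s t))) G"
    using yR ye ab
  proof eventually_elim
    case (elim t)
    have seg: "(y t)(l := r) \<in> U" if "r \<in> closed_segment (a t) (b t)" for r
    proof (rule e(2))
      have "\<bar>r - x l\<bar> < e" using that elim by (auto simp: closed_segment_eq_real_ivl split: if_splits)
      then show "\<forall>i<n. \<bar>((y t)(l := r)) i - x i\<bar> < e" using elim by auto
    qed (use elim l in \<open>simp add: Rn_upd\<close>)
    show ?case
      unfolding s_def by (rule someI_ex) (use partial_mean_value[OF U f l seg] in auto)
  qed
  have slim: "(s \<longlongrightarrow> x l) G"
  proof (rule tendstoI)
    fix d :: real assume "d > 0"
    then have "eventually (\<lambda>t. \<bar>a t - x l\<bar> < d) G" "eventually (\<lambda>t. \<bar>b t - x l\<bar> < d) G"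
      using tendstoD[OF a] tendstoD[OF b] by (auto simp: dist_real_def)
    with s show "eventually (\<lambda>t. dist (s t) (x l) < d) G"
      by eventually_elim (auto simp: closed_segment_eq_real_ivl dist_real_def split: if_splits)
  qed
  have "filterlim (\<lambda>t. (y t)(l := s t)) (nb n x) G"
  proof (rule filterlim_nb[OF xR])
    show "\<forall>\<^sub>F t in G. (y t)(l := s t) \<in> Rn n" using yR by eventually_elim (use l in \<open>simp add: Rn_upd\<close>)
    show "((\<lambda>t. ((y t)(l := s t)) j) \<longlongrightarrow> x j) G" for j
      using slim yj by (cases "j = l") auto
  qed
  moreover have "(partial l f \<longlongrightarrow> partial l f x) (nb n x)"
  proof -
    have "continuous_on U (partial l f)" using f l by simp
    then show ?thesis using x by (simp only: continuous_on_nb[OF U])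
  qed
  ultimately have "((\<lambda>t. partial l f ((y t)(l := s t))) \<longlongrightarrow> partial l f x) G"
    by (rule filterlim_compose[rotated])
  then show ?thesis by (rule that) (use s in \<open>auto elim: eventually_mono\<close>)
qed

lemma chain_rule_curve:
  assumes V: "openin (E m) V" and f: "C_k_on m (Suc 0) V f" and g0: "g t0 \<in> V"
    and gR: "eventually (\<lambda>t. g t \<in> Rn m) (nhds t0)"
    and g: "\<And>j. j < m \<Longrightarrow> ((\<lambda>t. g t j) has_real_derivative v j) (at t0)"
  shows "((\<lambda>t. f (g t)) has_real_derivative dir_deriv m f (g t0) v) (at t0)"
proof -
  have g0R: "g t0 \<in> Rn m" using V g0 openin_Rn by blast
  \<comment> \<open>Telescoping: \<open>h l t\<close> has moved its first l coordinates from
    \<open>g t0\<close> to \<open>g t\<close>, so consecutive steps differ in one coordinate and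
    \<open>partial_increment\<close> applies.\<close>
  define h where "h l t = (\<lambda>i. if i < l then g t i else g t0 i)" for l t
  have gj: "((\<lambda>t. g t j) \<longlongrightarrow> g t0 j) (at t0)" if "j < m" for j
    using DERIV_isCont[OF g[OF that]] by (simp add: isCont_def)
  have hlim: "filterlim (h l) (nb m (g t0)) (at t0)" if "l \<le> m" for l
  proof (rule filterlim_nb[OF g0R])
    show "\<forall>\<^sub>F t in at t0. h l t \<in> Rn m"
      using that g0R by (auto simp: h_def mem_Rn)
    show "((\<lambda>t. h l t j) \<longlongrightarrow> g t0 j) (at t0)" if "j < m" for j
      using gj[OF that] by (cases "j < l") (simp_all add: h_def)
  qed
  have "((\<lambda>t. f (h l t)) has_real_derivative (\<Sum>j<l. v j * partial j f (g t0))) (at t0)" if "l \<le> m" for l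
    using that
  proof (induction l)
    case 0
    then show ?case by (simp add: h_def)
  next
    case (Suc l)
    then have l: "l < m" by simp
    obtain D where D: "(D \<longlongrightarrow> partial l f (g t0)) (at t0)"
      and Deq: "eventually (\<lambda>t. f ((h l t)(l := g t l)) - f ((h l t)(l := g t0 l)) = (g t l - g t0 l) * D t) (at t0)"
      using partial_increment[OF V f g0 l hlim[OF less_imp_le[OF l]] tendsto_const gj[OF l]] by blast
    have eq: "(h l t)(l := g t l) = h (Suc l) t" "(h l t)(l := g t0 l) = h l t" for t
      by (auto simp: h_def fun_eq_iff less_Suc_eq)
    have h0: "h l t0 = g t0" for l by (simp add: h_def)
    have "((\<lambda>t. (g t l - g t0 l) / (t - t0) * D t) \<longlongrightarrow> v l * partial l f (g t0)) (at t0)"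
      using g[OF l] D by (intro tendsto_mult) (simp add: has_field_derivative_iff)
    then have "((\<lambda>t. (f (h (Suc l) t) - f (h l t) - (f (h (Suc l) t0) - f (h l t0))) / (t - t0))
        \<longlongrightarrow> v l * partial l f (g t0)) (at t0)"
      by (rule Lim_transform_eventually) (use Deq in eventually_elim, auto simp: eq h0)
    then have "((\<lambda>t. f (h (Suc l) t) - f (h l t)) has_real_derivative v l * partial l f (g t0)) (at t0)"
      by (simp only: has_field_derivative_iff)
    from DERIV_add[OF Suc.IH this] show ?case using Suc.prems by simp
  qed
  from this[OF order_refl] have "((\<lambda>t. f (h m t)) has_real_derivative dir_deriv m f (g t0) v) (at t0)"
    by (simp add: dir_deriv_def)
  moreover have "eventually (\<lambda>t. f (g t) = f (h m t)) (nhds t0)"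
    using gR
  proof eventually_elim
    case (elim t)
    then have "h m t = g t" using g0R by (auto simp: h_def mem_Rn fun_eq_iff)
    then show ?case by simp
  qed
  ultimately show ?thesis by (subst DERIV_cong_ev[OF refl _ refl]) 
qed

text \<open>Induction on k for all f at once: by the chain rule the partial derivatives of the
  composite involve \<open>partial j f\<close> along F, to which the hypothesis for k
  applies.\<close>

lemma C_k_on_compose:
  assumes U: "openin (E n) U" and V: "openin (E m) V" and FV: "F ` U \<subseteq> V"
    and F: "\<And>j. j < m \<Longrightarrow> C_k_on n k U (\<lambda>x. F x j)" and f: "C_k_on m k V f"
  shows "C_k_on n k U (\<lambda>x. f (F x))"
  using F f
proof (induction k arbitrary: f)
  case 0
  show ?case unfolding C_k_on.simps continuous_on_nb[OF U]
  proof
    fix x assume x: "x \<in> U"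
    then have Fx: "F x \<in> V" using FV by auto
    have "filterlim F (nb m (F x)) (nb n x)"
    proof (rule filterlim_nb)
      show "F x \<in> Rn m" using Fx V openin_Rn by blast
      show "\<forall>\<^sub>F t in nb n x. F t \<in> Rn m"
        using openin_eventually_nb[OF U x] by eventually_elim (use FV V openin_Rn in blast)
      show "((\<lambda>t. F t j) \<longlongrightarrow> F x j) (nb n x)" if "j < m" for j
        using 0(1)[OF that] by (intro continuous_onD_nb[OF _ U x]) simp
    qed
    moreover have "(f \<longlongrightarrow> f (F x)) (nb m (F x))"
      using 0(2) by (intro continuous_onD_nb[OF _ V Fx]) simp
    ultimately show "((\<lambda>x. f (F x)) \<longlongrightarrow> f (F x)) (nb n x)" by (rule filterlim_compose[rotated])
  qed
next
  case (Suc k)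
  have Fk: "C_k_on n k U (\<lambda>x. F x j)" if "j < m" for j
    using Suc.prems(1)[OF that] by (rule C_k_on_Suc)
  show ?case
  proof (rule C_k_on_SucI[OF U, where D = "\<lambda>i x. \<Sum>j<m. partial i (\<lambda>y. F y j) x * partial j f (F x)"])
    have "C_k_on n k U (\<lambda>x. f (F x))" using Fk C_k_on_Suc[OF Suc.prems(2)] by (rule Suc.IH)
    then show "continuous_on U (\<lambda>x. f (F x))" by (rule C_k_on_continuous)
  next
    fix i x assume i: "i < n" and x: "x \<in> U"
    have Fx: "F (x(i := x i)) \<in> V" using FV x by auto
    have "((\<lambda>t. f (F (x(i := t)))) has_real_derivative
        dir_deriv m f (F (x(i := x i))) (\<lambda>j. partial i (\<lambda>y. F y j) x)) (at (x i))"
    proof (rule chain_rule_curve[where g = "\<lambda>t. F (x(i := t))", OF V _ Fx])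
      show "C_k_on m (Suc 0) V f" using Suc.prems(2) by (rule C_k_on_le) simp
      show "\<forall>\<^sub>F t in nhds (x i). F (x(i := t)) \<in> Rn m"
        using openin_upd[OF U x i] by eventually_elim (use FV V openin_Rn in blast)
      show "((\<lambda>t. F (x(i := t)) j) has_real_derivative partial i (\<lambda>y. F y j) x) (at (x i))" if "j < m" for j
        using C_k_on_partial[OF Suc.prems(1)[OF that] x i] .
    qed
    then show "((\<lambda>t. f (F (x(i := t)))) has_real_derivative
        (\<Sum>j<m. partial i (\<lambda>y. F y j) x * partial j f (F x))) (at (x i))"
      by (simp only: dir_deriv_def fun_upd_triv)
  next
    fix i assume i: "i < n"
    have "C_k_on n k U (\<lambda>x. partial j f (F x))" if "j < m" for j
      by (rule Suc.IH[OF Fk]) (use Suc.prems(2) that in auto)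
    moreover have "C_k_on n k U (partial i (\<lambda>y. F y j))" if "j < m" for j
      using Suc.prems(1)[OF that] i by simp
    ultimately show "C_k_on n k U (\<lambda>x. \<Sum>j<m. partial i (\<lambda>y. F y j) x * partial j f (F x))"
      by (intro C_k_on_sum[OF U] C_k_on_mult[OF U]) auto
  qed
qed

section \<open>Germs of smooth maps\<close>

text \<open>Charts, transition maps and plots all come with domains of their own. Working with germs
  replaces intersections of domains by \<open>eventually\<close> statements.\<close>

definition smooth_at :: "nat \<Rightarrow> ((nat \<Rightarrow> real) \<Rightarrow> real) \<Rightarrow> (nat \<Rightarrow> real) \<Rightarrow> bool" where
  "smooth_at n f x \<longleftrightarrow> (\<exists>U. openin (E n) U \<and> x \<in> U \<and> smooth_fun_on n U f)"

definition smooth_map_at ::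
    "nat \<Rightarrow> nat \<Rightarrow> ((nat \<Rightarrow> real) \<Rightarrow> nat \<Rightarrow> real) \<Rightarrow> (nat \<Rightarrow> real) \<Rightarrow> bool" where
  "smooth_map_at n m F x \<longleftrightarrow> x \<in> Rn n \<and> eventually (\<lambda>y. F y \<in> Rn m) (nb n x) \<and>
     (\<forall>j<m. smooth_at n (\<lambda>y. F y j) x)"

lemma smooth_atE:
  assumes "smooth_at n f x"
  obtains U where "openin (E n) U" "x \<in> U" "\<And>k. C_k_on n k U f"
  using assms unfolding smooth_at_def smooth_fun_on_def by metis

lemma smooth_atI: "openin (E n) U \<Longrightarrow> x \<in> U \<Longrightarrow> (\<And>k. C_k_on n k U f) \<Longrightarrow> smooth_at n f x"
  unfolding smooth_at_def smooth_fun_on_def by metis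

lemma smooth_at_Rn: "smooth_at n f x \<Longrightarrow> x \<in> Rn n"
  using openin_Rn by (elim smooth_atE) (metis subsetD)

lemma smooth_fun_on_iff:
  assumes U: "openin (E n) U"
  shows "smooth_fun_on n U f \<longleftrightarrow> (\<forall>x\<in>U. smooth_at n f x)"
proof
  assume "smooth_fun_on n U f"
  then show "\<forall>x\<in>U. smooth_at n f x" using U unfolding smooth_at_def by metis
next
  assume *: "\<forall>x\<in>U. smooth_at n f x"
  show "smooth_fun_on n U f" unfolding smooth_fun_on_def
  proof (intro allI C_k_on_open_cover[OF U])
    fix k x assume "x \<in> U"
    with * have "smooth_at n f x" by simp
    then show "\<exists>V. openin (E n) V \<and> x \<in> V \<and> C_k_on n k V f"
      by (elim smooth_atE) metis
  qed
qed

lemma smooth_vec_on_iff: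
  assumes U: "openin (E n) U"
  shows "smooth_vec_on n m U F \<longleftrightarrow> F ` U \<subseteq> Rn m \<and> (\<forall>x\<in>U. smooth_map_at n m F x)"
proof -
  have "eventually (\<lambda>y. F y \<in> Rn m) (nb n x)" if "F ` U \<subseteq> Rn m" "x \<in> U" for x
    using openin_eventually_nb[OF U that(2)] by (rule eventually_mono) (use that(1) in blast)
  then show ?thesis
    unfolding smooth_vec_on_def smooth_fun_on_iff[OF U] smooth_map_at_def
    using openin_Rn[OF U] by (auto simp del: topspace_Euclidean_space)
qed

lemma smooth_map_atI:
  assumes "openin (E n) U" "x \<in> U" "smooth_vec_on n m U F"
  shows "smooth_map_at n m F x"
  using assms smooth_vec_on_iff by metis

lemma smooth_at_cong:
  assumes f: "smooth_at n f x" and eq: "eventually (\<lambda>y. f y = g y) (nb n x)"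
  shows "smooth_at n g x"
proof -
  obtain U where U: "openin (E n) U" "x \<in> U" "\<And>k. C_k_on n k U f" using f by (rule smooth_atE) blast
  obtain V where V: "openin (E n) V" "x \<in> V" "\<And>y. y \<in> V \<Longrightarrow> f y = g y"
    using eq unfolding eventually_nb[OF smooth_at_Rn[OF f]] by blast
  have UV: "openin (E n) (U \<inter> V)" using U V by blast
  show ?thesis
  proof (rule smooth_atI[OF UV])
    show "C_k_on n k (U \<inter> V) g" for k
      by (rule C_k_on_cong[OF UV _ C_k_on_subset[OF U(3)]]) (use V in auto)
  qed (use U V in auto)
qed

lemma smooth_at_eventually:
  assumes "smooth_at n f x"
  shows "eventually (smooth_at n f) (nb n x)"
proof -
  obtain U where U: "openin (E n) U" "x \<in> U" "\<And>k. C_k_on n k U f" using assms by (rule smooth_atE) blast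
  show ?thesis
    using openin_eventually_nb[OF U(1,2)] by (rule eventually_mono) (rule smooth_atI[OF U(1) _ U(3)])
qed

lemma smooth_at_const: "x \<in> Rn n \<Longrightarrow> smooth_at n (\<lambda>x. a) x"
  by (rule smooth_atI[of n "Rn n"]) (auto intro: C_k_on_const)

lemma smooth_at_coord: "x \<in> Rn n \<Longrightarrow> smooth_at n (\<lambda>x. x j) x"
  by (rule smooth_atI[of n "Rn n"]) (auto intro: C_k_on_coord)

lemma smooth_at_binop:
  assumes f: "smooth_at n f x" and g: "smooth_at n g x"
    and op: "\<And>U k. openin (E n) U \<Longrightarrow> C_k_on n k U f \<Longrightarrow> C_k_on n k U g \<Longrightarrow> C_k_on n k U h"
  shows "smooth_at n h x"
proof -
  obtain U where U: "openin (E n) U" "x \<in> U" "\<And>k. C_k_on n k U f" using f by (rule smooth_atE) blast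
  obtain V where V: "openin (E n) V" "x \<in> V" "\<And>k. C_k_on n k V g" using g by (rule smooth_atE) blast
  have UV: "openin (E n) (U \<inter> V)" using U V by blast
  have "C_k_on n k (U \<inter> V) h" for k
    by (rule op[OF UV]) (rule C_k_on_subset[OF U(3)] C_k_on_subset[OF V(3)], blast)+
  then show ?thesis using U V by (intro smooth_atI[OF UV]) auto
qed

lemma smooth_at_add: "smooth_at n f x \<Longrightarrow> smooth_at n g x \<Longrightarrow> smooth_at n (\<lambda>x. f x + g x) x"
  by (rule smooth_at_binop[of n f x g]) (auto intro: C_k_on_add)

lemma smooth_at_mult: "smooth_at n f x \<Longrightarrow> smooth_at n g x \<Longrightarrow> smooth_at n (\<lambda>x. f x * g x) x"
  by (rule smooth_at_binop[of n f x g]) (auto intro: C_k_on_mult)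

lemma smooth_at_sum:
  "x \<in> Rn n \<Longrightarrow> (\<And>j. j \<in> J \<Longrightarrow> smooth_at n (f j) x) \<Longrightarrow> smooth_at n (\<lambda>x. \<Sum>j\<in>J. f j x) x"
  by (induction J rule: infinite_finite_induct) (auto intro: smooth_at_const smooth_at_add)

lemma smooth_at_partial: "smooth_at n f x \<Longrightarrow> i < n \<Longrightarrow> smooth_at n (partial i f) x"
proof (elim smooth_atE)
  fix U assume U: "openin (E n) U" "x \<in> U" "\<And>k. C_k_on n k U f" and i: "i < n"
  have "C_k_on n k U (partial i f)" for k using U(3)[of "Suc k"] i by simp
  then show ?thesis by (rule smooth_atI[OF U(1,2)])
qed

lemma smooth_at_tendsto: "smooth_at n f x \<Longrightarrow> (f \<longlongrightarrow> f x) (nb n x)"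
  by (elim smooth_atE) (metis continuous_onD_nb C_k_on_continuous)

lemma smooth_map_at_Rn: "smooth_map_at n m F x \<Longrightarrow> F x \<in> Rn m"
  using eventually_nb_self by (auto simp: smooth_map_at_def)

lemma smooth_map_at_dom: "smooth_map_at n m F x \<Longrightarrow> x \<in> Rn n"
  by (simp add: smooth_map_at_def)

text \<open>The claim includes j beyond m, where the coordinate is locally 0; later arguments then
  need no case distinction on j.\<close>

lemma smooth_map_at_coord: "smooth_map_at n m F x \<Longrightarrow> smooth_at n (\<lambda>y. F y j) x"
proof (cases "j < m")
  case False
  assume F: "smooth_map_at n m F x"
  have "eventually (\<lambda>y. 0 = F y j) (nb n x)"
    using F False unfolding smooth_map_at_def by (auto elim!: eventually_mono simp: mem_Rn)
  then show ?thesis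
    by (rule smooth_at_cong[OF smooth_at_const[OF smooth_map_at_dom[OF F]]])
qed (simp add: smooth_map_at_def)

lemma smooth_map_at_filterlim:
  assumes F: "smooth_map_at n m F x"
  shows "filterlim F (nb m (F x)) (nb n x)"
  by (rule filterlim_nb[OF smooth_map_at_Rn[OF F]])
     (use F smooth_at_tendsto[OF smooth_map_at_coord[OF F]] in \<open>auto simp: smooth_map_at_def\<close>)

lemma eventually_smooth_map_at:
  "smooth_map_at n m F x \<Longrightarrow> eventually P (nb m (F x)) \<Longrightarrow> eventually (\<lambda>y. P (F y)) (nb n x)"
  using eventually_compose_filterlim smooth_map_at_filterlim by blast

lemma smooth_map_at_eventually:
  assumes F: "smooth_map_at n m F x"
  shows "eventually (smooth_map_at n m F) (nb n x)"
proof -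
  have x: "x \<in> Rn n" using F by (rule smooth_map_at_dom)
  have "eventually (\<lambda>y. eventually (\<lambda>y. F y \<in> Rn m) (nb n y)) (nb n x)"
    using F x by (intro eventually_nb_nb) (auto simp: smooth_map_at_def)
  moreover have "eventually (\<lambda>y. \<forall>j\<in>{..<m}. smooth_at n (\<lambda>y. F y j) y) (nb n x)"
    by (intro eventually_ball_finite ballI smooth_at_eventually smooth_map_at_coord[OF F]) simp
  ultimately show ?thesis
    using eventually_nb_Rn by eventually_elim (auto simp: smooth_map_at_def)
qed

lemma smooth_at_compose:
  assumes F: "smooth_map_at n m F x" and f: "smooth_at m f (F x)"
  shows "smooth_at n (\<lambda>x. f (F x)) x"
proof -
  have x: "x \<in> Rn n" using F by (rule smooth_map_at_dom)
  obtain V where V: "openin (E m) V" "F x \<in> V" "\<And>k. C_k_on m k V f" using f by (rule smooth_atE) blast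
  have "eventually (\<lambda>y. F y \<in> V \<and> (\<forall>j\<in>{..<m}. smooth_at n (\<lambda>y. F y j) y)) (nb n x)"
    by (intro eventually_conj eventually_ball_finite ballI smooth_at_eventually smooth_map_at_coord[OF F]
        eventually_smooth_map_at[OF F] openin_eventually_nb[OF V(1,2)]) simp
  then obtain U where U: "openin (E n) U" "x \<in> U"
    "\<And>y. y \<in> U \<Longrightarrow> F y \<in> V \<and> (\<forall>j\<in>{..<m}. smooth_at n (\<lambda>y. F y j) y)"
    unfolding eventually_nb[OF x] by blast
  have "C_k_on n k U (\<lambda>y. F y j)" if "j < m" for j k
  proof -
    have "smooth_fun_on n U (\<lambda>y. F y j)"
      unfolding smooth_fun_on_iff[OF U(1)] using U(3) that by simp
    then show ?thesis by (simp add: smooth_fun_on_def)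
  qed
  moreover have "F ` U \<subseteq> V" using U(3) by blast
  ultimately have "C_k_on n k U (\<lambda>x. f (F x))" for k
    by (intro C_k_on_compose[OF U(1) V(1) _ _ V(3), of F]) simp_all
  then show ?thesis by (rule smooth_atI[OF U(1,2)])
qed

lemma smooth_map_at_compose:
  assumes F: "smooth_map_at n m F x" and G: "smooth_map_at m l G (F x)"
  shows "smooth_map_at n l (\<lambda>x. G (F x)) x"
  unfolding smooth_map_at_def
proof (intro conjI allI impI)
  show "x \<in> Rn n" using F by (rule smooth_map_at_dom)
  show "\<forall>\<^sub>F y in nb n x. G (F y) \<in> Rn l"
    using eventually_smooth_map_at[OF F] G by (auto simp: smooth_map_at_def)
  show "smooth_at n (\<lambda>y. G (F y) j) x" for j
    using smooth_at_compose[OF F smooth_map_at_coord[OF G]] .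
qed

lemma smooth_map_at_cong:
  assumes F: "smooth_map_at n m F x" and eq: "eventually (\<lambda>y. F y = G y) (nb n x)"
  shows "smooth_map_at n m G x"
  unfolding smooth_map_at_def
proof (intro conjI allI impI)
  show "x \<in> Rn n" using F by (rule smooth_map_at_dom)
  have "eventually (\<lambda>y. F y \<in> Rn m) (nb n x)" using F by (simp add: smooth_map_at_def)
  then show "\<forall>\<^sub>F y in nb n x. G y \<in> Rn m" using eq by eventually_elim simp
  show "smooth_at n (\<lambda>y. G y j) x" for j
    by (rule smooth_at_cong[OF smooth_map_at_coord[OF F]]) (use eq in eventually_elim, simp)
qed

lemma smooth_map_at_id: "x \<in> Rn n \<Longrightarrow> smooth_map_at n n (\<lambda>x. x) x"
  by (simp add: smooth_map_at_def eventually_nb_Rn smooth_at_coord)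

lemma smooth_map_at_upd:
  assumes "smooth_map_at n m F x" "smooth_at n f x" "j < m"
  shows "smooth_map_at n m (\<lambda>y. (F y)(j := f y)) x"
  unfolding smooth_map_at_def
proof (intro conjI allI impI)
  show "smooth_at n (\<lambda>y. ((F y)(j := f y)) i) x" for i
    using assms smooth_map_at_coord[OF assms(1)] by (cases "i = j") auto
  have "eventually (\<lambda>y. F y \<in> Rn m) (nb n x)" using assms by (simp add: smooth_map_at_def)
  then show "eventually (\<lambda>y. (F y)(j := f y) \<in> Rn m) (nb n x)"
    by eventually_elim (use assms(3) in \<open>simp add: Rn_upd\<close>)
qed (use assms in \<open>simp add: smooth_map_at_def\<close>)

subsection \<open>Derivatives\<close>

lemma smooth_at_DERIV_partial:
  "smooth_at n f x \<Longrightarrow> i < n \<Longrightarrow> ((\<lambda>t. f (x(i := t))) has_real_derivative partial i f x) (at (x i))"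
  by (elim smooth_atE) (rule C_k_on_partial)

lemma smooth_at_DERIV_curve:
  assumes f: "smooth_at m f (g t0)" and gR: "eventually (\<lambda>t. g t \<in> Rn m) (nhds t0)"
    and g: "\<And>j. j < m \<Longrightarrow> ((\<lambda>t. g t j) has_real_derivative v j) (at t0)"
  shows "((\<lambda>t. f (g t)) has_real_derivative dir_deriv m f (g t0) v) (at t0)"
proof -
  obtain V where V: "openin (E m) V" "g t0 \<in> V" "\<And>k. C_k_on m k V f" using f by (rule smooth_atE) blast
  show ?thesis by (rule chain_rule_curve[OF V(1,3,2) gR g])
qed

lemma smooth_at_DERIV_line:
  assumes f: "smooth_at n f x" and v: "v \<in> Rn n"
  shows "((\<lambda>t. f (\<lambda>i. x i + t * v i)) has_real_derivative dir_deriv n f x v) (at 0)"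
proof -
  have x: "x = (\<lambda>i. x i + 0 * v i)" by simp
  have "((\<lambda>t. f (\<lambda>i. x i + t * v i)) has_real_derivative dir_deriv n f (\<lambda>i. x i + 0 * v i) v) (at 0)"
  proof (rule smooth_at_DERIV_curve[where g = "\<lambda>t i. x i + t * v i"])
    show "smooth_at n f (\<lambda>i. x i + 0 * v i)" using f by simp
    show "\<forall>\<^sub>F t in nhds 0. (\<lambda>i. x i + t * v i) \<in> Rn n"
      using v smooth_at_Rn[OF f] by (simp add: mem_Rn)
    show "((\<lambda>t. x j + t * v j) has_real_derivative v j) (at 0)" for j
      by (auto intro!: derivative_eq_intros)
  qed
  then show ?thesis by simp
qed

lemma partial_cong_nb:
  assumes "eventually (\<lambda>y. f y = g y) (nb n x)" "x \<in> Rn n" "i < n"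
  shows "partial i f x = partial i g x"
proof -
  obtain U where "openin (E n) U" "x \<in> U" "\<And>y. y \<in> U \<Longrightarrow> f y = g y"
    using assms(1) unfolding eventually_nb[OF assms(2)] by blast
  then show ?thesis using assms(3) by (metis partial_cong)
qed

lemma dir_deriv_cong:
  assumes "eventually (\<lambda>y. f y = g y) (nb n x)" "x \<in> Rn n"
  shows "dir_deriv n f x v = dir_deriv n g x v"
  unfolding dir_deriv_def using partial_cong_nb[OF assms] by simp

lemma jacobian_map_cong:
  assumes "eventually (\<lambda>y. F y = G y) (nb n x)" "x \<in> Rn n"
  shows "jacobian_map n m F x v = jacobian_map n m G x v"
proof -
  have "eventually (\<lambda>y. F y j = G y j) (nb n x)" for j using assms(1) by eventually_elim simp
  then show ?thesis unfolding jacobian_map_def using dir_deriv_cong[OF _ assms(2)] by auto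
qed

lemma dir_deriv_lincomb:
  "dir_deriv n f x (\<lambda>i. a * u i + b * v i) = a * dir_deriv n f x u + b * dir_deriv n f x v"
  by (simp add: dir_deriv_def algebra_simps sum.distrib sum_distrib_left)

lemma jacobian_map_lincomb:
  "jacobian_map n m F x (\<lambda>i. a * u i + b * v i) =
     (\<lambda>j. a * jacobian_map n m F x u j + b * jacobian_map n m F x v j)"
  by (auto simp: jacobian_map_def dir_deriv_lincomb)

lemma dir_deriv_unit_vec: "i < n \<Longrightarrow> dir_deriv n f x (unit_vec i) = partial i f x"
proof -
  assume i: "i < n"
  have "unit_vec i j * partial j f x = (if j = i then partial i f x else 0)" for j
    by (simp add: unit_vec_def)
  then show ?thesis using i by (simp add: dir_deriv_def)
qed

lemma partial_eqI:
  "((\<lambda>t. f (x(i := t))) has_real_derivative d) (at (x i)) \<Longrightarrow> partial i f x = d"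
  unfolding partial_def by (rule DERIV_imp_deriv)

lemma partial_coord: "partial i (\<lambda>x. x j) x = (if i = j then 1 else 0)"
  by (rule partial_eqI) (cases "i = j"; simp)

lemma partial_const: "partial i (\<lambda>x. a) x = 0"
  by (rule partial_eqI) simp

lemma dir_deriv_const: "dir_deriv n (\<lambda>x. a) x v = 0"
  by (simp add: dir_deriv_def partial_const)

lemma dir_deriv_coord: "v \<in> Rn n \<Longrightarrow> dir_deriv n (\<lambda>x. x j) x v = v j"
proof -
  assume v: "v \<in> Rn n"
  have "v i * partial i (\<lambda>x. x j) x = (if i = j then v j else 0)" for i by (simp add: partial_coord)
  then show ?thesis using v by (simp add: dir_deriv_def mem_Rn)
qed

lemma partial_add:
  assumes "smooth_at n f x" "smooth_at n g x" "i < n"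
  shows "partial i (\<lambda>x. f x + g x) x = partial i f x + partial i g x"
  by (rule partial_eqI) (rule DERIV_add[OF smooth_at_DERIV_partial[OF assms(1,3)] smooth_at_DERIV_partial[OF assms(2,3)]])

lemma partial_mult:
  assumes "smooth_at n f x" "smooth_at n g x" "i < n"
  shows "partial i (\<lambda>x. f x * g x) x = partial i f x * g x + f x * partial i g x"
  by (rule partial_eqI, rule DERIV_cong[OF DERIV_mult[OF smooth_at_DERIV_partial[OF assms(1,3)]
        smooth_at_DERIV_partial[OF assms(2,3)]]]) (simp only: fun_upd_triv mult.commute)

lemma dir_deriv_add:
  assumes "smooth_at n f x" "smooth_at n g x"
  shows "dir_deriv n (\<lambda>x. f x + g x) x v = dir_deriv n f x v + dir_deriv n g x v"
  by (simp add: dir_deriv_def partial_add[OF assms] algebra_simps sum.distrib)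

lemma dir_deriv_mult:
  assumes "smooth_at n f x" "smooth_at n g x"
  shows "dir_deriv n (\<lambda>x. f x * g x) x v = dir_deriv n f x v * g x + f x * dir_deriv n g x v"
  by (simp add: dir_deriv_def partial_mult[OF assms] algebra_simps sum.distrib sum_distrib_left sum_distrib_right)

lemma dir_deriv_cmult:
  assumes "smooth_at n f x"
  shows "dir_deriv n (\<lambda>x. a * f x) x v = a * dir_deriv n f x v"
  using dir_deriv_mult[OF smooth_at_const[OF smooth_at_Rn[OF assms]] assms, of a v]
  by (simp add: dir_deriv_const)

lemma dir_deriv_sum:
  assumes x: "x \<in> Rn n"
  shows "finite J \<Longrightarrow> (\<And>j. j \<in> J \<Longrightarrow> smooth_at n (f j) x) \<Longrightarrow>
    dir_deriv n (\<lambda>x. \<Sum>j\<in>J. f j x) x v = (\<Sum>j\<in>J. dir_deriv n (f j) x v)"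
proof (induction J rule: finite_induct)
  case (insert j J)
  have "smooth_at n (\<lambda>x. \<Sum>j\<in>J. f j x) x" by (rule smooth_at_sum[OF x]) (use insert in auto)
  then show ?case
    using insert dir_deriv_add[of n "f j" x "\<lambda>x. \<Sum>j\<in>J. f j x"] by simp
qed (simp add: dir_deriv_const)

lemma dir_deriv_compose:
  assumes F: "smooth_map_at n m F x" and f: "smooth_at m f (F x)"
  shows "dir_deriv n (\<lambda>x. f (F x)) x v = dir_deriv m f (F x) (jacobian_map n m F x v)"
proof -
  have x: "x \<in> Rn n" using F by (rule smooth_map_at_dom)
  have part: "partial i (\<lambda>x. f (F x)) x = (\<Sum>j<m. partial i (\<lambda>y. F y j) x * partial j f (F x))" if i: "i < n" for i
  proof (rule partial_eqI)
    have "((\<lambda>t. f (F (x(i := t)))) has_real_derivative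
        dir_deriv m f (F (x(i := x i))) (\<lambda>j. partial i (\<lambda>y. F y j) x)) (at (x i))"
    proof (rule smooth_at_DERIV_curve[where g = "\<lambda>t. F (x(i := t))"])
      show "smooth_at m f (F (x(i := x i)))" using f by simp
      have "filterlim (\<lambda>t. x(i := t)) (nb n x) (nhds (x i))"
      proof (rule filterlim_nb[OF x])
        show "\<forall>\<^sub>F t in nhds (x i). x(i := t) \<in> Rn n" using x i by (simp add: Rn_upd)
        show "((\<lambda>t. (x(i := t)) j) \<longlongrightarrow> x j) (nhds (x i))" for j
          by (cases "j = i") (auto simp: filterlim_ident)
      qed
      moreover have "eventually (\<lambda>y. F y \<in> Rn m) (nb n x)" using F by (simp add: smooth_map_at_def)
      ultimately show "\<forall>\<^sub>F t in nhds (x i). F (x(i := t)) \<in> Rn m"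
        by (rule eventually_compose_filterlim[rotated])
      show "((\<lambda>t. F (x(i := t)) j) has_real_derivative partial i (\<lambda>y. F y j) x) (at (x i))" for j
        by (rule smooth_at_DERIV_partial[OF smooth_map_at_coord[OF F] i])
    qed
    then show "((\<lambda>t. f (F (x(i := t)))) has_real_derivative
        (\<Sum>j<m. partial i (\<lambda>y. F y j) x * partial j f (F x))) (at (x i))"
      by (simp only: dir_deriv_def fun_upd_triv)
  qed
  have "dir_deriv n (\<lambda>x. f (F x)) x v = (\<Sum>i<n. \<Sum>j<m. v i * (partial i (\<lambda>y. F y j) x * partial j f (F x)))"
    by (simp add: dir_deriv_def part sum_distrib_left)
  also have "\<dots> = (\<Sum>j<m. \<Sum>i<n. v i * (partial i (\<lambda>y. F y j) x * partial j f (F x)))"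
    by (rule sum.swap)
  also have "\<dots> = dir_deriv m f (F x) (jacobian_map n m F x v)"
    by (simp add: dir_deriv_def jacobian_map_def sum_distrib_right mult.assoc)
  finally show ?thesis .
qed

lemma jacobian_map_compose:
  assumes F: "smooth_map_at n m F x" and G: "smooth_map_at m l G (F x)"
  shows "jacobian_map n l (\<lambda>x. G (F x)) x v = jacobian_map m l G (F x) (jacobian_map n m F x v)"
proof
  fix j
  have "dir_deriv n (\<lambda>x. G (F x) j) x v = dir_deriv m (\<lambda>y. G y j) (F x) (jacobian_map n m F x v)"
    by (rule dir_deriv_compose[OF F smooth_map_at_coord[OF G]])
  then show "jacobian_map n l (\<lambda>x. G (F x)) x v j = jacobian_map m l G (F x) (jacobian_map n m F x v) j"
    by (simp only: jacobian_map_def)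
qed

lemma jacobian_map_id:
  assumes "eventually (\<lambda>y. F y = y) (nb n x)" "x \<in> Rn n" "v \<in> Rn n"
  shows "jacobian_map n n F x v = v"
  unfolding jacobian_map_cong[OF assms(1,2)]
  using assms(3) by (auto simp: jacobian_map_def dir_deriv_coord mem_Rn)

lemma jacobian_map_nth: "j < m \<Longrightarrow> jacobian_map n m F x v j = dir_deriv n (\<lambda>y. F y j) x v"
  by (simp add: jacobian_map_def)

lemma smooth_map_at_jacobian:
  assumes F: "smooth_map_at n m F x" and V: "smooth_map_at n n V x"
  shows "smooth_map_at n m (\<lambda>y. jacobian_map n m F y (V y)) x"
  unfolding smooth_map_at_def
proof (intro conjI allI impI)
  show x: "x \<in> Rn n" using F by (rule smooth_map_at_dom)
  show "\<forall>\<^sub>F y in nb n x. jacobian_map n m F y (V y) \<in> Rn m" by (simp add: jacobian_map_Rn)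
  fix j assume j: "j < m"
  show "smooth_at n (\<lambda>y. jacobian_map n m F y (V y) j) x"
    unfolding jacobian_map_nth[OF j] dir_deriv_def
    by (intro smooth_at_sum x smooth_at_mult smooth_map_at_coord[OF V] smooth_at_partial
        smooth_map_at_coord[OF F]) auto
qed

lemma smooth_map_at_const: "x \<in> Rn n \<Longrightarrow> v \<in> Rn m \<Longrightarrow> smooth_map_at n m (\<lambda>x. v) x"
  by (simp add: smooth_map_at_def smooth_at_const)

text \<open>Schwarz's theorem: the second difference of f over a square of side h is symmetric in i
  and j, and two uses of the mean value theorem turn it into \<open>h * h\<close> times a mixed
  partial derivative at a point that tends to x.\<close>

lemma partial_commute:
  assumes f: "smooth_at n f x" and i: "i < n" and j: "j < n"
  shows "partial i (partial j f) x = partial j (partial i f) x"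
proof (cases "i = j")
  case False
  have x: "x \<in> Rn n" using f by (rule smooth_at_Rn)
  obtain U where U: "openin (E n) U" "x \<in> U" "\<And>k. C_k_on n k U f" using f by (rule smooth_atE) blast
  obtain e where e: "e > 0" "\<And>z. z \<in> Rn n \<Longrightarrow> (\<forall>i<n. \<bar>z i - x i\<bar> < e) \<Longrightarrow> z \<in> U"
    using openin_eventually_nb[OF U(1,2)] eventually_nb_box[OF x] by auto
  define D where "D i j h = f (x(i := x i + h, j := x j + h)) - f (x(i := x i + h)) - f (x(j := x j + h)) + f x"
    for i j h
  have step: "\<exists>s r. \<bar>s - x j\<bar> \<le> h \<and> \<bar>r - x i\<bar> \<le> h \<and>
      D i j h = h * h * partial i (partial j f) (x(j := s, i := r))"
    if h: "0 < h" "h < e" and ij: "i < n" "j < n" "i \<noteq> j" for h i j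
  proof -
    have inU: "x(i := r, j := s) \<in> U" "x(j := s, i := r) \<in> U"
      if "\<bar>r - x i\<bar> \<le> h" "\<bar>s - x j\<bar> \<le> h" for r s
      using that h ij x e(1) by (auto intro!: e(2) Rn_upd)
    \<comment> \<open>The increment in direction i as a function of coordinate j. The mean value
      theorem for p yields s; the remaining difference in direction i then yields r.\<close>
    define p where "p s = f (x(i := x i + h, j := s)) - f (x(i := x i, j := s))" for s
    have "(p has_real_derivative partial j f (x(i := x i + h, j := s)) - partial j f (x(i := x i, j := s))) (at s)"
      if "x j \<le> s" "s \<le> x j + h" for s
    proof -
      have *: "((\<lambda>t. f (x(i := r, j := s, j := t))) has_real_derivative partial j f (x(i := r, j := s))) (at s)"
        if "\<bar>r - x i\<bar> \<le> h" for r
      proof -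
        have "((\<lambda>t. f (x(i := r, j := s, j := t))) has_real_derivative partial j f (x(i := r, j := s)))
            (at ((x(i := r, j := s)) j))"
          by (rule C_k_on_partial[OF U(3)]) (use inU[OF that, of s] \<open>x j \<le> s\<close> \<open>s \<le> x j + h\<close> ij in auto)
        then show ?thesis by (simp only: fun_upd_same)
      qed
      have "\<bar>x i + h - x i\<bar> \<le> h" "\<bar>x i - x i\<bar> \<le> h" using h by auto
      from DERIV_diff[OF *[OF this(1)] *[OF this(2)]] show ?thesis
        unfolding p_def by (simp only: fun_upd_upd)
    qed
    then obtain s where s: "x j < s" "s < x j + h"
      "p (x j + h) - p (x j) = h * (partial j f (x(i := x i + h, j := s)) - partial j f (x(i := x i, j := s)))"
      using MVT2[of "x j" "x j + h" p "\<lambda>s. partial j f (x(i := x i + h, j := s)) - partial j f (x(i := x i, j := s))"]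
        h by auto
    have "C_k_on n (Suc 0) U (partial j f)" using U(3)[of "Suc (Suc 0)"] ij by simp
    from partial_mean_value[OF U(1) this ij(1), of "x i" "x i + h" "x(j := s)"]
    obtain r where r: "r \<in> closed_segment (x i) (x i + h)"
      "partial j f (x(j := s, i := x i + h)) - partial j f (x(j := s, i := x i))
        = h * partial i (partial j f) (x(j := s, i := r))"
      using inU(2) s h by (auto simp: closed_segment_eq_real_ivl)
    have "D i j h = p (x j + h) - p (x j)"
      using ij by (simp add: D_def p_def fun_upd_twist fun_upd_idem)
    also have "\<dots> = h * h * partial i (partial j f) (x(j := s, i := r))"
      using r(2) unfolding s(3) fun_upd_twist[OF ij(3), of x] by simp
    finally show ?thesis
      using s r(1) h by (intro exI[of _ s] exI[of _ r]) (auto simp: closed_segment_eq_real_ivl)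
  qed
  have lim: "\<exists>A. (A \<longlongrightarrow> partial i (partial j f) x) (at_right 0) \<and>
      (\<forall>h. 0 < h \<longrightarrow> h < e \<longrightarrow> D i j h = h * h * A h)" if ij: "i < n" "j < n" "i \<noteq> j" for i j
  proof -
    obtain s r where sr: "\<And>h. 0 < h \<Longrightarrow> h < e \<Longrightarrow> \<bar>s h - x j\<bar> \<le> h \<and> \<bar>r h - x i\<bar> \<le> h \<and>
      D i j h = h * h * partial i (partial j f) (x(j := s h, i := r h))"
      using step[OF _ _ ij] by metis
    have ev: "eventually (\<lambda>h. 0 < h \<and> h < e) (at_right (0::real))"
      using e(1) by (auto simp: eventually_at_right_field)
    have h0: "((\<lambda>h. h) \<longlongrightarrow> (0::real)) (at_right 0)" by (rule tendsto_ident_at)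
    have "((\<lambda>h. s h - x j) \<longlongrightarrow> 0) (at_right 0)" "((\<lambda>h. r h - x i) \<longlongrightarrow> 0) (at_right 0)"
      by (rule Lim_null_comparison[OF _ h0], use ev in eventually_elim, use sr in auto)+
    then have "(s \<longlongrightarrow> x j) (at_right 0)" "(r \<longlongrightarrow> x i) (at_right 0)"
      by (simp_all add: LIM_zero_iff)
    then have "((\<lambda>h. (x(j := s h, i := r h)) l) \<longlongrightarrow> x l) (at_right 0)" for l
      by (cases "l = i"; cases "l = j") (auto simp: ij)
    then have "filterlim (\<lambda>h. x(j := s h, i := r h)) (nb n x) (at_right 0)"
      using x ij by (intro filterlim_nb) (auto simp: Rn_upd)
    with smooth_at_tendsto[OF smooth_at_partial[OF smooth_at_partial[OF f ij(2)] ij(1)]]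
    have "((\<lambda>h. partial i (partial j f) (x(j := s h, i := r h))) \<longlongrightarrow> partial i (partial j f) x) (at_right 0)"
      by (rule filterlim_compose)
    with sr show ?thesis
      by (intro exI[of _ "\<lambda>h. partial i (partial j f) (x(j := s h, i := r h))"]) auto
  qed
  have Dsym: "D i j h = D j i h" for h
    using fun_upd_twist[OF False, of x] by (simp add: D_def)
  obtain A where A: "(A \<longlongrightarrow> partial i (partial j f) x) (at_right 0)"
      "\<And>h. 0 < h \<Longrightarrow> h < e \<Longrightarrow> D i j h = h * h * A h"
    using lim[OF i j False] by auto
  obtain B where B: "(B \<longlongrightarrow> partial j (partial i f) x) (at_right 0)"
      "\<And>h. 0 < h \<Longrightarrow> h < e \<Longrightarrow> D j i h = h * h * B h"
    using lim[OF j i] False by auto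
  have "eventually (\<lambda>h. 0 < h \<and> h < e) (at_right (0::real))"
    using e(1) by (auto simp: eventually_at_right_field)
  then have "eventually (\<lambda>h. A h = B h) (at_right 0)"
    by eventually_elim (use A(2) B(2) Dsym in fastforce)
  then have "(B \<longlongrightarrow> partial i (partial j f) x) (at_right 0)"
    using A(1) by (rule Lim_transform_eventually[rotated])
  then show ?thesis using B(1) tendsto_unique trivial_limit_at_right_real by blast
qed simp

section \<open>Straightening submersions\<close>

definition local_diffeo ::
    "nat \<Rightarrow> (nat \<Rightarrow> real) \<Rightarrow> ((nat \<Rightarrow> real) \<Rightarrow> nat \<Rightarrow> real) \<Rightarrow> ((nat \<Rightarrow> real) \<Rightarrow> nat \<Rightarrow> real) \<Rightarrow> bool" where
  "local_diffeo n x \<Theta> \<Psi> \<longleftrightarrow> smooth_map_at n n \<Theta> x \<and> smooth_map_at n n \<Psi> (\<Theta> x) \<and>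
     eventually (\<lambda>y. \<Psi> (\<Theta> y) = y) (nb n x) \<and> eventually (\<lambda>z. \<Theta> (\<Psi> z) = z) (nb n (\<Theta> x))"

lemma local_diffeo_inverse_at: "local_diffeo n x \<Theta> \<Psi> \<Longrightarrow> \<Psi> (\<Theta> x) = x"
  unfolding local_diffeo_def
  by (rule eventually_nb_self[of "\<lambda>y. \<Psi> (\<Theta> y) = y" n]) (auto dest: smooth_map_at_dom)

lemma local_diffeo_compose:
  assumes A: "local_diffeo n x \<Theta> \<Psi>" and B: "local_diffeo n (\<Theta> x) \<Theta>' \<Psi>'"
  shows "local_diffeo n x (\<lambda>y. \<Theta>' (\<Theta> y)) (\<lambda>z. \<Psi> (\<Psi>' z))"
proof -
  have \<Theta>: "smooth_map_at n n \<Theta> x" and \<Psi>: "smooth_map_at n n \<Psi> (\<Theta> x)"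
    and \<Theta>': "smooth_map_at n n \<Theta>' (\<Theta> x)" and \<Psi>': "smooth_map_at n n \<Psi>' (\<Theta>' (\<Theta> x))"
    using A B by (auto simp: local_diffeo_def)
  have eq: "\<Psi>' (\<Theta>' (\<Theta> x)) = \<Theta> x" using local_diffeo_inverse_at[OF B] .
  have "eventually (\<lambda>y. \<Psi>' (\<Theta>' (\<Theta> y)) = \<Theta> y) (nb n x)"
    by (rule eventually_smooth_map_at[OF \<Theta>]) (use B in \<open>simp add: local_diffeo_def\<close>)
  moreover have "eventually (\<lambda>y. \<Psi> (\<Theta> y) = y) (nb n x)" using A by (simp add: local_diffeo_def)
  ultimately have 1: "eventually (\<lambda>y. \<Psi> (\<Psi>' (\<Theta>' (\<Theta> y))) = y) (nb n x)"
    by eventually_elim simp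
  have "eventually (\<lambda>z. \<Theta> (\<Psi> (\<Psi>' z)) = \<Psi>' z) (nb n (\<Theta>' (\<Theta> x)))"
    by (rule eventually_smooth_map_at[OF \<Psi>']) (use A eq in \<open>simp add: local_diffeo_def\<close>)
  moreover have "eventually (\<lambda>z. \<Theta>' (\<Psi>' z) = z) (nb n (\<Theta>' (\<Theta> x)))"
    using B by (simp add: local_diffeo_def)
  ultimately have 2: "eventually (\<lambda>z. \<Theta>' (\<Theta> (\<Psi> (\<Psi>' z))) = z) (nb n (\<Theta>' (\<Theta> x)))"
    by eventually_elim simp
  show ?thesis
    unfolding local_diffeo_def
    using 1 2 smooth_map_at_compose[OF \<Theta> \<Theta>'] smooth_map_at_compose[OF \<Psi>', of n \<Psi>] \<Psi> by (simp add: eq)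
qed

lemma local_diffeo_id: "x \<in> Rn n \<Longrightarrow> local_diffeo n x (\<lambda>y. y) (\<lambda>y. y)"
  by (simp add: local_diffeo_def smooth_map_at_id)

lemma smooth_map_at_swap:
  assumes "x \<in> Rn n" "i < n" "j < n"
  shows "smooth_map_at n n (\<lambda>y. y(i := y j, j := y i)) x"
  by (intro smooth_map_at_upd smooth_map_at_id smooth_at_coord assms)

lemma local_diffeo_swap:
  assumes "x \<in> Rn n" "i < n" "j < n"
  shows "local_diffeo n x (\<lambda>y. y(i := y j, j := y i)) (\<lambda>y. y(i := y j, j := y i))"
proof -
  have "x(i := x j, j := x i) \<in> Rn n" using assms by (intro Rn_upd)
  moreover have "(y(i := y j, j := y i))(i := (y(i := y j, j := y i)) j, j := (y(i := y j, j := y i)) i) = y"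
    for y :: "nat \<Rightarrow> real" by (auto simp: fun_eq_iff)
  ultimately show ?thesis
    unfolding local_diffeo_def using assms smooth_map_at_swap by simp
qed

lemma local_diffeo_jacobian:
  assumes "local_diffeo n x \<Theta> \<Psi>" "v \<in> Rn n"
  shows "jacobian_map n n \<Psi> (\<Theta> x) (jacobian_map n n \<Theta> x v) = v"
proof -
  have "jacobian_map n n (\<lambda>y. \<Psi> (\<Theta> y)) x v = v"
    using assms smooth_map_at_dom by (intro jacobian_map_id) (auto simp: local_diffeo_def)
  then show ?thesis using jacobian_map_compose[of n n \<Theta> x n \<Psi> v] assms by (simp add: local_diffeo_def)
qed

text \<open>The inverse function theorem for a map that changes a single coordinate. Along
  coordinate j the function f is strictly monotone near x, so the inverse is found by the
  intermediate value theorem. It differs from the identity only in coordinate j, where its value is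
  an implicit function g.\<close>

lemma straighten_coordinate:
  assumes f: "smooth_at n f x" and j: "j < n" and nz: "partial j f x \<noteq> 0"
  shows "\<exists>\<Psi>. local_diffeo n x (\<lambda>y. y(j := f y)) \<Psi>"
proof -
  have x: "x \<in> Rn n" using f by (rule smooth_at_Rn)
  \<comment> \<open>Multiplying by a makes the derivative positive, so both signs of
    \<open>partial j f x\<close> are handled at once.\<close>
  define a where "a = partial j f x"
  have "((\<lambda>y. a * partial j f y) \<longlongrightarrow> a * partial j f x) (nb n x)"
    by (intro tendsto_intros smooth_at_tendsto smooth_at_partial f j)
  moreover have "a * partial j f x > 0" using nz unfolding a_def by (metis not_real_square_gt_zero)
  ultimately have "eventually (\<lambda>y. a * partial j f y > 0) (nb n x)" by (rule order_tendstoD)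
  with smooth_at_eventually[OF f]
  have "eventually (\<lambda>y. smooth_at n f y \<and> a * partial j f y > 0) (nb n x)"
    by eventually_elim simp
  then obtain e where e: "e > 0"
    "\<And>y. y \<in> Rn n \<Longrightarrow> (\<forall>i<n. \<bar>y i - x i\<bar> < e) \<Longrightarrow> smooth_at n f y \<and> a * partial j f y > 0"
    unfolding eventually_nb_box[OF x] by blast
  \<comment> \<open>A box is stable under changing coordinate j within its bounds, so the mean value
    theorem applies along every segment in direction j.\<close>
  define Q where "Q = {y \<in> Rn n. \<forall>i<n. \<bar>y i - x i\<bar> < e}"
  have Qnb: "eventually (\<lambda>z. z \<in> Q) (nb n y)" if "y \<in> Q" for y
  proof -
    have "eventually (\<lambda>z. \<forall>i\<in>{..<n}. \<bar>z i - x i\<bar> < e) (nb n y)"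
    proof (intro eventually_ball_finite ballI)
      fix i assume "i \<in> {..<n}"
      then have "\<bar>y i - x i\<bar> < e" using that by (simp add: Q_def)
      moreover have "((\<lambda>z. \<bar>z i - x i\<bar>) \<longlongrightarrow> \<bar>y i - x i\<bar>) (nb n y)"
        by (intro tendsto_intros tendsto_coord_nb)
      ultimately show "eventually (\<lambda>z. \<bar>z i - x i\<bar> < e) (nb n y)" by (metis order_tendstoD(2))
    qed simp
    with eventually_nb_Rn show ?thesis by eventually_elim (simp add: Q_def)
  qed
  have QR: "Q \<subseteq> Rn n" by (auto simp: Q_def)
  have Q: "openin (E n) Q" unfolding openin_iff_nb using Qnb QR by simp
  have xQ: "x \<in> Q" using x e(1) by (simp add: Q_def)
  have fQ: "smooth_at n f y" "a * partial j f y > 0" if "y \<in> Q" for y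
    using e(2) that by (auto simp: Q_def)
  have "smooth_fun_on n Q f" unfolding smooth_fun_on_iff[OF Q] using fQ(1) by simp
  then have CQ: "C_k_on n k Q f" for k by (simp add: smooth_fun_on_def)
  have Qupd: "y(j := s) \<in> Q" if "y \<in> Q" "\<bar>s - x j\<bar> < e" for y s
    using that j by (simp add: Q_def Rn_upd)
  have mono: "a * (f (y(j := t)) - f (y(j := s))) > 0"
    if y: "y \<in> Q" and st: "s < t" "\<bar>s - x j\<bar> < e" "\<bar>t - x j\<bar> < e" for y s t
  proof -
    have "\<bar>r - x j\<bar> < e" if "r \<in> closed_segment s t" for r
      using that st by (auto simp: closed_segment_eq_real_ivl split: if_splits)
    then obtain r where r: "r \<in> closed_segment s t" "\<bar>r - x j\<bar> < e"
        "f (y(j := t)) - f (y(j := s)) = (t - s) * partial j f (y(j := r))"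
      using partial_mean_value[OF Q CQ j, of s t y] Qupd[OF y] by metis
    have "a * (f (y(j := t)) - f (y(j := s))) = (t - s) * (a * partial j f (y(j := r)))"
      unfolding r(3) by simp
    also have "\<dots> > 0" using st(1) fQ(2)[OF Qupd[OF y r(2)]] by simp
    finally show ?thesis .
  qed
  define \<Theta> where "\<Theta> y = y(j := f y)" for y
  define g where "g z = (THE s. z(j := s) \<in> Q \<and> f (z(j := s)) = z j)" for z
  define \<Psi> where "\<Psi> z = z(j := g z)" for z
  have g_eq: "g z = s" if s: "z(j := s) \<in> Q" "f (z(j := s)) = z j" for z s
    unfolding g_def
  proof (rule the_equality)
    fix t assume t: "z(j := t) \<in> Q \<and> f (z(j := t)) = z j"
    have sj: "\<bar>s - x j\<bar> < e" "\<bar>t - x j\<bar> < e" using s t j by (auto simp: Q_def)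
    show "t = s"
    proof (rule ccontr)
      assume "t \<noteq> s"
      then consider "s < t" | "t < s" by linarith
      then show False
      proof cases
        case 1 with mono[OF s(1) 1 sj] s t show ?thesis by simp
      next
        case 2 with mono[OF s(1) 2 sj(2,1)] s t show ?thesis by simp
      qed
    qed
  qed (use s in simp)
  have left: "\<Psi> (\<Theta> y) = y" if "y \<in> Q" for y
  proof -
    have "g (\<Theta> y) = y j" by (rule g_eq) (use that in \<open>simp_all add: \<Theta>_def\<close>)
    then show ?thesis by (simp add: \<Psi>_def \<Theta>_def)
  qed
  have local_inv: "eventually (\<lambda>z. \<Psi> z \<in> Q \<and> \<Theta> (\<Psi> z) = z \<and> \<bar>g z - y j\<bar> < d) (nb n (\<Theta> y))"
    if y: "y \<in> Q" and d: "d > 0" for y d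
  proof -
    have yj: "\<bar>y j - x j\<bar> < e" using y j by (simp add: Q_def)
    \<comment> \<open>Halving keeps the interval of radius d' about \<open>y j\<close> strictly
      inside the box and makes d' smaller than d. At the two ends
      \<open>a * (f (z(j := s)) - z j)\<close> has opposite signs for z near
      \<open>\<Theta> y\<close>, which brackets the solution s.\<close>
    define d' where "d' = min (d / 2) ((e - \<bar>y j - x j\<bar>) / 2)"
    have d': "d' > 0" "d' < d" "d' < e - \<bar>y j - x j\<bar>" using d yj by (auto simp: d'_def min_def)
    have near: "\<bar>s - x j\<bar> < e" if "\<bar>s - y j\<bar> \<le> d'" for s using d'(3) that by linarith
    have \<Theta>y: "\<Theta> y \<in> Rn n" using y QR j by (auto simp: \<Theta>_def intro: Rn_upd)
    have upd_eq: "(\<Theta> y)(j := s) = y(j := s)" for s by (simp add: \<Theta>_def)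
    have lim: "((\<lambda>z. a * (f (z(j := s)) - z j)) \<longlongrightarrow> a * (f (y(j := s)) - f y)) (nb n (\<Theta> y))"
      if s: "\<bar>s - y j\<bar> \<le> d'" for s
    proof -
      have "smooth_map_at n n (\<lambda>z. z(j := s)) (\<Theta> y)"
        by (intro smooth_map_at_upd smooth_map_at_id smooth_at_const \<Theta>y j)
      from smooth_map_at_filterlim[OF this]
      have "filterlim (\<lambda>z. z(j := s)) (nb n (y(j := s))) (nb n (\<Theta> y))" by (simp add: upd_eq)
      with smooth_at_tendsto[OF fQ(1)[OF Qupd[OF y near[OF s]]]]
      have "((\<lambda>z. f (z(j := s))) \<longlongrightarrow> f (y(j := s))) (nb n (\<Theta> y))" by (rule filterlim_compose)
      moreover have "((\<lambda>z. z j) \<longlongrightarrow> f y) (nb n (\<Theta> y))"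
        using tendsto_coord_nb[of j "\<Theta> y" n] by (simp add: \<Theta>_def)
      ultimately show ?thesis by (intro tendsto_intros)
    qed
    have "a * (f (y(j := y j + d')) - f y) > 0" "a * (f (y(j := y j - d')) - f y) < 0"
      using mono[OF y, of "y j" "y j + d'"] mono[OF y, of "y j - d'" "y j"] near[of "y j + d'"] near[of "y j - d'"] d'(1) yj
      by (auto simp: algebra_simps)
    then have "eventually (\<lambda>z. a * (f (z(j := y j + d')) - z j) > 0) (nb n (\<Theta> y))"
        "eventually (\<lambda>z. a * (f (z(j := y j - d')) - z j) < 0) (nb n (\<Theta> y))"
      using order_tendstoD(1)[OF lim] order_tendstoD(2)[OF lim] d'(1) by auto
    moreover have "eventually (\<lambda>z. z(j := y j) \<in> Q) (nb n (\<Theta> y))"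
    proof -
      have "smooth_map_at n n (\<lambda>z. z(j := y j)) (\<Theta> y)"
        by (intro smooth_map_at_upd smooth_map_at_id smooth_at_const \<Theta>y j)
      then show ?thesis by (rule eventually_smooth_map_at) (use Qnb[OF y] in \<open>simp add: upd_eq\<close>)
    qed
    ultimately show ?thesis
    proof eventually_elim
      case (elim z)
      have zQ: "z(j := s) \<in> Q" if "\<bar>s - y j\<bar> \<le> d'" for s
        using Qupd[OF elim(3) near[OF that]] by simp
      have cont: "isCont (\<lambda>s. a * (f (z(j := s)) - z j)) s" if "\<bar>s - y j\<bar> \<le> d'" for s
      proof -
        have "((\<lambda>t. f ((z(j := s))(j := t))) has_real_derivative partial j f (z(j := s))) (at ((z(j := s)) j))"
          by (rule smooth_at_DERIV_partial[OF fQ(1)[OF zQ[OF that]] j])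
        then have "isCont (\<lambda>t. f (z(j := t))) s"
          by (simp only: fun_upd_upd fun_upd_same DERIV_isCont)
        then show ?thesis by (intro continuous_intros)
      qed
      obtain s where s: "y j - d' \<le> s" "s \<le> y j + d'" "a * (f (z(j := s)) - z j) = 0"
        using IVT[of "\<lambda>s. a * (f (z(j := s)) - z j)" "y j - d'" 0 "y j + d'"] elim(1,2) d'(1) cont
        by (auto simp: abs_le_iff)
      have sd: "\<bar>s - y j\<bar> \<le> d'" using s by (simp add: abs_le_iff)
      have "f (z(j := s)) = z j" using s(3) nz by (simp add: a_def)
      then have gz: "g z = s" by (intro g_eq zQ sd)
      have "\<Psi> z = z(j := s)" by (simp add: \<Psi>_def gz)
      moreover have "\<Theta> (z(j := s)) = z" using \<open>f (z(j := s)) = z j\<close> by (simp add: \<Theta>_def)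
      ultimately show ?case using zQ[OF sd] sd d'(2) gz by simp
    qed
  qed
  define W where "W = \<Theta> ` Q"
  have WR: "W \<subseteq> Rn n" unfolding W_def \<Theta>_def using QR j Rn_upd by blast
  have W: "openin (E n) W"
    unfolding openin_iff_nb
  proof (intro conjI ballI WR)
    fix z assume "z \<in> W"
    then obtain y where "y \<in> Q" "z = \<Theta> y" by (auto simp: W_def)
    with local_inv[of y 1] have "eventually (\<lambda>z. \<Psi> z \<in> Q \<and> \<Theta> (\<Psi> z) = z \<and> \<bar>g z - y j\<bar> < 1) (nb n z)"
      by simp
    then show "eventually (\<lambda>z. z \<in> W) (nb n z)"
      by eventually_elim (metis W_def imageI)
  qed
  have inv: "\<Psi> z \<in> Q" "\<Theta> (\<Psi> z) = z" if "z \<in> W" for z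
    using that left by (auto simp: W_def)
  have g_cont: "continuous_on W g"
    unfolding continuous_on_nb[OF W]
  proof
    fix z assume z: "z \<in> W"
    show "(g \<longlongrightarrow> g z) (nb n z)"
    proof (rule tendstoI)
      fix d :: real assume "d > 0"
      from local_inv[OF inv(1)[OF z] this] show "eventually (\<lambda>w. dist (g w) (g z) < d) (nb n z)"
        unfolding inv(2)[OF z] by eventually_elim (simp add: dist_real_def \<Psi>_def)
    qed
  qed
  \<comment> \<open>Implicit differentiation of \<open>f (z(j := g z)) = z j\<close>: for i = j the
    left side depends on \<open>z i\<close> only through g, for other i also through coordinate i
    itself.\<close>
  define G where "G i z = (if i = j then 1 else - 1 * partial i f (\<Psi> z)) * inverse (partial j f (\<Psi> z))" for i z
  have f\<Psi>: "f (z(j := g z)) = z j" if "z \<in> W" for z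
    using arg_cong[OF inv(2)[OF that], of "\<lambda>w. w j"] by (simp add: \<Theta>_def \<Psi>_def)
  have der: "((\<lambda>t. g (z(i := t))) has_real_derivative G i z) (at (z i))"
    if i: "i < n" and z: "z \<in> W" for i z
  proof -
    define y where "y = \<Psi> z"
    have y: "y \<in> Q" "y j = g z" unfolding y_def using inv[OF z] by (simp_all add: \<Psi>_def)
    have zR: "z \<in> Rn n" using z WR by blast
    have updlim: "filterlim (\<lambda>t. w(i := t)) (nb n w) (at (w i))" if "w \<in> Rn n" for w
    proof (rule filterlim_nb[OF that])
      show "\<forall>\<^sub>F t in at (w i). w(i := t) \<in> Rn n" using that i by (simp add: Rn_upd)
      show "((\<lambda>t. (w(i := t)) l) \<longlongrightarrow> w l) (at (w i))" for l by (cases "l = i") auto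
    qed
    have tW: "eventually (\<lambda>t. z(i := t) \<in> W) (at (z i))"
      using openin_eventually_nb[OF W z] updlim[OF zR] by (rule eventually_compose_filterlim)
    have glim: "((\<lambda>t. g (z(i := t))) \<longlongrightarrow> y j) (at (z i))"
      unfolding y(2) using continuous_onD_nb[OF g_cont W z] updlim[OF zR] by (rule filterlim_compose)
    have yR: "y \<in> Rn n" using y(1) QR by blast
    have ylim0: "filterlim (\<lambda>t. y) (nb n y) (at (z i))"
      by (rule filterlim_nb[OF yR]) (simp_all only: yR eventually_True tendsto_const)
    have nz_y: "partial j f y \<noteq> 0" using fQ(2)[OF y(1)] by auto
    have "((\<lambda>t. (g (z(i := t)) - g z) / (t - z i)) \<longlongrightarrow> G i z) (at (z i))"
    proof (cases "i = j")
      case True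
      obtain D where D: "(D \<longlongrightarrow> partial j f y) (at (z i))"
        "eventually (\<lambda>t. f (y(j := g (z(i := t)))) - f (y(j := y j)) = (g (z(i := t)) - y j) * D t) (at (z i))"
        using partial_increment[OF Q CQ y(1) j ylim0 tendsto_const glim] by blast
      have "eventually (\<lambda>t. D t \<noteq> 0) (at (z i))" using tendsto_imp_eventually_ne[OF D(1) nz_y] .
      then have "eventually (\<lambda>t. 1 / D t = (g (z(i := t)) - g z) / (t - z i)) (at (z i))"
        using D(2) tW eventually_neq_at_within[of "z i" "z i" UNIV]
      proof eventually_elim
        case (elim t)
        have "f (y(j := g (z(i := t)))) = t"
          using f\<Psi>[OF elim(3)] True by (simp add: y_def \<Psi>_def)
        moreover have "f (y(j := y j)) = z i"
          using f\<Psi>[OF z] True by (simp add: y_def \<Psi>_def)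
        ultimately have "t - z i = (g (z(i := t)) - g z) * D t" using elim(2) y(2) by simp
        then show ?case using elim(1,4) by (simp add: field_simps)
      qed
      moreover have "((\<lambda>t. 1 / D t) \<longlongrightarrow> G i z) (at (z i))"
        using tendsto_divide[OF tendsto_const D(1) nz_y, of 1] True by (simp add: G_def y_def field_simps)
      ultimately show ?thesis by (rule Lim_transform_eventually[rotated])
    next
      case False
      have yi: "y i = z i" using False by (simp add: y_def \<Psi>_def)
      have ylim: "filterlim (\<lambda>t. y(i := t)) (nb n y) (at (z i))"
        using updlim[of y] y(1) QR yi by auto
      obtain D where D: "(D \<longlongrightarrow> partial j f y) (at (z i))"
        "eventually (\<lambda>t. f (y(i := t, j := g (z(i := t)))) - f (y(i := t, j := y j)) = (g (z(i := t)) - y j) * D t) (at (z i))"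
        using partial_increment[OF Q CQ y(1) j ylim tendsto_const glim] by blast
      have tlim: "((\<lambda>t. t) \<longlongrightarrow> y i) (at (z i))" unfolding yi by (rule tendsto_ident_at)
      obtain D' where D': "(D' \<longlongrightarrow> partial i f y) (at (z i))"
        "eventually (\<lambda>t. f (y(i := t)) - f (y(i := y i)) = (t - y i) * D' t) (at (z i))"
        using partial_increment[OF Q CQ y(1) i ylim0 tendsto_const tlim] by blast
      have "eventually (\<lambda>t. D t \<noteq> 0) (at (z i))" using tendsto_imp_eventually_ne[OF D(1) nz_y] .
      then have "eventually (\<lambda>t. - D' t / D t = (g (z(i := t)) - g z) / (t - z i)) (at (z i))"
        using D(2) D'(2) tW eventually_neq_at_within[of "z i" "z i" UNIV]
      proof eventually_elim
        case (elim t)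
        have "y(i := t, j := g (z(i := t))) = (z(i := t))(j := g (z(i := t)))"
          using False by (auto simp: y_def \<Psi>_def fun_eq_iff)
        then have "f (y(i := t, j := g (z(i := t)))) = z j"
          using f\<Psi>[OF elim(4)] False by simp
        moreover have "f (y(i := y i)) = z j"
          using f\<Psi>[OF z] unfolding fun_upd_triv by (simp only: y_def \<Psi>_def)
        moreover have "y(i := t, j := y j) = y(i := t)" using False by (auto simp: fun_eq_iff)
        ultimately have "(g (z(i := t)) - g z) * D t = - ((t - z i) * D' t)"
          using elim(2,3) y(2) yi by simp
        then show ?case using elim(1,5) by (simp add: field_simps)
      qed
      moreover have "((\<lambda>t. - D' t / D t) \<longlongrightarrow> G i z) (at (z i))"
        using tendsto_divide[OF tendsto_minus[OF D'(1)] D(1) nz_y] False by (simp add: G_def y_def field_simps)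
      ultimately show ?thesis by (rule Lim_transform_eventually[rotated])
    qed
    then show ?thesis by (simp add: has_field_derivative_iff)
  qed
  have \<Psi>Q: "\<Psi> ` W \<subseteq> Q" using inv(1) by blast
  \<comment> \<open>Bootstrapping: G is built from partial derivatives of f along
    \<open>\<Psi>\<close>, and \<open>\<Psi>\<close> is as regular as g, so if g is of class C^k
    then its derivatives are too.\<close>
  have g_C: "C_k_on n k W g" for k
  proof (induction k)
    case 0
    show ?case using g_cont by simp
  next
    case (Suc k)
    have \<Psi>_C: "C_k_on n k W (\<lambda>z. \<Psi> z l)" for l
      unfolding \<Psi>_def using Suc C_k_on_coord[OF W] by (cases "l = j") simp_all
    have comp: "C_k_on n k W (\<lambda>z. partial i f (\<Psi> z))" if "i < n" for i
      by (rule C_k_on_compose[OF W Q \<Psi>Q \<Psi>_C]) (use CQ[of "Suc k"] that in auto)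
    show ?case
    proof (rule C_k_on_SucI[OF W g_cont der])
      fix i assume i: "i < n"
      have "C_k_on n k W (\<lambda>z. if i = j then 1 else - 1 * partial i f (\<Psi> z))"
        using C_k_on_const[OF W] C_k_on_mult[OF W C_k_on_const[OF W, where a = "-1"] comp[OF i]] by (cases "i = j") auto
      moreover have "C_k_on n k W (\<lambda>z. inverse (partial j f (\<Psi> z)))"
        by (rule C_k_on_inverse[OF W comp[OF j]]) (use fQ(2)[OF inv(1)] in fastforce)
      ultimately show "C_k_on n k W (G i)" unfolding G_def by (rule C_k_on_mult[OF W])
    qed
  qed
  have xW: "\<Theta> x \<in> W" using xQ by (simp add: W_def)
  have "local_diffeo n x \<Theta> \<Psi>"
    unfolding local_diffeo_def
  proof (intro conjI)
    show "smooth_map_at n n \<Theta> x"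
      unfolding \<Theta>_def by (intro smooth_map_at_upd smooth_map_at_id f x j)
    have "smooth_at n g (\<Theta> x)" by (rule smooth_atI[OF W xW g_C])
    then show "smooth_map_at n n \<Psi> (\<Theta> x)"
      unfolding \<Psi>_def using xW WR by (intro smooth_map_at_upd smooth_map_at_id j) auto
    show "\<forall>\<^sub>F y in nb n x. \<Psi> (\<Theta> y) = y" using Qnb[OF xQ] by eventually_elim (rule left)
    show "\<forall>\<^sub>F z in nb n (\<Theta> x). \<Theta> (\<Psi> z) = z"
      using openin_eventually_nb[OF W xW] by eventually_elim (rule inv(2))
  qed
  then show ?thesis unfolding \<Theta>_def by auto
qed

text \<open>Induction on the number l of components already straightened. A vector u with image
  \<open>unit_vec l\<close> is transported to the new coordinates; the first l components of F are
  coordinates there, so u' vanishes in those slots, and component l has a nonzero partial derivative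
  in some direction j with l \<le> j. Replacing coordinate j by this component and exchanging j with
  l leaves the first l coordinates alone. The bound on n comes from l \<le> j < m.\<close>

lemma submersion_normal_form:
  assumes F: "smooth_map_at m n F x"
    and surj: "\<And>w. w \<in> Rn n \<Longrightarrow> \<exists>u\<in>Rn m. jacobian_map m n F x u = w"
  shows "n \<le> m \<and> (\<exists>\<Theta> \<Psi>. local_diffeo m x \<Theta> \<Psi> \<and> eventually (\<lambda>y. \<forall>i<n. \<Theta> y i = F y i) (nb m x))"
proof -
  have x: "x \<in> Rn m" using F by (rule smooth_map_at_dom)
  have "l \<le> m \<and> (\<exists>\<Theta> \<Psi>. local_diffeo m x \<Theta> \<Psi> \<and> eventually (\<lambda>y. \<forall>i<l. \<Theta> y i = F y i) (nb m x))"
    if "l \<le> n" for l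
    using that
  proof (induction l)
    case 0
    then show ?case using local_diffeo_id[OF x] by auto
  next
    case (Suc l)
    then obtain \<Theta> \<Psi> where D: "local_diffeo m x \<Theta> \<Psi>" and eq: "eventually (\<lambda>y. \<forall>i<l. \<Theta> y i = F y i) (nb m x)"
      by auto
    have l: "l < n" "l \<le> m" using Suc by auto
    define z where "z = \<Theta> x"
    have \<Theta>: "smooth_map_at m m \<Theta> x" and \<Psi>: "smooth_map_at m m \<Psi> z"
      and \<Psi>\<Theta>: "eventually (\<lambda>y. \<Psi> (\<Theta> y) = y) (nb m x)" and \<Theta>\<Psi>: "eventually (\<lambda>w. \<Theta> (\<Psi> w) = w) (nb m z)"
      using D by (auto simp: local_diffeo_def z_def)
    have \<Psi>z: "\<Psi> z = x" unfolding z_def by (rule local_diffeo_inverse_at[OF D])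
    have z: "z \<in> Rn m" using \<Psi> by (rule smooth_map_at_dom)
    have F\<Psi>: "smooth_map_at m n (\<lambda>w. F (\<Psi> w)) z"
      by (rule smooth_map_at_compose[OF \<Psi>]) (simp add: F \<Psi>z)
    define h where "h w = F (\<Psi> w) l" for w
    have h: "smooth_at m h z" unfolding h_def by (rule smooth_map_at_coord[OF F\<Psi>])
    obtain u where u: "u \<in> Rn m" "jacobian_map m n F x u = unit_vec l"
      using surj[OF unit_vec_Rn[OF l(1)]] by blast
    define u' where "u' = jacobian_map m m \<Theta> x u"
    have u'R: "u' \<in> Rn m" unfolding u'_def by (rule jacobian_map_Rn)
    have J: "jacobian_map m n (\<lambda>w. F (\<Psi> w)) z u' = unit_vec l"
      using jacobian_map_compose[OF \<Psi>, of n F u'] F \<Psi>z local_diffeo_jacobian[OF D u(1)] u(2)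
      by (simp add: u'_def z_def)
    have "eventually (\<lambda>w. \<forall>i<l. \<Theta> (\<Psi> w) i = F (\<Psi> w) i) (nb m z)"
      by (rule eventually_smooth_map_at[OF \<Psi>]) (simp add: eq \<Psi>z)
    with \<Theta>\<Psi> have Fi: "eventually (\<lambda>w. \<forall>i<l. F (\<Psi> w) i = w i) (nb m z)"
      by eventually_elim simp
    have u'0: "u' i = 0" if i: "i < l" for i
    proof -
      have ev: "eventually (\<lambda>w. F (\<Psi> w) i = w i) (nb m z)" using Fi by eventually_elim (use i in simp)
      have "0 = jacobian_map m n (\<lambda>w. F (\<Psi> w)) z u' i" using i unfolding J by (simp add: unit_vec_def)
      also have "\<dots> = dir_deriv m (\<lambda>w. F (\<Psi> w) i) z u'" using i l by (simp add: jacobian_map_nth)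
      also have "\<dots> = dir_deriv m (\<lambda>w. w i) z u'" by (rule dir_deriv_cong[OF ev z])
      also have "\<dots> = u' i" by (rule dir_deriv_coord[OF u'R])
      finally show ?thesis by simp
    qed
    have "1 = jacobian_map m n (\<lambda>w. F (\<Psi> w)) z u' l" unfolding J by (simp add: unit_vec_def)
    also have "\<dots> = (\<Sum>j<m. u' j * partial j h z)"
      using l by (simp add: jacobian_map_nth dir_deriv_def h_def[abs_def])
    finally have "(\<Sum>j<m. u' j * partial j h z) \<noteq> 0" by simp
    then obtain j where j: "j < m" "u' j * partial j h z \<noteq> 0"
      by (metis (no_types, lifting) lessThan_iff sum.neutral)
    have jl: "l \<le> j" using u'0 j(2) by (metis mult_zero_left not_le)
    have lm: "l < m" using jl j(1) by simp
    obtain \<Psi>1 where D1: "local_diffeo m z (\<lambda>w. w(j := h w)) \<Psi>1"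
      using straighten_coordinate[OF h j(1)] j(2) by auto
    define z1 where "z1 = z(j := h z)"
    have z1: "z1 \<in> Rn m" unfolding z1_def by (rule Rn_upd[OF z j(1)])
    have D2: "local_diffeo m z1 (\<lambda>y. y(l := y j, j := y l)) (\<lambda>y. y(l := y j, j := y l))"
      by (rule local_diffeo_swap[OF z1 lm j(1)])
    have D3: "local_diffeo m (\<Theta> x)
        (\<lambda>w. (w(j := h w))(l := (w(j := h w)) j, j := (w(j := h w)) l)) (\<lambda>w. \<Psi>1 (w(l := w j, j := w l)))"
      using local_diffeo_compose[OF D1 D2[unfolded z1_def]] by (simp only: z_def)
    note D4 = local_diffeo_compose[OF D D3]
    have "eventually (\<lambda>y. \<forall>i<Suc l. (((\<Theta> y)(j := h (\<Theta> y)))(l := ((\<Theta> y)(j := h (\<Theta> y))) j,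
        j := ((\<Theta> y)(j := h (\<Theta> y))) l)) i = F y i) (nb m x)"
      using eq \<Psi>\<Theta>
    proof eventually_elim
      case (elim y)
      have "(((\<Theta> y)(j := h (\<Theta> y)))(l := ((\<Theta> y)(j := h (\<Theta> y))) j, j := ((\<Theta> y)(j := h (\<Theta> y))) l)) i = F y i"
        if "i < Suc l" for i
        using that elim jl by (cases "i = l") (auto simp: h_def)
      then show ?case by blast
    qed
    with D4 have "\<exists>\<Theta> \<Psi>. local_diffeo m x \<Theta> \<Psi> \<and> eventually (\<lambda>y. \<forall>i<Suc l. \<Theta> y i = F y i) (nb m x)"
      by (intro exI conjI)
    with lm show ?case by simp
  qed
  from this[OF order_refl] show ?thesis .
qed

section \<open>Bump functions\<close>

text \<open>The functions e^(-1/t) / t^m have derivatives that are linear combinations of members of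
  the same family (\<open>DERIV_flat\<close>), so smoothness to all orders follows from one
  induction over k with m arbitrary.\<close>

definition flat :: "nat \<Rightarrow> real \<Rightarrow> real" where
  "flat m t = (if t > 0 then exp (- inverse t) * inverse t ^ m else 0)"

lemma flat_tendsto_0: "(flat m \<longlongrightarrow> 0) (at 0)"
proof -
  have "((\<lambda>s. s ^ m / exp s) \<longlongrightarrow> 0) (at_top :: real filter)" by (rule tendsto_power_div_exp_0)
  from filterlim_compose[OF this filterlim_inverse_at_top_right]
  have "((\<lambda>t. inverse t ^ m / exp (inverse t)) \<longlongrightarrow> 0) (at_right (0::real))" .
  then have "(flat m \<longlongrightarrow> 0) (at_right 0)"
    by (rule Lim_transform_eventually)
       (auto simp: eventually_at_right_field flat_def exp_minus field_simps intro!: exI[of _ 1])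
  moreover have "(flat m \<longlongrightarrow> 0) (at_left 0)"
    by (rule Lim_transform_eventually[OF tendsto_const])
       (auto simp: eventually_at_left_field flat_def intro!: exI[of _ "-1"])
  ultimately show ?thesis by (simp add: filterlim_at_split)
qed

lemma DERIV_flat: "(flat m has_real_derivative flat (m + 2) t - real m * flat (m + 1) t) (at t)"
proof -
  consider "t > 0" | "t < 0" | "t = 0" by linarith
  then show ?thesis
  proof cases
    case 1
    have ev: "eventually (\<lambda>s. flat m s = exp (- inverse s) * inverse s ^ m) (nhds t)"
      by (rule eventually_mono[OF order_tendstoD(1)[OF filterlim_ident 1]]) (simp add: flat_def)
    have "((\<lambda>s. exp (- inverse s) * inverse s ^ m) has_real_derivative
        (exp (- inverse t) * (inverse t * inverse t)) * inverse t ^ m +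
        (real m * inverse t ^ (m - 1) * (- (inverse t * inverse t))) * exp (- inverse t)) (at t)"
      using 1 by (auto intro!: derivative_eq_intros)
    moreover have "(exp (- inverse t) * (inverse t * inverse t)) * inverse t ^ m +
        (real m * inverse t ^ (m - 1) * (- (inverse t * inverse t))) * exp (- inverse t)
        = flat (m + 2) t - real m * flat (m + 1) t"
      using 1 by (cases m) (simp_all add: flat_def algebra_simps)
    ultimately show ?thesis by (simp add: DERIV_cong_ev[OF refl ev refl])
  next
    case 2
    have ev: "eventually (\<lambda>s. flat m s = 0) (nhds t)"
      by (rule eventually_mono[OF order_tendstoD(2)[OF filterlim_ident 2]]) (simp add: flat_def)
    show ?thesis using 2 by (simp add: DERIV_cong_ev[OF refl ev refl] flat_def)
  next
    case 3
    \<comment> \<open>The difference quotient at 0 is \<open>flat (Suc m) h\<close>: dividing by h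
      adds one power of \<open>inverse h\<close>.\<close>
    have "((\<lambda>h. (flat m h - flat m 0) / (h - 0)) \<longlongrightarrow> 0) (at 0)"
      by (rule Lim_transform_eventually[OF flat_tendsto_0[of "Suc m"]])
         (auto simp: flat_def field_simps)
    then show ?thesis unfolding 3 has_field_derivative_iff by (simp add: flat_def)
  qed
qed

lemma C_k_on_flat:
  assumes U: "openin (E n) U" and g: "C_k_on n k U g"
  shows "C_k_on n k U (\<lambda>x. flat m (g x))"
  using g
proof (induction k arbitrary: m)
  case 0
  have "continuous_on UNIV (flat m)"
    by (rule DERIV_continuous_on) (rule DERIV_subset[OF DERIV_flat], simp)
  then show ?case using 0 continuous_on_compose2[of UNIV "flat m" U g] by simp
next
  case (Suc k)
  have gk: "C_k_on n k U g" using Suc.prems by (rule C_k_on_Suc)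
  show ?case
  proof (rule C_k_on_SucI[OF U, where
      D = "\<lambda>i x. (flat (m + 2) (g x) + (- real m) * flat (m + 1) (g x)) * partial i g x"])
    show "continuous_on U (\<lambda>x. flat m (g x))" using C_k_on_continuous[OF Suc.IH[OF gk]] .
    show "((\<lambda>t. flat m (g (x(i := t)))) has_real_derivative
        (flat (m + 2) (g x) + (- real m) * flat (m + 1) (g x)) * partial i g x) (at (x i))"
      if "i < n" "x \<in> U" for i x
      by (rule DERIV_cong[OF DERIV_chain2[OF DERIV_flat C_k_on_partial[OF Suc.prems that(2,1)]]])
         (simp only: fun_upd_triv, simp)
    show "C_k_on n k U (\<lambda>x. (flat (m + 2) (g x) + (- real m) * flat (m + 1) (g x)) * partial i g x)"
      if "i < n" for i
      by (intro C_k_on_mult[OF U] C_k_on_add[OF U] C_k_on_const[OF U] Suc.IH[OF gk])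
         (use Suc.prems that in auto)
  qed
qed

lemma smooth_at_flat: "smooth_at n g x \<Longrightarrow> smooth_at n (\<lambda>x. flat m (g x)) x"
  by (elim smooth_atE) (rule smooth_atI, assumption, assumption, rule C_k_on_flat)

text \<open>The function exp(-1/(r^2 - |x|^2)), extended by 0 off the ball of radius r and
  normalized to 1 at the origin; the ball lies in the box of half-width r.\<close>

lemma bump_function:
  assumes "r > 0"
  obtains \<rho> :: "(nat \<Rightarrow> real) \<Rightarrow> real" where "\<And>x. x \<in> Rn n \<Longrightarrow> smooth_at n \<rho> x" "\<rho> (\<lambda>i. 0) = 1"
    "\<And>x. \<rho> x \<noteq> 0 \<Longrightarrow> \<forall>i<n. \<bar>x i\<bar> \<le> r"
proof
  define g where "g x = r\<^sup>2 + (-1) * (\<Sum>i<n. x i * x i)" for x :: "nat \<Rightarrow> real"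
  define \<rho> where "\<rho> x = inverse (flat 0 (r\<^sup>2)) * flat 0 (g x)" for x
  show "smooth_at n \<rho> x" if "x \<in> Rn n" for x
    unfolding \<rho>_def g_def
    by (intro smooth_at_mult smooth_at_flat smooth_at_add smooth_at_const smooth_at_sum smooth_at_coord that)
  show "\<rho> (\<lambda>i. 0) = 1" using assms by (simp add: \<rho>_def g_def flat_def)
  show "\<forall>i<n. \<bar>x i\<bar> \<le> r" if "\<rho> x \<noteq> 0" for x
  proof (intro allI impI)
    fix i assume i: "i < n"
    have "g x > 0" using that by (auto simp: \<rho>_def flat_def split: if_splits)
    then have "(\<Sum>i<n. x i * x i) < r\<^sup>2" by (simp add: g_def)
    moreover have "x i * x i \<le> (\<Sum>i<n. x i * x i)"
      using i by (intro member_le_sum) auto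
    ultimately have "(x i)\<^sup>2 \<le> r\<^sup>2" by (simp add: power2_eq_square)
    then show "\<bar>x i\<bar> \<le> r" using assms by (simp add: abs_le_square_iff[symmetric])
  qed
qed

section \<open>Alternating forms in coordinates\<close>

definition del :: "nat \<Rightarrow> 'v list \<Rightarrow> 'v list" where
  "del i vs = take i vs @ drop (Suc i) vs"

lemma length_del: "i < length vs \<Longrightarrow> length (del i vs) = length vs - 1"
  by (simp add: del_def)

lemma set_del: "set (del i vs) \<subseteq> set vs"
  by (auto simp: del_def dest: in_set_takeD in_set_dropD)

lemma map_del: "map f (del i vs) = del i (map f vs)"
  by (simp add: del_def take_map drop_map)

lemma del_0: "del 0 (v # vs) = vs"
  by (simp add: del_def)

lemma del_Suc: "del (Suc i) (v # vs) = v # del i vs"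
  by (simp add: del_def)

lemma nth_del: "i < length vs \<Longrightarrow> del i vs ! l = (if l < i then vs ! l else vs ! Suc l)"
  by (simp add: del_def nth_append)

lemma del_del: "i \<le> l \<Longrightarrow> Suc l < length vs \<Longrightarrow> del l (del i vs) = del i (del (Suc l) vs)"
  by (rule nth_equalityI) (auto simp: nth_del length_del)

definition multilinear :: "nat \<Rightarrow> nat \<Rightarrow> ((nat \<Rightarrow> real) list \<Rightarrow> real) \<Rightarrow> bool" where
  "multilinear n k A \<longleftrightarrow> (\<forall>vs. length vs = k \<and> set vs \<subseteq> Rn n \<longrightarrow>
     (\<forall>i<k. \<forall>u\<in>Rn n. \<forall>w\<in>Rn n. \<forall>a b.
        A (vs[i := (\<lambda>j. a * u j + b * w j)]) = a * A (vs[i := u]) + b * A (vs[i := w])))"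

definition alternating :: "nat \<Rightarrow> nat \<Rightarrow> ((nat \<Rightarrow> real) list \<Rightarrow> real) \<Rightarrow> bool" where
  "alternating n k A \<longleftrightarrow> (\<forall>vs. length vs = k \<and> set vs \<subseteq> Rn n \<longrightarrow>
     (\<forall>i<k. \<forall>j<k. i \<noteq> j \<and> vs ! i = vs ! j \<longrightarrow> A vs = 0))"

lemma multilinearD:
  "multilinear n k A \<Longrightarrow> length vs = k \<Longrightarrow> set vs \<subseteq> Rn n \<Longrightarrow> i < k \<Longrightarrow> u \<in> Rn n \<Longrightarrow> w \<in> Rn n \<Longrightarrow>
    A (vs[i := (\<lambda>j. a * u j + b * w j)]) = a * A (vs[i := u]) + b * A (vs[i := w])"
  unfolding multilinear_def by blast

lemma alternatingD:
  "alternating n k A \<Longrightarrow> length vs = k \<Longrightarrow> set vs \<subseteq> Rn n \<Longrightarrow> i < k \<Longrightarrow> j < k \<Longrightarrow> i \<noteq> j \<Longrightarrow>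
    vs ! i = vs ! j \<Longrightarrow> A vs = 0"
  unfolding alternating_def by blast

lemma multilinear_zero:
  assumes "multilinear n k A" "length vs = k" "set vs \<subseteq> Rn n" "i < k"
  shows "A (vs[i := (\<lambda>j. 0)]) = 0"
  using multilinearD[OF assms zero_Rn zero_Rn, of 0 0] by simp

lemma multilinear_Cons:
  assumes A: "multilinear n (Suc k) A" and v: "v \<in> Rn n"
  shows "multilinear n k (\<lambda>vs. A (v # vs))"
  unfolding multilinear_def
proof (intro allI impI ballI, elim conjE)
  fix vs i u w a b assume "i < k" "u \<in> Rn n" "w \<in> Rn n" "length vs = k" "set vs \<subseteq> Rn n"
  then show "A (v # vs[i := (\<lambda>j. a * u j + b * w j)]) = a * A (v # vs[i := u]) + b * A (v # vs[i := w])"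
    using multilinearD[OF A, of "v # vs" "Suc i" u w a b] v by simp
qed

lemma alternating_Cons:
  assumes A: "alternating n (Suc k) A" and v: "v \<in> Rn n"
  shows "alternating n k (\<lambda>vs. A (v # vs))"
  unfolding alternating_def
proof (intro allI impI, elim conjE)
  fix vs i j assume "i < k" "j < k" "length vs = k" "set vs \<subseteq> Rn n" "i \<noteq> j" "vs ! i = vs ! j"
  then show "A (v # vs) = 0"
    using alternatingD[OF A, of "v # vs" "Suc i" "Suc j"] v by simp
qed

lemma multilinear_head:
  assumes A: "multilinear n (Suc k) A" and vs: "length vs = k" "set vs \<subseteq> Rn n" and uw: "u \<in> Rn n" "w \<in> Rn n"
  shows "A ((\<lambda>j. a * u j + b * w j) # vs) = a * A (u # vs) + b * A (w # vs)"
  using multilinearD[OF A, of "u # vs" 0 u w a b] vs uw by simp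

lemma multilinear_head_sum:
  assumes A: "multilinear n (Suc k) A" and vs: "length vs = k" "set vs \<subseteq> Rn n"
    and J: "finite J" and e: "\<And>j. j \<in> J \<Longrightarrow> e j \<in> Rn n"
  shows "A ((\<lambda>i. \<Sum>j\<in>J. c j * e j i) # vs) = (\<Sum>j\<in>J. c j * A (e j # vs))"
  using J e
proof (induction J rule: finite_induct)
  case empty
  show ?case using multilinear_head[OF A vs zero_Rn zero_Rn, of 0 0] by simp
next
  case (insert j J)
  have "(\<lambda>i. \<Sum>j\<in>J. c j * e j i) \<in> Rn n" using insert.prems by (simp add: mem_Rn)
  then have "A ((\<lambda>i. c j * e j i + 1 * (\<Sum>j\<in>J. c j * e j i)) # vs)
      = c j * A (e j # vs) + 1 * A ((\<lambda>i. \<Sum>j\<in>J. c j * e j i) # vs)"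
    using insert.prems by (intro multilinear_head[OF A vs]) auto
  then show ?case using insert by simp
qed

lemma Rn_expand: "u \<in> Rn n \<Longrightarrow> u = (\<lambda>i. \<Sum>j<n. u j * unit_vec j i)"
proof
  fix i assume u: "u \<in> Rn n"
  have "u j * unit_vec j i = (if j = i then u i else 0)" for j by (simp add: unit_vec_def)
  then show "u i = (\<Sum>j<n. u j * unit_vec j i)" using u by (simp add: mem_Rn)
qed

lemma multilinear_head_expand:
  assumes A: "multilinear n (Suc k) A" and vs: "length vs = k" "set vs \<subseteq> Rn n" and u: "u \<in> Rn n"
  shows "A (u # vs) = (\<Sum>j<n. u j * A (unit_vec j # vs))"
  using multilinear_head_sum[OF A vs, of "{..<n}" unit_vec u] unit_vec_Rn
  by (simp add: Rn_expand[OF u, symmetric])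

text \<open>Polarization: with the sum of both arguments in both slots the value is 0, and the
  expansion leaves only the two mixed terms.\<close>

lemma alternating_swap:
  assumes M: "multilinear n k A" and A: "alternating n k A"
    and vs: "length vs = k" "set vs \<subseteq> Rn n" and ij: "i < k" "j < k" "i \<noteq> j"
  shows "A (vs[i := vs ! j, j := vs ! i]) = - A vs"
proof -
  define u where "u = vs ! i"
  define w where "w = vs ! j"
  have uw: "u \<in> Rn n" "w \<in> Rn n" using vs ij by (auto simp: u_def w_def)
  \<comment> \<open>The factors 1 give s the shape of a linear combination that
    \<open>multilinearD\<close> expects.\<close>
  define s where "s = (\<lambda>l. 1 * u l + 1 * w l)"
  have s: "s \<in> Rn n" unfolding s_def using uw by (rule lincomb_Rn)
  have set2: "set (vs[p := a, q := b]) \<subseteq> Rn n" if "a \<in> Rn n" "b \<in> Rn n" for a b p q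
    using that vs(2) by (meson insert_subset order_trans set_update_subset_insert)
  have set1: "set (vs[p := a]) \<subseteq> Rn n" if "a \<in> Rn n" for a p
    using that vs(2) by (meson insert_subset order_trans set_update_subset_insert)
  have alt: "A (vs[i := a, j := a]) = 0" if "a \<in> Rn n" for a
    by (rule alternatingD[OF A _ set2[OF that that] ij]) (use vs ij in auto)
  have "0 = A (vs[i := s, j := s])" using alt[OF s] by simp
  also have "\<dots> = A (vs[i := s, j := u]) + A (vs[i := s, j := w])"
    using multilinearD[OF M _ set1[OF s] ij(2) uw, of i 1 1] vs unfolding s_def[symmetric] by simp
  also have "vs[i := s, j := u] = vs[j := u, i := s]" by (rule list_update_swap[OF ij(3)])
  also have "vs[i := s, j := w] = vs[j := w, i := s]" by (rule list_update_swap[OF ij(3)])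
  also have "A (vs[j := u, i := s]) = A (vs[j := u, i := u]) + A (vs[j := u, i := w])"
    using multilinearD[OF M _ set1[OF uw(1)] ij(1) uw, of j 1 1] vs unfolding s_def[symmetric] by simp
  also have "A (vs[j := w, i := s]) = A (vs[j := w, i := u]) + A (vs[j := w, i := w])"
    using multilinearD[OF M _ set1[OF uw(2)] ij(1) uw, of j 1 1] vs unfolding s_def[symmetric] by simp
  also have "A (vs[j := u, i := u]) = 0" using alt[OF uw(1)] ij by (simp add: list_update_swap)
  also have "A (vs[j := w, i := w]) = 0" using alt[OF uw(2)] ij by (simp add: list_update_swap)
  also have "vs[j := w, i := u] = vs" unfolding u_def w_def by simp
  also have "vs[j := u, i := w] = vs[i := w, j := u]" using ij by (simp add: list_update_swap)
  finally show ?thesis by (simp add: u_def w_def)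
qed

text \<open>g travels from the front to position p by p adjacent transpositions, each contributing a
  sign.\<close>

lemma alternating_insert:
  assumes M: "multilinear n k A" and A: "alternating n k A"
    and vs: "Suc (length vs) = k" "set vs \<subseteq> Rn n" and g: "g \<in> Rn n" and p: "p \<le> length vs"
  shows "A (take p vs @ g # drop p vs) = (-1) ^ p * A (g # vs)"
  using p
proof (induction p)
  case (Suc p)
  let ?L = "take p vs @ g # drop p vs" and ?L' = "take (Suc p) vs @ g # drop (Suc p) vs"
  have L: "length ?L = k" "set ?L \<subseteq> Rn n"
    using Suc.prems vs g by (auto dest: in_set_takeD in_set_dropD)
  have "?L' = ?L[p := ?L ! Suc p, Suc p := ?L ! p]"
  proof -
    have "drop p vs = vs ! p # drop (Suc p) vs" using Suc.prems by (simp add: Cons_nth_drop_Suc)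
    moreover have "take (Suc p) vs = take p vs @ [vs ! p]" using Suc.prems by (simp add: take_Suc_conv_app_nth)
    ultimately show ?thesis using Suc.prems by (simp add: nth_append list_update_append)
  qed
  then have "A ?L' = - A ?L"
    using alternating_swap[OF M A L, of p "Suc p"] Suc.prems vs by simp
  then show ?case using Suc by simp
qed simp

text \<open>Moving a replaced argument to the front produces the list \<open>del i vs\<close> and
  the sign (-1)^i, the same data that occur in \<open>ext_d\<close>. Terms with a differentiated
  argument become comparable in this form.\<close>

lemma alternating_update:
  assumes M: "multilinear n k A" and A: "alternating n k A"
    and vs: "length vs = k" "set vs \<subseteq> Rn n" and g: "g \<in> Rn n" and i: "i < k"
  shows "A (vs[i := g]) = (-1) ^ i * A (g # del i vs)"
proof -
  have "vs[i := g] = take i (del i vs) @ g # drop i (del i vs)"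
    using i vs by (simp add: del_def upd_conv_take_nth_drop)
  then show ?thesis
    using alternating_insert[OF M A, of "del i vs" g i] vs set_del[of i vs] g i by (simp add: length_del)
qed

section \<open>Germs of forms and the product rule\<close>

definition form_germ ::
    "nat \<Rightarrow> nat \<Rightarrow> ((nat \<Rightarrow> real) list \<Rightarrow> (nat \<Rightarrow> real) \<Rightarrow> real) \<Rightarrow> (nat \<Rightarrow> real) \<Rightarrow> bool" where
  "form_germ n k A y \<longleftrightarrow> y \<in> Rn n \<and>
     eventually (\<lambda>z. multilinear n k (\<lambda>vs. A vs z) \<and> alternating n k (\<lambda>vs. A vs z)) (nb n y) \<and>
     (\<forall>vs. length vs = k \<and> set vs \<subseteq> Rn n \<longrightarrow> smooth_at n (A vs) y)"

lemma form_germD: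
  assumes "form_germ n k A y"
  shows "y \<in> Rn n" "eventually (\<lambda>z. multilinear n k (\<lambda>vs. A vs z)) (nb n y)"
    "multilinear n k (\<lambda>vs. A vs y)" "alternating n k (\<lambda>vs. A vs y)"
    "\<And>vs. length vs = k \<Longrightarrow> set vs \<subseteq> Rn n \<Longrightarrow> smooth_at n (A vs) y"
proof -
  show "smooth_at n (A vs) y" if "length vs = k" "set vs \<subseteq> Rn n" for vs
    using assms that by (auto simp: form_germ_def)
  show y: "y \<in> Rn n" using assms by (auto simp: form_germ_def)
  have *: "eventually (\<lambda>z. multilinear n k (\<lambda>vs. A vs z) \<and> alternating n k (\<lambda>vs. A vs z)) (nb n y)"
    using assms by (auto simp: form_germ_def)
  then show "eventually (\<lambda>z. multilinear n k (\<lambda>vs. A vs z)) (nb n y)" by eventually_elim simp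
  from eventually_nb_self[OF * y]
  show "multilinear n k (\<lambda>vs. A vs y)" "alternating n k (\<lambda>vs. A vs y)" by auto
qed

lemma form_germ_Cons:
  assumes A: "form_germ n (Suc k) A y" and v: "v \<in> Rn n"
  shows "form_germ n k (\<lambda>vs. A (v # vs)) y"
  unfolding form_germ_def
proof (intro conjI allI impI)
  show "y \<in> Rn n" using A by (simp add: form_germ_def)
  have "eventually (\<lambda>z. multilinear n (Suc k) (\<lambda>vs. A vs z) \<and> alternating n (Suc k) (\<lambda>vs. A vs z)) (nb n y)"
    using A by (simp add: form_germ_def)
  then show "eventually (\<lambda>z. multilinear n k (\<lambda>vs. A (v # vs) z) \<and> alternating n k (\<lambda>vs. A (v # vs) z)) (nb n y)"
    by eventually_elim (use v in \<open>auto intro: multilinear_Cons alternating_Cons\<close>)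
  show "smooth_at n (A (v # vs)) y" if "length vs = k \<and> set vs \<subseteq> Rn n" for vs
    using form_germD(5)[OF A] that v by simp
qed

lemma map_eval_Rn:
  assumes "\<And>V. V \<in> set Vs \<Longrightarrow> smooth_map_at m n V x"
  shows "eventually (\<lambda>z. set (map (\<lambda>V. V z) Vs) \<subseteq> Rn n) (nb m x)"
proof -
  have "eventually (\<lambda>z. \<forall>V\<in>set Vs. V z \<in> Rn n) (nb m x)"
    using assms by (intro eventually_ball_finite ballI) (auto simp: smooth_map_at_def)
  then show ?thesis by eventually_elim auto
qed

text \<open>Smoothness of a form germ is known for constant arguments only. Expanding the first
  argument in unit vectors makes it constant at the price of coefficient functions, so lists of
  varying arguments can be treated by induction.\<close>

lemma form_compose_expand:
  assumes A: "form_germ n (Suc k) A (F x)" and F: "smooth_map_at m n F x"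
    and Vs: "length Vs = k" "\<And>V. V \<in> set (V0 # Vs) \<Longrightarrow> smooth_map_at m n V x"
  shows "eventually (\<lambda>z. A (map (\<lambda>V. V z) (V0 # Vs)) (F z) =
    (\<Sum>j<n. V0 z j * A (unit_vec j # map (\<lambda>V. V z) Vs) (F z))) (nb m x)"
proof -
  have "eventually (\<lambda>z. set (map (\<lambda>V. V z) (V0 # Vs)) \<subseteq> Rn n) (nb m x)"
    by (rule map_eval_Rn) (rule Vs(2))
  then show ?thesis
    using eventually_smooth_map_at[OF F form_germD(2)[OF A]]
  proof eventually_elim
    case (elim z)
    then show ?case using multilinear_head_expand[OF elim(2), of "map (\<lambda>V. V z) Vs" "V0 z"] Vs(1) by simp
  qed
qed

lemma smooth_at_form_compose:
  assumes "form_germ n k A (F x)" and F: "smooth_map_at m n F x"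
    and "length Vs = k" "\<And>V. V \<in> set Vs \<Longrightarrow> smooth_map_at m n V x"
  shows "smooth_at m (\<lambda>z. A (map (\<lambda>V. V z) Vs) (F z)) x"
  using assms(1,3,4)
proof (induction Vs arbitrary: k A)
  case Nil
  then show ?case using smooth_at_compose[OF F] form_germD(5)[OF Nil(1)] by simp
next
  case (Cons V0 Vs)
  then obtain k' where k: "k = Suc k'" and A: "form_germ n (Suc k') A (F x)" and len: "length Vs = k'"
    by auto
  have "eventually (\<lambda>z. (\<Sum>j<n. V0 z j * A (unit_vec j # map (\<lambda>V. V z) Vs) (F z)) =
      A (map (\<lambda>V. V z) (V0 # Vs)) (F z)) (nb m x)"
    using form_compose_expand[OF A F len, of V0] Cons.prems(3) by (auto elim: eventually_mono)
  moreover have "smooth_at m (\<lambda>z. \<Sum>j<n. V0 z j * A (unit_vec j # map (\<lambda>V. V z) Vs) (F z)) x"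
  proof (intro smooth_at_sum smooth_at_mult)
    show "x \<in> Rn m" using F by (rule smooth_map_at_dom)
    show "smooth_at m (\<lambda>z. V0 z j) x" for j by (rule smooth_map_at_coord[of m n V0]) (use Cons.prems(3) in simp)
    show "smooth_at m (\<lambda>z. A (unit_vec j # map (\<lambda>V. V z) Vs) (F z)) x" if "j \<in> {..<n}" for j
      by (rule Cons.IH[OF form_germ_Cons[OF A unit_vec_Rn] len]) (use that Cons.prems(3) in auto)
  qed
  ultimately show ?case by (rule smooth_at_cong[rotated])
qed

text \<open>The product rule for A with varying arguments at a varying point. The induction expands
  the first argument in unit vectors, differentiates coefficient, base point and remaining arguments
  separately, and folds each sum back by multilinearity.\<close>

lemma dir_deriv_form_compose:
  assumes "form_germ n k A (F x)" and F: "smooth_map_at m n F x"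
    and "length Vs = k" "\<And>V. V \<in> set Vs \<Longrightarrow> smooth_map_at m n V x"
  shows "dir_deriv m (\<lambda>z. A (map (\<lambda>V. V z) Vs) (F z)) x u =
    dir_deriv n (A (map (\<lambda>V. V x) Vs)) (F x) (jacobian_map m n F x u) +
    (\<Sum>l<k. A ((map (\<lambda>V. V x) Vs)[l := jacobian_map m n (Vs ! l) x u]) (F x))"
  using assms(1,3,4)
proof (induction Vs arbitrary: k A)
  case Nil
  then show ?case using dir_deriv_compose[OF F] form_germD(5)[OF Nil(1)] by simp
next
  case (Cons V0 Vs)
  then obtain k' where k: "k = Suc k'" and A: "form_germ n (Suc k') A (F x)" and len: "length Vs = k'"
    by auto
  have V0: "smooth_map_at m n V0 x" using Cons.prems(3) by simp
  have Vs: "smooth_map_at m n V x" if "V \<in> set Vs" for V using Cons.prems(3) that by simp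
  have x: "x \<in> Rn m" using F by (rule smooth_map_at_dom)
  have Fx: "F x \<in> Rn n" using F by (rule smooth_map_at_Rn)
  define R where "R z = map (\<lambda>V. V z) Vs" for z
  define J where "J = jacobian_map m n F x u"
  have R: "length (R x) = k'" "set (R x) \<subseteq> Rn n"
  proof -
    show "length (R x) = k'" by (simp add: R_def len)
    show "set (R x) \<subseteq> Rn n"
      unfolding R_def set_map
    proof (rule image_subsetI)
      fix V assume "V \<in> set Vs"
      from smooth_map_at_Rn[OF Vs[OF this]] show "V x \<in> Rn n" .
    qed
  qed
  have V0x: "V0 x \<in> Rn n" using V0 by (rule smooth_map_at_Rn)
  have Aj: "form_germ n k' (\<lambda>vs. A (unit_vec j # vs)) (F x)" if "j < n" for j
    by (rule form_germ_Cons[OF A unit_vec_Rn[OF that]])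
  have sj: "smooth_at m (\<lambda>z. A (unit_vec j # R z) (F z)) x" if "j < n" for j
    unfolding R_def by (rule smooth_at_form_compose[OF Aj[OF that] F len Vs])
  note expand = multilinear_head_expand[OF form_germD(3)[OF A]]
  have upd: "set ((R x)[l := jacobian_map m n (Vs ! l) x u]) \<subseteq> Rn n" for l
    using R(2) jacobian_map_Rn by (meson insert_subset order_trans set_update_subset_insert)
  have "dir_deriv m (\<lambda>z. A (map (\<lambda>V. V z) (V0 # Vs)) (F z)) x u
      = dir_deriv m (\<lambda>z. \<Sum>j<n. V0 z j * A (unit_vec j # R z) (F z)) x u"
    unfolding R_def by (rule dir_deriv_cong[OF form_compose_expand[OF A F len Cons.prems(3)] x])
  also have "\<dots> = (\<Sum>j<n. dir_deriv m (\<lambda>z. V0 z j * A (unit_vec j # R z) (F z)) x u)"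
    by (rule dir_deriv_sum[OF x]) (simp_all add: smooth_at_mult smooth_map_at_coord[OF V0] sj)
  also have "\<dots> = (\<Sum>j<n. jacobian_map m n V0 x u j * A (unit_vec j # R x) (F x) +
      V0 x j * (dir_deriv n (A (unit_vec j # R x)) (F x) J +
        (\<Sum>l<k'. A (unit_vec j # (R x)[l := jacobian_map m n (Vs ! l) x u]) (F x))))"
  proof (rule sum.cong[OF refl])
    fix j assume "j \<in> {..<n}"
    then have j: "j < n" by simp
    show "dir_deriv m (\<lambda>z. V0 z j * A (unit_vec j # R z) (F z)) x u =
        jacobian_map m n V0 x u j * A (unit_vec j # R x) (F x) +
        V0 x j * (dir_deriv n (A (unit_vec j # R x)) (F x) J +
          (\<Sum>l<k'. A (unit_vec j # (R x)[l := jacobian_map m n (Vs ! l) x u]) (F x)))"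
      using dir_deriv_mult[OF smooth_map_at_coord[OF V0] sj[OF j], of j u]
        Cons.IH[OF Aj[OF j] len Vs] j
      by (simp add: R_def J_def jacobian_map_nth)
  qed
  also have "\<dots> = (\<Sum>j<n. jacobian_map m n V0 x u j * A (unit_vec j # R x) (F x)) +
      (\<Sum>j<n. V0 x j * dir_deriv n (A (unit_vec j # R x)) (F x) J) +
      (\<Sum>l<k'. \<Sum>j<n. V0 x j * A (unit_vec j # (R x)[l := jacobian_map m n (Vs ! l) x u]) (F x))"
    by (subst sum.swap[of _ "{..<n}"]) (simp add: sum.distrib algebra_simps sum_distrib_left)
  also have "(\<Sum>j<n. jacobian_map m n V0 x u j * A (unit_vec j # R x) (F x))
      = A (jacobian_map m n V0 x u # R x) (F x)"
    by (rule expand[OF R jacobian_map_Rn, symmetric])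
  also have "(\<Sum>l<k'. \<Sum>j<n. V0 x j * A (unit_vec j # (R x)[l := jacobian_map m n (Vs ! l) x u]) (F x))
      = (\<Sum>l<k'. A (V0 x # (R x)[l := jacobian_map m n (Vs ! l) x u]) (F x))"
    by (rule sum.cong[OF refl], rule expand[OF _ upd V0x, symmetric]) (use R in simp)
  also have "(\<Sum>j<n. V0 x j * dir_deriv n (A (unit_vec j # R x)) (F x) J)
      = dir_deriv n (\<lambda>y. \<Sum>j<n. V0 x j * A (unit_vec j # R x) y) (F x) J"
  proof -
    have sm: "smooth_at n (A (unit_vec j # R x)) (F x)" if "j < n" for j
      using form_germD(5)[OF Aj[OF that] R] .
    have "dir_deriv n (\<lambda>y. \<Sum>j<n. V0 x j * A (unit_vec j # R x) y) (F x) J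
        = (\<Sum>j<n. dir_deriv n (\<lambda>y. V0 x j * A (unit_vec j # R x) y) (F x) J)"
      by (rule dir_deriv_sum[OF Fx]) (simp_all add: smooth_at_mult smooth_at_const Fx sm)
    also have "\<dots> = (\<Sum>j<n. V0 x j * dir_deriv n (A (unit_vec j # R x)) (F x) J)"
      by (rule sum.cong[OF refl]) (simp add: dir_deriv_cmult[OF sm])
    finally show ?thesis by simp
  qed
  also have "\<dots> = dir_deriv n (A (V0 x # R x)) (F x) J"
  proof (rule dir_deriv_cong[OF _ Fx])
    show "\<forall>\<^sub>F y in nb n (F x). (\<Sum>j<n. V0 x j * A (unit_vec j # R x) y) = A (V0 x # R x) y"
      using form_germD(2)[OF A] by eventually_elim (rule multilinear_head_expand[OF _ R V0x, symmetric])
  qed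
  finally show ?case
    by (simp add: k R_def J_def sum.lessThan_Suc_shift algebra_simps del: sum.lessThan_Suc)
qed

text \<open>The coordinate form of \<open>ext_deriv\<close>. No bracket terms occur because the
  arguments are extended to constant vector fields, which commute.\<close>

definition ext_d ::
    "nat \<Rightarrow> ((nat \<Rightarrow> real) list \<Rightarrow> (nat \<Rightarrow> real) \<Rightarrow> real) \<Rightarrow> (nat \<Rightarrow> real) list \<Rightarrow> (nat \<Rightarrow> real) \<Rightarrow> real" where
  "ext_d n A ws y = (\<Sum>i<length ws. (-1) ^ i * dir_deriv n (A (del i ws)) y (ws ! i))"

lemma ext_d_cong:
  assumes "y \<in> Rn n" "eventually (\<lambda>z. \<forall>vs. set vs \<subseteq> Rn n \<longrightarrow> A vs z = B vs z) (nb n y)" "set ws \<subseteq> Rn n"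
  shows "ext_d n A ws y = ext_d n B ws y"
  unfolding ext_d_def
proof (rule sum.cong[OF refl])
  fix i
  have "set (del i ws) \<subseteq> Rn n" by (rule order_trans[OF set_del assms(3)])
  then have "eventually (\<lambda>z. A (del i ws) z = B (del i ws) z) (nb n y)"
    by (intro eventually_mono[OF assms(2)]) simp
  then show "(-1) ^ i * dir_deriv n (A (del i ws)) y (ws ! i) = (-1) ^ i * dir_deriv n (B (del i ws)) y (ws ! i)"
    using dir_deriv_cong[OF _ assms(1)] by simp
qed

text \<open>Both sides are the second derivative of F applied to u and v, so this is the symmetry of
  second partial derivatives.\<close>

lemma second_derivative_commute:
  assumes F: "smooth_map_at m n F x"
  shows "jacobian_map m n (\<lambda>z. jacobian_map m n F z u) x v = jacobian_map m n (\<lambda>z. jacobian_map m n F z v) x u"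
proof
  fix j
  have x: "x \<in> Rn m" using F by (rule smooth_map_at_dom)
  have f: "smooth_at m (\<lambda>y. F y j) x" using F by (rule smooth_map_at_coord)
  have *: "dir_deriv m (\<lambda>z. dir_deriv m (\<lambda>y. F y j) z u) x v =
      (\<Sum>i<m. \<Sum>l<m. v i * u l * partial i (partial l (\<lambda>y. F y j)) x)" for u v
  proof -
    have "dir_deriv m (\<lambda>z. dir_deriv m (\<lambda>y. F y j) z u) x v
        = (\<Sum>l<m. dir_deriv m (\<lambda>z. u l * partial l (\<lambda>y. F y j) z) x v)"
      unfolding dir_deriv_def[of m "\<lambda>y. F y j"]
      by (rule dir_deriv_sum[OF x]) (simp_all add: smooth_at_mult smooth_at_const x smooth_at_partial f)
    also have "\<dots> = (\<Sum>l<m. u l * (\<Sum>i<m. v i * partial i (partial l (\<lambda>y. F y j)) x))"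
      by (rule sum.cong[OF refl]) (simp add: dir_deriv_cmult smooth_at_partial f, simp add: dir_deriv_def)
    also have "\<dots> = (\<Sum>l<m. \<Sum>i<m. v i * u l * partial i (partial l (\<lambda>y. F y j)) x)"
      by (simp add: sum_distrib_left mult_ac)
    also have "\<dots> = (\<Sum>i<m. \<Sum>l<m. v i * u l * partial i (partial l (\<lambda>y. F y j)) x)"
      by (rule sum.swap)
    finally show ?thesis .
  qed
  have "(\<Sum>i<m. \<Sum>l<m. v i * u l * partial i (partial l (\<lambda>y. F y j)) x)
      = (\<Sum>l<m. \<Sum>i<m. u l * v i * partial l (partial i (\<lambda>y. F y j)) x)"
    by (subst sum.swap) (intro sum.cong refl, simp add: partial_commute[OF f] mult_ac)
  then have "dir_deriv m (\<lambda>z. dir_deriv m (\<lambda>y. F y j) z u) x v = dir_deriv m (\<lambda>z. dir_deriv m (\<lambda>y. F y j) z v) x u"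
    unfolding * .
  then show "jacobian_map m n (\<lambda>z. jacobian_map m n F z u) x v j = jacobian_map m n (\<lambda>z. jacobian_map m n F z v) x u j"
    by (cases "j < n") (simp_all add: jacobian_map_nth, simp add: jacobian_map_def)
qed

text \<open>Once the changed slot is moved to the front, deleting argument i and changing slot l
  gives, for i \<le> l, the same value of A as deleting argument \<open>Suc l\<close> and changing
  slot i. The signs are opposite, so the terms cancel in pairs.\<close>

lemma alternating_sum_symmetric:
  fixes H :: "'u \<Rightarrow> 'u \<Rightarrow> nat \<Rightarrow> real" and J :: "'u \<Rightarrow> nat \<Rightarrow> real"
  assumes M: "multilinear n k A" and A: "alternating n k A" and us: "length us = Suc k"
    and J: "\<And>u. J u \<in> Rn n" and HR: "\<And>u v. H u v \<in> Rn n" and sym: "\<And>u v. H u v = H v u"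
  shows "(\<Sum>i<Suc k. (-1) ^ i * (\<Sum>l<k. A ((map J (del i us))[l := H (us ! i) (del i us ! l)]))) = 0"
proof -
  define vs where "vs = map J us"
  have vs: "length vs = Suc k" "set vs \<subseteq> Rn n" using us J by (auto simp: vs_def)
  define T where "T = (\<lambda>(i, l). (-1) ^ (i + l) * A (H (us ! i) (del i us ! l) # del l (del i vs)))"
  have "(\<Sum>i<Suc k. (-1) ^ i * (\<Sum>l<k. A ((map J (del i us))[l := H (us ! i) (del i us ! l)])))
      = (\<Sum>i<Suc k. \<Sum>l<k. T (i, l))"
  proof (intro sum.cong refl, subst sum_distrib_left, intro sum.cong refl)
    fix i l assume "i \<in> {..<Suc k}" "l \<in> {..<k}"
    then show "(-1) ^ i * A ((map J (del i us))[l := H (us ! i) (del i us ! l)]) = T (i, l)"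
      using alternating_update[OF M A, of "del i vs" "H (us ! i) (del i us ! l)" l] vs set_del[of i vs] HR
      by (simp add: T_def length_del map_del vs_def power_add)
  qed
  also have "\<dots> = sum T ({..<Suc k} \<times> {..<k})" by (simp add: sum.cartesian_product)
  also have "{..<Suc k} \<times> {..<k} = {(i, l). i \<le> l \<and> l < k} \<union> {(i, l). l < i \<and> i < Suc k}" (is "_ = ?P \<union> ?Q")
    by auto
  also have "sum T (?P \<union> ?Q) = sum T ?P + sum T ?Q"
  proof (rule sum.union_disjoint)
    show "finite ?P" by (rule finite_subset[of _ "{..<k} \<times> {..<k}"]) auto
    show "finite ?Q" by (rule finite_subset[of _ "{..<Suc k} \<times> {..<k}"]) auto
  qed auto
  \<comment> \<open>Deleting entry i shifts entry \<open>Suc l\<close> to position l when i \<le> l;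
    hence (i, l) is matched with (\<open>Suc l\<close>, i), whose index sum has the other
    parity.\<close>
  also have "sum T ?P = (\<Sum>p\<in>?Q. - T p)"
  proof (rule sum.reindex_bij_witness[of _ "\<lambda>(i, l). (l, i - 1)" "\<lambda>(i, l). (Suc l, i)"])
    fix p assume "p \<in> ?P"
    then obtain i l where p: "p = (i, l)" "i \<le> l" "l < k" by auto
    have "del i us ! l = us ! Suc l" "del (Suc l) us ! i = us ! i"
      using p us by (simp_all add: nth_del)
    moreover have "del l (del i vs) = del i (del (Suc l) vs)" by (rule del_del) (use p vs in auto)
    ultimately show "- T (case p of (i, l) \<Rightarrow> (Suc l, i)) = T p"
      using sym[of "us ! i" "us ! Suc l"] by (simp add: T_def p add.commute)
  qed auto
  finally show ?thesis by (simp add: sum_negf)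
qed

text \<open>Naturality of d. By the product rule each summand splits into a derivative of A along an
  image vector, and these assemble to dA, and into terms with second derivatives of F, which cancel
  by symmetry.\<close>

lemma ext_d_pullback:
  assumes A: "form_germ n k A (F x)" and F: "smooth_map_at m n F x"
    and us: "length us = Suc k" "set us \<subseteq> Rn m"
  shows "ext_d m (\<lambda>ws z. A (map (jacobian_map m n F z) ws) (F z)) us x
    = ext_d n A (map (jacobian_map m n F x) us) (F x)"
proof -
  have x: "x \<in> Rn m" using F by (rule smooth_map_at_dom)
  define J where "J = jacobian_map m n F x"
  define H where "H u v = jacobian_map m n (\<lambda>z. jacobian_map m n F z v) x u" for u v
  have "dir_deriv m (\<lambda>z. A (map (jacobian_map m n F z) (del i us)) (F z)) x (us ! i) =
      dir_deriv n (A (map J (del i us))) (F x) (J (us ! i)) +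
      (\<Sum>l<k. A ((map J (del i us))[l := H (us ! i) (del i us ! l)]) (F x))" if i: "i < Suc k" for i
  proof -
    \<comment> \<open>Pulling back turns constant arguments into the varying vectors
      \<open>jacobian_map m n F z u\<close>, so the product rule for varying arguments is the one to
      use.\<close>
    define Vs where "Vs = map (\<lambda>u z. jacobian_map m n F z u) (del i us)"
    have len: "length Vs = k" using i us by (simp add: Vs_def length_del)
    have sm: "smooth_map_at m n V x" if "V \<in> set Vs" for V
    proof -
      have "V \<in> (\<lambda>u z. jacobian_map m n F z u) ` set (del i us)" using that by (simp add: Vs_def)
      then obtain u where u: "V = (\<lambda>z. jacobian_map m n F z u)" "u \<in> set (del i us)"
        by (rule imageE)
      then have "u \<in> Rn m" using set_del[of i us] us(2) by blast
      then show ?thesis unfolding u(1) by (intro smooth_map_at_jacobian[OF F] smooth_map_at_const x)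
    qed
    have *: "map (\<lambda>V. V z) Vs = map (jacobian_map m n F z) (del i us)" for z by (simp add: Vs_def)
    have "Vs ! l = (\<lambda>z. jacobian_map m n F z (del i us ! l))" if "l < k" for l
      using that len by (simp add: Vs_def)
    then show ?thesis
      using dir_deriv_form_compose[where Vs = Vs and u = "us ! i", OF A F len sm]
      by (simp add: * J_def H_def)
  qed
  then have "ext_d m (\<lambda>ws z. A (map (jacobian_map m n F z) ws) (F z)) us x =
      (\<Sum>i<Suc k. (-1) ^ i * dir_deriv n (A (map J (del i us))) (F x) (J (us ! i))) +
      (\<Sum>i<Suc k. (-1) ^ i * (\<Sum>l<k. A ((map J (del i us))[l := H (us ! i) (del i us ! l)]) (F x)))"
    unfolding ext_d_def us(1) sum.distrib[symmetric]
    by (intro sum.cong refl) (simp add: algebra_simps)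
  also have "(\<Sum>i<Suc k. (-1) ^ i * (\<Sum>l<k. A ((map J (del i us))[l := H (us ! i) (del i us ! l)]) (F x))) = 0"
  proof (rule alternating_sum_symmetric[OF form_germD(3,4)[OF A] us(1)])
    show "J u \<in> Rn n" for u by (simp add: J_def jacobian_map_Rn)
    show "H u v \<in> Rn n" for u v by (simp add: H_def jacobian_map_Rn)
    show "H u v = H v u" for u v unfolding H_def by (rule second_derivative_commute[OF F])
  qed
  also have "(\<Sum>i<Suc k. (-1) ^ i * dir_deriv n (A (map J (del i us))) (F x) (J (us ! i))) = ext_d n A (map J us) (F x)"
    unfolding ext_d_def length_map us(1) by (intro sum.cong refl) (simp add: map_del us(1))
  finally show ?thesis by (simp add: J_def)
qed

text \<open>Cartan's formula \<open>L\<^sub>X = \<iota>\<^sub>X d + d \<iota>\<^sub>X\<close> for a form annihilated by \<open>\<iota>\<^sub>X\<close>, \<open>X\<close> having coordinates \<open>\<xi>\<close>.\<close>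

lemma cartan_horizontal:
  assumes A: "form_germ n k A x" and \<xi>: "smooth_map_at n n \<xi> x" and ws: "length ws = k" "set ws \<subseteq> Rn n"
    and hor: "eventually (\<lambda>y. \<forall>vs. Suc (length vs) = k \<and> set vs \<subseteq> Rn n \<longrightarrow> A (\<xi> y # vs) y = 0) (nb n x)"
  shows "ext_d n A (\<xi> x # ws) x =
    dir_deriv n (A ws) x (\<xi> x) + (\<Sum>i<k. A (ws[i := jacobian_map n n \<xi> x (ws ! i)]) x)"
proof -
  have x: "x \<in> Rn n" using \<xi> by (rule smooth_map_at_dom)
  \<comment> \<open>Differentiate the identity \<open>A (\<xi> z # del i ws) z = 0\<close> in
    direction \<open>ws ! i\<close>. Among the terms that differentiate an argument only that of
    \<open>\<xi>\<close> survives, the other arguments being constant.\<close>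
  have "dir_deriv n (A (\<xi> x # del i ws)) x (ws ! i) = - ((-1) ^ i * A (ws[i := jacobian_map n n \<xi> x (ws ! i)]) x)"
    if i: "i < k" for i
  proof -
    define D where "D = jacobian_map n n \<xi> x (ws ! i)"
    define Vs where "Vs = \<xi> # map (\<lambda>w z. w) (del i ws)"
    have dR: "set (del i ws) \<subseteq> Rn n" using set_del[of i ws] ws(2) by blast
    have len: "length Vs = k" using i ws by (simp add: Vs_def length_del)
    have sm: "smooth_map_at n n V x" if "V \<in> set Vs" for V
      using that dR by (auto simp: Vs_def \<xi> intro: smooth_map_at_const x)
    have eval: "map (\<lambda>V. V z) Vs = \<xi> z # del i ws" for z by (simp add: Vs_def comp_def)
    have "dir_deriv n (\<lambda>z. A (map (\<lambda>V. V z) Vs) z) x (ws ! i) = dir_deriv n (\<lambda>z. 0) x (ws ! i)"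
      by (rule dir_deriv_cong[OF eventually_mono[OF hor] x])
         (use dR len in \<open>auto simp: eval Vs_def length_del\<close>)
    then have "0 = dir_deriv n (A (\<xi> x # del i ws)) x (jacobian_map n n (\<lambda>z. z) x (ws ! i)) +
        (\<Sum>l<k. A ((\<xi> x # del i ws)[l := jacobian_map n n (Vs ! l) x (ws ! i)]) x)"
      using dir_deriv_form_compose[where F = "\<lambda>z. z" and u = "ws ! i", OF A smooth_map_at_id[OF x] len sm]
      by (simp add: eval dir_deriv_const)
    moreover have "jacobian_map n n (\<lambda>z. z) x (ws ! i) = ws ! i"
      by (rule jacobian_map_id) (use x ws i nth_mem in auto)
    moreover have "(\<Sum>l<k. A ((\<xi> x # del i ws)[l := jacobian_map n n (Vs ! l) x (ws ! i)]) x) = A (D # del i ws) x"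
    proof -
      have "A ((\<xi> x # del i ws)[l := jacobian_map n n (Vs ! l) x (ws ! i)]) x =
          (if l = 0 then A (D # del i ws) x else 0)" if l: "l < k" for l
      proof (cases l)
        case 0 then show ?thesis by (simp add: Vs_def D_def)
      next
        case (Suc l')
        then have "Vs ! l = (\<lambda>z. del i ws ! l')" using l len by (simp add: Vs_def)
        then have "jacobian_map n n (Vs ! l) x (ws ! i) = (\<lambda>j. 0)"
          by (simp add: jacobian_map_def dir_deriv_const fun_eq_iff)
        moreover have "A ((\<xi> x # del i ws)[l := (\<lambda>j. 0)]) x = 0"
          by (rule multilinear_zero[OF form_germD(3)[OF A]])
             (use dR l len smooth_map_at_Rn[OF \<xi>] in \<open>auto simp: Vs_def\<close>)
        ultimately show ?thesis using Suc by simp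
      qed
      then have "(\<Sum>l<k. A ((\<xi> x # del i ws)[l := jacobian_map n n (Vs ! l) x (ws ! i)]) x)
          = (\<Sum>l<k. if l = 0 then A (D # del i ws) x else 0)" by (intro sum.cong) auto
      then show ?thesis using i by simp
    qed
    moreover have "A (ws[i := D]) x = (-1) ^ i * A (D # del i ws) x"
      by (rule alternating_update[OF form_germD(3,4)[OF A] ws _ i]) (simp add: D_def jacobian_map_Rn)
    ultimately show ?thesis by (simp add: D_def power_mult_distrib[symmetric] mult.assoc[symmetric])
  qed
  then have "(\<Sum>i<k. (-1) ^ Suc i * dir_deriv n (A (\<xi> x # del i ws)) x (ws ! i))
      = (\<Sum>i<k. A (ws[i := jacobian_map n n \<xi> x (ws ! i)]) x)"
    by (intro sum.cong refl) (simp add: power_mult_distrib[symmetric] mult.assoc[symmetric])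
  then show ?thesis
    by (simp add: ext_d_def ws(1) sum.lessThan_Suc_shift del_0 del_Suc
        del: power_Suc sum.lessThan_Suc)
qed

section \<open>Charts and tangent vectors\<close>

text \<open>Convex coordinate images: a segment between two points of a chart that agree in the base
  coordinates stays in the chart and in one fiber.\<close>

definition cube :: "nat \<Rightarrow> (nat \<Rightarrow> real) \<Rightarrow> real \<Rightarrow> (nat \<Rightarrow> real) set" where
  "cube n z e = {y \<in> Rn n. \<forall>i<n. \<bar>y i - z i\<bar> < e}"

lemma openin_cube: "openin (E n) (cube n z e)"
  unfolding openin_iff_nb
proof (intro conjI ballI)
  fix y assume y: "y \<in> cube n z e"
  have "eventually (\<lambda>w. \<forall>i\<in>{..<n}. \<bar>w i - z i\<bar> < e) (nb n y)"
  proof (intro eventually_ball_finite ballI)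
    fix i assume "i \<in> {..<n}"
    then have "\<bar>y i - z i\<bar> < e" using y by (simp add: cube_def)
    moreover have "((\<lambda>w. \<bar>w i - z i\<bar>) \<longlongrightarrow> \<bar>y i - z i\<bar>) (nb n y)"
      by (intro tendsto_intros tendsto_coord_nb)
    ultimately show "eventually (\<lambda>w. \<bar>w i - z i\<bar> < e) (nb n y)" by (rule order_tendstoD(2)[rotated])
  qed simp
  with eventually_nb_Rn show "eventually (\<lambda>w. w \<in> cube n z e) (nb n y)"
    by eventually_elim (simp add: cube_def)
qed (auto simp: cube_def)

lemma eventually_nb_cube:
  assumes "z \<in> Rn n" "eventually P (nb n z)"
  shows "\<exists>e>0. \<forall>y\<in>cube n z e. P y"
proof -
  obtain e where "e > 0" "\<And>y. y \<in> Rn n \<Longrightarrow> (\<forall>i<n. \<bar>y i - z i\<bar> < e) \<Longrightarrow> P y"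
    using assms(2) unfolding eventually_nb_box[OF assms(1)] by auto
  then show ?thesis by (intro exI[of _ e]) (simp add: cube_def)
qed

lemma charts_atD: "c \<in> charts_at M x \<Longrightarrow> c \<in> atlas M" "c \<in> charts_at M x \<Longrightarrow> x \<in> fst c"
  by (auto simp: charts_at_def)

locale mfd =
  fixes M :: "'a manifold"
  assumes smooth_mfd: "smooth_manifold M"
begin

abbreviation "dm \<equiv> mdim M"

lemma atlas_maximal: "maximal_atlas (mcarrier M) dm (atlas M)"
  using smooth_mfd by (simp add: smooth_manifold_def)

lemma atlas_chart:
  assumes "c \<in> atlas M"
  shows "fst c \<subseteq> mcarrier M" "inj_on (snd c) (fst c)" "openin (E dm) (snd c ` fst c)"
  using assms atlas_maximal by (auto simp: maximal_atlas_def is_chart_def)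

lemma chart_inv_left: "c \<in> atlas M \<Longrightarrow> x \<in> fst c \<Longrightarrow> chart_inv c (snd c x) = x"
  by (simp add: chart_inv_def atlas_chart(2))

lemma chart_inv_right:
  assumes "y \<in> snd c ` fst c"
  shows "chart_inv c y \<in> fst c" "snd c (chart_inv c y) = y"
  using assms by (simp_all add: chart_inv_def inv_into_into f_inv_into_f)

lemma coord_Rn: "c \<in> atlas M \<Longrightarrow> x \<in> fst c \<Longrightarrow> snd c x \<in> Rn dm"
  using openin_Rn[OF atlas_chart(3)[of c]] by (simp add: image_subset_iff)

lemma charts_at_carrier: "c \<in> charts_at M x \<Longrightarrow> x \<in> mcarrier M"
  using subsetD[OF atlas_chart(1)[OF charts_atD(1)] charts_atD(2)] .

lemma charts_at_coord_Rn: "c \<in> charts_at M x \<Longrightarrow> snd c x \<in> Rn dm"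
  using coord_Rn by (simp add: charts_at_def)

lemma chart_at_in: "x \<in> mcarrier M \<Longrightarrow> chart_at M x \<in> charts_at M x"
proof -
  assume "x \<in> mcarrier M"
  then have "x \<in> (\<Union>c\<in>atlas M. fst c)"
    using atlas_maximal by (simp add: maximal_atlas_def)
  then obtain c where "c \<in> atlas M" "x \<in> fst c" by (rule UN_E)
  then have "c \<in> charts_at M x" by (simp add: charts_at_def)
  then show ?thesis unfolding chart_at_def by (rule someI)
qed

lemma compatible: "c \<in> atlas M \<Longrightarrow> d \<in> atlas M \<Longrightarrow> compatible dm c d"
  using atlas_maximal by (simp add: maximal_atlas_def)

lemma overlap_open: "c \<in> atlas M \<Longrightarrow> d \<in> atlas M \<Longrightarrow> openin (E dm) (snd c ` (fst c \<inter> fst d))"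
  using compatible by (simp add: compatible_def smooth_transition_def)

lemma transition_at: "c \<in> charts_at M x \<Longrightarrow> transition c d (snd c x) = snd d x"
  by (simp add: transition_def chart_inv_left charts_atD)

lemma transition_smooth:
  assumes "c \<in> charts_at M x" "d \<in> charts_at M x"
  shows "smooth_map_at dm dm (transition c d) (snd c x)"
  using assms compatible[of c d]
  by (intro smooth_map_atI[of dm "snd c ` (fst c \<inter> fst d)"])
     (auto simp: compatible_def smooth_transition_def charts_at_def)

lemma eventually_overlap:
  assumes "c \<in> charts_at M x" "d \<in> charts_at M x"
  shows "eventually (\<lambda>y. y \<in> snd c ` fst c \<and> chart_inv c y \<in> fst d) (nb dm (snd c x))"
proof -
  have "eventually (\<lambda>y. y \<in> snd c ` (fst c \<inter> fst d)) (nb dm (snd c x))"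
    using assms by (intro openin_eventually_nb overlap_open) (auto simp: charts_at_def)
  then show ?thesis
  proof eventually_elim
    case (elim y)
    then obtain x' where "x' \<in> fst c" "x' \<in> fst d" "y = snd c x'" by blast
    then show ?case using chart_inv_left[OF charts_atD(1)[OF assms(1)]] by simp
  qed
qed

lemma eventually_chart:
  "c \<in> charts_at M x \<Longrightarrow> eventually (\<lambda>y. y \<in> snd c ` fst c) (nb dm (snd c x))"
  by (rule eventually_mono[OF eventually_overlap[of c x c]]) simp_all

lemma eventually_charts_at:
  "c \<in> charts_at M x \<Longrightarrow> d \<in> charts_at M x \<Longrightarrow>
    eventually (\<lambda>y. c \<in> charts_at M (chart_inv c y) \<and> d \<in> charts_at M (chart_inv c y) \<and>
      snd c (chart_inv c y) = y) (nb dm (snd c x))"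
  by (rule eventually_mono[OF eventually_overlap[of c x d]])
     (simp_all add: charts_at_def chart_inv_right)

text \<open>The chain rule applied to the cocycle identity of transition maps; it gives
  \<open>coord_vec\<close> the transformation law of tangent vectors.\<close>

lemma transition_jacobian:
  assumes c: "c \<in> charts_at M x" and d: "d \<in> charts_at M x" and e: "e \<in> charts_at M x"
  shows "jacobian_map dm dm (transition d e) (snd d x) (jacobian_map dm dm (transition c d) (snd c x) w)
    = jacobian_map dm dm (transition c e) (snd c x) w"
proof -
  have "eventually (\<lambda>y. transition d e (transition c d y) = transition c e y) (nb dm (snd c x))"
    using eventually_overlap[OF c d]
    by eventually_elim (simp add: transition_def chart_inv_left[OF charts_atD(1)[OF d]])
  then have "jacobian_map dm dm (\<lambda>y. transition d e (transition c d y)) (snd c x) w =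
      jacobian_map dm dm (transition c e) (snd c x) w"
    by (rule jacobian_map_cong) (rule charts_at_coord_Rn[OF c])
  then show ?thesis
    using jacobian_map_compose[OF transition_smooth[OF c d], of dm "transition d e" w]
      transition_smooth[OF d e] by (simp add: transition_at[OF c])
qed

lemma transition_self_jacobian:
  assumes c: "c \<in> charts_at M x" and w: "w \<in> Rn dm"
  shows "jacobian_map dm dm (transition c c) (snd c x) w = w"
proof (rule jacobian_map_id[OF _ charts_at_coord_Rn[OF c] w])
  show "eventually (\<lambda>y. transition c c y = y) (nb dm (snd c x))"
    using eventually_chart[OF c] by eventually_elim (simp add: transition_def chart_inv_right)
qed

lemma tangent_Rn: "v \<in> tangent_space M x \<Longrightarrow> c \<in> charts_at M x \<Longrightarrow> v c \<in> Rn dm"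
  unfolding tangent_space_def by blast

lemma tangent_transform:
  "v \<in> tangent_space M x \<Longrightarrow> c \<in> charts_at M x \<Longrightarrow> d \<in> charts_at M x \<Longrightarrow>
    v d = jacobian_map dm dm (transition c d) (snd c x) (v c)"
  unfolding tangent_space_def by blast

lemma coord_vec_tangent: "c \<in> charts_at M x \<Longrightarrow> coord_vec M c x w \<in> tangent_space M x"
  unfolding tangent_space_def mem_Collect_eq
  by (intro conjI ballI allI impI) (simp_all only: coord_vec_def if_True if_False jacobian_map_Rn transition_jacobian)

lemma coord_vec_apply:
  "d \<in> charts_at M x \<Longrightarrow> coord_vec M c x w d = jacobian_map dm dm (transition c d) (snd c x) w"
  by (simp add: coord_vec_def)

lemma coord_vec_same: "c \<in> charts_at M x \<Longrightarrow> w \<in> Rn dm \<Longrightarrow> coord_vec M c x w c = w"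
  by (simp add: coord_vec_def transition_self_jacobian)

lemma coord_vec_tangent_eq:
  assumes v: "v \<in> tangent_space M x" and c: "c \<in> charts_at M x"
  shows "coord_vec M c x (v c) = v"
proof
  fix d
  show "coord_vec M c x (v c) d = v d"
  proof (cases "d \<in> charts_at M x")
    case True
    then show ?thesis using tangent_transform[OF v c True] by (simp add: coord_vec_def)
  next
    case False
    then have "v d = (\<lambda>i. 0)" using v unfolding tangent_space_def by blast
    then show ?thesis using False by (simp add: coord_vec_def)
  qed
qed

lemma tangent_eqI:
  assumes "v \<in> tangent_space M x" "w \<in> tangent_space M x" "c \<in> charts_at M x" "v c = w c"
  shows "v = w"
proof -
  have "v = coord_vec M c x (v c)" by (rule coord_vec_tangent_eq[OF assms(1,3), symmetric])
  also have "\<dots> = coord_vec M c x (w c)" by (simp only: assms(4))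
  also have "\<dots> = w" by (rule coord_vec_tangent_eq[OF assms(2,3)])
  finally show ?thesis .
qed

lemma coord_vec_lincomb:
  "coord_vec M c x (\<lambda>j. a * u j + b * w j) = tv_lincomb a (coord_vec M c x u) b (coord_vec M c x w)"
  by (auto simp: coord_vec_def tv_lincomb_def jacobian_map_lincomb fun_eq_iff)

lemma zero_tangent: "x \<in> mcarrier M \<Longrightarrow> (\<lambda>c i. 0) \<in> tangent_space M x"
proof -
  have "jacobian_map dm dm F y (\<lambda>i. 0) = (\<lambda>i. 0)" for F y
    by (simp add: jacobian_map_def dir_deriv_def fun_eq_iff)
  then show ?thesis by (auto simp: tangent_space_def mem_Rn)
qed

lemma tv_lincomb_tangent:
  assumes u: "u \<in> tangent_space M x" and w: "w \<in> tangent_space M x" and x: "x \<in> mcarrier M"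
  shows "tv_lincomb a u b w \<in> tangent_space M x"
proof -
  note c = chart_at_in[OF x]
  have "tv_lincomb a u b w = coord_vec M (chart_at M x) x (\<lambda>j. a * u (chart_at M x) j + b * w (chart_at M x) j)"
    by (simp add: coord_vec_lincomb coord_vec_tangent_eq[OF _ c] u w)
  then show ?thesis using coord_vec_tangent[OF c] by simp
qed

subsection \<open>The manifold topology\<close>

lemma openin_mtopology:
  "openin (mtopology M) U \<longleftrightarrow> U \<subseteq> mcarrier M \<and> (\<forall>c\<in>atlas M. openin (E dm) (snd c ` (U \<inter> fst c)))"
proof -
  have "istopology (\<lambda>U. U \<subseteq> mcarrier M \<and> (\<forall>c\<in>atlas M. openin (E dm) (snd c ` (U \<inter> fst c))))"
    unfolding istopology_def
  proof (intro conjI allI impI)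
    fix S T
    assume S: "S \<subseteq> mcarrier M \<and> (\<forall>c\<in>atlas M. openin (E dm) (snd c ` (S \<inter> fst c)))"
      and T: "T \<subseteq> mcarrier M \<and> (\<forall>c\<in>atlas M. openin (E dm) (snd c ` (T \<inter> fst c)))"
    show "S \<inter> T \<subseteq> mcarrier M" using S by blast
    show "\<forall>c\<in>atlas M. openin (E dm) (snd c ` (S \<inter> T \<inter> fst c))"
    proof
      fix c assume c: "c \<in> atlas M"
      have "snd c ` (S \<inter> T \<inter> fst c) = snd c ` (S \<inter> fst c) \<inter> snd c ` (T \<inter> fst c)"
        using atlas_chart(2)[OF c] by (auto simp: inj_on_def)
      then show "openin (E dm) (snd c ` (S \<inter> T \<inter> fst c))" using S T c by auto
    qed
  next
    fix K assume K: "\<forall>S\<in>K. S \<subseteq> mcarrier M \<and> (\<forall>c\<in>atlas M. openin (E dm) (snd c ` (S \<inter> fst c)))"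
    show "\<Union>K \<subseteq> mcarrier M" using K by blast
    show "\<forall>c\<in>atlas M. openin (E dm) (snd c ` (\<Union>K \<inter> fst c))"
    proof
      fix c assume c: "c \<in> atlas M"
      have "snd c ` (\<Union>K \<inter> fst c) = (\<Union>S\<in>K. snd c ` (S \<inter> fst c))" by blast
      then show "openin (E dm) (snd c ` (\<Union>K \<inter> fst c))" using K c by auto
    qed
  qed
  then show ?thesis unfolding mtopology_def by (simp add: topology_inverse')
qed

lemma openin_chart: "c \<in> atlas M \<Longrightarrow> openin (mtopology M) (fst c)"
proof -
  assume c: "c \<in> atlas M"
  have "openin (E dm) (snd d ` (fst c \<inter> fst d))" if "d \<in> atlas M" for d
    using overlap_open[OF that c] by (simp only: Int_commute)
  then show ?thesis unfolding openin_mtopology using atlas_chart(1)[OF c] by simp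
qed

lemma topspace_mtopology: "topspace (mtopology M) = mcarrier M"
proof
  show "topspace (mtopology M) \<subseteq> mcarrier M"
    using openin_topspace[of "mtopology M"] unfolding openin_mtopology by blast
  show "mcarrier M \<subseteq> topspace (mtopology M)"
  proof
    fix x assume "x \<in> mcarrier M"
    from chart_at_in[OF this] show "x \<in> topspace (mtopology M)"
      using subsetD[OF openin_subset[OF openin_chart[OF charts_atD(1)]] charts_atD(2)] by simp
  qed
qed

lemma transition_eventually:
  assumes c: "c \<in> charts_at M x" and d: "d \<in> charts_at M x" and P: "eventually P (nb dm (snd c x))"
  shows "eventually (\<lambda>z. P (snd c (chart_inv d z))) (nb dm (snd d x))"
proof -
  have "eventually P (nb dm (transition d c (snd d x)))" using P by (simp only: transition_at[OF d])
  from eventually_smooth_map_at[OF transition_smooth[OF d c] this] show ?thesis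
    by (simp add: transition_def)
qed

subsection \<open>Changing coordinates\<close>

text \<open>After shrinking, a chart followed by a local diffeomorphism is compatible with the whole
  atlas and hence belongs to it by maximality. Shrinking to a cube provides convexity, and any
  property P that holds near the point can be made to hold on the whole new domain.\<close>

lemma reparametrized_chart:
  assumes c: "c \<in> charts_at M x" and D: "local_diffeo dm (snd c x) \<Theta> \<Psi>"
    and P: "eventually P (nb dm (snd c x))"
  obtains c' e where "c' \<in> charts_at M x" "fst c' \<subseteq> fst c" "e > 0"
    "snd c' ` fst c' = cube dm (\<Theta> (snd c x)) e"
    "\<And>x'. x' \<in> fst c' \<Longrightarrow> snd c' x' = \<Theta> (snd c x') \<and> P (snd c x')"
proof -
  define y where "y = snd c x"
  define z where "z = \<Theta> y"
  note cA = charts_atD(1)[OF c]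
  have y: "y \<in> Rn dm" unfolding y_def by (rule charts_at_coord_Rn[OF c])
  have \<Theta>: "smooth_map_at dm dm \<Theta> y" and \<Psi>: "smooth_map_at dm dm \<Psi> z"
    and \<Psi>\<Theta>: "eventually (\<lambda>y. \<Psi> (\<Theta> y) = y) (nb dm y)" and \<Theta>\<Psi>: "eventually (\<lambda>w. \<Theta> (\<Psi> w) = w) (nb dm z)"
    using D by (auto simp: local_diffeo_def z_def y_def)
  have \<Psi>z: "\<Psi> z = y" unfolding z_def y_def by (rule local_diffeo_inverse_at[OF D])
  have z: "z \<in> Rn dm" using \<Psi> by (rule smooth_map_at_dom)
  \<comment> \<open>All local requirements are gathered before the cube is chosen, so that they hold
    at each of its points. The nested \<open>eventually\<close> supplies the left inverse near every
    point of the new domain, as the transitions into c' require.\<close>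
  have "eventually (\<lambda>y. y \<in> snd c ` fst c \<and> P y \<and> smooth_map_at dm dm \<Theta> y \<and>
      eventually (\<lambda>y. \<Psi> (\<Theta> y) = y) (nb dm y)) (nb dm y)"
    using eventually_chart[OF c] P smooth_map_at_eventually[OF \<Theta>] eventually_nb_nb[OF \<Psi>\<Theta> y]
    unfolding y_def by eventually_elim simp
  then have "eventually (\<lambda>w. \<Psi> w \<in> snd c ` fst c \<and> P (\<Psi> w) \<and> smooth_map_at dm dm \<Theta> (\<Psi> w) \<and>
      eventually (\<lambda>y. \<Psi> (\<Theta> y) = y) (nb dm (\<Psi> w))) (nb dm z)"
    by (intro eventually_smooth_map_at[OF \<Psi>]) (simp add: \<Psi>z)
  then have "eventually (\<lambda>w. (\<Psi> w \<in> snd c ` fst c \<and> P (\<Psi> w) \<and> smooth_map_at dm dm \<Theta> (\<Psi> w) \<and>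
      eventually (\<lambda>y. \<Psi> (\<Theta> y) = y) (nb dm (\<Psi> w))) \<and> \<Theta> (\<Psi> w) = w \<and> smooth_map_at dm dm \<Psi> w) (nb dm z)"
    using \<Theta>\<Psi> smooth_map_at_eventually[OF \<Psi>] by eventually_elim simp
  from eventually_nb_cube[OF z this] obtain e where e: "e > 0" and
    C0: "\<forall>w\<in>cube dm z e. (\<Psi> w \<in> snd c ` fst c \<and> P (\<Psi> w) \<and> smooth_map_at dm dm \<Theta> (\<Psi> w) \<and>
      eventually (\<lambda>y. \<Psi> (\<Theta> y) = y) (nb dm (\<Psi> w))) \<and> \<Theta> (\<Psi> w) = w \<and> smooth_map_at dm dm \<Psi> w"
    by blast
  define C where "C = cube dm z e"
  have C: "\<Psi> w \<in> snd c ` fst c" "P (\<Psi> w)" "smooth_map_at dm dm \<Theta> (\<Psi> w)"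
      "eventually (\<lambda>y. \<Psi> (\<Theta> y) = y) (nb dm (\<Psi> w))" "\<Theta> (\<Psi> w) = w" "smooth_map_at dm dm \<Psi> w"
    if "w \<in> C" for w using C0 that by (simp_all add: C_def)
  have C_open: "openin (E dm) C" unfolding C_def by (rule openin_cube)
  define pt where "pt w = chart_inv c (\<Psi> w)" for w
  have pt: "pt w \<in> fst c" "snd c (pt w) = \<Psi> w" if "w \<in> C" for w
    using chart_inv_right[OF C(1)[OF that]] by (simp_all add: pt_def)
  define c' where "c' = (pt ` C, restrict (\<lambda>x. \<Theta> (snd c x)) (pt ` C))"
  have fst_c': "fst c' = pt ` C" by (simp add: c'_def)
  have snd_c': "snd c' x' = \<Theta> (snd c x')" if "x' \<in> fst c'" for x' using that by (simp add: c'_def)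
  have snd_pt: "snd c' (pt w) = w" if "w \<in> C" for w
    using that by (simp add: c'_def pt C(5))
  have img: "snd c' ` fst c' = C"
    unfolding fst_c' image_image using snd_pt by simp
  have inj: "inj_on (snd c') (fst c')"
    unfolding fst_c' by (rule inj_onI) (use snd_pt in fastforce)
  have inv: "chart_inv c' w = pt w" if "w \<in> C" for w
    unfolding chart_inv_def by (rule inv_into_f_eq[OF inj]) (use that in \<open>auto simp: fst_c' snd_pt\<close>)
  have chart: "is_chart (mcarrier M) dm c'"
    unfolding is_chart_def
  proof (intro conjI inj)
    show "fst c' \<subseteq> mcarrier M"
      using pt(1) atlas_chart(1)[OF cA] unfolding fst_c' by (auto simp: subset_iff)
    show "snd c' \<in> extensional (fst c')" by (simp add: c'_def)
    show "openin (E dm) (snd c' ` fst c')" using C_open by (simp only: img)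
  qed
  have compat1: "smooth_transition dm c' d" if d: "d \<in> atlas M" for d
  proof -
    have pts: "c \<in> charts_at M (pt w)" "d \<in> charts_at M (pt w)" "w \<in> C"
      if "w \<in> snd c' ` (fst c' \<inter> fst d)" for w
    proof -
      from that obtain w' where "w' \<in> C" "pt w' \<in> fst d" "w = snd c' (pt w')" by (auto simp: fst_c')
      then show "c \<in> charts_at M (pt w)" "d \<in> charts_at M (pt w)" "w \<in> C"
        using cA d pt(1) by (auto simp: charts_at_def snd_pt)
    qed
    have op: "openin (E dm) (snd c' ` (fst c' \<inter> fst d))"
      unfolding openin_iff_nb
    proof (intro conjI ballI)
      show "snd c' ` (fst c' \<inter> fst d) \<subseteq> Rn dm" using pts(3) openin_Rn[OF C_open] by blast
      fix w assume w: "w \<in> snd c' ` (fst c' \<inter> fst d)"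
      note p = pts[OF w]
      have "eventually (\<lambda>w. chart_inv c (\<Psi> w) \<in> fst d) (nb dm w)"
        by (rule eventually_smooth_map_at[OF C(6)[OF p(3)]])
           (use eventually_overlap[OF p(1,2)] in \<open>simp add: pt(2)[OF p(3)] eventually_conj_iff\<close>)
      with openin_eventually_nb[OF C_open p(3)]
      show "eventually (\<lambda>w. w \<in> snd c' ` (fst c' \<inter> fst d)) (nb dm w)"
      proof eventually_elim
        case (elim w)
        then have "pt w \<in> fst c' \<inter> fst d" "snd c' (pt w) = w"
          using snd_pt[OF elim(1)] by (auto simp: fst_c' pt_def)
        then show ?case by (metis imageI)
      qed
    qed
    have "smooth_map_at dm dm (transition c' d) w" if w: "w \<in> snd c' ` (fst c' \<inter> fst d)" for w
    proof (rule smooth_map_at_cong)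
      note p = pts[OF w]
      show "smooth_map_at dm dm (\<lambda>w. transition c d (\<Psi> w)) w"
        by (rule smooth_map_at_compose[OF C(6)[OF p(3)]])
           (use transition_smooth[OF p(1,2)] in \<open>simp add: pt(2)[OF p(3)]\<close>)
      show "eventually (\<lambda>w. transition c d (\<Psi> w) = transition c' d w) (nb dm w)"
        using openin_eventually_nb[OF C_open p(3)]
        by eventually_elim (simp add: transition_def inv pt_def)
    qed
    moreover have "transition c' d ` (snd c' ` (fst c' \<inter> fst d)) \<subseteq> Rn dm"
    proof (rule image_subsetI)
      fix w assume "w \<in> snd c' ` (fst c' \<inter> fst d)"
      from pts[OF this] show "transition c' d w \<in> Rn dm"
        using charts_at_coord_Rn by (simp add: transition_def inv)
    qed
    ultimately show ?thesis unfolding smooth_transition_def smooth_vec_on_iff[OF op] using op by blast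
  qed
  have compat2: "smooth_transition dm d c'" if d: "d \<in> atlas M" for d
  proof -
    have pts: "\<exists>x w. v = snd d x \<and> c \<in> charts_at M x \<and> d \<in> charts_at M x \<and> w \<in> C \<and> x = pt w"
      if v: "v \<in> snd d ` (fst d \<inter> fst c')" for v
    proof -
      obtain w where "w \<in> C" "pt w \<in> fst d" "v = snd d (pt w)" using v by (auto simp: fst_c')
      then show ?thesis using cA d pt(1)[of w]
        by (intro exI[of _ "pt w"] exI[of _ w]) (simp add: charts_at_def)
    qed
    have ev: "eventually (\<lambda>v. v \<in> snd d ` (fst d \<inter> fst c') \<and> transition d c' v = \<Theta> (transition d c v)) (nb dm (snd d x))"
      if x: "c \<in> charts_at M x" "d \<in> charts_at M x" "w \<in> C" "x = pt w" for x w
    proof -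
      have cx: "snd c x = \<Psi> w" using x pt by simp
      have "eventually (\<lambda>y. \<Theta> y \<in> C) (nb dm (\<Psi> w))"
        by (rule eventually_smooth_map_at[OF C(3)[OF x(3)]])
           (use openin_eventually_nb[OF C_open x(3)] in \<open>simp add: C(5)[OF x(3)]\<close>)
      with C(4)[OF x(3)] have "eventually (\<lambda>y. \<Theta> y \<in> C \<and> \<Psi> (\<Theta> y) = y) (nb dm (snd c x))"
        unfolding cx by eventually_elim simp
      from transition_eventually[OF x(1,2) this] eventually_overlap[OF x(2,1)]
      show ?thesis
      proof eventually_elim
        case (elim v)
        have "chart_inv d v = pt (\<Theta> (snd c (chart_inv d v)))"
          using elim chart_inv_left[OF cA] by (simp add: pt_def)
        then have 1: "chart_inv d v \<in> fst c'" using elim unfolding fst_c' by blast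
        have 2: "chart_inv d v \<in> fst d" "snd d (chart_inv d v) = v" using chart_inv_right[of v d] elim by auto
        have "v \<in> snd d ` (fst d \<inter> fst c')" by (rule image_eqI[of _ _ "chart_inv d v"]) (use 1 2 in auto)
        then show ?case by (simp add: transition_def snd_c'[OF 1])
      qed
    qed
    have op: "openin (E dm) (snd d ` (fst d \<inter> fst c'))"
      unfolding openin_iff_nb
    proof (intro conjI ballI)
      show "snd d ` (fst d \<inter> fst c') \<subseteq> Rn dm" using coord_Rn[OF d] by (simp add: image_subset_iff)
      fix v assume "v \<in> snd d ` (fst d \<inter> fst c')"
      from pts[OF this] obtain x w where x: "v = snd d x" "c \<in> charts_at M x" "d \<in> charts_at M x" "w \<in> C" "x = pt w"
        by blast
      show "eventually (\<lambda>v. v \<in> snd d ` (fst d \<inter> fst c')) (nb dm v)"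
        using ev[OF x(2-5)] unfolding x(1) by eventually_elim simp
    qed
    have "smooth_map_at dm dm (transition d c') v \<and> transition d c' v \<in> Rn dm"
      if "v \<in> snd d ` (fst d \<inter> fst c')" for v
    proof -
      from pts[OF that] obtain x w where x: "v = snd d x" "c \<in> charts_at M x" "d \<in> charts_at M x" "w \<in> C" "x = pt w"
        by blast
      have tv: "transition d c v = \<Psi> w" unfolding x(1) transition_at[OF x(3)] using x pt by simp
      have "smooth_map_at dm dm (\<lambda>v. \<Theta> (transition d c v)) v"
      proof (rule smooth_map_at_compose[where F = "transition d c" and G = \<Theta>])
        show "smooth_map_at dm dm (transition d c) v" unfolding x(1) by (rule transition_smooth[OF x(3,2)])
        show "smooth_map_at dm dm \<Theta> (transition d c v)" unfolding tv by (rule C(3)[OF x(4)])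
      qed
      then have *: "smooth_map_at dm dm (transition d c') v"
        by (rule smooth_map_at_cong) (use ev[OF x(2-5)] in \<open>unfold x(1), eventually_elim, simp\<close>)
      then show ?thesis using smooth_map_at_Rn[OF *] by simp
    qed
    then show ?thesis unfolding smooth_transition_def smooth_vec_on_iff[OF op] using op by blast
  qed
  have "\<forall>d\<in>atlas M. compatible dm c' d" using compat1 compat2 by (simp add: compatible_def)
  moreover have "\<forall>c. is_chart (mcarrier M) dm c \<and> (\<forall>d\<in>atlas M. compatible dm c d) \<longrightarrow> c \<in> atlas M"
    using atlas_maximal unfolding maximal_atlas_def by (elim conjE)
  ultimately have "c' \<in> atlas M" using chart by blast
  moreover have "z \<in> C" using z e by (simp add: C_def cube_def)
  moreover have "pt z = x" by (simp add: pt_def \<Psi>z y_def chart_inv_left[OF cA charts_atD(2)[OF c]])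
  ultimately have "c' \<in> charts_at M x" by (auto simp: charts_at_def fst_c')
  moreover have "fst c' \<subseteq> fst c" using pt(1) by (auto simp: fst_c')
  moreover have "snd c' ` fst c' = cube dm (\<Theta> (snd c x)) e" by (simp add: img C_def z_def y_def)
  moreover have "snd c' x' = \<Theta> (snd c x') \<and> P (snd c x')" if "x' \<in> fst c'" for x'
    using that snd_c' C(2) pt(2) by (auto simp: fst_c')
  ultimately show ?thesis using that e by blast
qed

end

section \<open>Forms in charts and pullbacks\<close>

text \<open>\<open>diff_forms\<close> asks for smooth coefficients on the coordinate basis;
  expanding one argument after the other extends this to all constant arguments.\<close>

lemma smooth_on_basis_imp_smooth:
  assumes "y \<in> Rn n" "eventually (\<lambda>z. multilinear n k (\<lambda>vs. A vs z)) (nb n y)"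
    and "\<And>js. length js = k \<Longrightarrow> set js \<subseteq> {..<n} \<Longrightarrow> smooth_at n (A (map unit_vec js)) y"
    and "length ws = k" "set ws \<subseteq> Rn n"
  shows "smooth_at n (A ws) y"
  using assms(2-5)
proof (induction ws arbitrary: k A)
  case Nil
  then show ?case using Nil(2)[of "[]"] by simp
next
  case (Cons w ws)
  then obtain k' where k: "k = Suc k'" "length ws = k'" by auto
  have w: "w \<in> Rn n" "set ws \<subseteq> Rn n" using Cons.prems by auto
  have ej: "smooth_at n (A (unit_vec j # ws)) y" if j: "j < n" for j
  proof (rule Cons.IH[of k' "\<lambda>vs. A (unit_vec j # vs)"])
    show "eventually (\<lambda>z. multilinear n k' (\<lambda>vs. A (unit_vec j # vs) z)) (nb n y)"
      using Cons.prems(1) unfolding k(1) by eventually_elim (rule multilinear_Cons[OF _ unit_vec_Rn[OF j]])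
    show "smooth_at n (A (unit_vec j # map unit_vec js)) y" if "length js = k'" "set js \<subseteq> {..<n}" for js
      using Cons.prems(2)[of "j # js"] that j k by simp
  qed (use k w in auto)
  have "smooth_at n (\<lambda>z. \<Sum>j<n. w j * A (unit_vec j # ws) z) y"
    using ej by (intro smooth_at_sum smooth_at_mult smooth_at_const assms(1)) auto
  moreover have "eventually (\<lambda>z. (\<Sum>j<n. w j * A (unit_vec j # ws) z) = A (w # ws) z) (nb n y)"
    using Cons.prems(1) unfolding k(1)
    by eventually_elim (rule multilinear_head_expand[OF _ k(2) w(2) w(1), symmetric])
  ultimately show ?case by (rule smooth_at_cong)
qed

text \<open>The guard keeps the convention that forms vanish on all other inputs, so that identities
  between pullbacks are equations of functions.\<close>

definition pullback :: "'a manifold \<Rightarrow> 'b manifold \<Rightarrow> ('a \<Rightarrow> 'b) \<Rightarrow> 'b form \<Rightarrow> 'a form" where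
  "pullback M N p \<alpha> x vs = (if x \<in> mcarrier M \<and> set vs \<subseteq> tangent_space M x
     then \<alpha> (p x) (map (tangent_map M N p x) vs) else 0)"

lemma diff_forms_outside:
  assumes "\<alpha> \<in> diff_forms M k" "\<not> (x \<in> mcarrier M \<and> length vs = k \<and> set vs \<subseteq> tangent_space M x)"
  shows "\<alpha> x vs = 0"
proof -
  note * = assms(1)[unfolded diff_forms_def mem_Collect_eq, THEN conjunct1]
  show ?thesis using *[THEN spec, THEN spec, THEN mp, OF assms(2)] .
qed

lemma diff_forms_pointwise:
  assumes "\<alpha> \<in> diff_forms M k" "x \<in> mcarrier M" "length vs = k \<and> set vs \<subseteq> tangent_space M x"
  shows "(\<forall>i<k. \<forall>u\<in>tangent_space M x. \<forall>w\<in>tangent_space M x. \<forall>a b.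
        \<alpha> x (vs[i := tv_lincomb a u b w]) = a * \<alpha> x (vs[i := u]) + b * \<alpha> x (vs[i := w])) \<and>
     (\<forall>i<k. \<forall>j<k. i \<noteq> j \<and> vs ! i = vs ! j \<longrightarrow> \<alpha> x vs = 0)"
proof -
  note * = assms(1)[unfolded diff_forms_def mem_Collect_eq, THEN conjunct2, THEN conjunct1]
  show ?thesis using *[THEN bspec, OF assms(2), THEN spec, THEN mp, OF assms(3)] .
qed

lemma diff_forms_lincomb:
  assumes "\<alpha> \<in> diff_forms M k" "x \<in> mcarrier M" "length vs = k" "set vs \<subseteq> tangent_space M x" "i < k"
    "u \<in> tangent_space M x" "w \<in> tangent_space M x"
  shows "\<alpha> x (vs[i := tv_lincomb a u b w]) = a * \<alpha> x (vs[i := u]) + b * \<alpha> x (vs[i := w])"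
  using diff_forms_pointwise[OF assms(1,2) conjI[OF assms(3,4)]] assms(5-7) by simp

lemma diff_forms_alternating:
  assumes "\<alpha> \<in> diff_forms M k" "x \<in> mcarrier M" "length vs = k" "set vs \<subseteq> tangent_space M x"
    "i < k" "j < k" "i \<noteq> j" "vs ! i = vs ! j"
  shows "\<alpha> x vs = 0"
  using diff_forms_pointwise[OF assms(1,2) conjI[OF assms(3,4)]] assms(5-8) by blast

lemma diff_forms_smooth:
  assumes "\<alpha> \<in> diff_forms M k" "c \<in> atlas M" "length js = k" "set js \<subseteq> {..<mdim M}"
  shows "smooth_fun_on (mdim M) (snd c ` fst c) (local_form M \<alpha> c (map unit_vec js))"
proof -
  note * = assms(1)[unfolded diff_forms_def mem_Collect_eq, THEN conjunct2, THEN conjunct2]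
  show ?thesis
    using *[THEN bspec, OF assms(2), THEN spec, THEN mp, OF conjI[OF assms(3,4)]]
    by (simp add: local_form_def[abs_def] comp_def)
qed

context mfd
begin

lemma local_form_germ:
  assumes \<alpha>: "\<alpha> \<in> diff_forms M k" and c: "c \<in> charts_at M x"
  shows "form_germ dm k (local_form M \<alpha> c) (snd c x)"
proof -
  have y: "snd c x \<in> Rn dm" by (rule charts_at_coord_Rn[OF c])
  have ev: "eventually (\<lambda>z. multilinear dm k (\<lambda>vs. local_form M \<alpha> c vs z) \<and>
      alternating dm k (\<lambda>vs. local_form M \<alpha> c vs z)) (nb dm (snd c x))"
    using eventually_charts_at[OF c c]
  proof eventually_elim
    case (elim z)
    define x' where "x' = chart_inv c z"
    have x': "c \<in> charts_at M x'" "x' \<in> mcarrier M" using elim charts_at_carrier[of c "chart_inv c z"] by (simp_all add: x'_def)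
    have T: "set (map (coord_vec M c x') vs) \<subseteq> tangent_space M x'" for vs
      using coord_vec_tangent[OF x'(1)] by auto
    show ?case
      unfolding multilinear_def alternating_def local_form_def x'_def[symmetric]
    proof (intro conjI allI impI ballI; elim conjE)
      fix vs :: "(nat \<Rightarrow> real) list" and i u w a b assume "length vs = k" "i < k"
      then show "\<alpha> x' (map (coord_vec M c x') (vs[i := \<lambda>j. a * u j + b * w j])) =
          a * \<alpha> x' (map (coord_vec M c x') (vs[i := u])) + b * \<alpha> x' (map (coord_vec M c x') (vs[i := w]))"
        using diff_forms_lincomb[OF \<alpha> x'(2) _ T, of vs i "coord_vec M c x' u" "coord_vec M c x' w" a b]
          coord_vec_tangent[OF x'(1)] by (simp add: map_update coord_vec_lincomb)
    next
      fix vs :: "(nat \<Rightarrow> real) list" and i j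
      assume "length vs = k" "i < k" "j < k" "i \<noteq> j" "vs ! i = vs ! j"
      then show "\<alpha> x' (map (coord_vec M c x') vs) = 0"
        by (intro diff_forms_alternating[OF \<alpha> x'(2) _ T, of _ i j]) auto
    qed
  qed
  have basis: "smooth_at dm (local_form M \<alpha> c (map unit_vec js)) (snd c x)"
    if "length js = k" "set js \<subseteq> {..<dm}" for js
    using diff_forms_smooth[OF \<alpha> charts_atD(1)[OF c] that] charts_atD[OF c]
    unfolding smooth_fun_on_iff[OF atlas_chart(3)[OF charts_atD(1)[OF c]]] by simp
  have ev': "eventually (\<lambda>z. multilinear dm k (\<lambda>vs. local_form M \<alpha> c vs z)) (nb dm (snd c x))"
    using ev by eventually_elim simp
  show ?thesis
    unfolding form_germ_def using y ev smooth_on_basis_imp_smooth[OF y ev' basis] by blast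
qed

lemma local_form_apply:
  assumes c: "c \<in> charts_at M x" and vs: "set vs \<subseteq> tangent_space M x"
  shows "local_form M \<alpha> c (map (\<lambda>v. v c) vs) (snd c x) = \<alpha> x vs"
proof -
  have "map (\<lambda>v. coord_vec M c x (v c)) vs = vs"
    using vs coord_vec_tangent_eq[OF _ c] by (intro map_idI) auto
  then show ?thesis
    by (simp add: local_form_def chart_inv_left[OF charts_atD[OF c]] comp_def)
qed

lemma map_coords_Rn:
  "c \<in> charts_at M x \<Longrightarrow> set vs \<subseteq> tangent_space M x \<Longrightarrow> set (map (\<lambda>v. v c) vs) \<subseteq> Rn dm"
  using tangent_Rn[of _ x c] unfolding set_map by (intro image_subsetI) (simp add: subset_iff)

lemma local_form_wrong_length:
  "\<alpha> \<in> diff_forms M k \<Longrightarrow> length ws \<noteq> k \<Longrightarrow> local_form M \<alpha> c ws y = 0"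
  unfolding local_form_def by (rule diff_forms_outside) auto

lemma ext_deriv_eq_ext_d:
  assumes "x \<in> mcarrier M" "set vs \<subseteq> tangent_space M x"
  shows "ext_deriv M \<alpha> x vs =
    ext_d dm (local_form M \<alpha> (chart_at M x)) (map (\<lambda>v. v (chart_at M x)) vs) (snd (chart_at M x) x)"
  using assms by (simp add: ext_deriv_def ext_d_def Let_def del_def)

lemma ext_deriv_outside:
  "\<not> (x \<in> mcarrier M \<and> set vs \<subseteq> tangent_space M x) \<Longrightarrow> ext_deriv M \<alpha> x vs = 0"
  by (auto simp: ext_deriv_def)

lemma ext_deriv_wrong_length:
  assumes \<alpha>: "\<alpha> \<in> diff_forms M k" and vs: "length vs \<noteq> Suc k"
  shows "ext_deriv M \<alpha> x vs = 0"
proof (cases "x \<in> mcarrier M \<and> set vs \<subseteq> tangent_space M x")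
  case True
  let ?ws = "map (\<lambda>v. v (chart_at M x)) vs"
  have "local_form M \<alpha> (chart_at M x) (del i ?ws) = (\<lambda>y. 0)" if "i < length ?ws" for i
    using that vs by (intro ext local_form_wrong_length[OF \<alpha>]) (auto simp: length_del)
  then show ?thesis using True by (simp add: ext_deriv_eq_ext_d ext_d_def dir_deriv_const)
qed (rule ext_deriv_outside)

end

section \<open>Tangent maps and pullback along a smooth map\<close>

locale mfd_map = M: mfd M + N: mfd N for M :: "'a manifold" and N :: "'b manifold" +
  fixes p :: "'a \<Rightarrow> 'b"
  assumes smooth_p: "smooth_map M N p"
begin

abbreviation "rep c d \<equiv> \<lambda>y. snd d (p (chart_inv c y))"

lemma p_carrier: "x \<in> mcarrier M \<Longrightarrow> p x \<in> mcarrier N"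
  using smooth_p by (auto simp: smooth_map_def)

text \<open>\<open>smooth_map\<close> supplies one good pair of charts at each point; transition
  maps on both sides carry smoothness to any pair.\<close>

lemma rep_germ:
  assumes c: "c \<in> charts_at M x" and d: "d \<in> charts_at N (p x)"
  shows "smooth_map_at M.dm N.dm (rep c d) (snd c x) \<and>
    eventually (\<lambda>y. p (chart_inv c y) \<in> fst d) (nb M.dm (snd c x))"
proof -
  have "x \<in> mcarrier M" by (rule M.charts_at_carrier[OF c])
  then have "\<exists>c\<in>charts_at M x. \<exists>d\<in>charts_at N (p x). p ` fst c \<subseteq> fst d \<and>
      smooth_vec_on M.dm N.dm (snd c ` fst c) (snd d \<circ> p \<circ> chart_inv c)"
    using smooth_p unfolding smooth_map_def by blast
  then obtain c0 d0 where c0: "c0 \<in> charts_at M x" and d0: "d0 \<in> charts_at N (p x)"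
    and sub: "p ` fst c0 \<subseteq> fst d0"
    and sm: "smooth_vec_on M.dm N.dm (snd c0 ` fst c0) (snd d0 \<circ> p \<circ> chart_inv c0)" by blast
  have r0: "smooth_map_at M.dm N.dm (rep c0 d0) (snd c0 x)"
    by (rule smooth_map_atI[OF M.atlas_chart(3)[OF charts_atD(1)[OF c0]]])
       (use charts_atD(2)[OF c0] sm in \<open>simp_all add: comp_def\<close>)
  have cx: "chart_inv c0 (snd c0 x) = x" by (rule M.chart_inv_left[OF charts_atD[OF c0]])
  have "eventually (\<lambda>y. chart_inv d0 (rep c0 d0 y) \<in> fst d) (nb M.dm (snd c0 x))"
    by (rule eventually_smooth_map_at[OF r0])
       (use N.eventually_overlap[OF d0 d] in \<open>simp add: cx eventually_conj_iff\<close>)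
  moreover have "eventually (\<lambda>y. p (chart_inv c0 y) \<in> fst d0) (nb M.dm (snd c0 x))"
    using M.eventually_chart[OF c0]
  proof eventually_elim
    case (elim y)
    show ?case by (rule subsetD[OF sub], rule imageI, rule M.chart_inv_right(1)[OF elim])
  qed
  ultimately have ev0: "eventually (\<lambda>y. p (chart_inv c0 y) \<in> fst d0 \<and> p (chart_inv c0 y) \<in> fst d) (nb M.dm (snd c0 x))"
    by eventually_elim (simp add: N.chart_inv_left[OF charts_atD(1)[OF d0]])
  have ev: "eventually (\<lambda>y. p (chart_inv c y) \<in> fst d0 \<and> p (chart_inv c y) \<in> fst d \<and>
      chart_inv c0 (transition c c0 y) = chart_inv c y) (nb M.dm (snd c x))"
    using M.transition_eventually[OF c0 c ev0] M.eventually_overlap[OF c c0]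
    by eventually_elim (simp add: M.chart_inv_left[OF charts_atD(1)[OF c0]] transition_def)
  have "smooth_map_at M.dm N.dm (\<lambda>y. rep c0 d0 (transition c c0 y)) (snd c x)"
    by (rule smooth_map_at_compose[OF M.transition_smooth[OF c c0], of _ "rep c0 d0"])
       (simp add: M.transition_at[OF c] r0)
  then have "smooth_map_at M.dm N.dm (\<lambda>y. transition d0 d (rep c0 d0 (transition c c0 y))) (snd c x)"
    by (rule smooth_map_at_compose[of _ _ "\<lambda>y. rep c0 d0 (transition c c0 y)" _ _ "transition d0 d"])
       (use N.transition_smooth[OF d0 d] in \<open>simp add: M.transition_at[OF c] cx\<close>)
  then have "smooth_map_at M.dm N.dm (rep c d) (snd c x)"
  proof (rule smooth_map_at_cong)
    show "eventually (\<lambda>y. transition d0 d (rep c0 d0 (transition c c0 y)) = rep c d y) (nb M.dm (snd c x))"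
      using ev by eventually_elim (simp add: transition_def[of d0 d] N.chart_inv_left[OF charts_atD(1)[OF d0]])
  qed
  moreover have "eventually (\<lambda>y. p (chart_inv c y) \<in> fst d) (nb M.dm (snd c x))"
    using ev by eventually_elim simp
  ultimately show ?thesis by blast
qed

lemmas rep_smooth = rep_germ[THEN conjunct1]
lemmas eventually_rep = rep_germ[THEN conjunct2]

lemma eventually_rep_charts:
  assumes c: "c \<in> charts_at M x" and d: "d \<in> charts_at N (p x)"
  shows "eventually (\<lambda>y. c \<in> charts_at M (chart_inv c y) \<and> d \<in> charts_at N (p (chart_inv c y)) \<and>
    snd c (chart_inv c y) = y) (nb M.dm (snd c x))"
  using M.eventually_charts_at[OF c c] eventually_rep[OF c d]
  by eventually_elim (use charts_atD(1)[OF d] in \<open>simp add: charts_at_def\<close>)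

text \<open>\<open>tangent_map\<close> is computed in a chosen chart of the source; the chain rule
  with the transition map removes the dependence on that choice.\<close>

lemma tangent_map_apply:
  assumes v: "v \<in> tangent_space M x" and c: "c \<in> charts_at M x" and d: "d \<in> charts_at N (p x)"
  shows "tangent_map M N p x v d = jacobian_map M.dm N.dm (rep c d) (snd c x) (v c)"
proof -
  define c1 where "c1 = chart_at M x"
  have c1: "c1 \<in> charts_at M x" unfolding c1_def by (rule M.chart_at_in[OF M.charts_at_carrier[OF c]])
  have "tangent_map M N p x v d = jacobian_map M.dm N.dm (rep c1 d) (snd c1 x) (v c1)"
    using d by (simp add: tangent_map_def Let_def c1_def comp_def)
  also have "v c1 = jacobian_map M.dm M.dm (transition c c1) (snd c x) (v c)"
    by (rule M.tangent_transform[OF v c c1])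
  also have "jacobian_map M.dm N.dm (rep c1 d) (snd c1 x) (jacobian_map M.dm M.dm (transition c c1) (snd c x) (v c))
      = jacobian_map M.dm N.dm (\<lambda>y. rep c1 d (transition c c1 y)) (snd c x) (v c)"
    using jacobian_map_compose[OF M.transition_smooth[OF c c1], of N.dm "rep c1 d" "v c"] rep_smooth[OF c1 d]
    by (simp add: M.transition_at[OF c])
  also have "\<dots> = jacobian_map M.dm N.dm (rep c d) (snd c x) (v c)"
  proof (rule jacobian_map_cong[OF _ M.charts_at_coord_Rn[OF c]])
    show "eventually (\<lambda>y. rep c1 d (transition c c1 y) = rep c d y) (nb M.dm (snd c x))"
      using M.eventually_overlap[OF c c1]
      by eventually_elim (simp add: transition_def M.chart_inv_left[OF charts_atD(1)[OF c1]])
  qed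
  finally show ?thesis .
qed

lemma tangent_map_eq:
  assumes v: "v \<in> tangent_space M x" and c: "c \<in> charts_at M x" and d: "d \<in> charts_at N (p x)"
  shows "tangent_map M N p x v = coord_vec N d (p x) (jacobian_map M.dm N.dm (rep c d) (snd c x) (v c))"
proof
  fix d'
  have cx: "chart_inv c (snd c x) = x" by (rule M.chart_inv_left[OF charts_atD[OF c]])
  show "tangent_map M N p x v d' = coord_vec N d (p x) (jacobian_map M.dm N.dm (rep c d) (snd c x) (v c)) d'"
  proof (cases "d' \<in> charts_at N (p x)")
    case True
    have "jacobian_map N.dm N.dm (transition d d') (snd d (p x)) (jacobian_map M.dm N.dm (rep c d) (snd c x) (v c))
        = jacobian_map M.dm N.dm (\<lambda>y. transition d d' (rep c d y)) (snd c x) (v c)"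
      using jacobian_map_compose[OF rep_smooth[OF c d], of N.dm "transition d d'" "v c"]
        N.transition_smooth[OF d True] by (simp add: cx)
    also have "\<dots> = jacobian_map M.dm N.dm (rep c d') (snd c x) (v c)"
    proof (rule jacobian_map_cong[OF _ M.charts_at_coord_Rn[OF c]])
      show "eventually (\<lambda>y. transition d d' (rep c d y) = rep c d' y) (nb M.dm (snd c x))"
        using eventually_rep[OF c d]
        by eventually_elim (simp add: transition_def N.chart_inv_left[OF charts_atD(1)[OF d]])
    qed
    finally show ?thesis using tangent_map_apply[OF v c True] N.coord_vec_apply[OF True] by simp
  next
    case False
    then show ?thesis by (simp add: tangent_map_def Let_def coord_vec_def)
  qed
qed

lemma tangent_map_tangent:
  assumes v: "v \<in> tangent_space M x" and x: "x \<in> mcarrier M"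
  shows "tangent_map M N p x v \<in> tangent_space N (p x)"
  using N.coord_vec_tangent[OF N.chart_at_in[OF p_carrier[OF x]]]
  by (simp add: tangent_map_eq[OF v M.chart_at_in[OF x] N.chart_at_in[OF p_carrier[OF x]]])

lemma tangent_map_coord_vec:
  assumes c: "c \<in> charts_at M x" and d: "d \<in> charts_at N (p x)" and w: "w \<in> Rn M.dm"
  shows "tangent_map M N p x (coord_vec M c x w) =
    coord_vec N d (p x) (jacobian_map M.dm N.dm (rep c d) (snd c x) w)"
  using tangent_map_eq[OF M.coord_vec_tangent[OF c] c d] by (simp add: M.coord_vec_same[OF c w])

lemma tangent_map_lincomb:
  "tangent_map M N p x (tv_lincomb a u b w) = tv_lincomb a (tangent_map M N p x u) b (tangent_map M N p x w)"
  by (auto simp: tangent_map_def Let_def tv_lincomb_def jacobian_map_lincomb fun_eq_iff)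

text \<open>Near x the coordinate expression of the pullback is the pullback of the coordinate
  expression. All argument lists share one neighbourhood, as \<open>ext_d_cong\<close>
  demands.\<close>

lemma local_form_pullback:
  assumes c: "c \<in> charts_at M x" and d: "d \<in> charts_at N (p x)"
  shows "eventually (\<lambda>y. \<forall>ws. set ws \<subseteq> Rn M.dm \<longrightarrow>
    local_form N \<alpha> d (map (jacobian_map M.dm N.dm (rep c d) y) ws) (rep c d y) =
    local_form M (pullback M N p \<alpha>) c ws y) (nb M.dm (snd c x))"
  using eventually_rep_charts[OF c d]
proof eventually_elim
  case (elim y)
  define x' where "x' = chart_inv c y"
  have x': "c \<in> charts_at M x'" "d \<in> charts_at N (p x')" "snd c x' = y" using elim by (auto simp: x'_def)
  have T: "set (map (coord_vec M c x') ws) \<subseteq> tangent_space M x'" for ws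
    using M.coord_vec_tangent[OF x'(1)] by auto
  show ?case
  proof (intro allI impI)
    fix ws assume ws: "set ws \<subseteq> Rn M.dm"
    have "map (tangent_map M N p x') (map (coord_vec M c x') ws) =
        map (\<lambda>w. coord_vec N d (p x') (jacobian_map M.dm N.dm (rep c d) y w)) ws"
      unfolding map_map comp_def
    proof (rule map_cong[OF refl])
      fix w assume "w \<in> set ws"
      with ws have "w \<in> Rn M.dm" by blast
      then show "tangent_map M N p x' (coord_vec M c x' w) = coord_vec N d (p x') (jacobian_map M.dm N.dm (rep c d) y w)"
        using tangent_map_coord_vec[OF x'(1,2)] by (simp add: x'(3))
    qed
    moreover have "chart_inv d (rep c d y) = p x'"
      unfolding x'_def[symmetric] by (rule N.chart_inv_left[OF charts_atD[OF x'(2)]])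
    ultimately show "local_form N \<alpha> d (map (jacobian_map M.dm N.dm (rep c d) y) ws) (rep c d y) =
        local_form M (pullback M N p \<alpha>) c ws y"
      unfolding local_form_def pullback_def x'_def[symmetric]
      using T[of ws] M.charts_at_carrier[OF x'(1)] by (simp add: comp_def del: map_eq_conv)
  qed
qed

text \<open>Naturality in arbitrary charts, not only in those selected by \<open>chart_at\<close>.
  For the identity map it becomes the statement that \<open>ext_deriv\<close> does not depend on the
  chart.\<close>

lemma ext_d_local_pullback:
  assumes \<alpha>: "\<alpha> \<in> diff_forms N k" and c: "c \<in> charts_at M x" and d: "d \<in> charts_at N (p x)"
    and vs: "length vs = Suc k" "set vs \<subseteq> tangent_space M x"
  shows "ext_d M.dm (local_form M (pullback M N p \<alpha>) c) (map (\<lambda>v. v c) vs) (snd c x) =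
    ext_d N.dm (local_form N \<alpha> d) (map (\<lambda>v. tangent_map M N p x v d) vs) (snd d (p x))"
proof -
  have cx: "chart_inv c (snd c x) = x" by (rule M.chart_inv_left[OF charts_atD[OF c]])
  have ws: "set (map (\<lambda>v. v c) vs) \<subseteq> Rn M.dm" by (rule M.map_coords_Rn[OF c vs(2)])
  have germ: "form_germ N.dm k (local_form N \<alpha> d) (rep c d (snd c x))"
    using N.local_form_germ[OF \<alpha> d] by (simp add: cx)
  have "ext_d M.dm (local_form M (pullback M N p \<alpha>) c) (map (\<lambda>v. v c) vs) (snd c x) =
      ext_d M.dm (\<lambda>ws y. local_form N \<alpha> d (map (jacobian_map M.dm N.dm (rep c d) y) ws) (rep c d y))
        (map (\<lambda>v. v c) vs) (snd c x)"
    by (rule ext_d_cong[OF M.charts_at_coord_Rn[OF c] _ ws])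
       (use local_form_pullback[OF c d, of \<alpha>] in eventually_elim, simp)
  also have "\<dots> = ext_d N.dm (local_form N \<alpha> d)
      (map (jacobian_map M.dm N.dm (rep c d) (snd c x)) (map (\<lambda>v. v c) vs)) (rep c d (snd c x))"
    by (rule ext_d_pullback[OF germ rep_smooth[OF c d] _ ws]) (simp add: vs(1))
  also have "map (jacobian_map M.dm N.dm (rep c d) (snd c x)) (map (\<lambda>v. v c) vs)
      = map (\<lambda>v. tangent_map M N p x v d) vs"
    unfolding map_map comp_def
    by (rule map_cong[OF refl], rule tangent_map_apply[OF _ c d, symmetric]) (use vs(2) in blast)
  finally show ?thesis by (simp add: cx)
qed

lemma pullback_ext_deriv:
  assumes \<alpha>: "\<alpha> \<in> diff_forms N k" and p\<alpha>: "pullback M N p \<alpha> \<in> diff_forms M k"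
  shows "pullback M N p (ext_deriv N \<alpha>) = ext_deriv M (pullback M N p \<alpha>)"
proof (intro ext)
  fix x vs
  show "pullback M N p (ext_deriv N \<alpha>) x vs = ext_deriv M (pullback M N p \<alpha>) x vs"
  proof (cases "x \<in> mcarrier M \<and> set vs \<subseteq> tangent_space M x")
    case False
    then show ?thesis using M.ext_deriv_outside[OF False] unfolding pullback_def by auto
  next
    case True
    then have x: "x \<in> mcarrier M" and vs: "set vs \<subseteq> tangent_space M x" by auto
    show ?thesis
    proof (cases "length vs = Suc k")
      case False
      then show ?thesis
        using M.ext_deriv_wrong_length[OF p\<alpha> False] N.ext_deriv_wrong_length[OF \<alpha>] by (simp add: pullback_def)
    next
      case len: True
      have T: "set (map (tangent_map M N p x) vs) \<subseteq> tangent_space N (p x)"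
        using tangent_map_tangent[OF _ x] vs by (auto simp: subset_iff)
      show ?thesis
        unfolding M.ext_deriv_eq_ext_d[OF x vs]
          ext_d_local_pullback[OF \<alpha> M.chart_at_in[OF x] N.chart_at_in[OF p_carrier[OF x]] len vs]
        using N.ext_deriv_eq_ext_d[OF p_carrier[OF x] T] x vs by (simp add: pullback_def comp_def)
    qed
  qed
qed

lemma pullback_diff_form:
  assumes \<alpha>: "\<alpha> \<in> diff_forms N k"
  shows "pullback M N p \<alpha> \<in> diff_forms M k"
  unfolding diff_forms_def mem_Collect_eq
proof (intro conjI allI impI ballI)
  fix x vs assume "\<not> (x \<in> mcarrier M \<and> length vs = k \<and> set vs \<subseteq> tangent_space M x)"
  then show "pullback M N p \<alpha> x vs = 0"
    using diff_forms_outside[OF \<alpha>, of "p x" "map (tangent_map M N p x) vs"] by (auto simp: pullback_def)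
next
  fix x vs i u w a b
  assume x: "x \<in> mcarrier M" and vs: "length vs = k \<and> set vs \<subseteq> tangent_space M x" and i: "i < k"
    and uw: "u \<in> tangent_space M x" "w \<in> tangent_space M x"
  have T: "set (map (tangent_map M N p x) vs) \<subseteq> tangent_space N (p x)"
    using tangent_map_tangent[OF _ x] vs by (auto simp: subset_iff)
  have upd: "set (vs[i := z]) \<subseteq> tangent_space M x" if "z \<in> tangent_space M x" for z
    using that vs by (meson insert_subset order_trans set_update_subset_insert)
  show "pullback M N p \<alpha> x (vs[i := tv_lincomb a u b w]) =
      a * pullback M N p \<alpha> x (vs[i := u]) + b * pullback M N p \<alpha> x (vs[i := w])"
    using diff_forms_lincomb[OF \<alpha> p_carrier[OF x] _ T i tangent_map_tangent[OF uw(1) x] tangent_map_tangent[OF uw(2) x]]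
      x vs upd[OF uw(1)] upd[OF uw(2)] upd[OF M.tv_lincomb_tangent[OF uw x]]
    by (simp add: pullback_def map_update tangent_map_lincomb)
next
  fix x vs i j
  assume x: "x \<in> mcarrier M" and vs: "length vs = k \<and> set vs \<subseteq> tangent_space M x" and i: "i < k" "j < k"
    and eq: "i \<noteq> j \<and> vs ! i = vs ! j"
  have T: "set (map (tangent_map M N p x) vs) \<subseteq> tangent_space N (p x)"
    using tangent_map_tangent[OF _ x] vs by (auto simp: subset_iff)
  show "pullback M N p \<alpha> x vs = 0"
    using diff_forms_alternating[OF \<alpha> p_carrier[OF x] _ T i] x vs i eq by (simp add: pullback_def)
next
  fix c js assume c: "c \<in> atlas M" and js: "length js = k \<and> set js \<subseteq> {..<M.dm}"
  have "smooth_at M.dm (local_form M (pullback M N p \<alpha>) c (map unit_vec js)) (snd c x)" if x: "x \<in> fst c" for x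
  proof -
    have c': "c \<in> charts_at M x" using c x by (simp add: charts_at_def)
    have y: "snd c x \<in> Rn M.dm" by (rule M.charts_at_coord_Rn[OF c'])
    have cx: "chart_inv c (snd c x) = x" by (rule M.chart_inv_left[OF c x])
    define d where "d = chart_at N (p x)"
    have d: "d \<in> charts_at N (p x)"
      unfolding d_def by (rule N.chart_at_in[OF p_carrier[OF M.charts_at_carrier[OF c']]])
    have germ: "form_germ N.dm k (local_form N \<alpha> d) (rep c d (snd c x))"
      using N.local_form_germ[OF \<alpha> d] by (simp add: cx)
    define Vs where "Vs = map (\<lambda>j y. jacobian_map M.dm N.dm (rep c d) y (unit_vec j)) js"
    have sm: "smooth_map_at M.dm N.dm V (snd c x)" if "V \<in> set Vs" for V
    proof -
      have "V \<in> (\<lambda>j y. jacobian_map M.dm N.dm (rep c d) y (unit_vec j)) ` set js" using that by (simp add: Vs_def)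
      then obtain j where V: "V = (\<lambda>y. jacobian_map M.dm N.dm (rep c d) y (unit_vec j))" "j \<in> set js"
        by (rule imageE)
      have j: "unit_vec j \<in> Rn M.dm" using V(2) js by (intro unit_vec_Rn) blast
      show ?thesis unfolding V(1)
        by (rule smooth_map_at_jacobian[OF rep_smooth[OF c' d] smooth_map_at_const[OF y j]])
    qed
    have "smooth_at M.dm (\<lambda>y. local_form N \<alpha> d (map (\<lambda>V. V y) Vs) (rep c d y)) (snd c x)"
      by (rule smooth_at_form_compose[where F = "rep c d", OF germ rep_smooth[OF c' d] _ sm])
         (use js in \<open>simp_all add: Vs_def\<close>)
    moreover have "eventually (\<lambda>y. local_form N \<alpha> d (map (\<lambda>V. V y) Vs) (rep c d y) =
        local_form M (pullback M N p \<alpha>) c (map unit_vec js) y) (nb M.dm (snd c x))"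
      using local_form_pullback[OF c' d, of \<alpha>]
    proof eventually_elim
      case (elim y)
      have "set (map unit_vec js) \<subseteq> Rn M.dm" using js unit_vec_Rn by auto
      from elim[THEN spec, THEN mp, OF this] show ?case by (simp add: Vs_def comp_def)
    qed
    ultimately show ?thesis by (rule smooth_at_cong)
  qed
  then have "smooth_fun_on M.dm (snd c ` fst c) (local_form M (pullback M N p \<alpha>) c (map unit_vec js))"
    unfolding smooth_fun_on_iff[OF M.atlas_chart(3)[OF c]] by blast
  then show "smooth_fun_on M.dm (snd c ` fst c)
      (\<lambda>y. pullback M N p \<alpha> (chart_inv c y) (map (\<lambda>j. coord_vec M c (chart_inv c y) (unit_vec j)) js))"
    by (simp add: local_form_def[abs_def] comp_def)
qed

end

context mfd
begin

lemma smooth_map_ident: "smooth_map M M (\<lambda>x. x)"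
  unfolding smooth_map_def
proof (intro conjI ballI)
  fix x assume x: "x \<in> mcarrier M"
  define c where "c = chart_at M x"
  have c: "c \<in> charts_at M x" unfolding c_def by (rule chart_at_in[OF x])
  have cA: "c \<in> atlas M" by (rule charts_atD(1)[OF c])
  have sm: "smooth_map_at dm dm (snd c \<circ> (\<lambda>x. x) \<circ> chart_inv c) y" if "y \<in> snd c ` fst c" for y
  proof (rule smooth_map_at_cong[OF smooth_map_at_id])
    show "y \<in> Rn dm" using that openin_Rn[OF atlas_chart(3)[OF cA]] by blast
    show "eventually (\<lambda>y. y = (snd c \<circ> (\<lambda>x. x) \<circ> chart_inv c) y) (nb dm y)"
      using openin_eventually_nb[OF atlas_chart(3)[OF cA] that] by eventually_elim (simp add: chart_inv_right)
  qed
  have im: "(snd c \<circ> (\<lambda>x. x) \<circ> chart_inv c) ` (snd c ` fst c) \<subseteq> Rn dm"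
    using sm smooth_map_at_Rn by (intro image_subsetI) metis
  show "\<exists>c\<in>charts_at M x. \<exists>d\<in>charts_at M x. (\<lambda>x. x) ` fst c \<subseteq> fst d \<and>
      smooth_vec_on dm dm (snd c ` fst c) (snd d \<circ> (\<lambda>x. x) \<circ> chart_inv c)"
    using c sm im by (intro bexI[of _ c]) (simp_all add: smooth_vec_on_iff[OF atlas_chart(3)[OF cA]])
qed simp

sublocale ident: mfd_map M M "\<lambda>x. x"
  by unfold_locales (rule smooth_map_ident)

lemma tangent_map_ident: "v \<in> tangent_space M x \<Longrightarrow> c \<in> charts_at M x \<Longrightarrow> tangent_map M M (\<lambda>x. x) x v = v"
  using ident.tangent_map_eq[of v x c c] transition_self_jacobian[of c x "v c"] tangent_Rn[of v x c]
    coord_vec_tangent_eq[of v x c] by (simp add: transition_def[abs_def] comp_def)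

lemma pullback_ident:
  assumes \<alpha>: "\<alpha> \<in> diff_forms M k"
  shows "pullback M M (\<lambda>x. x) \<alpha> = \<alpha>"
proof (intro ext)
  fix x vs
  have "map (tangent_map M M (\<lambda>x. x) x) vs = vs" if "x \<in> mcarrier M" "set vs \<subseteq> tangent_space M x"
    using that tangent_map_ident[OF _ chart_at_in[OF that(1)]] by (intro map_idI) blast
  then show "pullback M M (\<lambda>x. x) \<alpha> x vs = \<alpha> x vs"
    using diff_forms_outside[OF \<alpha>, of x vs] by (auto simp: pullback_def)
qed

text \<open>Naturality of d under the identity map, read with \<open>chart_at M x\<close> on the
  source side and c on the target side.\<close>

lemma ext_deriv_chart:
  assumes \<alpha>: "\<alpha> \<in> diff_forms M k" and c: "c \<in> charts_at M x"
    and vs: "length vs = Suc k" "set vs \<subseteq> tangent_space M x"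
  shows "ext_deriv M \<alpha> x vs = ext_d dm (local_form M \<alpha> c) (map (\<lambda>v. v c) vs) (snd c x)"
proof -
  note x = charts_at_carrier[OF c]
  have "map (\<lambda>v. tangent_map M M (\<lambda>x. x) x v c) vs = map (\<lambda>v. v c) vs"
    using vs tangent_map_ident[OF _ c] by (intro map_cong refl) (simp add: subset_iff)
  then show ?thesis
    using ident.ext_d_local_pullback[OF \<alpha> chart_at_in[OF x] c vs] ext_deriv_eq_ext_d[OF x vs(2), of \<alpha>]
    by (simp add: pullback_ident[OF \<alpha>] del: map_eq_conv)
qed

end

section \<open>Plots and leaf tangent spaces\<close>

lemma homogeneous_system_nontrivial:
  fixes a :: "nat \<Rightarrow> 'j \<Rightarrow> real"
  assumes "finite J" "card J = Suc k"
  shows "\<exists>x. (\<exists>j\<in>J. x j \<noteq> 0) \<and> (\<forall>i<k. (\<Sum>j\<in>J. a i j * x j) = 0)"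
  using assms
proof (induction k arbitrary: J a)
  case 0
  then obtain j where "J = {j}" using card_1_singletonE by auto
  then show ?case by (intro exI[of _ "\<lambda>_. 1"]) simp
next
  case (Suc k)
  have split: "(\<Sum>j\<in>J. f j) = f m + (\<Sum>j\<in>J - {m}. f j)" if "m \<in> J" for m and f :: "'j \<Rightarrow> real"
    using Suc.prems(1) that by (rule sum.remove)
  show ?case
  proof (cases "\<forall>j\<in>J. a k j = 0")
    case True
    obtain m where m: "m \<in> J" using Suc.prems by fastforce
    obtain x where x: "\<exists>j\<in>J - {m}. x j \<noteq> 0" "\<forall>i<k. (\<Sum>j\<in>J - {m}. a i j * x j) = 0"
      using Suc.IH[of "J - {m}" a] Suc.prems m by auto
    define x' where "x' = x(m := 0)"
    have "(\<Sum>j\<in>J - {m}. a i j * x' j) = (\<Sum>j\<in>J - {m}. a i j * x j)" for i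
      by (rule sum.cong) (auto simp: x'_def)
    then have "(\<Sum>j\<in>J. a i j * x' j) = 0" if "i < Suc k" for i
      using that x(2) True split[OF m, of "\<lambda>j. a i j * x' j"]
      by (cases "i = k") (simp_all add: x'_def)
    moreover have "\<exists>j\<in>J. x' j \<noteq> 0" using x(1) by (auto simp: x'_def)
    ultimately show ?thesis by blast
  next
    case False
    then obtain m where m: "m \<in> J" "a k m \<noteq> 0" by blast
    \<comment> \<open>Gaussian elimination: equation k is solved for the unknown m, and b holds the
      coefficients left in the other equations.\<close>
    define b where "b i j = a i j - a i m * a k j / a k m" for i j
    obtain x where x: "\<exists>j\<in>J - {m}. x j \<noteq> 0" "\<forall>i<k. (\<Sum>j\<in>J - {m}. b i j * x j) = 0"
      using Suc.IH[of "J - {m}" b] Suc.prems m by auto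
    define s where "s = (\<Sum>j\<in>J - {m}. a k j * x j)"
    define x' where "x' = x(m := - s / a k m)"
    have eq: "(\<Sum>j\<in>J. a i j * x' j) = (\<Sum>j\<in>J - {m}. a i j * x j) - a i m * s / a k m" for i
    proof -
      have "(\<Sum>j\<in>J - {m}. a i j * x' j) = (\<Sum>j\<in>J - {m}. a i j * x j)"
        by (rule sum.cong) (auto simp: x'_def)
      then show ?thesis using split[OF m(1), of "\<lambda>j. a i j * x' j"] by (simp add: x'_def)
    qed
    have "(\<Sum>j\<in>J. a i j * x' j) = 0" if i: "i < Suc k" for i
    proof (cases "i = k")
      case True
      then show ?thesis using m(2) unfolding eq by (simp add: s_def)
    next
      case False
      then have "(\<Sum>j\<in>J - {m}. b i j * x j) = 0" using x(2) i by simp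
      moreover have "(\<Sum>j\<in>J - {m}. b i j * x j) = (\<Sum>j\<in>J - {m}. a i j * x j) - a i m * s / a k m"
      proof -
        have "a i m * s / a k m = (\<Sum>j\<in>J - {m}. a i m * a k j / a k m * x j)"
          by (simp add: s_def sum_distrib_left sum_divide_distrib mult_ac)
        then show ?thesis by (simp only: b_def left_diff_distrib sum_subtractf)
      qed
      ultimately show ?thesis unfolding eq by simp
    qed
    moreover have "\<exists>j\<in>J. x' j \<noteq> 0" using x(1) by (auto simp: x'_def)
    ultimately show ?thesis by blast
  qed
qed

text \<open>Preimages of the k unit vectors together with z are k + 1 vectors of
  \<open>Rn k\<close>, hence linearly dependent. Applying A gives a relation between the unit
  vectors and \<open>A z\<close>, in which \<open>A z\<close> has a nonzero coefficient because the
  unit vectors are independent.\<close>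

lemma linear_image_dimension:
  fixes A :: "(nat \<Rightarrow> real) \<Rightarrow> nat \<Rightarrow> real"
  assumes lin: "\<And>a b u w. A (\<lambda>j. a * u j + b * w j) = (\<lambda>j. a * A u j + b * A w j)"
    and surj: "\<And>i. i < k \<Longrightarrow> \<exists>u\<in>Rn k. A u = unit_vec i"
    and z: "z \<in> Rn k"
  shows "A z \<in> Rn k"
proof -
  obtain u where u: "\<And>i. i < k \<Longrightarrow> u i \<in> Rn k" "\<And>i. i < k \<Longrightarrow> A (u i) = unit_vec i"
    using surj by metis
  have A0: "A (\<lambda>j. 0) = (\<lambda>j. 0)" using lin[of 0 "\<lambda>j. 0" 0 "\<lambda>j. 0"] by simp
  have Asum: "A (\<lambda>j. \<Sum>i\<in>I. c i * f i j) = (\<lambda>j. \<Sum>i\<in>I. c i * A (f i) j)"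
    if "finite I" for I :: "nat set" and c f
    using that
  proof (induction I rule: finite_induct)
    case (insert i I)
    then show ?case using lin[of "c i" "f i" 1 "\<lambda>j. \<Sum>i\<in>I. c i * f i j"] by simp
  qed (simp add: A0)
  define U where "U i = (if i < k then u i else z)" for i
  obtain x where x: "\<exists>i\<in>{..<Suc k}. x i \<noteq> 0" "\<forall>j<k. (\<Sum>i\<in>{..<Suc k}. U i j * x i) = 0"
    using homogeneous_system_nontrivial[of "{..<Suc k}" k "\<lambda>j i. U i j"] by auto
  have "(\<Sum>i<Suc k. x i * U i j) = 0" for j
  proof (cases "j < k")
    case True
    then show ?thesis using x(2) by (simp add: mult.commute)
  next
    case False
    then have "U i j = 0" for i using u(1) z by (simp add: U_def mem_Rn)
    then show ?thesis by simp
  qed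
  then have "(\<lambda>j. \<Sum>i<Suc k. x i * A (U i) j) = (\<lambda>j. 0)"
    using Asum[of "{..<Suc k}" x U] A0 by simp
  then have rel: "(\<Sum>i<k. x i * unit_vec i j) + x k * A z j = 0" for j
    using u(2) by (simp add: U_def fun_eq_iff)
  have sum_unit: "(\<Sum>i<k. x i * unit_vec i j) = (if j < k then x j else 0)" for j
  proof -
    have "x i * unit_vec i j = (if i = j then x j else 0)" for i by (simp add: unit_vec_def)
    then show ?thesis by simp
  qed
  have "x k \<noteq> 0"
  proof
    assume "x k = 0"
    then have "x j = 0" if "j < k" for j using rel[of j] sum_unit[of j] that by simp
    with x(1) \<open>x k = 0\<close> show False by (auto simp: less_Suc_eq)
  qed
  then have "A z j = 0" if "j \<ge> k" for j using rel[of j] sum_unit[of j] that by simp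
  then show ?thesis by (simp add: mem_Rn)
qed

context mfd
begin

lemma smooth_into_germ:
  assumes q: "smooth_into r Q M q" and u: "u \<in> Q" and d: "d \<in> charts_at M (q u)"
  shows "smooth_map_at r dm (\<lambda>y. snd d (q y)) u \<and> eventually (\<lambda>y. q y \<in> fst d) (nb r u)"
proof -
  have "\<exists>P. openin (E r) P \<and> u \<in> P \<and> P \<subseteq> Q \<and>
      (\<exists>d\<in>charts_at M (q u). q ` P \<subseteq> fst d \<and> smooth_vec_on r dm P (snd d \<circ> q))"
    using q u by (simp add: smooth_into_def)
  then obtain P d0 where P: "openin (E r) P" "u \<in> P" "P \<subseteq> Q" and d0: "d0 \<in> charts_at M (q u)"
    and sub: "q ` P \<subseteq> fst d0" and sm: "smooth_vec_on r dm P (snd d0 \<circ> q)" by (elim exE conjE bexE)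
  have s0: "smooth_map_at r dm (\<lambda>y. snd d0 (q y)) u"
    using smooth_map_atI[OF P(1,2) sm] by (simp add: comp_def)
  have ev0: "eventually (\<lambda>y. chart_inv d0 (snd d0 (q y)) = q y) (nb r u)"
    using openin_eventually_nb[OF P(1,2)]
  proof eventually_elim
    case (elim y)
    show ?case by (rule chart_inv_left[OF charts_atD(1)[OF d0] subsetD[OF sub imageI[OF elim]]])
  qed
  have "eventually (\<lambda>y. chart_inv d0 (snd d0 (q y)) \<in> fst d) (nb r u)"
    by (rule eventually_smooth_map_at[OF s0]) (use eventually_overlap[OF d0 d] in \<open>simp add: eventually_conj_iff\<close>)
  then have ev: "eventually (\<lambda>y. q y \<in> fst d) (nb r u)"
    using ev0 by eventually_elim simp
  have "smooth_map_at r dm (\<lambda>y. transition d0 d (snd d0 (q y))) u"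
    by (rule smooth_map_at_compose[OF s0]) (rule transition_smooth[OF d0 d])
  then have "smooth_map_at r dm (\<lambda>y. snd d (q y)) u"
    by (rule smooth_map_at_cong) (use ev0 in eventually_elim, simp add: transition_def)
  with ev show ?thesis by blast
qed

lemma smooth_intoI:
  assumes Q: "openin (E r) Q"
    and d: "\<And>u. u \<in> Q \<Longrightarrow> \<exists>d\<in>charts_at M (q u). eventually (\<lambda>y. q y \<in> fst d) (nb r u) \<and>
      smooth_map_at r dm (\<lambda>y. snd d (q y)) u"
  shows "smooth_into r Q M q"
  unfolding smooth_into_def
proof (intro conjI ballI)
  show "q ` Q \<subseteq> mcarrier M"
  proof (rule image_subsetI)
    fix u assume "u \<in> Q"
    from d[OF this] obtain d where "d \<in> charts_at M (q u)" by (elim bexE)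
    then show "q u \<in> mcarrier M" by (rule charts_at_carrier)
  qed
  fix u assume u: "u \<in> Q"
  from d[OF u] obtain d where d: "d \<in> charts_at M (q u)" "eventually (\<lambda>y. q y \<in> fst d) (nb r u)"
      "smooth_map_at r dm (\<lambda>y. snd d (q y)) u" by (elim bexE conjE)
  have "eventually (\<lambda>y. y \<in> Q \<and> q y \<in> fst d \<and> smooth_map_at r dm (\<lambda>y. snd d (q y)) y) (nb r u)"
    using openin_eventually_nb[OF Q u] d(2) smooth_map_at_eventually[OF d(3)] by eventually_elim simp
  then obtain P where P: "openin (E r) P" "u \<in> P"
    "\<And>y. y \<in> P \<Longrightarrow> y \<in> Q \<and> q y \<in> fst d \<and> smooth_map_at r dm (\<lambda>y. snd d (q y)) y"
    unfolding eventually_nb[OF smooth_map_at_dom[OF d(3)]] by blast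
  have "smooth_vec_on r dm P (snd d \<circ> q)"
    unfolding smooth_vec_on_iff[OF P(1)] comp_def
    using P(3) coord_Rn[OF charts_atD(1)[OF d(1)]] by (auto simp del: topspace_Euclidean_space)
  moreover have "q ` P \<subseteq> fst d" "P \<subseteq> Q" using P(3) by auto
  ultimately show "\<exists>P. openin (E r) P \<and> u \<in> P \<and> P \<subseteq> Q \<and>
      (\<exists>d\<in>charts_at M (q u). q ` P \<subseteq> fst d \<and> smooth_vec_on r dm P (snd d \<circ> q))"
    using P(1,2) d(1) by (intro exI[of _ P] conjI bexI[of _ d])
qed

lemma smooth_into_chart_inv:
  assumes Q: "openin (E r) Q" and c: "c \<in> atlas M"
    and \<phi>: "\<And>u. u \<in> Q \<Longrightarrow> smooth_map_at r dm \<phi> u \<and> \<phi> u \<in> snd c ` fst c"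
  shows "smooth_into r Q M (\<lambda>u. chart_inv c (\<phi> u))"
proof (rule smooth_intoI[OF Q])
  fix u assume u: "u \<in> Q"
  have "c \<in> charts_at M (chart_inv c (\<phi> u))"
    using c chart_inv_right(1)[OF conjunct2[OF \<phi>[OF u]]] by (simp add: charts_at_def)
  moreover have "eventually (\<lambda>y. chart_inv c (\<phi> y) \<in> fst c) (nb r u)"
    using openin_eventually_nb[OF Q u] by eventually_elim (rule chart_inv_right(1)[OF conjunct2[OF \<phi>]])
  moreover have "smooth_map_at r dm (\<lambda>y. snd c (chart_inv c (\<phi> y))) u"
  proof (rule smooth_map_at_cong)
    show "smooth_map_at r dm \<phi> u" using \<phi>[OF u] by blast
    show "eventually (\<lambda>y. \<phi> y = snd c (chart_inv c (\<phi> y))) (nb r u)"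
      using openin_eventually_nb[OF Q u]
      by eventually_elim (rule chart_inv_right(2)[OF conjunct2[OF \<phi>], symmetric])
  qed
  ultimately show "\<exists>d\<in>charts_at M (chart_inv c (\<phi> u)). eventually (\<lambda>y. chart_inv c (\<phi> y) \<in> fst d) (nb r u) \<and>
      smooth_map_at r dm (\<lambda>y. snd d (chart_inv c (\<phi> y))) u" by blast
qed

lemma eventually_chart_inv_open:
  assumes U: "openin (mtopology M) U" "x \<in> U" and c: "c \<in> charts_at M x"
  shows "eventually (\<lambda>y. chart_inv c y \<in> U) (nb dm (snd c x))"
proof -
  have "openin (E dm) (snd c ` (U \<inter> fst c))"
    using U(1) charts_atD(1)[OF c] unfolding openin_mtopology by blast
  moreover have "snd c x \<in> snd c ` (U \<inter> fst c)" using U(2) charts_atD(2)[OF c] by blast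
  ultimately have "eventually (\<lambda>y. y \<in> snd c ` (U \<inter> fst c)) (nb dm (snd c x))"
    by (rule openin_eventually_nb)
  then show ?thesis
    by eventually_elim (use chart_inv_left[OF charts_atD(1)[OF c]] in auto)
qed

end

definition is_plot_of :: "'a manifold \<Rightarrow> 'a set \<Rightarrow> nat \<Rightarrow> (nat \<Rightarrow> real) set \<Rightarrow> ((nat \<Rightarrow> real) \<Rightarrow> 'a) \<Rightarrow> bool" where
  "is_plot_of M L r Q q \<longleftrightarrow> openin (E r) Q \<and> smooth_into r Q M q \<and> q ` Q \<subseteq> L"

lemma (in mfd_map) plot_compose:
  assumes q: "is_plot_of M L r Q q" and L: "p ` L \<subseteq> L'"
  shows "is_plot_of N L' r Q (\<lambda>u. p (q u))"
    and "\<And>u w c d. u \<in> Q \<Longrightarrow> c \<in> charts_at M (q u) \<Longrightarrow> d \<in> charts_at N (p (q u)) \<Longrightarrow>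
      jacobian_map r N.dm (\<lambda>y. snd d (p (q y))) u w =
      jacobian_map M.dm N.dm (rep c d) (snd c (q u)) (jacobian_map r M.dm (\<lambda>y. snd c (q y)) u w)"
proof -
  have Q: "openin (E r) Q" and sq: "smooth_into r Q M q" and qL: "q ` Q \<subseteq> L"
    using q by (auto simp: is_plot_of_def)
  have qC: "q u \<in> mcarrier M" if "u \<in> Q" for u using sq that by (auto simp: smooth_into_def)
  have ev: "smooth_map_at r N.dm (\<lambda>y. rep c d (snd c (q y))) u \<and>
      eventually (\<lambda>y. p (q y) \<in> fst d) (nb r u) \<and>
      eventually (\<lambda>y. rep c d (snd c (q y)) = snd d (p (q y))) (nb r u)"
    if u: "u \<in> Q" and c: "c \<in> charts_at M (q u)" and d: "d \<in> charts_at N (p (q u))" for u c d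
  proof (intro conjI)
    note s = M.smooth_into_germ[OF sq u c]
    show "smooth_map_at r N.dm (\<lambda>y. rep c d (snd c (q y))) u"
      by (rule smooth_map_at_compose[OF conjunct1[OF s], of N.dm "rep c d"]) (rule rep_smooth[OF c d])
    have eq: "eventually (\<lambda>y. chart_inv c (snd c (q y)) = q y) (nb r u)"
      using conjunct2[OF s] by eventually_elim (rule M.chart_inv_left[OF charts_atD(1)[OF c]])
    then show "eventually (\<lambda>y. rep c d (snd c (q y)) = snd d (p (q y))) (nb r u)"
      by eventually_elim simp
    have "eventually (\<lambda>y. p (chart_inv c (snd c (q y))) \<in> fst d) (nb r u)"
      by (rule eventually_smooth_map_at[OF conjunct1[OF s]]) (rule eventually_rep[OF c d])
    with eq show "eventually (\<lambda>y. p (q y) \<in> fst d) (nb r u)" by eventually_elim simp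
  qed
  have "smooth_into r Q N (\<lambda>u. p (q u))"
  proof (rule N.smooth_intoI[OF Q])
    fix u assume u: "u \<in> Q"
    define c where "c = chart_at M (q u)"
    define d where "d = chart_at N (p (q u))"
    have c: "c \<in> charts_at M (q u)" unfolding c_def by (rule M.chart_at_in[OF qC[OF u]])
    have d: "d \<in> charts_at N (p (q u))" unfolding d_def by (rule N.chart_at_in[OF p_carrier[OF qC[OF u]]])
    note e = ev[OF u c d]
    have "smooth_map_at r N.dm (\<lambda>y. snd d (p (q y))) u"
      using e by (elim conjE) (rule smooth_map_at_cong)
    with d e show "\<exists>d\<in>charts_at N (p (q u)). eventually (\<lambda>y. p (q y) \<in> fst d) (nb r u) \<and>
        smooth_map_at r N.dm (\<lambda>y. snd d (p (q y))) u" by blast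
  qed
  moreover have "(\<lambda>u. p (q u)) ` Q \<subseteq> L'" using qL L by blast
  ultimately show "is_plot_of N L' r Q (\<lambda>u. p (q u))" using Q by (simp add: is_plot_of_def)
  fix u w c d assume u: "u \<in> Q" and c: "c \<in> charts_at M (q u)" and d: "d \<in> charts_at N (p (q u))"
  have uR: "u \<in> Rn r" using u openin_Rn[OF Q] by blast
  note e = ev[OF u c d]
  have "jacobian_map r N.dm (\<lambda>y. rep c d (snd c (q y))) u w = jacobian_map r N.dm (\<lambda>y. snd d (p (q y))) u w"
    by (rule jacobian_map_cong[OF _ uR]) (use e in blast)
  moreover have "jacobian_map r N.dm (\<lambda>y. rep c d (snd c (q y))) u w =
      jacobian_map M.dm N.dm (rep c d) (snd c (q u)) (jacobian_map r M.dm (\<lambda>y. snd c (q y)) u w)"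
    by (rule jacobian_map_compose[OF conjunct1[OF M.smooth_into_germ[OF sq u c]] rep_smooth[OF c d]])
  ultimately show "jacobian_map r N.dm (\<lambda>y. snd d (p (q y))) u w =
      jacobian_map M.dm N.dm (rep c d) (snd c (q u)) (jacobian_map r M.dm (\<lambda>y. snd c (q y)) u w)" by simp
qed

section \<open>Tangent spaces of leaves through plots\<close>

locale leaf = mfd M for M :: "'a manifold" +
  fixes L :: "'a set"
  assumes weakly_embedded: "weakly_embedded M L"
begin

abbreviation "S \<equiv> submanifold_structure M L"

lemma leaf_structure: "diffeological_structure M L S"
  using weakly_embedded unfolding weakly_embedded_def diffeological_submanifold_def submanifold_structure_def
  by (auto intro: someI_ex)

lemma leaf_structure_carrier: "mcarrier S = L"
  using leaf_structure by (simp add: diffeological_structure_def)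

sublocale incl: mfd_map S M "\<lambda>x. x"
proof unfold_locales
  show "smooth_manifold S" using leaf_structure by (simp add: diffeological_structure_def)
  show "smooth_map S M (\<lambda>x. x)" using weakly_embedded by (simp add: weakly_embedded_def immersion_def)
qed

lemma leaf_carrier: "x \<in> L \<Longrightarrow> x \<in> mcarrier M"
  using incl.p_carrier[of x] leaf_structure_carrier by simp

lemma leaf_tangent_space_eq: "leaf_tangent_space M L x = tangent_map S M (\<lambda>x. x) x ` tangent_space S x"
  by (simp add: leaf_tangent_space_def Let_def)

lemma leaf_tangent_subset: "x \<in> L \<Longrightarrow> leaf_tangent_space M L x \<subseteq> tangent_space M x"
  unfolding leaf_tangent_space_eq
  by (rule image_subsetI) (rule incl.tangent_map_tangent, simp_all add: leaf_structure_carrier)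

lemma zero_leaf_tangent: "x \<in> L \<Longrightarrow> (\<lambda>c i. 0) \<in> leaf_tangent_space M L x"
proof -
  assume "x \<in> L"
  then have "(\<lambda>c i. 0) \<in> tangent_space S x" by (simp add: incl.M.zero_tangent leaf_structure_carrier)
  moreover have "tangent_map S M (\<lambda>x. x) x (\<lambda>c i. 0) = (\<lambda>c i. 0)"
    by (simp add: tangent_map_def Let_def jacobian_map_def dir_deriv_def fun_eq_iff)
  ultimately show ?thesis unfolding leaf_tangent_space_eq by (metis imageI)
qed

text \<open>By the defining property of the diffeological structure, a map into L that is smooth
  into M is smooth into the manifold S. Its velocity computed in S is a tangent vector of S that the
  inclusion sends to v.\<close>

lemma plot_velocity_in_leaf_tangent:
  assumes q: "is_plot_of M L r Q q" and u: "u \<in> Q" and x: "q u = x"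
    and v: "v \<in> tangent_space M x" and c: "c \<in> charts_at M x"
    and vc: "v c = jacobian_map r dm (\<lambda>y. snd c (q y)) u w"
  shows "v \<in> leaf_tangent_space M L x"
proof -
  have Q: "openin (E r) Q" "smooth_into r Q M q" "q ` Q \<subseteq> L" using q by (auto simp: is_plot_of_def)
  have uR: "u \<in> Rn r" using u openin_Rn[OF Q(1)] by blast
  have qS: "smooth_into r Q S q"
    using leaf_structure Q unfolding diffeological_structure_def by blast
  have xL: "x \<in> mcarrier S" using Q(3) u x leaf_structure_carrier by blast
  define d where "d = chart_at S x"
  have d: "d \<in> charts_at S x" unfolding d_def by (rule incl.M.chart_at_in[OF xL])
  define uS where "uS = jacobian_map r incl.M.dm (\<lambda>y. snd d (q y)) u w"
  have uSR: "uS \<in> Rn incl.M.dm" unfolding uS_def by (rule jacobian_map_Rn)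
  have "is_plot_of S L r Q q" using Q(1,3) qS by (simp add: is_plot_of_def)
  from incl.plot_compose(2)[OF this, of L u d c w] u d c x
  have "v c = jacobian_map incl.M.dm dm (incl.rep d c) (snd d x) uS"
    by (simp add: vc uS_def)
  also have "\<dots> = tangent_map S M (\<lambda>x. x) x (coord_vec S d x uS) c"
    using incl.tangent_map_apply[OF incl.M.coord_vec_tangent[OF d] d c] by (simp add: incl.M.coord_vec_same[OF d uSR])
  finally have eq: "v c = tangent_map S M (\<lambda>x. x) x (coord_vec S d x uS) c" .
  have T: "coord_vec S d x uS \<in> tangent_space S x" by (rule incl.M.coord_vec_tangent[OF d])
  have "v = tangent_map S M (\<lambda>x. x) x (coord_vec S d x uS)"
    by (rule tangent_eqI[OF v incl.tangent_map_tangent[OF T xL] c eq])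
  then show ?thesis unfolding leaf_tangent_space_eq using T by blast
qed

text \<open>The plot is the inverse of a chart of the leaf, and w is the coordinate vector of a
  preimage of v under the inclusion.\<close>

lemma leaf_tangent_plot:
  assumes v: "v \<in> leaf_tangent_space M L x" and x: "x \<in> L"
  obtains r Q q u w where "is_plot_of M L r Q q" "u \<in> Q" "q u = x"
    "\<forall>c\<in>charts_at M x. v c = jacobian_map r dm (\<lambda>y. snd c (q y)) u w"
proof -
  obtain vS where vS: "vS \<in> tangent_space S x" "v = tangent_map S M (\<lambda>x. x) x vS"
    using v unfolding leaf_tangent_space_eq by blast
  define d where "d = chart_at S x"
  have d: "d \<in> charts_at S x" unfolding d_def by (rule incl.M.chart_at_in) (simp add: leaf_structure_carrier x)
  note dA = charts_atD(1)[OF d]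
  define Q where "Q = snd d ` fst d"
  have Q: "openin (E incl.M.dm) Q" unfolding Q_def by (rule incl.M.atlas_chart(3)[OF dA])
  have qS: "smooth_into incl.M.dm Q S (chart_inv d)"
  proof (rule incl.M.smooth_into_chart_inv[OF Q dA, of "\<lambda>y. y"])
    fix u assume u: "u \<in> Q"
    then have "smooth_map_at incl.M.dm incl.M.dm (\<lambda>y. y) u"
      by (intro smooth_map_at_id subsetD[OF openin_Rn[OF Q]])
    with u show "smooth_map_at incl.M.dm incl.M.dm (\<lambda>y. y) u \<and> u \<in> snd d ` fst d" by (simp only: Q_def)
  qed
  have "chart_inv d ` Q \<subseteq> mcarrier S"
    unfolding Q_def
    by (rule image_subsetI) (rule subsetD[OF incl.M.atlas_chart(1)[OF dA] incl.M.chart_inv_right(1)])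
  then have im: "chart_inv d ` Q \<subseteq> L" by (simp only: leaf_structure_carrier)
  have qM: "smooth_into incl.M.dm Q M (chart_inv d)"
    using leaf_structure Q im qS unfolding diffeological_structure_def by blast
  show ?thesis
  proof (rule that)
    show "is_plot_of M L incl.M.dm Q (chart_inv d)" using Q qM im by (simp add: is_plot_of_def)
    show "snd d x \<in> Q" unfolding Q_def using charts_atD(2)[OF d] by (rule imageI)
    show "chart_inv d (snd d x) = x" by (rule incl.M.chart_inv_left[OF charts_atD[OF d]])
    show "\<forall>c\<in>charts_at M x. v c = jacobian_map incl.M.dm dm (\<lambda>y. snd c (chart_inv d y)) (snd d x) (vS d)"
      unfolding vS(2) by (intro ballI incl.tangent_map_apply[OF vS(1) d])
  qed
qed

end

section \<open>Foliated charts and tangent vector fields\<close>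

locale foliation = mfd M for M :: "'a manifold" +
  fixes F :: "'a set set"
  assumes foliation: "singular_foliation M F"
begin

lemma leafI: "L \<in> F \<Longrightarrow> leaf M L"
  using foliation by unfold_locales (simp add: singular_foliation_def)

lemma leaves_cover: "x \<in> mcarrier M \<Longrightarrow> \<exists>L\<in>F. x \<in> L"
  using foliation unfolding singular_foliation_def partition_on_def by blast

lemma leaves_in_carrier: "L \<in> F \<Longrightarrow> x \<in> L \<Longrightarrow> x \<in> mcarrier M"
  using foliation unfolding singular_foliation_def partition_on_def by blast

text \<open>The image of L is a product, so fixing the transverse coordinates and varying the first
  k stays inside L and gives a plot. This works for every leaf that meets the chart, whatever its
  dimension, and so makes one vector field tangent to all leaves at once.\<close>

lemma plaque_direction_tangent:
  assumes c: "c \<in> atlas M" and U: "openin (E k) U" and k: "k \<le> dm"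
    and img: "snd c ` fst c = cartesian_prod k U W"
    and L: "L \<in> F" and l: "snd c ` (L \<inter> fst c) = cartesian_prod k U l"
    and y: "y \<in> L" "y \<in> fst c" and w: "w \<in> Rn k"
  shows "coord_vec M c y w \<in> leaf_tangent_space M L y"
proof -
  interpret leaf M L by (rule leafI[OF L])
  define z where "z = snd c y"
  define u0 where "u0 i = (if i < k then z i else 0)" for i
  define \<phi> where "\<phi> u i = (if i < k then u i else z i)" for u i
  have cy: "c \<in> charts_at M y" using c y(2) by (simp add: charts_at_def)
  have zR: "z \<in> Rn dm" unfolding z_def by (rule coord_Rn[OF c y(2)])
  have zl: "z \<in> cartesian_prod k U l" unfolding l[symmetric] z_def using y by blast
  have u0: "u0 \<in> U" using zl by (simp add: cartesian_prod_def u0_def[abs_def])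
  have \<phi>0: "\<phi> u0 = z" by (simp add: \<phi>_def u0_def fun_eq_iff)
  have \<phi>l: "\<phi> u \<in> cartesian_prod k U l" if u: "u \<in> U" for u
  proof -
    have "u \<in> Rn k" using u openin_Rn[OF U] by blast
    then have "(\<lambda>i. if i < k then \<phi> u i else 0) = u" by (auto simp: \<phi>_def mem_Rn fun_eq_iff)
    moreover have "(\<lambda>i. \<phi> u (k + i)) = (\<lambda>i. z (k + i))" by (simp add: \<phi>_def)
    ultimately show ?thesis using zl u by (simp add: cartesian_prod_def)
  qed
  have \<phi>c: "\<phi> u \<in> snd c ` fst c" if "u \<in> U" for u using \<phi>l[OF that] unfolding l[symmetric] by blast
  have smooth_coord: "smooth_at k (\<lambda>u. \<phi> u i) u" if "u \<in> Rn k" for u i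
    using that unfolding \<phi>_def by (cases "i < k") (simp_all add: smooth_at_coord smooth_at_const)
  have \<phi>R: "\<phi> u \<in> Rn dm" if "u \<in> Rn k" for u using zR k by (simp add: \<phi>_def mem_Rn)
  have \<phi>s: "smooth_map_at k dm \<phi> u" if u: "u \<in> Rn k" for u
    unfolding smooth_map_at_def using u smooth_coord[OF u] eventually_nb_Rn[of k u] \<phi>R
    by (auto elim!: eventually_mono simp del: topspace_Euclidean_space)
  have UR: "u \<in> Rn k" if "u \<in> U" for u using that openin_Rn[OF U] by blast
  have "is_plot_of M L k U (\<lambda>u. chart_inv c (\<phi> u))"
    unfolding is_plot_of_def
  proof (intro conjI U)
    show "smooth_into k U M (\<lambda>u. chart_inv c (\<phi> u))"
      by (rule smooth_into_chart_inv[OF U c]) (use \<phi>s[OF UR] \<phi>c in blast)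
    show "(\<lambda>u. chart_inv c (\<phi> u)) ` U \<subseteq> L"
    proof (rule image_subsetI)
      fix u assume "u \<in> U"
      then have "\<phi> u \<in> snd c ` (L \<inter> fst c)" using \<phi>l unfolding l by blast
      then show "chart_inv c (\<phi> u) \<in> L" using chart_inv_left[OF c] by auto
    qed
  qed
  moreover have "chart_inv c (\<phi> u0) = y" unfolding \<phi>0 z_def by (rule chart_inv_left[OF c y(2)])
  moreover have "coord_vec M c y w c = jacobian_map k dm (\<lambda>u. snd c (chart_inv c (\<phi> u))) u0 w"
  proof -
    have "jacobian_map k dm (\<lambda>u. snd c (chart_inv c (\<phi> u))) u0 w = jacobian_map k dm \<phi> u0 w"
    proof (rule jacobian_map_cong[OF _ UR[OF u0]])
      show "eventually (\<lambda>u. snd c (chart_inv c (\<phi> u)) = \<phi> u) (nb k u0)"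
        using openin_eventually_nb[OF U u0] by eventually_elim (rule chart_inv_right(2)[OF \<phi>c])
    qed
    also have "\<dots> = w"
    proof
      fix i
      have wR: "w \<in> Rn dm" using w k by (rule Rn_mono)
      show "jacobian_map k dm \<phi> u0 w i = w i"
      proof (cases "i < k")
        case True
        then show ?thesis using k w by (simp add: jacobian_map_nth \<phi>_def dir_deriv_coord)
      next
        case False
        then show ?thesis using w by (auto simp: jacobian_map_def \<phi>_def dir_deriv_const mem_Rn)
      qed
    qed
    finally show ?thesis using coord_vec_same[OF cy Rn_mono[OF w k]] by simp
  qed
  ultimately show ?thesis
    by (rule plot_velocity_in_leaf_tangent[OF _ u0 _ coord_vec_tangent[OF cy] cy])
qed

text \<open>The box is compact, and compact sets are closed because M is Hausdorff. Closedness in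
  all of M, and not only in the chart, allows a field supported in the box to be extended by
  0.\<close>

lemma closedin_chart_box:
  assumes c: "c \<in> atlas M" and B: "{y \<in> Rn dm. \<forall>i<dm. \<bar>y i\<bar> \<le> r} \<subseteq> snd c ` fst c" (is "?B \<subseteq> _")
  shows "closedin (mtopology M) (chart_inv c ` ?B)"
proof -
  \<comment> \<open>The factor {0} in the remaining coordinates writes the box as a product of
    compact sets, to which Tychonoff's theorem applies.\<close>
  define I where "I i = (if i < dm then {-r..r} else {0::real})" for i
  have "y \<in> ?B \<longleftrightarrow> (\<forall>i. y i \<in> I i)" for y
  proof
    assume y: "y \<in> ?B"
    show "\<forall>i. y i \<in> I i"
    proof
      fix i show "y i \<in> I i"
      proof (cases "i < dm")
        case True
        then have "\<bar>y i\<bar> \<le> r" using y by blast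
        then show ?thesis using True by (simp add: I_def abs_le_iff)
      qed (use y in \<open>simp add: I_def mem_Rn\<close>)
    qed
  next
    assume y: "\<forall>i. y i \<in> I i"
    have "\<bar>y i\<bar> \<le> r" if "i < dm" for i using y[THEN spec, of i] that by (simp add: I_def abs_le_iff)
    moreover have "y i = 0" if "i \<ge> dm" for i using y[THEN spec, of i] that by (simp add: I_def)
    ultimately show "y \<in> ?B" by (simp add: mem_Rn)
  qed
  then have "?B = (\<Pi>\<^sub>E i\<in>UNIV. I i)" by (simp only: set_eq_iff PiE_UNIV_domain Pi_iff) simp
  moreover have "compactin (powertop_real UNIV) (\<Pi>\<^sub>E i\<in>UNIV. I i)"
    unfolding compactin_PiE by (auto simp: I_def)
  ultimately have "compactin (powertop_real UNIV) ?B" by simp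
  then have "compactin (E dm) ?B"
    unfolding Euclidean_space_def compactin_subtopology by (auto simp: mem_Rn)
  then have "compactin (subtopology (E dm) (snd c ` fst c)) ?B"
    using B by (simp add: compactin_subtopology)
  moreover have "continuous_map (subtopology (E dm) (snd c ` fst c)) (mtopology M) (chart_inv c)"
    unfolding continuous_map_def
  proof (intro conjI allI impI)
    have top: "topspace (subtopology (E dm) (snd c ` fst c)) = snd c ` fst c"
      using openin_Rn[OF atlas_chart(3)[OF c]] by auto
    show "chart_inv c \<in> topspace (subtopology (E dm) (snd c ` fst c)) \<rightarrow> topspace (mtopology M)"
      unfolding top topspace_mtopology
      by (rule funcsetI) (rule subsetD[OF atlas_chart(1)[OF c] chart_inv_right(1)])
    fix U assume U: "openin (mtopology M) U"
    have "{y \<in> topspace (subtopology (E dm) (snd c ` fst c)). chart_inv c y \<in> U} = snd c ` (U \<inter> fst c)"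
      unfolding top using chart_inv_left[OF c] by auto
    moreover have "openin (E dm) (snd c ` (U \<inter> fst c))" using U c unfolding openin_mtopology by blast
    ultimately show "openin (subtopology (E dm) (snd c ` fst c))
        {y \<in> topspace (subtopology (E dm) (snd c ` fst c)). chart_inv c y \<in> U}"
      by (auto simp: openin_open_subtopology[OF atlas_chart(3)[OF c]])
  qed
  ultimately have "compactin (mtopology M) (chart_inv c ` ?B)" by (rule image_compactin)
  then show ?thesis
    using smooth_mfd by (intro compactin_imp_closedin) (simp_all add: smooth_manifold_def)
qed

text \<open>The field has the constant coordinates \<open>v c\<close> times a bump function. It is
  tangent to all leaves once \<open>v c\<close> lies in \<open>Rn k\<close>, the directions common
  to every leaf that meets the foliated chart.\<close>

lemma extend_leaf_tangent_vector:
  assumes L: "L \<in> F" and x: "x \<in> L" and v: "v \<in> leaf_tangent_space M L x"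
  obtains X where "smooth_vector_field M X" "tangent_to M F X" "X x = v"
proof -
  interpret leaf M L by (rule leafI[OF L])
  define k where "k = mdim S"
  have "\<exists>c. foliated_chart M F k x c"
    using foliation L x unfolding singular_foliation_def k_def by blast
  then obtain c U W where cx: "c \<in> charts_at M x" and c0: "snd c x = (\<lambda>i. 0)"
    and U: "openin (E k) U" "(\<lambda>i. 0) \<in> U" and W: "(\<lambda>i. 0) \<in> W"
    and img: "snd c ` fst c = cartesian_prod k U W"
    and lv: "\<forall>L\<in>F. \<exists>l\<subseteq>W. snd c ` (L \<inter> fst c) = cartesian_prod k U l"
    unfolding foliated_chart_def by (elim exE conjE)
  note c = charts_atD(1)[OF cx]
  have vT: "v \<in> tangent_space M x" using leaf_tangent_subset[OF x] v by blast
  have xM: "x \<in> mcarrier M" by (rule leaf_carrier[OF x])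
  \<comment> \<open>Subtraction in \<open>mdim M - k\<close> is truncated, so this bound has to be
    derived: for larger k, coordinate k - 1 could move within U although the chart image lies in
    \<open>Rn dm\<close>.\<close>
  have k: "k \<le> dm"
  proof (rule ccontr)
    assume "\<not> k \<le> dm"
    then have k1: "k - 1 < k" "dm \<le> k - 1" by auto
    have "eventually (\<lambda>t. (\<lambda>i. 0)(k - 1 := t) \<in> U) (at (0::real))"
      using openin_upd[OF U k1(1)] by (simp add: eventually_nhds_conv_at)
    moreover have "eventually (\<lambda>t. t \<noteq> 0) (at (0::real))" by (rule eventually_neq_at_within)
    ultimately have "eventually (\<lambda>t. (\<lambda>i. 0)(k - 1 := t) \<in> U \<and> t \<noteq> 0) (at (0::real))"
      by (rule eventually_conj)
    then obtain t :: real where t: "(\<lambda>i. 0)(k - 1 := t) \<in> U" "t \<noteq> 0"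
      using eventually_happens' by (metis (mono_tags, lifting) at_neq_bot)
    have eqs: "(\<lambda>i. if i < k then ((\<lambda>i. 0)(k - 1 := t)) i else 0) = (\<lambda>i. 0)(k - 1 := t)"
        "(\<lambda>i. ((\<lambda>i. 0)(k - 1 := t)) (k + i)) = (\<lambda>i. 0)"
      using k1 by (auto simp: fun_eq_iff)
    have "(\<lambda>i. 0)(k - 1 := t) \<in> cartesian_prod k U W"
      unfolding cartesian_prod_def mem_Collect_eq eqs using t(1) W by blast
    then have "(\<lambda>i. 0)(k - 1 := t) \<in> Rn dm"
      using openin_Rn[OF atlas_chart(3)[OF c]] unfolding img by blast
    then have "((\<lambda>i. 0)(k - 1 := t)) (k - 1) = 0" using k1(2) unfolding mem_Rn by blast
    then show False using t(2) by simp
  qed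
  have dir: "coord_vec M c y w \<in> leaf_tangent_space M L' y"
    if L': "L' \<in> F" "y \<in> L'" "y \<in> fst c" "w \<in> Rn k" for L' y w
  proof -
    obtain l where "snd c ` (L' \<inter> fst c) = cartesian_prod k U l" using lv L'(1) by blast
    from plaque_direction_tangent[OF c U(1) k img L'(1) this L'(2-4)] show ?thesis .
  qed
  \<comment> \<open>The tangent space of the leaf is a linear image of \<open>\<real>\<^sup>k\<close> and contains the \<open>k\<close> plaque directions.\<close>
  have vk: "v c \<in> Rn k"
  proof -
    define d where "d = chart_at S x"
    have d: "d \<in> charts_at S x" unfolding d_def by (rule incl.M.chart_at_in) (simp add: leaf_structure_carrier x)
    have A: "\<exists>u\<in>Rn k. z c = jacobian_map k dm (incl.rep d c) (snd d x) u"
      if z: "z \<in> leaf_tangent_space M L x" for z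
    proof -
      obtain zS where "z = tangent_map S M (\<lambda>x. x) x zS" "zS \<in> tangent_space S x"
        using z unfolding leaf_tangent_space_eq by (rule imageE)
      then show ?thesis using incl.tangent_map_apply[OF _ d cx] incl.M.tangent_Rn[OF _ d]
        unfolding k_def by blast
    qed
    obtain u where u: "u \<in> Rn k" "v c = jacobian_map k dm (incl.rep d c) (snd d x) u" using A[OF v] by blast
    show ?thesis unfolding u(2)
    proof (rule linear_image_dimension[OF jacobian_map_lincomb _ u(1)])
      fix i assume i: "i < k"
      have e: "unit_vec i \<in> Rn k" by (rule unit_vec_Rn[OF i])
      from A[OF dir[OF L x charts_atD(2)[OF cx] e]]
      show "\<exists>u\<in>Rn k. jacobian_map k dm (incl.rep d c) (snd d x) u = unit_vec i"
        unfolding coord_vec_same[OF cx Rn_mono[OF e k]] by metis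
    qed
  qed
  have "(\<lambda>i. 0) \<in> snd c ` fst c" using charts_atD(2)[OF cx] c0 by (metis imageI)
  from openin_eventually_nb[OF atlas_chart(3)[OF c] this]
  obtain e where e: "e > 0" "\<And>y. y \<in> Rn dm \<Longrightarrow> (\<forall>i<dm. \<bar>y i\<bar> < e) \<Longrightarrow> y \<in> snd c ` fst c"
    unfolding eventually_nb_box[OF zero_Rn] by auto
  \<comment> \<open>Half of e, so that the closed box of half-width r lies in the open chart
    image.\<close>
  define r where "r = e / 2"
  have r: "r > 0" "r < e" using e(1) by (auto simp: r_def)
  obtain \<rho> where \<rho>: "\<And>y. y \<in> Rn dm \<Longrightarrow> smooth_at dm \<rho> y" "\<rho> (\<lambda>i. 0) = 1"
      "\<And>y. \<rho> y \<noteq> 0 \<Longrightarrow> \<forall>i<dm. \<bar>y i\<bar> \<le> r" using bump_function[OF r(1)] by blast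
  define B where "B = {y \<in> Rn dm. \<forall>i<dm. \<bar>y i\<bar> \<le> r}"
  have B: "B \<subseteq> snd c ` fst c" unfolding B_def using e(2) r(2) by (auto intro!: e(2) simp del: topspace_Euclidean_space)
  define K where "K = chart_inv c ` B"
  have K: "closedin (mtopology M) K" unfolding K_def B_def by (rule closedin_chart_box[OF c B[unfolded B_def]])
  define X where "X y = (if y \<in> fst c then coord_vec M c y (\<lambda>i. \<rho> (snd c y) * v c i) else (\<lambda>d i. 0))" for y
  have coord_zero: "coord_vec M c y (\<lambda>i. 0) = (\<lambda>d i. 0)" for y
    by (simp add: coord_vec_def jacobian_map_def dir_deriv_def fun_eq_iff)
  have X_off: "X y = (\<lambda>d i. 0)" if "y \<notin> K" for y
  proof (cases "y \<in> fst c")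
    case True
    have "snd c y \<notin> B"
    proof
      assume "snd c y \<in> B"
      then have "chart_inv c (snd c y) \<in> K" unfolding K_def by (rule imageI)
      then show False using that chart_inv_left[OF c True] by simp
    qed
    then have "\<rho> (snd c y) = 0" using \<rho>(3)[of "snd c y"] coord_Rn[OF c True] unfolding B_def by blast
    then show ?thesis by (simp add: X_def coord_zero)
  qed (simp add: X_def)
  have scale: "(\<lambda>i. a * v c i) \<in> Rn k" for a using vk by (simp add: mem_Rn)
  have X_tangent: "tangent_to M F X"
    unfolding tangent_to_def
  proof (intro ballI)
    fix L' y assume L': "L' \<in> F" "y \<in> L'"
    interpret L': leaf M L' by (rule leafI[OF L'(1)])
    show "X y \<in> leaf_tangent_space M L' y"
      using dir[OF L' _ scale] L'.zero_leaf_tangent[OF L'(2)] by (simp add: X_def)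
  qed
  have X_in: "X y \<in> tangent_space M y" if "y \<in> mcarrier M" for y
    using coord_vec_tangent[of c y] zero_tangent[OF that] c by (simp add: X_def charts_at_def)
  have X_smooth: "smooth_map_at dm dm (\<lambda>z. X (chart_inv d z) d) z" if d: "d \<in> atlas M" and z: "z \<in> snd d ` fst d" for d z
  proof -
    define y where "y = chart_inv d z"
    have y: "d \<in> charts_at M y" "snd d y = z"
      using d chart_inv_right[OF z] by (simp_all add: y_def charts_at_def)
    have zR: "z \<in> Rn dm" unfolding y(2)[symmetric] by (rule charts_at_coord_Rn[OF y(1)])
    show ?thesis
    \<comment> \<open>Off the closed set K the field vanishes on a neighbourhood. Points of K lie in
      the domain of c, where the field has the coordinates w below and the transition map carries it
      to d.\<close>
    proof (cases "y \<in> K")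
      case False
      have "openin (mtopology M) (mcarrier M - K)"
        using K unfolding closedin_def topspace_mtopology by blast
      moreover have "y \<in> mcarrier M - K" using False charts_at_carrier[OF y(1)] by blast
      ultimately have "eventually (\<lambda>z. chart_inv d z \<in> mcarrier M - K) (nb dm z)"
        unfolding y(2)[symmetric] by (rule eventually_chart_inv_open[OF _ _ y(1)])
      then have "eventually (\<lambda>z. (\<lambda>i. 0) = X (chart_inv d z) d) (nb dm z)"
        by eventually_elim (simp add: X_off)
      then show ?thesis by (rule smooth_map_at_cong[OF smooth_map_at_const[OF zR zero_Rn]])
    next
      case True
      obtain b where b: "y = chart_inv c b" "b \<in> B" using True unfolding K_def by (rule imageE)
      have "y \<in> fst c" unfolding b(1) by (rule chart_inv_right(1)[OF subsetD[OF B b(2)]])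
      then have cy: "c \<in> charts_at M y" using c by (simp add: charts_at_def)
      have T: "smooth_map_at dm dm (transition d c) z" using transition_smooth[OF y(1) cy] by (simp add: y(2))
      have Tz: "transition d c z = snd c y" using transition_at[OF y(1), of c] by (simp add: y(2))
      define w where "w z i = \<rho> (transition d c z) * v c i" for z i
      have "smooth_map_at dm dm w z"
        unfolding smooth_map_at_def
      proof (intro conjI zR allI impI)
        show "eventually (\<lambda>z. w z \<in> Rn dm) (nb dm z)"
          using vk k by (simp add: w_def mem_Rn)
        show "smooth_at dm (\<lambda>z. w z i) z" for i
          unfolding w_def
          by (rule smooth_at_mult[OF smooth_at_compose[OF T \<rho>(1)[OF smooth_map_at_Rn[OF T]]] smooth_at_const[OF zR]])
      qed
      moreover have "smooth_map_at dm dm (transition c d) (transition d c z)"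
        unfolding Tz by (rule transition_smooth[OF cy y(1)])
      ultimately have "smooth_map_at dm dm (\<lambda>z. jacobian_map dm dm (transition c d) (transition d c z) (w z)) z"
      proof -
        assume w: "smooth_map_at dm dm w z" and T': "smooth_map_at dm dm (transition c d) (transition d c z)"
        show ?thesis
          unfolding smooth_map_at_def
        proof (intro conjI zR allI impI)
          show "eventually (\<lambda>z. jacobian_map dm dm (transition c d) (transition d c z) (w z) \<in> Rn dm) (nb dm z)"
            by (simp only: jacobian_map_Rn eventually_True)
          fix j assume j: "j < dm"
          have "smooth_at dm (\<lambda>z. w z i * partial i (\<lambda>y. transition c d y j) (transition d c z)) z" if "i < dm" for i
            by (rule smooth_at_mult[OF smooth_map_at_coord[OF w]
                smooth_at_compose[OF T smooth_at_partial[OF smooth_map_at_coord[OF T'] that]]])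
          then show "smooth_at dm (\<lambda>z. jacobian_map dm dm (transition c d) (transition d c z) (w z) j) z"
            unfolding jacobian_map_nth[OF j] dir_deriv_def by (intro smooth_at_sum[OF zR]) simp
        qed
      qed
      then show ?thesis
      proof (rule smooth_map_at_cong)
        show "eventually (\<lambda>z. jacobian_map dm dm (transition c d) (transition d c z) (w z) = X (chart_inv d z) d) (nb dm z)"
          using eventually_overlap[OF y(1) cy] eventually_charts_at[OF y(1) cy] unfolding y(2)
        proof eventually_elim
          case (elim z)
          then show ?case by (simp add: X_def w_def[abs_def] coord_vec_apply transition_def[of d c])
        qed
      qed
    qed
  qed
  have "smooth_vector_field M X"
    unfolding smooth_vector_field_def
  proof (intro conjI ballI X_in)
    fix d assume d: "d \<in> atlas M"
    have "(\<lambda>y. X (chart_inv d y) d) ` (snd d ` fst d) \<subseteq> Rn dm"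
      by (rule image_subsetI) (rule smooth_map_at_Rn[OF X_smooth[OF d]])
    then show "smooth_vec_on dm dm (snd d ` fst d) (\<lambda>y. X (chart_inv d y) d)"
      unfolding smooth_vec_on_iff[OF atlas_chart(3)[OF d]] using X_smooth[OF d] by blast
  qed
  moreover have "X x = v"
    using charts_atD(2)[OF cx] coord_vec_tangent_eq[OF vT cx] by (simp add: X_def c0 \<rho>(2))
  ultimately show ?thesis using X_tangent that by blast
qed

subsection \<open>Pointwise characterization of basic forms\<close>

text \<open>Cartan's formula in a chart. The horizontality of \<alpha> is assumed at all points
  because it gets differentiated; lists of the wrong length give 0 on both sides.\<close>

lemma lie_deriv_horizontal:
  assumes \<alpha>: "\<alpha> \<in> diff_forms M k" and X: "smooth_vector_field M X" and x: "x \<in> mcarrier M"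
    and hor: "\<And>y vs. y \<in> mcarrier M \<Longrightarrow> \<alpha> y (X y # vs) = 0"
  shows "lie_deriv M X \<alpha> x vs = ext_deriv M \<alpha> x (X x # vs)"
proof (cases "set vs \<subseteq> tangent_space M x")
  case False
  then show ?thesis by (simp add: lie_deriv_def ext_deriv_def)
next
  case vs: True
  have XT: "X y \<in> tangent_space M y" if "y \<in> mcarrier M" for y
    using X that by (simp add: smooth_vector_field_def)
  define c where "c = chart_at M x"
  have c: "c \<in> charts_at M x" unfolding c_def by (rule chart_at_in[OF x])
  define ws where "ws = map (\<lambda>v. v c) vs"
  define \<xi> where "\<xi> y = X (chart_inv c y) c" for y
  have lie: "lie_deriv M X \<alpha> x vs = dir_deriv dm (local_form M \<alpha> c ws) (snd c x) (X x c) +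
      (\<Sum>i<length vs. local_form M \<alpha> c (ws[i := jacobian_map dm dm \<xi> (snd c x) (ws ! i)]) (snd c x))"
    using x vs by (simp add: lie_deriv_def Let_def c_def[symmetric] ws_def \<xi>_def[abs_def])
  show ?thesis
  proof (cases "length vs = k")
    case False
    then have "local_form M \<alpha> c ws = (\<lambda>y. 0)" "local_form M \<alpha> c (ws[i := w]) = (\<lambda>y. 0)" for i w
      by (intro ext local_form_wrong_length[OF \<alpha>]; simp add: ws_def)+
    then have "lie_deriv M X \<alpha> x vs = 0" by (simp add: lie dir_deriv_const)
    then show ?thesis using ext_deriv_wrong_length[OF \<alpha>, of "X x # vs"] False by simp
  next
    case len: True
    have cx: "chart_inv c (snd c x) = x" by (rule chart_inv_left[OF charts_atD[OF c]])
    have ws: "length ws = k" "set ws \<subseteq> Rn dm"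
      using len map_coords_Rn[OF c vs] by (simp_all add: ws_def)
    have \<xi>: "smooth_map_at dm dm \<xi> (snd c x)"
      unfolding \<xi>_def using X charts_atD[OF c] atlas_chart(3)[OF charts_atD(1)[OF c]]
      by (intro smooth_map_atI[of dm "snd c ` fst c"]) (auto simp: smooth_vector_field_def)
    have "ext_d dm (local_form M \<alpha> c) (\<xi> (snd c x) # ws) (snd c x) =
        dir_deriv dm (local_form M \<alpha> c ws) (snd c x) (\<xi> (snd c x)) +
        (\<Sum>i<k. local_form M \<alpha> c (ws[i := jacobian_map dm dm \<xi> (snd c x) (ws ! i)]) (snd c x))"
    proof (rule cartan_horizontal[OF local_form_germ[OF \<alpha> c] \<xi> ws])
      show "eventually (\<lambda>y. \<forall>us. Suc (length us) = k \<and> set us \<subseteq> Rn dm \<longrightarrow> local_form M \<alpha> c (\<xi> y # us) y = 0)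
          (nb dm (snd c x))"
        using eventually_charts_at[OF c c]
      proof eventually_elim
        case (elim y)
        then have y: "c \<in> charts_at M (chart_inv c y)" by blast
        have "coord_vec M c (chart_inv c y) (\<xi> y) = X (chart_inv c y)"
          unfolding \<xi>_def by (rule coord_vec_tangent_eq[OF XT[OF charts_at_carrier[OF y]] y])
        then show ?case using hor[OF charts_at_carrier[OF y]] by (simp add: local_form_def)
      qed
    qed
    moreover have "ext_deriv M \<alpha> x (X x # vs) = ext_d dm (local_form M \<alpha> c) (\<xi> (snd c x) # ws) (snd c x)"
      using ext_deriv_eq_ext_d[OF x, of "X x # vs" \<alpha>] XT[OF x] vs
      by (simp add: c_def[symmetric] ws_def \<xi>_def cx)
    ultimately show ?thesis by (simp add: lie len \<xi>_def cx)
  qed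
qed

lemma basic_forms_iff:
  "\<alpha> \<in> basic_forms M F k \<longleftrightarrow> \<alpha> \<in> diff_forms M k \<and>
    (\<forall>L\<in>F. \<forall>x\<in>L. \<forall>v\<in>leaf_tangent_space M L x. \<forall>vs. \<alpha> x (v # vs) = 0 \<and> ext_deriv M \<alpha> x (v # vs) = 0)"
proof
  assume b: "\<alpha> \<in> basic_forms M F k"
  then have \<alpha>: "\<alpha> \<in> diff_forms M k" by (simp add: basic_forms_def)
  have "\<alpha> x (v # vs) = 0 \<and> ext_deriv M \<alpha> x (v # vs) = 0"
    if L: "L \<in> F" "x \<in> L" "v \<in> leaf_tangent_space M L x" for L x v vs
  proof -
    obtain X where X: "smooth_vector_field M X" "tangent_to M F X" "X x = v"
      by (rule extend_leaf_tangent_vector[OF L])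
    have *: "\<alpha> y (X y # us) = 0" "lie_deriv M X \<alpha> y us = 0" if "y \<in> mcarrier M" for y us
      using b X(1,2) that by (simp_all add: basic_forms_def interior_prod_def)
    have x: "x \<in> mcarrier M" by (rule leaves_in_carrier[OF L(1,2)])
    show ?thesis
      using *(1)[OF x] lie_deriv_horizontal[OF \<alpha> X(1) x *(1)] *(2)[OF x] by (simp add: X(3))
  qed
  with \<alpha> show "\<alpha> \<in> diff_forms M k \<and> (\<forall>L\<in>F. \<forall>x\<in>L. \<forall>v\<in>leaf_tangent_space M L x. \<forall>vs.
      \<alpha> x (v # vs) = 0 \<and> ext_deriv M \<alpha> x (v # vs) = 0)" by blast
next
  assume *: "\<alpha> \<in> diff_forms M k \<and> (\<forall>L\<in>F. \<forall>x\<in>L. \<forall>v\<in>leaf_tangent_space M L x. \<forall>vs.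
      \<alpha> x (v # vs) = 0 \<and> ext_deriv M \<alpha> x (v # vs) = 0)"
  then have \<alpha>: "\<alpha> \<in> diff_forms M k" by blast
  have "interior_prod X \<alpha> x vs = 0 \<and> lie_deriv M X \<alpha> x vs = 0"
    if X: "smooth_vector_field M X" "tangent_to M F X" and x: "x \<in> mcarrier M" for X x vs
  proof -
    have **: "\<alpha> y (X y # us) = 0 \<and> ext_deriv M \<alpha> y (X y # us) = 0" if y: "y \<in> mcarrier M" for y us
    proof -
      obtain L where L: "L \<in> F" "y \<in> L" using leaves_cover[OF y] by blast
      have "X y \<in> leaf_tangent_space M L y" using X(2) L by (simp add: tangent_to_def)
      with L * show ?thesis by blast
    qed
    show ?thesis
      using ** x lie_deriv_horizontal[OF \<alpha> X(1) x] by (simp add: interior_prod_def)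
  qed
  with \<alpha> show "\<alpha> \<in> basic_forms M F k" unfolding basic_forms_def by blast
qed

end

section \<open>Descending forms along submersions\<close>

text \<open>The arguments are exchanged one at a time, and each step changes the value by A of a
  difference. Vanishing in the first slot suffices, since alternation moves any slot there.\<close>

lemma multilinear_replace:
  assumes M: "multilinear n k A" and A: "alternating n k A"
    and ws: "length ws = k" "set ws \<subseteq> Rn n" and ws': "length ws' = k" "set ws' \<subseteq> Rn n"
    and kill: "\<And>i us. i < k \<Longrightarrow> Suc (length us) = k \<Longrightarrow> set us \<subseteq> Rn n \<Longrightarrow>
      A ((\<lambda>j. 1 * (ws' ! i) j + (- 1) * (ws ! i) j) # us) = 0"
  shows "A ws = A ws'"
proof -
  have "A (take j ws' @ drop j ws) = A ws" if "j \<le> k" for j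
    using that
  proof (induction j)
    case (Suc j)
    define L where "L = take j ws' @ drop j ws"
    have j: "j < k" using Suc.prems by simp
    have L: "length L = k" "set L \<subseteq> Rn n"
      using ws ws' j by (auto simp: L_def dest: in_set_takeD in_set_dropD)
    have wj: "ws ! j \<in> Rn n" "ws' ! j \<in> Rn n"
      using j ws ws' nth_mem[of j ws] nth_mem[of j ws'] by (auto simp del: topspace_Euclidean_space)
    define \<delta> where "\<delta> = (\<lambda>i. 1 * (ws' ! j) i + (- 1) * (ws ! j) i)"
    have \<delta>: "\<delta> \<in> Rn n" unfolding \<delta>_def by (rule lincomb_Rn[OF wj(2,1)])
    have "A (L[j := \<delta>]) = (-1) ^ j * A (\<delta> # del j L)"
      by (rule alternating_update[OF M A L \<delta> j])
    also have "A (\<delta> # del j L) = 0"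
      unfolding \<delta>_def by (rule kill[OF j]) (use L j set_del[of j L] in \<open>auto simp: length_del simp del: topspace_Euclidean_space\<close>)
    finally have "A (L[j := \<delta>]) = 0" by simp
    moreover have "A (L[j := \<delta>]) = 1 * A (L[j := ws' ! j]) + (- 1) * A (L[j := ws ! j])"
      unfolding \<delta>_def by (rule multilinearD[OF M L j wj(2,1)])
    moreover have "L[j := ws ! j] = L"
    proof -
      have "L ! j = ws ! j" using j ws ws' by (simp add: L_def nth_append)
      then show ?thesis by (metis list_update_id)
    qed
    moreover have "L[j := ws' ! j] = take (Suc j) ws' @ drop (Suc j) ws"
    proof -
      have "drop j ws = ws ! j # drop (Suc j) ws" using j ws by (simp add: Cons_nth_drop_Suc)
      moreover have "take (Suc j) ws' = take j ws' @ [ws' ! j]" using j ws' by (simp add: take_Suc_conv_app_nth)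
      ultimately show ?thesis using j ws ws' by (simp add: L_def list_update_append)
    qed
    ultimately have "A (take (Suc j) ws' @ drop (Suc j) ws) = A L" by simp
    then show ?case using Suc.IH Suc.prems by (simp add: L_def)
  qed simp
  from this[of k] show ?thesis using ws ws' by simp
qed

text \<open>The family \<open>\<phi>\<close> of coordinate vectors may leave the chart image; on the
  open set of parameters where it stays inside, it defines a plot. Vectors of the total space are
  shown in this way to be tangent to preimages of leaves.\<close>

lemma (in leaf) chart_plot_velocity:
  assumes c: "c \<in> charts_at M x" and Q: "openin (E r) Q" and u0: "u0 \<in> Q" and x: "\<phi> u0 = snd c x"
    and \<phi>: "\<And>u. u \<in> Q \<Longrightarrow> smooth_map_at r dm \<phi> u"
    and L: "\<And>u. u \<in> Q \<Longrightarrow> \<phi> u \<in> snd c ` fst c \<Longrightarrow> chart_inv c (\<phi> u) \<in> L"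
  shows "coord_vec M c x (jacobian_map r dm \<phi> u0 w) \<in> leaf_tangent_space M L x"
proof -
  note cA = charts_atD(1)[OF c]
  define Q' where "Q' = {u \<in> Q. \<phi> u \<in> snd c ` fst c}"
  have Q': "openin (E r) Q'"
    unfolding openin_iff_nb
  proof (intro conjI ballI)
    show "Q' \<subseteq> Rn r" using openin_Rn[OF Q] by (auto simp: Q'_def simp del: topspace_Euclidean_space)
    fix u assume "u \<in> Q'"
    then have u: "u \<in> Q" "\<phi> u \<in> snd c ` fst c" by (auto simp: Q'_def)
    have "eventually (\<lambda>u. \<phi> u \<in> snd c ` fst c) (nb r u)"
      by (rule eventually_smooth_map_at[OF \<phi>[OF u(1)] openin_eventually_nb[OF atlas_chart(3)[OF cA] u(2)]])
    with openin_eventually_nb[OF Q u(1)] show "eventually (\<lambda>u. u \<in> Q') (nb r u)"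
      by eventually_elim (simp add: Q'_def)
  qed
  have u0': "u0 \<in> Q'" using u0 x charts_atD(2)[OF c] by (simp add: Q'_def)
  have plot: "is_plot_of M L r Q' (\<lambda>u. chart_inv c (\<phi> u))"
    unfolding is_plot_of_def
  proof (intro conjI Q')
    show "smooth_into r Q' M (\<lambda>u. chart_inv c (\<phi> u))"
      by (rule smooth_into_chart_inv[OF Q' cA]) (use \<phi> in \<open>auto simp: Q'_def\<close>)
    show "(\<lambda>u. chart_inv c (\<phi> u)) ` Q' \<subseteq> L" using L by (auto simp: Q'_def)
  qed
  have "jacobian_map r dm (\<lambda>u. snd c (chart_inv c (\<phi> u))) u0 w = jacobian_map r dm \<phi> u0 w"
  proof (rule jacobian_map_cong)
    show "eventually (\<lambda>u. snd c (chart_inv c (\<phi> u)) = \<phi> u) (nb r u0)"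
      using openin_eventually_nb[OF Q' u0'] by eventually_elim (simp add: Q'_def chart_inv_right)
    show "u0 \<in> Rn r" using openin_Rn[OF Q] u0 by blast
  qed
  then show ?thesis
    by (intro plot_velocity_in_leaf_tangent[where w = w, OF plot u0' _ coord_vec_tangent[OF c] c])
       (simp_all add: x chart_inv_left[OF charts_atD[OF c]] coord_vec_same[OF c jacobian_map_Rn])
qed

text \<open>In adapted charts this projection is the tangent map of p, and its kernel consists of
  the vertical directions.\<close>

definition truncate :: "nat \<Rightarrow> (nat \<Rightarrow> real) \<Rightarrow> nat \<Rightarrow> real" where
  "truncate n w = (\<lambda>i. if i < n then w i else 0)"

section \<open>Charts adapted to a submersion\<close>

locale fibration = mfd_map M N p for M :: "'a manifold" and N :: "'b manifold" and p :: "'a \<Rightarrow> 'b" +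
  assumes fibration: "surj_submersion_conn_fibers M N p"
begin

text \<open>In such a pair of charts p is the projection onto the first \<open>N.dm\<close>
  coordinates. The cube makes the part of each fiber inside the chart convex.\<close>

definition adapted :: "'a chart \<Rightarrow> 'b chart \<Rightarrow> bool" where
  "adapted c d \<longleftrightarrow> c \<in> atlas M \<and> d \<in> atlas N \<and> N.dm \<le> M.dm \<and> (\<exists>z e. snd c ` fst c = cube M.dm z e) \<and>
     (\<forall>x\<in>fst c. p x \<in> fst d \<and> (\<forall>i<N.dm. snd c x i = snd d (p x) i))"

lemma tangent_map_surj:
  "x \<in> mcarrier M \<Longrightarrow> v \<in> tangent_space N (p x) \<Longrightarrow> \<exists>w\<in>tangent_space M x. tangent_map M N p x w = v"
proof -
  assume "x \<in> mcarrier M" "v \<in> tangent_space N (p x)"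
  then have "v \<in> tangent_map M N p x ` tangent_space M x"
    using fibration by (simp add: surj_submersion_conn_fibers_def submersion_def)
  then show ?thesis by auto
qed

lemma fiber_nonempty: "y \<in> mcarrier N \<Longrightarrow> \<exists>x\<in>mcarrier M. p x = y"
proof -
  assume "y \<in> mcarrier N"
  then have "y \<in> p ` mcarrier M" using fibration by (simp add: surj_submersion_conn_fibers_def)
  then show ?thesis by auto
qed

text \<open>The tangent map of p is onto, so the Jacobian of its coordinate representation is onto
  and \<open>submersion_normal_form\<close> applies; the straightened coordinates then become a
  chart with cube image.\<close>

lemma adapted_chart:
  assumes x: "x \<in> mcarrier M" and d: "d \<in> charts_at N (p x)"
  obtains c where "c \<in> charts_at M x" "adapted c d"
proof -
  define c0 where "c0 = chart_at M x"
  have c0: "c0 \<in> charts_at M x" unfolding c0_def by (rule M.chart_at_in[OF x])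
  have cx: "chart_inv c0 (snd c0 x) = x" by (rule M.chart_inv_left[OF charts_atD[OF c0]])
  have surj: "\<exists>u\<in>Rn M.dm. jacobian_map M.dm N.dm (rep c0 d) (snd c0 x) u = w" if w: "w \<in> Rn N.dm" for w
  proof -
    obtain v where v: "v \<in> tangent_space M x" "tangent_map M N p x v = coord_vec N d (p x) w"
      using tangent_map_surj[OF x N.coord_vec_tangent[OF d, of w]] by (elim bexE)
    have "jacobian_map M.dm N.dm (rep c0 d) (snd c0 x) (v c0) = w"
      using tangent_map_apply[OF v(1) c0 d] v(2) N.coord_vec_same[OF d w] by simp
    then show ?thesis using M.tangent_Rn[OF v(1) c0] by blast
  qed
  have "N.dm \<le> M.dm \<and> (\<exists>\<Theta> \<Psi>. local_diffeo M.dm (snd c0 x) \<Theta> \<Psi> \<and>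
      eventually (\<lambda>y. \<forall>i<N.dm. \<Theta> y i = rep c0 d y i) (nb M.dm (snd c0 x)))"
    by (rule submersion_normal_form[OF rep_smooth[OF c0 d]]) (rule surj)
  then obtain \<Theta> \<Psi> where dims: "N.dm \<le> M.dm" and D: "local_diffeo M.dm (snd c0 x) \<Theta> \<Psi>"
    and eq: "eventually (\<lambda>y. \<forall>i<N.dm. \<Theta> y i = rep c0 d y i) (nb M.dm (snd c0 x))" by (elim conjE exE)
  have P: "eventually (\<lambda>y. (\<forall>i<N.dm. \<Theta> y i = rep c0 d y i) \<and> p (chart_inv c0 y) \<in> fst d) (nb M.dm (snd c0 x))"
    using eq eventually_rep[OF c0 d] by eventually_elim simp
  obtain c e where c: "c \<in> charts_at M x" "fst c \<subseteq> fst c0"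
    and img: "snd c ` fst c = cube M.dm (\<Theta> (snd c0 x)) e"
    and coord: "\<And>x'. x' \<in> fst c \<Longrightarrow> snd c x' = \<Theta> (snd c0 x') \<and>
      ((\<forall>i<N.dm. \<Theta> (snd c0 x') i = rep c0 d (snd c0 x') i) \<and> p (chart_inv c0 (snd c0 x')) \<in> fst d)"
    by (rule M.reparametrized_chart[OF c0 D P]) blast
  have "p x' \<in> fst d \<and> (\<forall>i<N.dm. snd c x' i = snd d (p x') i)" if x': "x' \<in> fst c" for x'
    using coord[OF x'] M.chart_inv_left[OF charts_atD(1)[OF c0] subsetD[OF c(2) x']] by simp
  then have "adapted c d"
    unfolding adapted_def using charts_atD(1)[OF c(1)] charts_atD(1)[OF d] dims img by blast
  with c(1) show ?thesis by (rule that)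
qed

context
  fixes c d
  assumes cd: "adapted c d"
begin

lemma adapted_atlas: "c \<in> atlas M" "d \<in> atlas N" "N.dm \<le> M.dm"
  using cd by (auto simp: adapted_def)

lemma adapted_charts_at: "x \<in> fst c \<Longrightarrow> c \<in> charts_at M x" "x \<in> fst c \<Longrightarrow> d \<in> charts_at N (p x)"
  using cd by (auto simp: adapted_def charts_at_def)

lemma adapted_coord: "x \<in> fst c \<Longrightarrow> i < N.dm \<Longrightarrow> snd d (p x) i = snd c x i"
  using cd by (auto simp: adapted_def)

text \<open>Coordinates of points of N vanish from \<open>N.dm\<close> on, so agreement in the first
  \<open>N.dm\<close> ones determines the point.\<close>

lemma adapted_point:
  assumes y: "y \<in> snd c ` fst c" and z: "z \<in> fst d" and eq: "\<And>i. i < N.dm \<Longrightarrow> y i = snd d z i"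
  shows "p (chart_inv c y) = z"
proof -
  have x: "chart_inv c y \<in> fst c" "snd c (chart_inv c y) = y" using M.chart_inv_right[OF y] by auto
  have "snd d (p (chart_inv c y)) i = snd d z i" for i
  proof (cases "i < N.dm")
    case True
    then show ?thesis using adapted_coord[OF x(1) True] x(2) eq by simp
  next
    case False
    then show ?thesis
      using N.charts_at_coord_Rn[OF adapted_charts_at(2)[OF x(1)]] N.coord_Rn[OF adapted_atlas(2) z]
      by (simp add: mem_Rn)
  qed
  then have "snd d (p (chart_inv c y)) = snd d z" by auto
  then show ?thesis
    using N.atlas_chart(2)[OF adapted_atlas(2)] charts_atD(2)[OF adapted_charts_at(2)[OF x(1)]] z
    by (simp add: inj_on_eq_iff)
qed

lemma adapted_jacobian:
  assumes x: "x \<in> fst c" and w: "w \<in> Rn M.dm"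
  shows "jacobian_map M.dm N.dm (rep c d) (snd c x) w = truncate N.dm w"
proof
  fix i
  show "jacobian_map M.dm N.dm (rep c d) (snd c x) w i = truncate N.dm w i"
  proof (cases "i < N.dm")
    case True
    have "dir_deriv M.dm (\<lambda>y. rep c d y i) (snd c x) w = dir_deriv M.dm (\<lambda>y. y i) (snd c x) w"
    proof (rule dir_deriv_cong[OF _ M.coord_Rn[OF adapted_atlas(1) x]])
      show "eventually (\<lambda>y. rep c d y i = y i) (nb M.dm (snd c x))"
        using M.eventually_chart[OF adapted_charts_at(1)[OF x]]
        by eventually_elim (simp add: adapted_coord[OF M.chart_inv_right(1) True] M.chart_inv_right(2))
    qed
    then show ?thesis using True by (simp add: jacobian_map_nth dir_deriv_coord[OF w] truncate_def)
  qed (simp add: jacobian_map_def truncate_def)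
qed

lemma adapted_tangent_map:
  assumes x: "x \<in> fst c" and v: "v \<in> tangent_space M x"
  shows "tangent_map M N p x v d = truncate N.dm (v c)"
  using tangent_map_apply[OF v adapted_charts_at[OF x]]
    adapted_jacobian[OF x M.tangent_Rn[OF v adapted_charts_at(1)[OF x]]] by simp

lemma adapted_tangent_map_coord_vec:
  assumes x: "x \<in> fst c" and w: "w \<in> Rn M.dm"
  shows "tangent_map M N p x (coord_vec M c x w) = coord_vec N d (p x) (truncate N.dm w)"
  using tangent_map_coord_vec[OF adapted_charts_at[OF x] w] adapted_jacobian[OF x w] by simp

end

text \<open>An arbitrary choice, like that of \<open>tangent_lift\<close>;
  \<open>same_descent_fiber\<close> makes the descended form independent of both.\<close>

definition fiber_point :: "'b \<Rightarrow> 'a" where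
  "fiber_point y = (SOME x. x \<in> mcarrier M \<and> p x = y)"

definition tangent_lift :: "'a \<Rightarrow> 'b tvec \<Rightarrow> 'a tvec" where
  "tangent_lift x v = (SOME w. w \<in> tangent_space M x \<and> tangent_map M N p x w = v)"

lemma fiber_point: "y \<in> mcarrier N \<Longrightarrow> fiber_point y \<in> mcarrier M \<and> p (fiber_point y) = y"
proof -
  assume "y \<in> mcarrier N"
  from fiber_nonempty[OF this] have "\<exists>x. x \<in> mcarrier M \<and> p x = y" by auto
  then show ?thesis unfolding fiber_point_def by (rule someI_ex)
qed

lemma tangent_lift:
  assumes "x \<in> mcarrier M" "v \<in> tangent_space N (p x)"
  shows "tangent_lift x v \<in> tangent_space M x \<and> tangent_map M N p x (tangent_lift x v) = v"
proof -
  have "\<exists>w. w \<in> tangent_space M x \<and> tangent_map M N p x w = v" using tangent_map_surj[OF assms] by auto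
  then show ?thesis unfolding tangent_lift_def by (rule someI_ex)
qed

lemma map_tangent_lift:
  assumes x: "x \<in> mcarrier M" and vs: "set vs \<subseteq> tangent_space N (p x)"
  shows "set (map (tangent_lift x) vs) \<subseteq> tangent_space M x"
    and "map (tangent_map M N p x) (map (tangent_lift x) vs) = vs"
proof -
  have t: "tangent_lift x v \<in> tangent_space M x" "tangent_map M N p x (tangent_lift x v) = v" if "v \<in> set vs" for v
    using tangent_lift[OF x subsetD[OF vs that]] by auto
  show "set (map (tangent_lift x) vs) \<subseteq> tangent_space M x" using t(1) by auto
  show "map (tangent_map M N p x) (map (tangent_lift x) vs) = vs"
    unfolding map_map comp_def by (rule map_idI) (rule t(2))
qed

section \<open>Descent of forms that vanish on vertical vectors\<close>

definition vertical_annihilated :: "'a form \<Rightarrow> bool" where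
  "vertical_annihilated \<beta> \<longleftrightarrow> (\<forall>x\<in>mcarrier M. \<forall>v\<in>tangent_space M x.
     tangent_map M N p x v = (\<lambda>d i. 0) \<longrightarrow> (\<forall>vs. \<beta> x (v # vs) = 0 \<and> ext_deriv M \<beta> x (v # vs) = 0))"

context
  fixes \<beta> k
  assumes \<beta>: "\<beta> \<in> diff_forms M k" and vert: "vertical_annihilated \<beta>"
begin

lemma vertical_coord_vec:
  assumes cd: "adapted c d" and x: "x \<in> fst c" and w: "w \<in> Rn M.dm" "truncate N.dm w = (\<lambda>i. 0)"
  shows "\<beta> x (coord_vec M c x w # vs) = 0" "ext_deriv M \<beta> x (coord_vec M c x w # vs) = 0"
proof -
  note c = adapted_charts_at[OF cd x]
  have "tangent_map M N p x (coord_vec M c x w) = (\<lambda>d i. 0)"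
    unfolding adapted_tangent_map_coord_vec[OF cd x w(1)] w(2)
    by (simp add: coord_vec_def jacobian_map_def dir_deriv_def fun_eq_iff)
  with vert M.coord_vec_tangent[OF c(1)] M.charts_at_carrier[OF c(1)]
  show "\<beta> x (coord_vec M c x w # vs) = 0" "ext_deriv M \<beta> x (coord_vec M c x w # vs) = 0"
    unfolding vertical_annihilated_def by blast+
qed

lemma local_form_vertical:
  assumes cd: "adapted c d" and y: "y \<in> snd c ` fst c" and w: "w \<in> Rn M.dm" "truncate N.dm w = (\<lambda>i. 0)"
  shows "local_form M \<beta> c (w # ws) y = 0"
  using vertical_coord_vec(1)[OF cd M.chart_inv_right(1)[OF y] w] by (simp add: local_form_def)

text \<open>In d\<beta>(w, ws) every summand but the first keeps w among the arguments of \<beta>.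
  Those coefficients vanish on the whole chart, and so do their derivatives; the vanishing of
  d\<beta> on w then leaves the derivative along w.\<close>

lemma dir_deriv_vertical:
  assumes cd: "adapted c d" and y: "y \<in> snd c ` fst c" and w: "w \<in> Rn M.dm" "truncate N.dm w = (\<lambda>i. 0)"
    and ws: "length ws = k" "set ws \<subseteq> Rn M.dm"
  shows "dir_deriv M.dm (local_form M \<beta> c ws) y w = 0"
proof -
  define x where "x = chart_inv c y"
  have x: "x \<in> fst c" "snd c x = y" using M.chart_inv_right[OF y] by (simp_all add: x_def)
  note c = adapted_charts_at(1)[OF cd x(1)]
  have yR: "y \<in> Rn M.dm" using M.charts_at_coord_Rn[OF c] x(2) by simp
  define vs where "vs = map (coord_vec M c x) (w # ws)"
  have vs: "length vs = Suc k" "set vs \<subseteq> tangent_space M x"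
    using ws(1) M.coord_vec_tangent[OF c] by (auto simp: vs_def)
  have "map (\<lambda>v. v c) vs = w # ws"
    unfolding vs_def map_map comp_def
    by (rule map_idI) (use w(1) ws(2) M.coord_vec_same[OF c] in auto)
  then have "0 = ext_d M.dm (local_form M \<beta> c) (w # ws) y"
    using M.ext_deriv_chart[OF \<beta> c vs] vertical_coord_vec(2)[OF cd x(1) w] x(2) by (simp add: vs_def)
  moreover have "dir_deriv M.dm (local_form M \<beta> c (w # del i ws)) y v = 0" for i v
  proof -
    have "dir_deriv M.dm (local_form M \<beta> c (w # del i ws)) y v = dir_deriv M.dm (\<lambda>y. 0) y v"
    proof (rule dir_deriv_cong[OF _ yR])
      show "eventually (\<lambda>y. local_form M \<beta> c (w # del i ws) y = 0) (nb M.dm y)"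
        using openin_eventually_nb[OF M.atlas_chart(3)[OF adapted_atlas(1)[OF cd]] y]
        by eventually_elim (rule local_form_vertical[OF cd _ w])
    qed
    then show ?thesis by (simp add: dir_deriv_const)
  qed
  ultimately show ?thesis
    by (simp add: ext_d_def sum.lessThan_Suc_shift del_0 del_Suc del: sum.lessThan_Suc)
qed

text \<open>The two points differ by a vertical vector \<open>\<delta>\<close>. The segment between
  them stays in the cube, and the coefficient has derivative 0 along it.\<close>

lemma local_form_constant_on_fiber:
  assumes cd: "adapted c d" and y: "y1 \<in> snd c ` fst c" "y2 \<in> snd c ` fst c"
    and eq: "\<And>i. i < N.dm \<Longrightarrow> y1 i = y2 i" and ws: "length ws = k" "set ws \<subseteq> Rn M.dm"
  shows "local_form M \<beta> c ws y1 = local_form M \<beta> c ws y2"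
proof -
  obtain z e where img: "snd c ` fst c = cube M.dm z e" using cd by (auto simp: adapted_def)
  define \<delta> where "\<delta> i = y2 i - y1 i" for i
  have yR: "y1 \<in> Rn M.dm" "y2 \<in> Rn M.dm" using y unfolding img cube_def by auto
  have \<delta>: "\<delta> \<in> Rn M.dm" "truncate N.dm \<delta> = (\<lambda>i. 0)"
    using yR eq by (auto simp: \<delta>_def mem_Rn truncate_def fun_eq_iff)
  define Y where "Y t = (\<lambda>i. y1 i + t * \<delta> i)" for t :: real
  have Yin: "Y t \<in> snd c ` fst c" if t: "0 \<le> t" "t \<le> 1" for t
  proof -
    have "\<bar>Y t i - z i\<bar> < e" if i: "i < M.dm" for i
    proof -
      have "\<bar>y1 i - z i\<bar> < e" "\<bar>y2 i - z i\<bar> < e" using y i unfolding img cube_def by auto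
      moreover have "Y t i - z i = (1 - t) * (y1 i - z i) + t * (y2 i - z i)"
        by (simp add: Y_def \<delta>_def algebra_simps)
      moreover have "\<bar>(1 - t) * (y1 i - z i) + t * (y2 i - z i)\<bar> \<le> (1 - t) * \<bar>y1 i - z i\<bar> + t * \<bar>y2 i - z i\<bar>"
        using t by (intro order_trans[OF abs_triangle_ineq]) (simp add: abs_mult)
      moreover have "(1 - t) * \<bar>y1 i - z i\<bar> + t * \<bar>y2 i - z i\<bar> < e"
        using calculation(1,2) t by (intro convex_bound_lt) auto
      ultimately show ?thesis by linarith
    qed
    moreover have "Y t \<in> Rn M.dm" using yR \<delta> by (simp add: Y_def mem_Rn)
    ultimately show ?thesis unfolding img cube_def by blast
  qed
  have der: "((\<lambda>t. local_form M \<beta> c ws (Y t)) has_real_derivative 0) (at t)" if t: "0 \<le> t" "t \<le> 1" for t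
  proof -
    define x where "x = chart_inv c (Y t)"
    have x: "x \<in> fst c" "snd c x = Y t" using M.chart_inv_right[OF Yin[OF t]] by (simp_all add: x_def)
    have "smooth_at M.dm (local_form M \<beta> c ws) (Y t)"
      using form_germD(5)[OF M.local_form_germ[OF \<beta> adapted_charts_at(1)[OF cd x(1)]] ws] x(2) by simp
    from smooth_at_DERIV_line[OF this \<delta>(1)]
    have "((\<lambda>s. local_form M \<beta> c ws (\<lambda>i. Y t i + s * \<delta> i)) has_real_derivative 0) (at 0)"
      by (simp add: dir_deriv_vertical[OF cd Yin[OF t] \<delta> ws])
    moreover have "(\<lambda>i. Y t i + s * \<delta> i) = Y (s + t)" for s by (simp add: Y_def algebra_simps)
    ultimately have "((\<lambda>s. local_form M \<beta> c ws (Y (s + t))) has_real_derivative 0) (at 0)" by simp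
    then show ?thesis using DERIV_shift[of "\<lambda>s. local_form M \<beta> c ws (Y s)" 0 0 t] by simp
  qed
  obtain t where "local_form M \<beta> c ws (Y 1) - local_form M \<beta> c ws (Y 0) = (1 - 0) * 0"
    using MVT2[of 0 1 "\<lambda>t. local_form M \<beta> c ws (Y t)" "\<lambda>t. 0"] der by auto
  moreover have "Y 0 = y1" "Y 1 = y2" by (simp_all add: Y_def \<delta>_def)
  ultimately show ?thesis by simp
qed

text \<open>For points of one fiber: \<beta> at x and at x' induces the same values on vectors of N.
  All lifts are allowed, so the relation also contains independence of the lifts chosen.\<close>

definition same_descent :: "'a \<Rightarrow> 'a \<Rightarrow> bool" where
  "same_descent x x' \<longleftrightarrow> (\<forall>vs vs'. set vs \<subseteq> tangent_space M x \<and> set vs' \<subseteq> tangent_space M x' \<and>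
     map (tangent_map M N p x) vs = map (tangent_map M N p x') vs' \<longrightarrow> \<beta> x vs = \<beta> x' vs')"

text \<open>Two moves inside one adapted chart: the base point changes along the fiber while the
  coordinates of the arguments stay fixed, then the arguments are replaced by others that differ
  from them by vertical vectors.\<close>

lemma same_descent_local:
  assumes cd: "adapted c d" and x: "x \<in> fst c" "x' \<in> fst c" and px: "p x = p x'"
  shows "same_descent x x'"
  unfolding same_descent_def
proof (intro allI impI, elim conjE)
  fix vs vs'
  assume vs: "set vs \<subseteq> tangent_space M x" and vs': "set vs' \<subseteq> tangent_space M x'"
    and T: "map (tangent_map M N p x) vs = map (tangent_map M N p x') vs'"
  have len: "length vs = length vs'" using T by (rule map_eq_imp_length_eq)
  note c = adapted_charts_at(1)[OF cd x(1)] and c' = adapted_charts_at(1)[OF cd x(2)]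
  show "\<beta> x vs = \<beta> x' vs'"
  proof (cases "length vs = k")
    case False
    then show ?thesis using diff_forms_outside[OF \<beta>] len by metis
  next
    case True
    define ws where "ws = map (\<lambda>v. v c) vs"
    define ws' where "ws' = map (\<lambda>v. v c) vs'"
    have ws: "length ws = k" "set ws \<subseteq> Rn M.dm"
      using True M.map_coords_Rn[OF c vs] by (simp_all add: ws_def)
    have ws': "length ws' = k" "set ws' \<subseteq> Rn M.dm"
      using True len M.map_coords_Rn[OF c' vs'] by (simp_all add: ws'_def)
    have "\<beta> x vs = local_form M \<beta> c ws (snd c x)"
      unfolding ws_def by (rule M.local_form_apply[OF c vs, symmetric])
    also have "\<dots> = local_form M \<beta> c ws (snd c x')"
      by (rule local_form_constant_on_fiber[OF cd _ _ _ ws])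
         (use x px adapted_coord[OF cd x(1)] adapted_coord[OF cd x(2)] in auto)
    also have "\<dots> = local_form M \<beta> c ws' (snd c x')"
    proof -
      note germ = M.local_form_germ[OF \<beta> c']
      show ?thesis
      proof (rule multilinear_replace[OF form_germD(3,4)[OF germ] ws ws'])
        fix i us assume i: "i < k"
        have "tangent_map M N p x (vs ! i) = tangent_map M N p x' (vs' ! i)"
          using arg_cong[OF T, of "\<lambda>l. l ! i"] i True len by simp
        moreover have "vs ! i \<in> tangent_space M x" "vs' ! i \<in> tangent_space M x'"
          using vs vs' i True len nth_mem[of i vs] nth_mem[of i vs'] by auto
        ultimately have "truncate N.dm ((vs ! i) c) = truncate N.dm ((vs' ! i) c)"
          using adapted_tangent_map[OF cd x(1)] adapted_tangent_map[OF cd x(2)] by metis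
        then have tr: "truncate N.dm (ws ! i) = truncate N.dm (ws' ! i)"
          using i True len by (simp add: ws_def ws'_def)
        have wi: "ws ! i \<in> Rn M.dm" "ws' ! i \<in> Rn M.dm"
          using i ws ws' nth_mem[of i ws] nth_mem[of i ws'] by (auto simp del: topspace_Euclidean_space)
        have tr0: "truncate N.dm (\<lambda>j. 1 * (ws' ! i) j + (- 1) * (ws ! i) j) = (\<lambda>j. 0)"
        proof
          fix j show "truncate N.dm (\<lambda>j. 1 * (ws' ! i) j + (- 1) * (ws ! i) j) j = 0"
            using fun_cong[OF tr, of j] by (simp add: truncate_def split: if_splits)
        qed
        show "local_form M \<beta> c ((\<lambda>j. 1 * (ws' ! i) j + (- 1) * (ws ! i) j) # us) (snd c x') = 0"
          by (rule local_form_vertical[OF cd imageI[OF x(2)] lincomb_Rn[OF wi(2,1)] tr0])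
      qed
    qed
    also have "\<dots> = \<beta> x' vs'" unfolding ws'_def by (rule M.local_form_apply[OF c' vs'])
    finally show ?thesis .
  qed
qed

text \<open>Arguments at the middle point are produced by lifting, which the surjectivity of the
  tangent map there permits.\<close>

lemma same_descent_trans:
  assumes x': "x' \<in> mcarrier M" and x: "x \<in> mcarrier M" and px: "p x = p x'" and R: "same_descent x x'" "same_descent x' x''"
  shows "same_descent x x''"
  unfolding same_descent_def
proof (intro allI impI, elim conjE)
  fix vs vs''
  assume vs: "set vs \<subseteq> tangent_space M x" and vs'': "set vs'' \<subseteq> tangent_space M x''"
    and T: "map (tangent_map M N p x) vs = map (tangent_map M N p x'') vs''"
  have "\<exists>w. w \<in> tangent_space M x' \<and> tangent_map M N p x' w = tangent_map M N p x v" if "v \<in> set vs" for v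
  proof -
    have "tangent_map M N p x v \<in> tangent_space N (p x')"
      unfolding px[symmetric] using that vs by (intro tangent_map_tangent[OF _ x]) blast
    from tangent_map_surj[OF x' this] show ?thesis by blast
  qed
  then obtain f where f: "\<And>v. v \<in> set vs \<Longrightarrow> f v \<in> tangent_space M x' \<and> tangent_map M N p x' (f v) = tangent_map M N p x v"
    by metis
  have 1: "set (map f vs) \<subseteq> tangent_space M x'" using f by auto
  have 2: "map (tangent_map M N p x) vs = map (tangent_map M N p x') (map f vs)" using f by simp
  have "\<beta> x vs = \<beta> x' (map f vs)" using R(1) vs 1 2 unfolding same_descent_def by blast
  also have "\<dots> = \<beta> x'' vs''" using R(2) vs'' 1 2 T unfolding same_descent_def by metis
  finally show "\<beta> x vs = \<beta> x'' vs''" .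
qed

text \<open>A connectedness argument: chart domains about the points related to x and chart domains
  about the unrelated ones cover the fiber. They cannot meet on the fiber, since a common point
  would transport the relation from one kind of point to the other.\<close>

lemma same_descent_fiber:
  assumes x: "x \<in> mcarrier M" "x' \<in> mcarrier M" and px: "p x = p x'"
  shows "same_descent x x'"
proof (rule ccontr)
  assume neg: "\<not> same_descent x x'"
  define Fb where "Fb = {z \<in> mcarrier M. p z = p x}"
  have conn: "connectedin (mtopology M) Fb"
    using fibration p_carrier[OF x(1)] by (simp add: surj_submersion_conn_fibers_def Fb_def)
  have "\<exists>c d. z \<in> fst c \<and> adapted c d" if z: "z \<in> mcarrier M" for z
  proof -
    obtain c where c: "c \<in> charts_at M z" "adapted c (chart_at N (p z))"
      by (rule adapted_chart[OF z N.chart_at_in[OF p_carrier[OF z]]])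
    show ?thesis using charts_atD(2)[OF c(1)] c(2) by blast
  qed
  then obtain C D where C: "\<And>z. z \<in> mcarrier M \<Longrightarrow> z \<in> fst (C z) \<and> adapted (C z) (D z)" by metis
  have CF: "z \<in> fst (C z)" "adapted (C z) (D z)" "openin (mtopology M) (fst (C z))" if "z \<in> Fb" for z
    using C[of z] that M.openin_chart[of "C z"] adapted_atlas(1)[of "C z" "D z"] by (auto simp: Fb_def)
  define E1 where "E1 = (\<Union>z\<in>{z \<in> Fb. same_descent x z}. fst (C z))"
  define E2 where "E2 = (\<Union>z\<in>{z \<in> Fb. \<not> same_descent x z}. fst (C z))"
  have op: "openin (mtopology M) E1" "openin (mtopology M) E2"
    unfolding E1_def E2_def by (rule openin_Union; use CF(3) in auto)+
  have cover: "Fb \<subseteq> E1 \<union> E2"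
  proof
    fix z assume "z \<in> Fb"
    then show "z \<in> E1 \<union> E2" using CF(1)[of z] by (cases "same_descent x z") (auto simp: E1_def E2_def)
  qed
  have disj: "E1 \<inter> E2 \<inter> Fb = {}"
  proof (rule ccontr)
    assume "E1 \<inter> E2 \<inter> Fb \<noteq> {}"
    then obtain a z1 z2 where a: "a \<in> Fb" "z1 \<in> Fb" "same_descent x z1" "a \<in> fst (C z1)"
      "z2 \<in> Fb" "\<not> same_descent x z2" "a \<in> fst (C z2)"
      by (auto simp: E1_def E2_def)
    have "same_descent z1 a"
      by (rule same_descent_local[OF CF(2)[OF a(2)] CF(1)[OF a(2)] a(4)]) (use a in \<open>simp add: Fb_def\<close>)
    then have xa: "same_descent x a"
      by (intro same_descent_trans[of z1 x a]) (use a x in \<open>simp_all add: Fb_def\<close>)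
    have "same_descent a z2"
      by (rule same_descent_local[OF CF(2)[OF a(5)] a(7) CF(1)[OF a(5)]]) (use a in \<open>simp add: Fb_def\<close>)
    with xa have "same_descent x z2"
      by (intro same_descent_trans[of a x z2]) (use a x in \<open>simp_all add: Fb_def\<close>)
    with a(6) show False by blast
  qed
  have xF: "x \<in> Fb" "x' \<in> Fb" using x px by (simp_all add: Fb_def)
  have "same_descent x x" by (rule same_descent_local[OF CF(2)[OF xF(1)] CF(1)[OF xF(1)] CF(1)[OF xF(1)] refl])
  then have "x \<in> E1" using CF(1)[OF xF(1)] xF(1) by (auto simp: E1_def)
  moreover have "x' \<in> E2" using CF(1)[OF xF(2)] xF(2) neg by (auto simp: E2_def)
  ultimately show False
    using conn op cover disj xF unfolding connectedin by blast
qed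

definition descended :: "'b form" where
  "descended y vs = (if y \<in> mcarrier N \<and> length vs = k \<and> set vs \<subseteq> tangent_space N y
     then \<beta> (fiber_point y) (map (tangent_lift (fiber_point y)) vs) else 0)"

lemma descended_apply:
  assumes x: "x \<in> mcarrier M" and ws: "set ws \<subseteq> tangent_space M x"
  shows "descended (p x) (map (tangent_map M N p x) ws) = \<beta> x ws"
proof (cases "length ws = k")
  case False
  then show ?thesis using diff_forms_outside[OF \<beta>, of x ws] by (simp add: descended_def)
next
  case True
  define x0 where "x0 = fiber_point (p x)"
  have x0: "x0 \<in> mcarrier M" "p x0 = p x" using fiber_point[OF p_carrier[OF x]] by (simp_all add: x0_def)
  have T: "set (map (tangent_map M N p x) ws) \<subseteq> tangent_space N (p x0)"
    unfolding x0(2) using ws tangent_map_tangent[OF _ x] by (auto simp: subset_iff)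
  have "\<beta> x0 (map (tangent_lift x0) (map (tangent_map M N p x) ws)) = \<beta> x ws"
    using same_descent_fiber[OF x0(1) x x0(2)] map_tangent_lift[OF x0(1) T] ws
    unfolding same_descent_def by blast
  then show ?thesis
    using T p_carrier[OF x] True by (simp add: descended_def x0_def[symmetric] x0(2))
qed

lemma pullback_descended: "pullback M N p descended = \<beta>"
proof (intro ext)
  fix x vs show "pullback M N p descended x vs = \<beta> x vs"
    using descended_apply[of x vs] diff_forms_outside[OF \<beta>, of x vs] by (auto simp: pullback_def)
qed

text \<open>Freezing the fiber coordinates at those of x gives a local section
  \<open>\<iota>\<close> in adapted coordinates; the coefficients of the descended form are those of
  \<beta> along this section.\<close>

lemma descended_smooth:
  assumes d: "d \<in> atlas N" and js: "length js = k" "set js \<subseteq> {..<N.dm}" and y: "y \<in> fst d"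
  shows "smooth_at N.dm (local_form N descended d (map unit_vec js)) (snd d y)"
proof -
  have dy: "d \<in> charts_at N y" using d y by (simp add: charts_at_def)
  obtain x where x: "x \<in> mcarrier M" "p x = y" using fiber_nonempty[OF N.charts_at_carrier[OF dy]] by blast
  obtain c where c: "c \<in> charts_at M x" and cd: "adapted c d"
    by (rule adapted_chart[OF x(1), of d]) (simp add: x(2) dy)
  note xc = charts_atD(2)[OF c]
  have dims: "N.dm \<le> M.dm" by (rule adapted_atlas(3)[OF cd])
  have yR: "snd d y \<in> Rn N.dm" by (rule N.charts_at_coord_Rn[OF dy])
  define \<iota> where "\<iota> z i = (if i < N.dm then z i else snd c x i)" for z i
  have \<iota>0: "\<iota> (snd d y) = snd c x"
    using adapted_coord[OF cd xc] by (auto simp: \<iota>_def x(2) fun_eq_iff)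
  have \<iota>: "smooth_map_at N.dm M.dm \<iota> (snd d y)"
    unfolding smooth_map_at_def
  proof (intro conjI yR allI impI)
    have "\<iota> z \<in> Rn M.dm" for z
      using M.charts_at_coord_Rn[OF c] dims by (auto simp: \<iota>_def mem_Rn)
    then show "eventually (\<lambda>z. \<iota> z \<in> Rn M.dm) (nb N.dm (snd d y))" by (simp only: eventually_True)
    show "smooth_at N.dm (\<lambda>z. \<iota> z i) (snd d y)" for i
      unfolding \<iota>_def by (cases "i < N.dm") (simp_all add: smooth_at_coord smooth_at_const yR)
  qed
  have units: "set (map unit_vec js) \<subseteq> Rn M.dm"
    using js(2) dims by (auto simp: mem_Rn unit_vec_def)
  have "smooth_at N.dm (\<lambda>z. local_form M \<beta> c (map unit_vec js) (\<iota> z)) (snd d y)"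
    by (rule smooth_at_compose[OF \<iota>])
       (use form_germD(5)[OF M.local_form_germ[OF \<beta> c] _ units] js(1) in \<open>simp add: \<iota>0\<close>)
  then show ?thesis
  proof (rule smooth_at_cong)
    have "eventually (\<lambda>z. \<iota> z \<in> snd c ` fst c) (nb N.dm (snd d y))"
      by (rule eventually_smooth_map_at[OF \<iota>]) (use M.eventually_chart[OF c] in \<open>simp add: \<iota>0\<close>)
    with N.eventually_chart[OF dy]
    show "eventually (\<lambda>z. local_form M \<beta> c (map unit_vec js) (\<iota> z) =
        local_form N descended d (map unit_vec js) z) (nb N.dm (snd d y))"
    proof eventually_elim
      case (elim z)
      define x' where "x' = chart_inv c (\<iota> z)"
      have x': "x' \<in> fst c" unfolding x'_def by (rule M.chart_inv_right(1)[OF elim(2)])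
      note c' = adapted_charts_at(1)[OF cd x']
      have px': "p x' = chart_inv d z"
        unfolding x'_def
        by (rule adapted_point[OF cd elim(2) N.chart_inv_right(1)[OF elim(1)]])
           (simp add: \<iota>_def N.chart_inv_right(2)[OF elim(1)])
      have "map (tangent_map M N p x') (map (coord_vec M c x') (map unit_vec js)) =
          map (coord_vec N d (chart_inv d z)) (map unit_vec js)"
        unfolding map_map
      proof (rule map_cong[OF refl], simp only: comp_def)
        fix j assume "j \<in> set js"
        then have j: "j < N.dm" using js(2) by blast
        then have "unit_vec j \<in> Rn M.dm" using dims by (intro unit_vec_Rn) simp
        moreover have "truncate N.dm (unit_vec j) = unit_vec j"
          using j by (auto simp: truncate_def unit_vec_def fun_eq_iff)
        ultimately show "tangent_map M N p x' (coord_vec M c x' (unit_vec j)) = coord_vec N d (chart_inv d z) (unit_vec j)"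
          using adapted_tangent_map_coord_vec[OF cd x'] by (simp add: px')
      qed
      moreover have "set (map (coord_vec M c x') (map unit_vec js)) \<subseteq> tangent_space M x'"
        using M.coord_vec_tangent[OF c'] by auto
      ultimately show ?case
        using descended_apply[OF M.charts_at_carrier[OF c']]
        unfolding local_form_def x'_def[symmetric] by (metis px')
    qed
  qed
qed

lemma descended_diff_form: "descended \<in> diff_forms N k"
  unfolding diff_forms_def mem_Collect_eq
proof (intro conjI allI impI ballI)
  fix y vs assume "\<not> (y \<in> mcarrier N \<and> length vs = k \<and> set vs \<subseteq> tangent_space N y)"
  then show "descended y vs = 0" by (auto simp: descended_def)
next
  fix y vs i u w a b
  assume y: "y \<in> mcarrier N" and vs: "length vs = k \<and> set vs \<subseteq> tangent_space N y" and i: "i < k"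
    and uw: "u \<in> tangent_space N y" "w \<in> tangent_space N y"
  define x where "x = fiber_point y"
  have x: "x \<in> mcarrier M" "p x = y" using fiber_point[OF y] by (simp_all add: x_def)
  define ws where "ws = map (tangent_lift x) vs"
  have ws: "set ws \<subseteq> tangent_space M x" "map (tangent_map M N p x) ws = vs" "length ws = k"
    using map_tangent_lift[OF x(1), of vs] vs by (simp_all add: ws_def x(2))
  define u' where "u' = tangent_lift x u"
  define w' where "w' = tangent_lift x w"
  have u': "u' \<in> tangent_space M x" "tangent_map M N p x u' = u"
    using tangent_lift[OF x(1), of u] uw by (simp_all add: u'_def x(2))
  have w': "w' \<in> tangent_space M x" "tangent_map M N p x w' = w"
    using tangent_lift[OF x(1), of w] uw by (simp_all add: w'_def x(2))
  \<comment> \<open>\<open>tangent_lift\<close> is a pointwise choice and need not be linear, so the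
    lift of a combination may differ from the combination of the lifts.
    \<open>descended_apply\<close> permits computing with any lifts instead.\<close>
  have app: "descended y (vs[i := tangent_map M N p x z]) = \<beta> x (ws[i := z])" if z: "z \<in> tangent_space M x" for z
  proof -
    have "set (ws[i := z]) \<subseteq> tangent_space M x"
      using ws(1) z by (meson insert_subset order_trans set_update_subset_insert)
    from descended_apply[OF x(1) this] show ?thesis by (simp add: map_update ws(2) x(2))
  qed
  have "descended y (vs[i := tv_lincomb a u b w]) = \<beta> x (ws[i := tv_lincomb a u' b w'])"
    using app[OF M.tv_lincomb_tangent[OF u'(1) w'(1) x(1)], of a b] by (simp add: tangent_map_lincomb u'(2) w'(2))
  also have "\<dots> = a * \<beta> x (ws[i := u']) + b * \<beta> x (ws[i := w'])"
    by (rule diff_forms_lincomb[OF \<beta> x(1) ws(3,1) i u'(1) w'(1)])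
  also have "\<dots> = a * descended y (vs[i := u]) + b * descended y (vs[i := w])"
    using app[OF u'(1)] app[OF w'(1)] by (simp add: u'(2) w'(2))
  finally show "descended y (vs[i := tv_lincomb a u b w]) = a * descended y (vs[i := u]) + b * descended y (vs[i := w])" .
next
  fix y vs i j
  assume y: "y \<in> mcarrier N" and vs: "length vs = k \<and> set vs \<subseteq> tangent_space N y" and i: "i < k" "j < k"
    and eq: "i \<noteq> j \<and> vs ! i = vs ! j"
  have x: "fiber_point y \<in> mcarrier M" "p (fiber_point y) = y" using fiber_point[OF y] by simp_all
  have "set (map (tangent_lift (fiber_point y)) vs) \<subseteq> tangent_space M (fiber_point y)"
    using map_tangent_lift(1)[OF x(1), of vs] vs x(2) by simp
  \<comment> \<open>Equal entries of vs have equal lifts because \<open>tangent_lift\<close> is a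
    function, so alternation is inherited from \<beta>.\<close>
  then have "\<beta> (fiber_point y) (map (tangent_lift (fiber_point y)) vs) = 0"
    using vs i eq by (intro diff_forms_alternating[OF \<beta> x(1) _ _ i]) simp_all
  then show "descended y vs = 0" by (simp add: descended_def)
next
  fix d js assume d: "d \<in> atlas N" and js: "length js = k \<and> set js \<subseteq> {..<N.dm}"
  have "smooth_fun_on N.dm (snd d ` fst d) (local_form N descended d (map unit_vec js))"
    unfolding smooth_fun_on_iff[OF N.atlas_chart(3)[OF d]]
    using descended_smooth[OF d] js by blast
  then show "smooth_fun_on N.dm (snd d ` fst d)
      (\<lambda>y. descended (chart_inv d y) (map (\<lambda>j. coord_vec N d (chart_inv d y) (unit_vec j)) js))"
    by (simp add: local_form_def[abs_def] comp_def)
qed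

end

end

section \<open>Basic forms along foliated submersions\<close>

locale foliated_fibration =
  fibration M N p + down: foliation N F + up: foliation M "pullback_foliation M p F"
  for M :: "'a manifold" and N :: "'b manifold" and p :: "'a \<Rightarrow> 'b" and F :: "'b set set"
begin

abbreviation "pre L \<equiv> {x \<in> mcarrier M. p x \<in> L}"

lemma pre_leaf: "L \<in> F \<Longrightarrow> pre L \<in> pullback_foliation M p F"
  by (simp add: pullback_foliation_def)

lemma leaf_tangent_push:
  assumes L: "L \<in> F" and x: "x \<in> pre L" and v: "v \<in> leaf_tangent_space M (pre L) x"
  shows "tangent_map M N p x v \<in> leaf_tangent_space N L (p x)"
proof -
  interpret l: leaf N L by (rule down.leafI[OF L])
  interpret l': leaf M "pre L" by (rule up.leafI[OF pre_leaf[OF L]])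
  have xM: "x \<in> mcarrier M" using x by simp
  have vT: "v \<in> tangent_space M x" using l'.leaf_tangent_subset[OF x] v by blast
  define c where "c = chart_at M x"
  define d where "d = chart_at N (p x)"
  have c: "c \<in> charts_at M x" unfolding c_def by (rule M.chart_at_in[OF xM])
  have d: "d \<in> charts_at N (p x)" unfolding d_def by (rule N.chart_at_in[OF p_carrier[OF xM]])
  obtain r Q q u w where q: "is_plot_of M (pre L) r Q q" "u \<in> Q" "q u = x"
    and vc: "\<forall>c\<in>charts_at M x. v c = jacobian_map r M.dm (\<lambda>y. snd c (q y)) u w"
    by (rule l'.leaf_tangent_plot[OF v x])
  have pL: "p ` pre L \<subseteq> L" by auto
  have "tangent_map M N p x v d = jacobian_map r N.dm (\<lambda>y. snd d (p (q y))) u w"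
    using plot_compose(2)[OF q(1) pL q(2), of c d w] tangent_map_apply[OF vT c d] bspec[OF vc c] c d by (simp add: q(3))
  then show ?thesis
    by (intro l.plot_velocity_in_leaf_tangent[OF plot_compose(1)[OF q(1) pL] q(2) _ tangent_map_tangent[OF vT xM] d])
       (simp_all add: q(3))
qed

text \<open>In adapted coordinates the line through x with direction \<open>v c\<close> does not
  move the first \<open>N.dm\<close> coordinates. It stays in one fiber of p, hence in the preimage
  of L, and is a one-parameter plot with velocity v.\<close>

lemma vertical_leaf_tangent:
  assumes L: "L \<in> F" and x: "x \<in> pre L" and v: "v \<in> tangent_space M x" "tangent_map M N p x v = (\<lambda>d i. 0)"
  shows "v \<in> leaf_tangent_space M (pre L) x"
proof -
  interpret l': leaf M "pre L" by (rule up.leafI[OF pre_leaf[OF L]])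
  have xM: "x \<in> mcarrier M" using x by simp
  define d where "d = chart_at N (p x)"
  have d: "d \<in> charts_at N (p x)" unfolding d_def by (rule N.chart_at_in[OF p_carrier[OF xM]])
  obtain c where c: "c \<in> charts_at M x" and cd: "adapted c d" by (rule adapted_chart[OF xM d])
  note xc = charts_atD(2)[OF c]
  have vR: "v c \<in> Rn M.dm" by (rule M.tangent_Rn[OF v(1) c])
  have xR: "snd c x \<in> Rn M.dm" by (rule M.charts_at_coord_Rn[OF c])
  have "truncate N.dm (v c) = (\<lambda>i. 0)" using adapted_tangent_map[OF cd xc v(1)] v(2) by simp
  then have v0: "v c i = 0" if "i < N.dm" for i using that by (auto simp: truncate_def fun_eq_iff split: if_splits)
  define \<phi> where "\<phi> u i = snd c x i + u 0 * v c i" for u :: "nat \<Rightarrow> real" and i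
  have \<phi>s: "smooth_at 1 (\<lambda>u. \<phi> u i) u" if "u \<in> Rn 1" for u i
    unfolding \<phi>_def using that by (intro smooth_at_add smooth_at_mult smooth_at_const smooth_at_coord)
  have \<phi>R: "\<phi> u \<in> Rn M.dm" for u using xR vR by (simp add: \<phi>_def mem_Rn)
  have "coord_vec M c x (jacobian_map 1 M.dm \<phi> (\<lambda>i. 0) (unit_vec 0)) \<in> leaf_tangent_space M (pre L) x"
  proof (rule l'.chart_plot_velocity[where \<phi> = \<phi> and Q = "Rn 1", OF c])
    show "openin (E 1) (Rn 1)" by (rule openin_topspace)
    show "(\<lambda>i. 0) \<in> Rn 1" by (rule zero_Rn)
    show "\<phi> (\<lambda>i. 0) = snd c x" by (simp add: \<phi>_def fun_eq_iff)
    show "smooth_map_at 1 M.dm \<phi> u" if "u \<in> Rn 1" for u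
      using that \<phi>s[OF that] \<phi>R by (simp only: smooth_map_at_def eventually_True simp_thms)
    show "chart_inv c (\<phi> u) \<in> pre L" if u: "u \<in> Rn 1" "\<phi> u \<in> snd c ` fst c" for u
    proof -
      have "p (chart_inv c (\<phi> u)) = p x"
        by (rule adapted_point[OF cd u(2) charts_atD(2)[OF d]])
           (simp add: \<phi>_def v0 adapted_coord[OF cd xc])
      moreover have "chart_inv c (\<phi> u) \<in> mcarrier M"
        by (rule subsetD[OF M.atlas_chart(1)[OF charts_atD(1)[OF c]] M.chart_inv_right(1)[OF u(2)]])
      ultimately show ?thesis using x by simp
    qed
  qed
  moreover have "jacobian_map 1 M.dm \<phi> (\<lambda>i. 0) (unit_vec 0) = v c"
  proof
    fix i
    have "partial 0 (\<lambda>u. \<phi> u i) (\<lambda>i. 0) = v c i"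
      by (rule partial_eqI) (auto simp: \<phi>_def intro!: derivative_eq_intros)
    then show "jacobian_map 1 M.dm \<phi> (\<lambda>i. 0) (unit_vec 0) i = v c i"
      using vR by (auto simp: jacobian_map_def dir_deriv_unit_vec mem_Rn)
  qed
  ultimately show ?thesis using M.coord_vec_tangent_eq[OF v(1) c] by simp
qed

text \<open>A plot of L is lifted by using its coordinates for the base and freezing the fiber
  coordinates at those of x; the velocity of the lift projects to v.\<close>

lemma leaf_tangent_lift:
  assumes L: "L \<in> F" and x: "x \<in> pre L" and v: "v \<in> leaf_tangent_space N L (p x)"
  shows "\<exists>w\<in>leaf_tangent_space M (pre L) x. tangent_map M N p x w = v"
proof -
  interpret l: leaf N L by (rule down.leafI[OF L])
  interpret l': leaf M "pre L" by (rule up.leafI[OF pre_leaf[OF L]])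
  have xM: "x \<in> mcarrier M" and pxL: "p x \<in> L" using x by simp_all
  have vT: "v \<in> tangent_space N (p x)" using l.leaf_tangent_subset[OF pxL] v by blast
  define d where "d = chart_at N (p x)"
  have d: "d \<in> charts_at N (p x)" unfolding d_def by (rule N.chart_at_in[OF p_carrier[OF xM]])
  obtain c where c: "c \<in> charts_at M x" and cd: "adapted c d" by (rule adapted_chart[OF xM d])
  note xc = charts_atD(2)[OF c] and dims = adapted_atlas(3)[OF cd]
  have xR: "snd c x \<in> Rn M.dm" by (rule M.charts_at_coord_Rn[OF c])
  obtain r Q q u w where q: "is_plot_of N L r Q q" "u \<in> Q" "q u = p x"
    and vd: "\<forall>d\<in>charts_at N (p x). v d = jacobian_map r N.dm (\<lambda>y. snd d (q y)) u w"
    by (rule l.leaf_tangent_plot[OF v pxL])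
  have Q: "openin (E r) Q" and qs: "smooth_into r Q N q" and qL: "q ` Q \<subseteq> L"
    using q(1) by (auto simp: is_plot_of_def)
  \<comment> \<open>The lift is formed in the chart d, so the plot is restricted to the parameters
    that it sends into the domain of d.\<close>
  define Q' where "Q' = {u \<in> Q. q u \<in> fst d}"
  have dq: "d \<in> charts_at N (q u)" if "u \<in> Q'" for u
    using that charts_atD(1)[OF d] by (simp add: Q'_def charts_at_def)
  have Q': "openin (E r) Q'"
    unfolding openin_iff_nb
  proof (intro conjI ballI)
    show "Q' \<subseteq> Rn r" using openin_Rn[OF Q] by (auto simp: Q'_def simp del: topspace_Euclidean_space)
    fix u assume u: "u \<in> Q'"
    then have uQ: "u \<in> Q" by (simp add: Q'_def)
    from openin_eventually_nb[OF Q uQ] N.smooth_into_germ[OF qs uQ dq[OF u], THEN conjunct2]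
    show "eventually (\<lambda>u. u \<in> Q') (nb r u)" by eventually_elim (simp add: Q'_def)
  qed
  have uQ': "u \<in> Q'" using q charts_atD(2)[OF d] by (simp add: Q'_def)
  have uR: "u \<in> Rn r" using uQ' openin_Rn[OF Q'] by blast
  define \<phi> where "\<phi> z i = (if i < N.dm then snd d (q z) i else snd c x i)" for z i
  have \<phi>0: "\<phi> u = snd c x" using adapted_coord[OF cd xc] by (auto simp: \<phi>_def q(3) fun_eq_iff)
  have "coord_vec M c x (jacobian_map r M.dm \<phi> u w) \<in> leaf_tangent_space M (pre L) x"
  proof (rule l'.chart_plot_velocity[where \<phi> = \<phi>, OF c Q' uQ' \<phi>0])
    fix z assume z: "z \<in> Q'"
    then have zQ: "z \<in> Q" by (simp add: Q'_def)
    have zR: "z \<in> Rn r" using z openin_Rn[OF Q'] by blast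
    note s = N.smooth_into_germ[OF qs zQ dq[OF z], THEN conjunct1]
    show "smooth_map_at r M.dm \<phi> z"
      unfolding smooth_map_at_def
    proof (intro conjI zR allI impI)
      have "\<phi> y \<in> Rn M.dm" for y using xR dims by (auto simp: \<phi>_def mem_Rn)
      then show "eventually (\<lambda>y. \<phi> y \<in> Rn M.dm) (nb r z)" by (simp only: eventually_True)
      show "smooth_at r (\<lambda>y. \<phi> y i) z" for i
        unfolding \<phi>_def using smooth_map_at_coord[OF s] smooth_at_const[OF zR]
        by (cases "i < N.dm") simp_all
    qed
    assume im: "\<phi> z \<in> snd c ` fst c"
    have "p (chart_inv c (\<phi> z)) = q z"
      by (rule adapted_point[OF cd im charts_atD(2)[OF dq[OF z]]]) (simp add: \<phi>_def)
    moreover have "chart_inv c (\<phi> z) \<in> mcarrier M"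
      by (rule subsetD[OF M.atlas_chart(1)[OF charts_atD(1)[OF c]] M.chart_inv_right(1)[OF im]])
    ultimately show "chart_inv c (\<phi> z) \<in> pre L" using qL zQ by auto
  qed
  moreover have "tangent_map M N p x (coord_vec M c x (jacobian_map r M.dm \<phi> u w)) = v"
  proof -
    have "truncate N.dm (jacobian_map r M.dm \<phi> u w) = v d"
    proof
      fix i
      show "truncate N.dm (jacobian_map r M.dm \<phi> u w) i = v d i"
      proof (cases "i < N.dm")
        case True
        then show ?thesis using dims bspec[OF vd d] by (simp add: truncate_def jacobian_map_nth \<phi>_def)
      next
        case False
        then show ?thesis using N.tangent_Rn[OF vT d] by (simp add: truncate_def mem_Rn)
      qed
    qed
    then show ?thesis
      using adapted_tangent_map_coord_vec[OF cd xc jacobian_map_Rn] N.coord_vec_tangent_eq[OF vT d] by simp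
  qed
  ultimately show ?thesis by blast
qed

lemma pullback_basic:
  assumes \<alpha>: "\<alpha> \<in> basic_forms N F k"
  shows "pullback M N p \<alpha> \<in> basic_forms M (pullback_foliation M p F) k"
proof -
  have \<alpha>d: "\<alpha> \<in> diff_forms N k" using \<alpha> by (simp add: basic_forms_def)
  note p\<alpha> = pullback_diff_form[OF \<alpha>d]
  have "pullback M N p \<alpha> x (v # vs) = 0 \<and> ext_deriv M (pullback M N p \<alpha>) x (v # vs) = 0"
    if L': "L' \<in> pullback_foliation M p F" and x: "x \<in> L'" and v: "v \<in> leaf_tangent_space M L' x" for L' x v vs
  proof -
    obtain L where L: "L' = pre L" "L \<in> F" using L' unfolding pullback_foliation_def by (rule imageE)
    have T: "tangent_map M N p x v \<in> leaf_tangent_space N L (p x)"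
      using leaf_tangent_push[OF L(2)] x v by (simp add: L(1))
    have "\<alpha> (p x) (tangent_map M N p x v # us) = 0 \<and> ext_deriv N \<alpha> (p x) (tangent_map M N p x v # us) = 0" for us
      using \<alpha> L(2) x T unfolding down.basic_forms_iff L(1) by blast
    then show ?thesis
      unfolding pullback_ext_deriv[OF \<alpha>d p\<alpha>, symmetric] by (simp add: pullback_def)
  qed
  with p\<alpha> show ?thesis unfolding up.basic_forms_iff by blast
qed

lemma basic_descends:
  assumes \<beta>: "\<beta> \<in> basic_forms M (pullback_foliation M p F) k"
  shows "\<exists>\<alpha>\<in>basic_forms N F k. pullback M N p \<alpha> = \<beta>"
proof -
  have \<beta>d: "\<beta> \<in> diff_forms M k" using \<beta> by (simp add: basic_forms_def)
  have kill: "\<beta> x (v # vs) = 0 \<and> ext_deriv M \<beta> x (v # vs) = 0"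
    if "L \<in> F" "x \<in> pre L" "v \<in> leaf_tangent_space M (pre L) x" for L x v vs
    using \<beta> pre_leaf[OF that(1)] that(2,3) unfolding up.basic_forms_iff by blast
  have vert: "vertical_annihilated \<beta>"
    unfolding vertical_annihilated_def
  proof (intro ballI impI allI)
    fix x v vs
    assume x: "x \<in> mcarrier M" and v: "v \<in> tangent_space M x" "tangent_map M N p x v = (\<lambda>d i. 0)"
    obtain L where L: "L \<in> F" "p x \<in> L" using down.leaves_cover[OF p_carrier[OF x]] by blast
    then have xL: "x \<in> pre L" using x by simp
    show "\<beta> x (v # vs) = 0 \<and> ext_deriv M \<beta> x (v # vs) = 0"
      by (rule kill[OF L(1) xL vertical_leaf_tangent[OF L(1) xL v]])
  qed
  define \<alpha> where "\<alpha> = descended \<beta> k"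
  have \<alpha>: "\<alpha> \<in> diff_forms N k" unfolding \<alpha>_def by (rule descended_diff_form[OF \<beta>d vert])
  have p\<alpha>: "pullback M N p \<alpha> = \<beta>" unfolding \<alpha>_def by (rule pullback_descended[OF \<beta>d vert])
  have dp: "pullback M N p (ext_deriv N \<alpha>) = ext_deriv M \<beta>"
    using pullback_ext_deriv[OF \<alpha>] p\<alpha> \<beta>d by simp
  have "\<alpha> y (v # vs) = 0 \<and> ext_deriv N \<alpha> y (v # vs) = 0"
    if L: "L \<in> F" and y: "y \<in> L" and v: "v \<in> leaf_tangent_space N L y" for L y v vs
  proof (cases "set vs \<subseteq> tangent_space N y")
    case False
    then show ?thesis
      using diff_forms_outside[OF \<alpha>, of y "v # vs"] N.ext_deriv_outside[of y "v # vs" \<alpha>] by auto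
  next
    case True
    obtain x where x: "x \<in> mcarrier M" "p x = y"
      using fiber_nonempty[OF down.leaves_in_carrier[OF L y]] by blast
    have xL: "x \<in> pre L" using x y by simp
    interpret l': leaf M "pre L" by (rule up.leafI[OF pre_leaf[OF L]])
    obtain w where w: "w \<in> leaf_tangent_space M (pre L) x" "tangent_map M N p x w = v"
      using leaf_tangent_lift[OF L xL] v x(2) by blast
    define ws where "ws = map (tangent_lift x) vs"
    have ws: "set ws \<subseteq> tangent_space M x" "map (tangent_map M N p x) ws = vs"
      using map_tangent_lift[OF x(1)] True by (simp_all add: ws_def x(2))
    have T: "set (w # ws) \<subseteq> tangent_space M x" using ws(1) l'.leaf_tangent_subset[OF xL] w(1) by auto
    \<comment> \<open>Both \<alpha> and its differential are evaluated upstairs on lifted arguments;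
      the lift w of v is tangent to the preimage of the leaf, where \<beta> and its differential
      vanish.\<close>
    have eval: "\<gamma> y (v # vs) = pullback M N p \<gamma> x (w # ws)" for \<gamma>
      using T x ws(2) w(2) by (simp add: pullback_def)
    show ?thesis unfolding eval[of \<alpha>] eval[of "ext_deriv N \<alpha>"] p\<alpha> dp by (rule kill[OF L xL w(1)])
  qed
  with \<alpha> have "\<alpha> \<in> basic_forms N F k" unfolding down.basic_forms_iff by blast
  with p\<alpha> show ?thesis by blast
qed

text \<open>The assumptions ask only for vanishing on non-tangent inputs, so the lemma covers
  differentials and sums as well as basic forms.\<close>

lemma pullback_injective:
  assumes "\<And>y vs. \<not> (y \<in> mcarrier N \<and> set vs \<subseteq> tangent_space N y) \<Longrightarrow> \<alpha> y vs = 0"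
    and "\<And>y vs. \<not> (y \<in> mcarrier N \<and> set vs \<subseteq> tangent_space N y) \<Longrightarrow> \<alpha>' y vs = 0"
    and eq: "pullback M N p \<alpha> = pullback M N p \<alpha>'"
  shows "\<alpha> = \<alpha>'"
proof (intro ext)
  fix y vs
  show "\<alpha> y vs = \<alpha>' y vs"
  proof (cases "y \<in> mcarrier N \<and> set vs \<subseteq> tangent_space N y")
    case True
    then obtain x where x: "x \<in> mcarrier M" "p x = y" using fiber_nonempty by blast
    have "pullback M N p \<gamma> x (map (tangent_lift x) vs) = \<gamma> y vs" for \<gamma>
      using map_tangent_lift[OF x(1), of vs] True x by (simp add: pullback_def)
    then show ?thesis using eq by metis
  qed (use assms(1,2) in metis)
qed

end

section \<open>Isomorphisms of complexes and of cohomology\<close>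

text \<open>The operations of the quotient are formed elementwise from cosets, so taking images
  under \<open>\<phi>\<close> respects them once \<open>\<phi>\<close> is additive and homogeneous
  on a set D that contains the cosets. Injectivity on D makes the map on subsets of D
  injective.\<close>

lemma quotient_space_linear_iso:
  assumes inj: "inj_on \<phi> D" and D: "vset V \<subseteq> D" "B \<subseteq> D"
    and add: "\<And>u v. u \<in> D \<Longrightarrow> v \<in> D \<Longrightarrow> vadd V u v \<in> D \<and> \<phi> (vadd V u v) = vadd W (\<phi> u) (\<phi> v)"
    and scale: "\<And>a v. v \<in> D \<Longrightarrow> vscale V a v \<in> D \<and> \<phi> (vscale V a v) = vscale W a (\<phi> v)"
    and img: "\<phi> ` vset V = vset W" "\<phi> ` B = B'"
  shows "linear_iso ((`) \<phi>) (quotient_space V B) (quotient_space W B')"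
proof -
  have sub: "vcoset V B v \<subseteq> D" if "v \<in> vset V" for v
    using that D add by (auto simp: vcoset_def subset_iff)
  have coset: "\<phi> ` vcoset V B v = vcoset W B' (\<phi> v)" if "v \<in> vset V" for v
  proof -
    have "\<phi> ` vcoset V B v = (\<lambda>b. vadd W (\<phi> v) (\<phi> b)) ` B"
      unfolding vcoset_def image_image by (rule image_cong[OF refl]) (use that D add in blast)
    then show ?thesis unfolding vcoset_def img(2)[symmetric] image_image .
  qed
  have "bij_betw ((`) \<phi>) (vcoset V B ` vset V) (vcoset W B' ` vset W)"
    unfolding bij_betw_def
  proof
    have "vcoset V B ` vset V \<subseteq> Pow D" using sub by auto
    then show "inj_on ((`) \<phi>) (vcoset V B ` vset V)"
      using inj_on_image_Pow[OF inj] inj_on_subset by blast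
    have "(`) \<phi> ` vcoset V B ` vset V = (\<lambda>v. vcoset W B' (\<phi> v)) ` vset V"
      unfolding image_image by (rule image_cong[OF refl coset])
    then show "(`) \<phi> ` vcoset V B ` vset V = vcoset W B' ` vset W"
      unfolding img(1)[symmetric] image_image .
  qed
  moreover have "\<phi> ` {vadd V p q |p q. p \<in> P \<and> q \<in> Q} = {vadd W p q |p q. p \<in> \<phi> ` P \<and> q \<in> \<phi> ` Q}"
    if "P \<subseteq> D" "Q \<subseteq> D" for P Q
  proof -
    have "\<phi> (vadd V p q) = vadd W (\<phi> p) (\<phi> q)" if "p \<in> P" "q \<in> Q" for p q
      using add \<open>P \<subseteq> D\<close> \<open>Q \<subseteq> D\<close> that by blast
    then show ?thesis by (auto simp: image_iff) (metis | blast)+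
  qed
  moreover have "\<phi> ` {vadd V (vscale V a p) b |p b. p \<in> P \<and> b \<in> B} =
      {vadd W (vscale W a p) b |p b. p \<in> \<phi> ` P \<and> b \<in> B'}" if "P \<subseteq> D" for P a
  proof -
    have "\<phi> (vadd V (vscale V a p) b) = vadd W (vscale W a (\<phi> p)) (\<phi> b)" if "p \<in> P" "b \<in> B" for p b
      using add scale \<open>P \<subseteq> D\<close> D(2) that by (metis subsetD)
    then show ?thesis unfolding img(2)[symmetric] by (auto simp: image_iff) (metis | blast)+
  qed
  ultimately show ?thesis
    unfolding linear_iso_def quotient_space_def using sub by (auto simp: image_iff)
qed

text \<open>Unlike \<open>diff_forms\<close>, this condition fixes neither a degree nor smoothness.
  It holds for basic forms of every degree and for differentials, so a single map
  \<open>transfer\<close> serves all degrees.\<close>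

definition tangential :: "'a manifold \<Rightarrow> 'a form \<Rightarrow> bool" where
  "tangential N \<alpha> \<longleftrightarrow> (\<forall>y vs. \<not> (y \<in> mcarrier N \<and> set vs \<subseteq> tangent_space N y) \<longrightarrow> \<alpha> y vs = 0)"

lemma basic_form_tangential:
  assumes "\<alpha> \<in> basic_forms N F k"
  shows "tangential N \<alpha>"
proof -
  have "\<alpha> \<in> diff_forms N k" using assms by (simp add: basic_forms_def)
  then show ?thesis unfolding tangential_def by (intro allI impI diff_forms_outside) auto
qed

lemma ext_deriv_tangential: "tangential N (ext_deriv N \<alpha>)"
  by (auto simp: tangential_def ext_deriv_def)

text \<open>\<open>D\<close> is larger than the set of basic forms, so that it is not necessary to know that
  differentials of basic forms are basic.\<close>

locale foliated_span =
  l: foliated_fibration M N0 p0 F0 + r: foliated_fibration M N1 p1 F1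
  for M :: "'m manifold" and N0 :: "'a manifold" and p0 :: "'m \<Rightarrow> 'a" and F0 :: "'a set set"
    and N1 :: "'b manifold" and p1 :: "'m \<Rightarrow> 'b" and F1 :: "'b set set" +
  assumes same: "pullback_foliation M p0 F0 = pullback_foliation M p1 F1"
begin

text \<open>A relation in place of the composite map: it treats both sides alike, and injectivity of
  the two pullbacks makes it single-valued in both directions.\<close>

definition corresponds :: "'a form \<Rightarrow> 'b form \<Rightarrow> bool" where
  "corresponds \<alpha> \<gamma> \<longleftrightarrow> tangential N0 \<alpha> \<and> tangential N1 \<gamma> \<and> pullback M N0 p0 \<alpha> = pullback M N1 p1 \<gamma>"

definition D :: "'a form set" where
  "D = {\<alpha>. \<exists>\<gamma>. corresponds \<alpha> \<gamma>}"

definition transfer :: "'a form \<Rightarrow> 'b form" where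
  "transfer \<alpha> = (SOME \<gamma>. corresponds \<alpha> \<gamma>)"

lemma corresponds_unique_right: "corresponds \<alpha> \<gamma> \<Longrightarrow> corresponds \<alpha> \<gamma>' \<Longrightarrow> \<gamma> = \<gamma>'"
  by (rule r.pullback_injective) (auto simp: corresponds_def tangential_def)

lemma corresponds_unique_left: "corresponds \<alpha> \<gamma> \<Longrightarrow> corresponds \<alpha>' \<gamma> \<Longrightarrow> \<alpha> = \<alpha>'"
  by (rule l.pullback_injective) (auto simp: corresponds_def tangential_def)

lemma transferI: "corresponds \<alpha> \<gamma> \<Longrightarrow> \<alpha> \<in> D \<and> transfer \<alpha> = \<gamma>"
proof -
  assume c: "corresponds \<alpha> \<gamma>"
  then have "corresponds \<alpha> (transfer \<alpha>)" unfolding transfer_def by (rule someI[of "corresponds \<alpha>" \<gamma>])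
  then show ?thesis using corresponds_unique_right[OF _ c] c by (auto simp: D_def)
qed

lemma transfer_corresponds: "\<alpha> \<in> D \<Longrightarrow> corresponds \<alpha> (transfer \<alpha>)"
  using transferI by (auto simp: D_def)

lemma corresponds_add:
  "corresponds \<alpha> \<gamma> \<Longrightarrow> corresponds \<alpha>' \<gamma>' \<Longrightarrow>
    corresponds (\<lambda>x vs. \<alpha> x vs + \<alpha>' x vs) (\<lambda>x vs. \<gamma> x vs + \<gamma>' x vs)"
proof -
  assume c: "corresponds \<alpha> \<gamma>" "corresponds \<alpha>' \<gamma>'"
  have "pullback M N0 p0 (\<lambda>x vs. \<alpha> x vs + \<alpha>' x vs) =
      (\<lambda>x vs. pullback M N0 p0 \<alpha> x vs + pullback M N0 p0 \<alpha>' x vs)"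
    "pullback M N1 p1 (\<lambda>x vs. \<gamma> x vs + \<gamma>' x vs) =
      (\<lambda>x vs. pullback M N1 p1 \<gamma> x vs + pullback M N1 p1 \<gamma>' x vs)"
    by (simp_all add: pullback_def fun_eq_iff)
  with c show ?thesis unfolding corresponds_def tangential_def by simp
qed

lemma corresponds_scale:
  "corresponds \<alpha> \<gamma> \<Longrightarrow> corresponds (\<lambda>x vs. a * \<alpha> x vs) (\<lambda>x vs. a * \<gamma> x vs)"
proof -
  assume c: "corresponds \<alpha> \<gamma>"
  have "pullback M N0 p0 (\<lambda>x vs. a * \<alpha> x vs) = (\<lambda>x vs. a * pullback M N0 p0 \<alpha> x vs)"
    "pullback M N1 p1 (\<lambda>x vs. a * \<gamma> x vs) = (\<lambda>x vs. a * pullback M N1 p1 \<gamma> x vs)"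
    by (simp_all add: pullback_def fun_eq_iff)
  with c show ?thesis unfolding corresponds_def tangential_def by simp
qed

lemma corresponds_zero: "corresponds (\<lambda>x vs. 0) (\<lambda>x vs. 0)"
  by (simp add: corresponds_def tangential_def pullback_def fun_eq_iff)

lemma basic_corresponds: "\<alpha> \<in> basic_forms N0 F0 k \<Longrightarrow> \<exists>\<gamma>\<in>basic_forms N1 F1 k. corresponds \<alpha> \<gamma>"
proof -
  assume \<alpha>: "\<alpha> \<in> basic_forms N0 F0 k"
  from r.basic_descends[OF l.pullback_basic[OF \<alpha>, unfolded same]]
  obtain \<gamma> where "\<gamma> \<in> basic_forms N1 F1 k" "pullback M N1 p1 \<gamma> = pullback M N0 p0 \<alpha>" by (elim bexE)
  then show ?thesis using basic_form_tangential[OF \<alpha>] basic_form_tangential[of \<gamma> N1 F1 k] by (auto simp: corresponds_def)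
qed

lemma basic_corresponds': "\<gamma> \<in> basic_forms N1 F1 k \<Longrightarrow> \<exists>\<alpha>\<in>basic_forms N0 F0 k. corresponds \<alpha> \<gamma>"
proof -
  assume \<gamma>: "\<gamma> \<in> basic_forms N1 F1 k"
  from l.basic_descends[OF r.pullback_basic[OF \<gamma>, folded same]]
  obtain \<alpha> where "\<alpha> \<in> basic_forms N0 F0 k" "pullback M N0 p0 \<alpha> = pullback M N1 p1 \<gamma>" by (elim bexE)
  then show ?thesis using basic_form_tangential[OF \<gamma>] basic_form_tangential[of \<alpha> N0 F0 k] by (auto simp: corresponds_def)
qed

lemma basic_subset_D: "basic_forms N0 F0 k \<subseteq> D"
  using basic_corresponds by (auto simp: D_def)

lemma transfer_basic: "transfer ` basic_forms N0 F0 k = basic_forms N1 F1 k"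
proof
  show "transfer ` basic_forms N0 F0 k \<subseteq> basic_forms N1 F1 k"
  proof (rule image_subsetI)
    fix \<alpha> assume "\<alpha> \<in> basic_forms N0 F0 k"
    from basic_corresponds[OF this] show "transfer \<alpha> \<in> basic_forms N1 F1 k" using transferI by blast
  qed
  show "basic_forms N1 F1 k \<subseteq> transfer ` basic_forms N0 F0 k"
  proof
    fix \<gamma> assume "\<gamma> \<in> basic_forms N1 F1 k"
    from basic_corresponds'[OF this] obtain \<alpha> where "\<alpha> \<in> basic_forms N0 F0 k" "corresponds \<alpha> \<gamma>" by (elim bexE)
    then show "\<gamma> \<in> transfer ` basic_forms N0 F0 k" using transferI by (metis imageI)
  qed
qed

lemma transfer_inj: "inj_on transfer D"
  by (rule inj_onI) (metis transfer_corresponds corresponds_unique_left)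

lemma transfer_add:
  "\<alpha> \<in> D \<Longrightarrow> \<alpha>' \<in> D \<Longrightarrow> (\<lambda>x vs. \<alpha> x vs + \<alpha>' x vs) \<in> D \<and>
    transfer (\<lambda>x vs. \<alpha> x vs + \<alpha>' x vs) = (\<lambda>x vs. transfer \<alpha> x vs + transfer \<alpha>' x vs)"
  by (intro transferI corresponds_add transfer_corresponds)

lemma transfer_scale:
  "\<alpha> \<in> D \<Longrightarrow> (\<lambda>x vs. a * \<alpha> x vs) \<in> D \<and> transfer (\<lambda>x vs. a * \<alpha> x vs) = (\<lambda>x vs. a * transfer \<alpha> x vs)"
  by (intro transferI corresponds_scale transfer_corresponds)

lemma transfer_ext_deriv:
  assumes \<alpha>: "\<alpha> \<in> basic_forms N0 F0 k"
  shows "ext_deriv N0 \<alpha> \<in> D \<and> transfer (ext_deriv N0 \<alpha>) = ext_deriv N1 (transfer \<alpha>)"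
proof (rule transferI)
  have \<gamma>: "transfer \<alpha> \<in> basic_forms N1 F1 k" using \<alpha> transfer_basic by blast
  have d: "\<alpha> \<in> diff_forms N0 k" "transfer \<alpha> \<in> diff_forms N1 k" using \<alpha> \<gamma> by (simp_all add: basic_forms_def)
  have "corresponds \<alpha> (transfer \<alpha>)" using \<alpha> basic_subset_D by (intro transfer_corresponds) blast
  then have "pullback M N0 p0 \<alpha> = pullback M N1 p1 (transfer \<alpha>)" by (simp add: corresponds_def)
  then have "pullback M N0 p0 (ext_deriv N0 \<alpha>) = pullback M N1 p1 (ext_deriv N1 (transfer \<alpha>))"
    using l.pullback_ext_deriv[OF d(1) l.pullback_diff_form[OF d(1)]]
      r.pullback_ext_deriv[OF d(2) r.pullback_diff_form[OF d(2)]] by simp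
  then show "corresponds (ext_deriv N0 \<alpha>) (ext_deriv N1 (transfer \<alpha>))"
    by (simp add: corresponds_def ext_deriv_tangential)
qed

lemma transfer_zero: "(\<lambda>x vs. 0) \<in> D" "transfer (\<lambda>x vs. 0) = (\<lambda>x vs. 0)"
  using transferI[OF corresponds_zero] by auto

lemma basic_complexes_isomorphic: "isomorphic_complexes (basic_complex N0 F0) (basic_complex N1 F1)"
  unfolding isomorphic_complexes_def
proof (intro exI allI conjI)
  fix k
  have D: "\<alpha> \<in> basic_forms N0 F0 k \<Longrightarrow> \<alpha> \<in> D" for \<alpha> using basic_subset_D by blast
  show "linear_iso transfer (cspace (basic_complex N0 F0) k) (cspace (basic_complex N1 F1) k)"
    unfolding linear_iso_def basic_complex_def
    using inj_on_subset[OF transfer_inj basic_subset_D] transfer_basic[of k] transfer_add D transfer_scale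
    by (simp add: bij_betw_def)
  show "\<forall>\<alpha>\<in>vset (cspace (basic_complex N0 F0) k).
      transfer (cdiff (basic_complex N0 F0) k \<alpha>) = cdiff (basic_complex N1 F1) k (transfer \<alpha>)"
    using transfer_ext_deriv by (simp add: basic_complex_def)
qed

lemma basic_cohomologies_isomorphic:
  "linearly_isomorphic (basic_cohomology N0 F0 k) (basic_cohomology N1 F1 k)"
  unfolding linearly_isomorphic_def basic_cohomology_def cohomology_def
proof (rule exI, rule quotient_space_linear_iso[where \<phi> = transfer and D = D])
  let ?C0 = "basic_complex N0 F0" and ?C1 = "basic_complex N1 F1"
  have C: "cocycles (basic_complex N F) k = {\<alpha> \<in> basic_forms N F k. ext_deriv N \<alpha> = (\<lambda>x vs. 0)}"
    for N :: "'c manifold" and F by (simp add: cocycles_def basic_complex_def)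
  show "inj_on transfer D" by (rule transfer_inj)
  show "vset (cspace ?C0 k\<lparr>vset := cocycles ?C0 k\<rparr>) \<subseteq> D"
    using basic_subset_D by (auto simp: C)
  show "coboundaries ?C0 k \<subseteq> D"
    using transfer_zero(1) transfer_ext_deriv by (cases k) (auto simp: basic_complex_def)
  show "transfer ` coboundaries ?C0 k = coboundaries ?C1 k"
  proof (cases k)
    case 0
    then show ?thesis by (simp add: basic_complex_def transfer_zero)
  next
    case (Suc j)
    have "transfer ` ext_deriv N0 ` basic_forms N0 F0 j = ext_deriv N1 ` transfer ` basic_forms N0 F0 j"
      unfolding image_image by (rule image_cong[OF refl]) (use transfer_ext_deriv in blast)
    then show ?thesis unfolding Suc by (simp add: basic_complex_def transfer_basic)
  qed
  show "transfer ` vset (cspace ?C0 k\<lparr>vset := cocycles ?C0 k\<rparr>) = vset (cspace ?C1 k\<lparr>vset := cocycles ?C1 k\<rparr>)"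
  proof -
    \<comment> \<open>The differential of \<open>\<alpha>\<close> and the zero form both lie in D,
      where \<open>transfer\<close> is injective and sends 0 to 0; hence closed forms correspond to
      closed forms.\<close>
    have closed: "ext_deriv N0 \<alpha> = (\<lambda>x vs. 0) \<longleftrightarrow> ext_deriv N1 (transfer \<alpha>) = (\<lambda>x vs. 0)"
      if \<alpha>: "\<alpha> \<in> basic_forms N0 F0 k" for \<alpha>
      using transfer_ext_deriv[OF \<alpha>] transfer_zero inj_onD[OF transfer_inj, of "ext_deriv N0 \<alpha>" "\<lambda>x vs. 0"] by auto
    have "transfer ` {\<alpha> \<in> basic_forms N0 F0 k. ext_deriv N0 \<alpha> = (\<lambda>x vs. 0)} =
        {\<gamma> \<in> transfer ` basic_forms N0 F0 k. ext_deriv N1 \<gamma> = (\<lambda>x vs. 0)}"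
      using closed by blast
    then show ?thesis by (simp add: C transfer_basic)
  qed
  show "vadd (cspace ?C0 k\<lparr>vset := cocycles ?C0 k\<rparr>) u v \<in> D \<and>
      transfer (vadd (cspace ?C0 k\<lparr>vset := cocycles ?C0 k\<rparr>) u v) =
      vadd (cspace ?C1 k\<lparr>vset := cocycles ?C1 k\<rparr>) (transfer u) (transfer v)"
    if "u \<in> D" "v \<in> D" for u v
    using transfer_add[OF that] by (simp add: basic_complex_def)
  show "vscale (cspace ?C0 k\<lparr>vset := cocycles ?C0 k\<rparr>) a v \<in> D \<and>
      transfer (vscale (cspace ?C0 k\<lparr>vset := cocycles ?C0 k\<rparr>) a v) =
      vscale (cspace ?C1 k\<lparr>vset := cocycles ?C1 k\<rparr>) a (transfer v)"
    if "v \<in> D" for a v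
    using transfer_scale[OF that] by (simp add: basic_complex_def)
qed

end

lemma foliated_fibrationI:
  assumes M: "singular_foliation M F" and N: "singular_foliation N F'"
    and p: "surj_submersion_conn_fibers M N p" and eq: "pullback_foliation M p F' = F"
  shows "foliated_fibration M N p F'"
proof unfold_locales
  show "smooth_manifold M" "smooth_manifold N" using M N by (simp_all add: singular_foliation_def)
  show "smooth_map M N p" using p by (simp add: surj_submersion_conn_fibers_def submersion_def)
  show "surj_submersion_conn_fibers M N p" by (rule p)
  show "singular_foliation N F'" by (rule N)
  show "singular_foliation M (pullback_foliation M p F')" unfolding eq by (rule M)
qed

theorem corollary4p4:
  fixes N0 :: "'a manifold" and F0 :: "'a set set"
    and N1 :: "'b manifold" and F1 :: "'b set set"
  assumes "singular_foliation N0 F0"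
    and "singular_foliation N1 F1"
    and "molino_transverse_equivalent TYPE('m) N0 F0 N1 F1"
  shows "isomorphic_complexes (basic_complex N0 F0) (basic_complex N1 F1) \<and>
    (\<forall>k. linearly_isomorphic (basic_cohomology N0 F0 k) (basic_cohomology N1 F1 k))"
proof -
  obtain M :: "'m manifold" and F p0 p1 where M: "singular_foliation M F"
    and p: "surj_submersion_conn_fibers M N0 p0" "surj_submersion_conn_fibers M N1 p1"
    and F: "pullback_foliation M p0 F0 = F" "pullback_foliation M p1 F1 = F"
    using assms(3) unfolding molino_transverse_equivalent_def by (elim exE conjE)
  interpret foliated_span M N0 p0 F0 N1 p1 F1
    unfolding foliated_span_def foliated_span_axioms_def
    using foliated_fibrationI[OF M assms(1) p(1) F(1)] foliated_fibrationI[OF M assms(2) p(2) F(2)] F by simp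
  show ?thesis using basic_complexes_isomorphic basic_cohomologies_isomorphic by blast
qed

end
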